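(* If $\Lambda$ is a torsionless-finite artin algebra, then $\operatorname{repdim}\Lambda\le 3$.
   Context: An artin algebra is an algebra over a commutative artinian ring that is finitely generated as a module over that ring. Modules are left modules of finite length. A $\Lambda$-module is torsionless if it is isomorphic to a submodule of a (finite length) projective module. $\Lambda$ is torsionless-finite if there are only finitely many isomorphism classes of indecomposable torsionless $\Lambda$-modules. A generator-cogenerator is a $\Lambda$-module $M$ such that every indecomposable projective and every indecomposable injective $\Lambda$-module is a direct summand of $M$. The representation dimension $\operatorname{repdim}\Lambda$ is the minimal possible global dimension of $\operatorname{End}(M)$, where $M$ ranges over the generator-cogenerators of $\Lambda$. *)

theory Defs
  imports "HOL-Algebra.Module" "HOL-Algebra.Ideal" "HOL-Library.Extended_Nat"
begin

section \<open>Left modules over a not necessarily commutative ring\<close>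

text \<open>
  The library locale \<^locale>\<open>Module.module\<close> has the same axioms but requires a commutative ring. Its
  record type is reused here (the ring multiplication and unit of a module record play no role),
  as is \<^locale>\<open>submodule\<close>, which does not mention commutativity.
\<close>

locale left_module = R?: ring R + M?: abelian_group M
  for R :: "('a, 'b) ring_scheme" (structure) and M :: "('a, 'c, 'd) module_scheme" (structure) +
  assumes smult_closed [simp, intro]:
      "\<lbrakk>a \<in> carrier R; x \<in> carrier M\<rbrakk> \<Longrightarrow> a \<odot>\<^bsub>M\<^esub> x \<in> carrier M"
    and smult_l_distr:
      "\<lbrakk>a \<in> carrier R; b \<in> carrier R; x \<in> carrier M\<rbrakk> \<Longrightarrow>
        (a \<oplus>\<^bsub>R\<^esub> b) \<odot>\<^bsub>M\<^esub> x = a \<odot>\<^bsub>M\<^esub> x \<oplus>\<^bsub>M\<^esub> b \<odot>\<^bsub>M\<^esub> x"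
    and smult_r_distr:
      "\<lbrakk>a \<in> carrier R; x \<in> carrier M; y \<in> carrier M\<rbrakk> \<Longrightarrow>
        a \<odot>\<^bsub>M\<^esub> (x \<oplus>\<^bsub>M\<^esub> y) = a \<odot>\<^bsub>M\<^esub> x \<oplus>\<^bsub>M\<^esub> a \<odot>\<^bsub>M\<^esub> y"
    and smult_assoc1:
      "\<lbrakk>a \<in> carrier R; b \<in> carrier R; x \<in> carrier M\<rbrakk> \<Longrightarrow>
        (a \<otimes>\<^bsub>R\<^esub> b) \<odot>\<^bsub>M\<^esub> x = a \<odot>\<^bsub>M\<^esub> (b \<odot>\<^bsub>M\<^esub> x)"
    and smult_one [simp]:
      "x \<in> carrier M \<Longrightarrow> \<one>\<^bsub>R\<^esub> \<odot>\<^bsub>M\<^esub> x = x"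

definition mod_hom ::
  "('r, 'c) ring_scheme \<Rightarrow> ('r, 'm, 'd) module_scheme \<Rightarrow> ('r, 'n, 'e) module_scheme \<Rightarrow> ('m \<Rightarrow> 'n) set"
  where "mod_hom R M N =
    {f \<in> carrier M \<rightarrow>\<^sub>E carrier N.
      (\<forall>x\<in>carrier M. \<forall>y\<in>carrier M. f (x \<oplus>\<^bsub>M\<^esub> y) = f x \<oplus>\<^bsub>N\<^esub> f y) \<and>
      (\<forall>a\<in>carrier R. \<forall>x\<in>carrier M. f (a \<odot>\<^bsub>M\<^esub> x) = a \<odot>\<^bsub>N\<^esub> f x)}"

definition mod_iso ::
  "('r, 'c) ring_scheme \<Rightarrow> ('r, 'm, 'd) module_scheme \<Rightarrow> ('r, 'n, 'e) module_scheme \<Rightarrow> bool"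
  where "mod_iso R M N \<longleftrightarrow> (\<exists>f\<in>mod_hom R M N. bij_betw f (carrier M) (carrier N))"

definition module_length :: "('r, 'c) ring_scheme \<Rightarrow> ('r, 'm, 'd) module_scheme \<Rightarrow> enat"
  where "module_length R M =
    Sup {enat n | n. \<exists>N. (\<forall>i\<le>n. submodule (N i) R M) \<and> (\<forall>i<n. N i \<subset> N (Suc i))}"

definition finite_length_module :: "('r, 'c) ring_scheme \<Rightarrow> ('r, 'm, 'd) module_scheme \<Rightarrow> bool"
  where "finite_length_module R M \<longleftrightarrow> left_module R M \<and> module_length R M < \<infinity>"

definition direct_sum_decomp ::
  "('r, 'c) ring_scheme \<Rightarrow> ('r, 'm, 'd) module_scheme \<Rightarrow> 'm set \<Rightarrow> 'm set \<Rightarrow> bool"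
  where "direct_sum_decomp R M U V \<longleftrightarrow>
    submodule U R M \<and> submodule V R M \<and> U \<inter> V = {\<zero>\<^bsub>M\<^esub>} \<and> U <+>\<^bsub>M\<^esub> V = carrier M"

definition direct_summand ::
  "('r, 'c) ring_scheme \<Rightarrow> ('r, 'n, 'e) module_scheme \<Rightarrow> ('r, 'm, 'd) module_scheme \<Rightarrow> bool"
  where "direct_summand R N M \<longleftrightarrow>
    (\<exists>U V. direct_sum_decomp R M U V \<and> mod_iso R N (M\<lparr>carrier := U\<rparr>))"

definition indecomposable :: "('r, 'c) ring_scheme \<Rightarrow> ('r, 'm, 'd) module_scheme \<Rightarrow> bool"
  where "indecomposable R M \<longleftrightarrow>
    finite_length_module R M \<and> carrier M \<noteq> {\<zero>\<^bsub>M\<^esub>} \<and>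
    (\<forall>U V. direct_sum_decomp R M U V \<longrightarrow> U = {\<zero>\<^bsub>M\<^esub>} \<or> V = {\<zero>\<^bsub>M\<^esub>})"


section \<open>The category of finite length modules\<close>

text \<open>
  Quantification over all finite length modules over a ring with elements of type \<open>'r\<close> is
  rendered by quantification over the modules whose elements are lists over \<open>'r\<close>. No isomorphism
  class is lost: a finite length module is generated by some \<open>x\<^sub>1, \<dots>, x\<^sub>n\<close>, and choosing for each
  element a coefficient list with respect to these generators embeds it into the lists over \<open>'r\<close>.
  This is the lemma \<open>finite_length_module_on_lists\<close> at the end of this theory.

  As modules are of finite length by convention, projective and injective modules are the
  projective and injective objects of the category of finite length modules. For artin algebras
  these are precisely the finite length modules that are projective or injective among all modules.
\<close>

type_synonym 'r lmod = "('r, 'r list) module"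

definition projective_mod :: "('r, 'c) ring_scheme \<Rightarrow> ('r, 'm, 'd) module_scheme \<Rightarrow> bool"
  where "projective_mod R P \<longleftrightarrow>
    finite_length_module R P \<and>
    (\<forall>(A :: 'r lmod) (B :: 'r lmod). finite_length_module R A \<longrightarrow> finite_length_module R B \<longrightarrow>
      (\<forall>g\<in>mod_hom R A B. \<forall>f\<in>mod_hom R P B. g ` carrier A = carrier B \<longrightarrow>
        (\<exists>h\<in>mod_hom R P A. \<forall>x\<in>carrier P. g (h x) = f x)))"

definition injective_mod :: "('r, 'c) ring_scheme \<Rightarrow> ('r, 'm, 'd) module_scheme \<Rightarrow> bool"
  where "injective_mod R I \<longleftrightarrow>
    finite_length_module R I \<and>
    (\<forall>(A :: 'r lmod) (B :: 'r lmod). finite_length_module R A \<longrightarrow> finite_length_module R B \<longrightarrow>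
      (\<forall>g\<in>mod_hom R A B. \<forall>f\<in>mod_hom R A I. inj_on g (carrier A) \<longrightarrow>
        (\<exists>h\<in>mod_hom R B I. \<forall>x\<in>carrier A. h (g x) = f x)))"

definition torsionless :: "('r, 'c) ring_scheme \<Rightarrow> ('r, 'm, 'd) module_scheme \<Rightarrow> bool"
  where "torsionless R X \<longleftrightarrow>
    finite_length_module R X \<and>
    (\<exists>(P :: 'r lmod) U. projective_mod R P \<and> submodule U R P \<and> mod_iso R X (P\<lparr>carrier := U\<rparr>))"

definition torsionless_finite :: "('r, 'c) ring_scheme \<Rightarrow> bool"
  where "torsionless_finite R \<longleftrightarrow>
    finite ({X :: 'r lmod. indecomposable R X \<and> torsionless R X} //
      {(X, Y). indecomposable R X \<and> torsionless R X \<and> indecomposable R Y \<and> torsionless R Y \<and>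
        mod_iso R X Y})"

definition generator_cogenerator :: "('r, 'c) ring_scheme \<Rightarrow> ('r, 'm, 'd) module_scheme \<Rightarrow> bool"
  where "generator_cogenerator R M \<longleftrightarrow>
    finite_length_module R M \<and>
    (\<forall>N :: 'r lmod. indecomposable R N \<and> (projective_mod R N \<or> injective_mod R N) \<longrightarrow>
      direct_summand R N M)"


section \<open>Global dimension and representation dimension\<close>

text \<open>
  \<open>projective_resolution R X n P d \<epsilon>\<close>: the sequence
  \<open>0 \<rightarrow> P n \<rightarrow> \<dots> \<rightarrow> P 1 \<rightarrow> P 0 \<rightarrow> X \<rightarrow> 0\<close> is exact, with maps \<open>d i : P (i + 1) \<rightarrow> P i\<close> and
  \<open>\<epsilon> : P 0 \<rightarrow> X\<close>, and all \<open>P i\<close> projective; it is continued by zero modules beyond \<open>n\<close>.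
\<close>

definition projective_resolution ::
  "('r, 'c) ring_scheme \<Rightarrow> ('r, 'm, 'd) module_scheme \<Rightarrow> nat \<Rightarrow> (nat \<Rightarrow> 'r lmod) \<Rightarrow>
    (nat \<Rightarrow> 'r list \<Rightarrow> 'r list) \<Rightarrow> ('r list \<Rightarrow> 'm) \<Rightarrow> bool"
  where "projective_resolution R X n P d \<epsilon> \<longleftrightarrow>
    (\<forall>i. projective_mod R (P i)) \<and>
    (\<forall>i>n. carrier (P i) = {\<zero>\<^bsub>P i\<^esub>}) \<and>
    \<epsilon> \<in> mod_hom R (P 0) X \<and> (\<forall>i. d i \<in> mod_hom R (P (Suc i)) (P i)) \<and>
    \<epsilon> ` carrier (P 0) = carrier X \<and>
    d 0 ` carrier (P 1) = {x \<in> carrier (P 0). \<epsilon> x = \<zero>\<^bsub>X\<^esub>} \<and>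
    (\<forall>i. d (Suc i) ` carrier (P (Suc (Suc i))) = {x \<in> carrier (P (Suc i)). d i x = \<zero>\<^bsub>P i\<^esub>})"

text \<open>Below, \<open>Inf {} = \<infinity>\<close>.\<close>

definition proj_dim :: "('r, 'c) ring_scheme \<Rightarrow> ('r, 'm, 'd) module_scheme \<Rightarrow> enat"
  where "proj_dim R X = Inf {enat n | n. \<exists>P d \<epsilon>. projective_resolution R X n P d \<epsilon>}"

text \<open>
  The convention that modules are left modules of finite length also applies to the modules over
  endomorphism rings. For an artin algebra (such as the endomorphism ring of a finite length
  module over an artin algebra) this is the usual global dimension, and the left and the right
  global dimension agree.
\<close>

definition gldim :: "('r, 'c) ring_scheme \<Rightarrow> enat"
  where "gldim R = (SUP X \<in> {X :: 'r lmod. finite_length_module R X}. proj_dim R X)"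

definition End_ring :: "('r, 'c) ring_scheme \<Rightarrow> ('r, 'm, 'd) module_scheme \<Rightarrow> ('m \<Rightarrow> 'm) ring"
  where "End_ring R M =
    \<lparr>carrier = mod_hom R M M,
     mult = (\<lambda>f g. compose (carrier M) f g),
     one = (\<lambda>x\<in>carrier M. x),
     zero = (\<lambda>x\<in>carrier M. \<zero>\<^bsub>M\<^esub>),
     add = (\<lambda>f g. \<lambda>x\<in>carrier M. f x \<oplus>\<^bsub>M\<^esub> g x)\<rparr>"

text \<open>The order on \<^typ>\<open>enat\<close> is a well-order, so the infimum of a nonempty set is its minimum.\<close>

definition repdim :: "('r, 'c) ring_scheme \<Rightarrow> enat"
  where "repdim R = Inf {gldim (End_ring R M) | M :: 'r lmod. generator_cogenerator R M}"


section \<open>Artin algebras\<close>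

locale artinian_cring = cring +
  assumes descending_chain:
    "\<lbrakk>\<And>n. ideal (I n) R; \<And>n. I (Suc n) \<subseteq> I n\<rbrakk> \<Longrightarrow> \<exists>N. \<forall>n\<ge>N. I n = I N"

text \<open>The library locale \<^locale>\<open>Module.algebra\<close> cannot be used, as it requires \<open>\<Lambda>\<close> to be commutative.\<close>

locale artin_algebra = artinian_cring k + Module.module k \<Lambda> + \<Lambda>: ring \<Lambda>
  for k :: "('k, 'c) ring_scheme" (structure) and \<Lambda> :: "('k, 'a, 'd) module_scheme" (structure) +
  assumes smult_mult_left:
      "\<lbrakk>a \<in> carrier k; x \<in> carrier \<Lambda>; y \<in> carrier \<Lambda>\<rbrakk> \<Longrightarrow>
        (a \<odot>\<^bsub>\<Lambda>\<^esub> x) \<otimes>\<^bsub>\<Lambda>\<^esub> y = a \<odot>\<^bsub>\<Lambda>\<^esub> (x \<otimes>\<^bsub>\<Lambda>\<^esub> y)"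
    and smult_mult_right:
      "\<lbrakk>a \<in> carrier k; x \<in> carrier \<Lambda>; y \<in> carrier \<Lambda>\<rbrakk> \<Longrightarrow>
        x \<otimes>\<^bsub>\<Lambda>\<^esub> (a \<odot>\<^bsub>\<Lambda>\<^esub> y) = a \<odot>\<^bsub>\<Lambda>\<^esub> (x \<otimes>\<^bsub>\<Lambda>\<^esub> y)"
    and finitely_generated:
      "\<exists>S. finite S \<and> S \<subseteq> carrier \<Lambda> \<and> (\<forall>H. submodule H k \<Lambda> \<and> S \<subseteq> H \<longrightarrow> H = carrier \<Lambda>)"


section \<open>Every finite length module has a copy on lists\<close>

context left_module
begin

lemma smult_zero_l: "x \<in> carrier M \<Longrightarrow> \<zero>\<^bsub>R\<^esub> \<odot>\<^bsub>M\<^esub> x = \<zero>\<^bsub>M\<^esub>"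
  using smult_l_distr[of "\<zero>\<^bsub>R\<^esub>" "\<zero>\<^bsub>R\<^esub>" x] by (metis M.add.l_cancel_one' R.l_zero R.zero_closed smult_closed)

lemma smult_zero_r: "a \<in> carrier R \<Longrightarrow> a \<odot>\<^bsub>M\<^esub> \<zero>\<^bsub>M\<^esub> = \<zero>\<^bsub>M\<^esub>"
  using smult_r_distr[of a "\<zero>\<^bsub>M\<^esub>" "\<zero>\<^bsub>M\<^esub>"] by (metis M.add.l_cancel_one' M.l_zero M.zero_closed smult_closed)

lemma smult_minus_one: "x \<in> carrier M \<Longrightarrow> (\<ominus>\<^bsub>R\<^esub> \<one>\<^bsub>R\<^esub>) \<odot>\<^bsub>M\<^esub> x = \<ominus>\<^bsub>M\<^esub> x"
proof -
  assume x: "x \<in> carrier M"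
  have "(\<ominus>\<^bsub>R\<^esub> \<one>\<^bsub>R\<^esub>) \<odot>\<^bsub>M\<^esub> x \<oplus>\<^bsub>M\<^esub> x = (\<ominus>\<^bsub>R\<^esub> \<one>\<^bsub>R\<^esub> \<oplus>\<^bsub>R\<^esub> \<one>\<^bsub>R\<^esub>) \<odot>\<^bsub>M\<^esub> x"
    using smult_l_distr[of "\<ominus>\<^bsub>R\<^esub> \<one>\<^bsub>R\<^esub>" "\<one>\<^bsub>R\<^esub>" x] x by simp
  also have "\<dots> = \<zero>\<^bsub>M\<^esub>" using x by (simp add: R.l_neg smult_zero_l)
  finally show ?thesis
    using x by (metis M.minus_equality R.a_inv_closed R.one_closed smult_closed)
qed

lemma submodule_iff:
  "submodule H R M \<longleftrightarrow> H \<subseteq> carrier M \<and> \<zero>\<^bsub>M\<^esub> \<in> H \<and> (\<forall>x\<in>H. \<forall>y\<in>H. x \<oplus>\<^bsub>M\<^esub> y \<in> H) \<and>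
    (\<forall>a\<in>carrier R. \<forall>x\<in>H. a \<odot>\<^bsub>M\<^esub> x \<in> H)" (is "_ \<longleftrightarrow> ?r")
proof
  assume H: "submodule H R M"
  interpret submodule H R M by (rule H)
  show ?r using subset one_closed m_closed by auto
next
  assume r: ?r
  show "submodule H R M"
  proof (intro submodule.intro submodule_axioms.intro M.add.subgroupI)
    show "\<ominus>\<^bsub>M\<^esub> a \<in> H" if "a \<in> H" for a
    proof -
      have "(\<ominus>\<^bsub>R\<^esub> \<one>\<^bsub>R\<^esub>) \<odot>\<^bsub>M\<^esub> a \<in> H" using r that by blast
      moreover have "a \<in> carrier M" using r that by blast
      ultimately show ?thesis using smult_minus_one[of a] by metis
    qed
  qed (use r in auto)
qed

fun lincomb :: "'a list \<Rightarrow> 'c list \<Rightarrow> 'c" where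
  "lincomb (r # rs) (x # xs) = r \<odot>\<^bsub>M\<^esub> x \<oplus>\<^bsub>M\<^esub> lincomb rs xs"
| "lincomb _ _ = \<zero>\<^bsub>M\<^esub>"

definition lspan :: "'c list \<Rightarrow> 'c set" where
  "lspan xs = {lincomb rs xs | rs. set rs \<subseteq> carrier R \<and> length rs = length xs}"

lemma lspan_Nil: "lspan [] = {\<zero>\<^bsub>M\<^esub>}"
  by (auto simp: lspan_def)

lemma lspan_Cons: "lspan (x # xs) = {r \<odot>\<^bsub>M\<^esub> x \<oplus>\<^bsub>M\<^esub> y | r y. r \<in> carrier R \<and> y \<in> lspan xs}"
proof -
  have "\<exists>r y. lincomb rs (x # xs) = r \<odot>\<^bsub>M\<^esub> x \<oplus>\<^bsub>M\<^esub> y \<and> r \<in> carrier R \<and> y \<in> lspan xs"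
    if "set rs \<subseteq> carrier R" "length rs = length (x # xs)" for rs
    using that by (cases rs) (auto simp: lspan_def)
  moreover have "r \<odot>\<^bsub>M\<^esub> x \<oplus>\<^bsub>M\<^esub> lincomb rs xs \<in> lspan (x # xs)"
    if "r \<in> carrier R" "set rs \<subseteq> carrier R" "length rs = length xs" for r rs
    unfolding lspan_def using that by (intro CollectI exI[of _ "r # rs"]) auto
  ultimately show ?thesis by (auto simp: lspan_def)
qed

lemma lspan_submodule: "set xs \<subseteq> carrier M \<Longrightarrow> submodule (lspan xs) R M"
proof (induction xs)
  case Nil
  show ?case by (simp add: submodule_iff lspan_Nil smult_zero_r)
next
  case (Cons x xs)
  then have x: "x \<in> carrier M" and IH: "submodule (lspan xs) R M" by auto
  note S = IH[unfolded submodule_iff]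
  show ?case unfolding submodule_iff
  proof (intro conjI ballI)
    show "lspan (x # xs) \<subseteq> carrier M" using S x by (auto simp: lspan_Cons)
    show "\<zero>\<^bsub>M\<^esub> \<in> lspan (x # xs)" unfolding lspan_Cons using S x
      by (intro CollectI exI[of _ "\<zero>\<^bsub>R\<^esub>"] exI[of _ "\<zero>\<^bsub>M\<^esub>"]) (auto simp: smult_zero_l)
  next
    fix u v assume "u \<in> lspan (x # xs)" "v \<in> lspan (x # xs)"
    then obtain r y s z where uv: "u = r \<odot>\<^bsub>M\<^esub> x \<oplus>\<^bsub>M\<^esub> y" "v = s \<odot>\<^bsub>M\<^esub> x \<oplus>\<^bsub>M\<^esub> z"
      "r \<in> carrier R" "s \<in> carrier R" "y \<in> lspan xs" "z \<in> lspan xs"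
      by (auto simp: lspan_Cons)
    have c: "y \<in> carrier M" "z \<in> carrier M" using uv S by auto
    have "u \<oplus>\<^bsub>M\<^esub> v = (r \<oplus>\<^bsub>R\<^esub> s) \<odot>\<^bsub>M\<^esub> x \<oplus>\<^bsub>M\<^esub> (y \<oplus>\<^bsub>M\<^esub> z)"
      using uv c x by (simp add: smult_l_distr M.a_ac)
    then show "u \<oplus>\<^bsub>M\<^esub> v \<in> lspan (x # xs)" unfolding lspan_Cons using uv S
      by (intro CollectI exI[of _ "r \<oplus>\<^bsub>R\<^esub> s"] exI[of _ "y \<oplus>\<^bsub>M\<^esub> z"]) auto
  next
    fix a u assume a: "a \<in> carrier R" and "u \<in> lspan (x # xs)"
    then obtain r y where u: "u = r \<odot>\<^bsub>M\<^esub> x \<oplus>\<^bsub>M\<^esub> y" "r \<in> carrier R" "y \<in> lspan xs"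
      by (auto simp: lspan_Cons)
    have c: "y \<in> carrier M" using u S by auto
    have "a \<odot>\<^bsub>M\<^esub> u = (a \<otimes>\<^bsub>R\<^esub> r) \<odot>\<^bsub>M\<^esub> x \<oplus>\<^bsub>M\<^esub> a \<odot>\<^bsub>M\<^esub> y"
      using u c x a by (simp add: smult_r_distr smult_assoc1)
    then show "a \<odot>\<^bsub>M\<^esub> u \<in> lspan (x # xs)" unfolding lspan_Cons using u S a
      by (intro CollectI exI[of _ "a \<otimes>\<^bsub>R\<^esub> r"] exI[of _ "a \<odot>\<^bsub>M\<^esub> y"]) auto
  qed
qed

lemma lspan_psubset:
  assumes "set xs \<subseteq> carrier M" "x \<in> carrier M" "x \<notin> lspan xs"
  shows "lspan xs \<subset> lspan (x # xs)"
proof -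
  note S = lspan_submodule[OF assms(1), unfolded submodule_iff]
  have "y \<in> lspan (x # xs)" if "y \<in> lspan xs" for y
    unfolding lspan_Cons using that S assms
    by (intro CollectI exI[of _ "\<zero>\<^bsub>R\<^esub>"] exI[of _ y]) (auto simp: smult_zero_l subset_iff)
  moreover have "x \<in> lspan (x # xs)"
    unfolding lspan_Cons using S assms
    by (intro CollectI exI[of _ "\<one>\<^bsub>R\<^esub>"] exI[of _ "\<zero>\<^bsub>M\<^esub>"]) auto
  ultimately show ?thesis using assms(3) by blast
qed

lemma finite_length_imp_generated:
  assumes "module_length R M < \<infinity>"
  shows "\<exists>xs. set xs \<subseteq> carrier M \<and> lspan xs = carrier M"
proof (rule ccontr)
  assume no: "\<not> ?thesis"
  have step: "\<exists>x\<in>carrier M. x \<notin> lspan xs" if "set xs \<subseteq> carrier M" for xs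
  proof -
    have "lspan xs \<subseteq> carrier M" using lspan_submodule[OF that] by (simp add: submodule_iff)
    moreover have "lspan xs \<noteq> carrier M" using no that by simp
    ultimately show ?thesis by blast
  qed
  define nxt where "nxt xs = (SOME x. x \<in> carrier M \<and> x \<notin> lspan xs)" for xs
  define G where "G n = ((\<lambda>xs. nxt xs # xs) ^^ n) []" for n
  have nxt: "nxt xs \<in> carrier M \<and> nxt xs \<notin> lspan xs" if "set xs \<subseteq> carrier M" for xs
    unfolding nxt_def using someI_ex[of "\<lambda>x. x \<in> carrier M \<and> x \<notin> lspan xs"] step[OF that] by blast
  have GS: "G (Suc n) = nxt (G n) # G n" for n by (simp add: G_def)
  have G: "set (G n) \<subseteq> carrier M" for n
    by (induction n) (use nxt in \<open>auto simp: GS, auto simp: G_def\<close>)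
  have "enat n \<le> module_length R M" for n
    unfolding module_length_def
  proof (rule Sup_upper, intro CollectI exI conjI allI impI)
    show "submodule (lspan (G i)) R M" for i by (rule lspan_submodule[OF G])
    show "lspan (G i) \<subset> lspan (G (Suc i))" for i
      unfolding GS using lspan_psubset[OF G] nxt[OF G] by blast
  qed simp
  moreover obtain m where "module_length R M = enat m" using assms by (cases "module_length R M") auto
  ultimately show False by (metis enat_ord_simps(1) not_less_eq_eq order_refl)
qed

lemma transport:
  fixes e :: "'c \<Rightarrow> 'n"
  assumes inj: "inj_on e (carrier M)"
  shows "\<exists>Y :: ('a, 'n) module. left_module R Y \<and> restrict e (carrier M) \<in> mod_hom R M Y \<and>
    carrier Y = e ` carrier M"
proof -
  define g where "g = the_inv_into (carrier M) e"
  have g: "g (e x) = x" if "x \<in> carrier M" for x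
    unfolding g_def using the_inv_into_f_f[OF inj that] .
  define Y :: "('a, 'n) module" where "Y =
    \<lparr>carrier = e ` carrier M, mult = (\<lambda>x y. x), one = e \<zero>\<^bsub>M\<^esub>, zero = e \<zero>\<^bsub>M\<^esub>,
     add = (\<lambda>x y. e (g x \<oplus>\<^bsub>M\<^esub> g y)), smult = (\<lambda>a x. e (a \<odot>\<^bsub>M\<^esub> g x))\<rparr>"
  have "abelian_group Y"
  proof (rule abelian_groupI)
    show "\<exists>y\<in>carrier Y. y \<oplus>\<^bsub>Y\<^esub> x = \<zero>\<^bsub>Y\<^esub>" if "x \<in> carrier Y" for x
    proof -
      from that obtain u where "u \<in> carrier M" "x = e u" by (auto simp: Y_def)
      then show ?thesis
        by (intro bexI[of _ "e (\<ominus>\<^bsub>M\<^esub> u)"]) (auto simp: Y_def g M.l_neg)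
    qed
  qed (auto simp: Y_def g M.a_ac)
  then have "left_module R Y"
    by (intro left_module.intro left_module_axioms.intro R.ring_axioms)
      (auto simp: Y_def g smult_l_distr smult_r_distr smult_assoc1)
  moreover have "restrict e (carrier M) \<in> mod_hom R M Y"
    by (auto simp: mod_hom_def Y_def g)
  moreover have "carrier Y = e ` carrier M" by (simp add: Y_def)
  ultimately show ?thesis by blast
qed

end

lemma mod_iso_length_le:
  assumes M: "left_module R M" and N: "left_module R N"
    and f: "f \<in> mod_hom R M N" and b: "bij_betw f (carrier M) (carrier N)"
  shows "module_length R N \<le> module_length R M"
  unfolding module_length_def
proof (rule Sup_subset_mono, clarify)
  interpret M: left_module R M by (rule M)
  interpret N: left_module R N by (rule N)
  fix n S assume S: "\<forall>i\<le>n. submodule (S i) R N" "\<forall>i<n. S i \<subset> S (Suc i)"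
  define T where "T i = {x \<in> carrier M. f x \<in> S i}" for i
  have fc: "f x \<in> carrier N" if "x \<in> carrier M" for x using f that by (auto simp: mod_hom_def)
  have fa: "f (x \<oplus>\<^bsub>M\<^esub> y) = f x \<oplus>\<^bsub>N\<^esub> f y" if "x \<in> carrier M" "y \<in> carrier M" for x y
    using f that by (auto simp: mod_hom_def)
  have fs: "f (a \<odot>\<^bsub>M\<^esub> x) = a \<odot>\<^bsub>N\<^esub> f x" if "x \<in> carrier M" "a \<in> carrier R" for x a
    using f that by (auto simp: mod_hom_def)
  have f0: "f \<zero>\<^bsub>M\<^esub> = \<zero>\<^bsub>N\<^esub>"
    using fs[of "\<zero>\<^bsub>M\<^esub>" "\<zero>\<^bsub>R\<^esub>"] fc[of "\<zero>\<^bsub>M\<^esub>"] by (simp add: M.smult_zero_l N.smult_zero_l)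
  have im: "f ` T i = S i" if "i \<le> n" for i
  proof -
    have "submodule (S i) R N" using S(1) that by simp
    then have "S i \<subseteq> f ` carrier M"
      using bij_betw_imp_surj_on[OF b] by (simp add: N.submodule_iff)
    then show ?thesis unfolding T_def by auto
  qed
  have "submodule (T i) R M" if "i \<le> n" for i
  proof -
    have Si: "submodule (S i) R N" using S(1) that by simp
    then have "\<zero>\<^bsub>N\<^esub> \<in> S i" "\<And>x y. x \<in> S i \<Longrightarrow> y \<in> S i \<Longrightarrow> x \<oplus>\<^bsub>N\<^esub> y \<in> S i"
      "\<And>a x. a \<in> carrier R \<Longrightarrow> x \<in> S i \<Longrightarrow> a \<odot>\<^bsub>N\<^esub> x \<in> S i"
      by (simp_all add: N.submodule_iff)
    then show ?thesis by (simp add: M.submodule_iff T_def f0 fa fs subset_iff)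
  qed
  moreover have "T i \<subset> T (Suc i)" if "i < n" for i
  proof -
    have "S i \<subseteq> S (Suc i)" using S(2) that by blast
    then have "T i \<subseteq> T (Suc i)" unfolding T_def by blast
    moreover have "T i \<noteq> T (Suc i)" using im[of i] im[of "Suc i"] S(2) that
      by (metis Suc_leI less_imp_le_nat psubsetE subset_refl)
    ultimately show ?thesis by blast
  qed
  ultimately show "\<exists>m. enat n = enat m \<and>
      (\<exists>N. (\<forall>i\<le>m. submodule (N i) R M) \<and> (\<forall>i<m. N i \<subset> N (Suc i)))"
    by blast
qed

lemma finite_length_module_on_lists:
  fixes R :: "('r, 'c) ring_scheme" and X :: "('r, 'm, 'd) module_scheme"
  assumes X: "finite_length_module R X"
  shows "\<exists>Y :: 'r lmod. finite_length_module R Y \<and> mod_iso R X Y"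
proof -
  interpret left_module R X using X by (simp add: finite_length_module_def)
  obtain xs where xs: "lspan xs = carrier X"
    using finite_length_imp_generated X by (auto simp: finite_length_module_def)
  define e where "e x = (SOME rs. lincomb rs xs = x)" for x
  have "lincomb (e x) xs = x" if "x \<in> carrier X" for x
  proof -
    have "\<exists>rs. lincomb rs xs = x" using that unfolding xs[symmetric] lspan_def by blast
    then show ?thesis unfolding e_def by (rule someI_ex)
  qed
  then have inj: "inj_on e (carrier X)" by (metis inj_onI)
  from transport[OF inj] obtain Y :: "'r lmod" where Y: "left_module R Y"
    "restrict e (carrier X) \<in> mod_hom R X Y" "carrier Y = e ` carrier X" by blast
  have b: "bij_betw (restrict e (carrier X)) (carrier X) (carrier Y)"
    using inj Y(3) by (simp add: bij_betw_def inj_on_def)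
  have "module_length R Y \<le> module_length R X"
    by (rule mod_iso_length_le[OF left_module_axioms Y(1,2) b])
  then have "finite_length_module R Y"
    using X Y(1) unfolding finite_length_module_def by (meson order_le_less_trans)
  moreover have "mod_iso R X Y" unfolding mod_iso_def using Y(2) b by blast
  ultimately show ?thesis by blast
qed

end

theory Submission
  imports Defs
begin

text \<open>
  Let \<open>C = D(\<Lambda>\<^sub>\<Lambda>)\<close>, where \<open>D = Hom(-, J)\<close> and \<open>J\<close> is the longest module over the base ring with
  multiplicity free socle (the injective hull of the sum of the simple modules), and let \<open>K\<close> be the
  sum of the indecomposable torsionless modules. A module \<open>Y\<close> generated by \<open>C\<close> embeds
  into some \<open>P \<in> add C\<close>, and \<open>X = Im(Hom(C, P) \<rightarrow> Hom(C, P/Y))\<close> is torsionless; conversely \<open>Y\<close> is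
  recovered from \<open>Hom(C, P) \<rightarrow> X\<close> up to summands in \<open>add C\<close>. As \<open>X\<close> lies in \<open>add K\<close>, there is a single
  module \<open>Q\<close> such that the modules generated by \<open>C\<close> are those in \<open>add Q\<close>.

  The module \<open>M = Q \<oplus> K\<close> is a generator-cogenerator. For a module \<open>X\<close> take a left \<open>add Q\<close>-approximation
  \<open>X \<rightarrow> Q'\<close> and the largest torsionless quotient \<open>X/W\<close>. Every map from \<open>X\<close> to \<open>M\<close> extends along
  \<open>X \<rightarrow> Q' \<oplus> X/W\<close>, and the cokernel of this map is a quotient of \<open>Q'\<close>, so it is again generated by
  \<open>C\<close> and belongs to \<open>add M\<close>. Hence \<open>Hom(X, M)\<close> has projective dimension at most one over \<open>End(M)\<close>,
  and every \<open>End(M)\<close>-module has such a module, up to projective summands, as a second syzygy.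
\<close>

section \<open>Homomorphisms and submodules\<close>

text \<open>The product of \<open>End_ring\<close> is composition, so its left modules come from
  maps into M: the projectives are the groups Hom(A, M) with A in add M, contravariant in A. For
  this reason the bound is proved with left approximations and cokernels. The number 3 is the sum of
  2, for two steps of a resolution by such projectives after which the syzygy is Hom(X, M), and of
  1, for the resolution of Hom(X, M).

  The module X attached to Y \<subseteq> P is torsionless because P/Y embeds in a sum of copies of
  C, so that Hom(C, P/Y) embeds in a sum of copies of Hom(C, C) = \<Lambda>. It determines Y only
  modulo add C, because two lifts of one map between such X differ by a map that sends all of P into
  the relations. The cokernel of X \<rightarrow> Q' \<oplus> X/W is a quotient of Q' since X
  \<rightarrow> X/W is onto.

  Membership in add S means that the identity lies in an ideal of maps; in this form it survives
  constructions that are functorial only modulo add C. Indecomposable modules enter only where the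
  finiteness hypothesis is used and where direct summands are extracted.\<close>

lemma mod_hom_closed: "f \<in> mod_hom R M N \<Longrightarrow> x \<in> carrier M \<Longrightarrow> f x \<in> carrier N"
  by (auto simp: mod_hom_def)

lemma mod_hom_add:
  "f \<in> mod_hom R M N \<Longrightarrow> x \<in> carrier M \<Longrightarrow> y \<in> carrier M \<Longrightarrow> f (x \<oplus>\<^bsub>M\<^esub> y) = f x \<oplus>\<^bsub>N\<^esub> f y"
  by (auto simp: mod_hom_def)

lemma mod_hom_smult:
  "f \<in> mod_hom R M N \<Longrightarrow> a \<in> carrier R \<Longrightarrow> x \<in> carrier M \<Longrightarrow> f (a \<odot>\<^bsub>M\<^esub> x) = a \<odot>\<^bsub>N\<^esub> f x"
  by (auto simp: mod_hom_def)

lemma mod_hom_extensional: "f \<in> mod_hom R M N \<Longrightarrow> f \<in> extensional (carrier M)"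
  by (auto simp: mod_hom_def PiE_def)

lemma mod_hom_restrict [simp]: "f \<in> mod_hom R M N \<Longrightarrow> restrict f (carrier M) = f"
  by (rule extensional_restrict[OF mod_hom_extensional])

text \<open>Members of \<open>mod_hom\<close> are extensional, so agreement on the carrier is
  equality. This makes the Hom sets honest modules, at the price of a \<open>restrict\<close> around
  every composite.\<close>

lemma mod_hom_eqI:
  assumes "f \<in> mod_hom R M N" "g \<in> mod_hom R M N'" "\<And>x. x \<in> carrier M \<Longrightarrow> f x = g x"
  shows "f = g"
  by (rule extensionalityI[of _ "carrier M"]) (use assms mod_hom_extensional in blast)+

lemma mod_hom_zero:
  assumes "left_module R M" "left_module R N" "f \<in> mod_hom R M N"
  shows "f \<zero>\<^bsub>M\<^esub> = \<zero>\<^bsub>N\<^esub>"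
proof -
  interpret M: left_module R M by fact
  interpret N: left_module R N by fact
  show ?thesis
    using mod_hom_smult[OF assms(3), of "\<zero>\<^bsub>R\<^esub>" "\<zero>\<^bsub>M\<^esub>"] mod_hom_closed[OF assms(3), of "\<zero>\<^bsub>M\<^esub>"]
    by (simp add: M.smult_zero_l N.smult_zero_l)
qed

lemma mod_hom_minus:
  assumes "left_module R M" "left_module R N" "f \<in> mod_hom R M N" "x \<in> carrier M"
  shows "f (\<ominus>\<^bsub>M\<^esub> x) = \<ominus>\<^bsub>N\<^esub> f x"
proof -
  interpret M: left_module R M by fact
  interpret N: left_module R N by fact
  show ?thesis
    using mod_hom_smult[OF assms(3), of "\<ominus>\<^bsub>R\<^esub> \<one>\<^bsub>R\<^esub>" x] mod_hom_closed[OF assms(3), of x] assms(4)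
    by (simp add: M.smult_minus_one N.smult_minus_one)
qed

lemma mod_hom_restrictI:
  assumes "left_module R M"
    and "\<And>x. x \<in> carrier M \<Longrightarrow> t x \<in> carrier N"
    and "\<And>x y. x \<in> carrier M \<Longrightarrow> y \<in> carrier M \<Longrightarrow> t (x \<oplus>\<^bsub>M\<^esub> y) = t x \<oplus>\<^bsub>N\<^esub> t y"
    and "\<And>a x. a \<in> carrier R \<Longrightarrow> x \<in> carrier M \<Longrightarrow> t (a \<odot>\<^bsub>M\<^esub> x) = a \<odot>\<^bsub>N\<^esub> t x"
  shows "(\<lambda>x\<in>carrier M. t x) \<in> mod_hom R M N"
proof -
  interpret M: left_module R M by fact
  show ?thesis unfolding mod_hom_def using assms(2-4) by auto
qed

lemma mod_hom_const_zero:
  assumes "left_module R M" "left_module R N"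
  shows "(\<lambda>x\<in>carrier M. \<zero>\<^bsub>N\<^esub>) \<in> mod_hom R M N"
proof -
  interpret N: left_module R N by fact
  show ?thesis by (rule mod_hom_restrictI[OF assms(1)]) (auto simp: N.smult_zero_r)
qed

lemma mod_hom_id:
  assumes "left_module R M"
  shows "(\<lambda>x\<in>carrier M. x) \<in> mod_hom R M M"
  by (rule mod_hom_restrictI[OF assms]) auto

lemma mod_hom_plus:
  assumes "left_module R M" "left_module R N" "f \<in> mod_hom R M N" "g \<in> mod_hom R M N"
  shows "(\<lambda>x\<in>carrier M. f x \<oplus>\<^bsub>N\<^esub> g x) \<in> mod_hom R M N"
proof -
  interpret N: left_module R N by fact
  show ?thesis using mod_hom_closed[OF assms(3)] mod_hom_closed[OF assms(4)]
    by (intro mod_hom_restrictI[OF assms(1)])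
      (auto simp: mod_hom_add[OF assms(3)] mod_hom_add[OF assms(4)] mod_hom_smult[OF assms(3)]
        mod_hom_smult[OF assms(4)] N.M.a_ac N.smult_r_distr)
qed

lemma mod_hom_uminus:
  assumes "left_module R M" "left_module R N" "f \<in> mod_hom R M N"
  shows "(\<lambda>x\<in>carrier M. \<ominus>\<^bsub>N\<^esub> f x) \<in> mod_hom R M N"
proof -
  interpret M: left_module R M by fact
  interpret N: left_module R N by fact
  note c = mod_hom_closed[OF assms(3)]
  have "\<ominus>\<^bsub>N\<^esub> (a \<odot>\<^bsub>N\<^esub> y) = a \<odot>\<^bsub>N\<^esub> (\<ominus>\<^bsub>N\<^esub> y)" if "a \<in> carrier R" "y \<in> carrier N" for a y
    using N.smult_r_distr[of a y "\<ominus>\<^bsub>N\<^esub> y"] that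
    by (simp add: N.M.r_neg N.smult_zero_r) (metis N.M.add.inv_equality N.M.add.inv_closed N.M.a_comm N.smult_closed)
  then show ?thesis using c
    by (intro mod_hom_restrictI[OF assms(1)])
      (auto simp: mod_hom_add[OF assms(3)] mod_hom_smult[OF assms(3)] N.M.minus_add)
qed

lemma mod_hom_comp:
  assumes "left_module R L" "f \<in> mod_hom R L M" "g \<in> mod_hom R M N"
  shows "(\<lambda>x\<in>carrier L. g (f x)) \<in> mod_hom R L N"
  using mod_hom_closed[OF assms(2)] mod_hom_closed[OF assms(3)]
  by (intro mod_hom_restrictI[OF assms(1)])
    (auto simp: mod_hom_add[OF assms(3)] mod_hom_add[OF assms(2)] mod_hom_smult[OF assms(2)]
      mod_hom_smult[OF assms(3)])

section \<open>Submodules: sums, intersections, images and preimages\<close>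

lemma submodule_subset: "left_module R M \<Longrightarrow> submodule U R M \<Longrightarrow> U \<subseteq> carrier M"
  by (simp add: left_module.submodule_iff)

lemma submodule_zero: "left_module R M \<Longrightarrow> submodule U R M \<Longrightarrow> \<zero>\<^bsub>M\<^esub> \<in> U"
  by (simp add: left_module.submodule_iff)

lemma submodule_add:
  "left_module R M \<Longrightarrow> submodule U R M \<Longrightarrow> x \<in> U \<Longrightarrow> y \<in> U \<Longrightarrow> x \<oplus>\<^bsub>M\<^esub> y \<in> U"
  by (simp add: left_module.submodule_iff)

lemma submodule_smult:
  "left_module R M \<Longrightarrow> submodule U R M \<Longrightarrow> a \<in> carrier R \<Longrightarrow> x \<in> U \<Longrightarrow> a \<odot>\<^bsub>M\<^esub> x \<in> U"
  by (simp add: left_module.submodule_iff)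

lemma submodule_uminus:
  assumes "left_module R M" "submodule U R M" "x \<in> U"
  shows "\<ominus>\<^bsub>M\<^esub> x \<in> U"
proof -
  interpret M: left_module R M by fact
  have "x \<in> carrier M" using submodule_subset assms by blast
  then show ?thesis using submodule_smult[OF assms(1,2), of "\<ominus>\<^bsub>R\<^esub> \<one>\<^bsub>R\<^esub>" x] assms(3)
    by (simp add: M.smult_minus_one)
qed

lemma submodule_diff:
  assumes "left_module R M" "submodule U R M" "x \<in> U" "y \<in> U"
  shows "x \<ominus>\<^bsub>M\<^esub> y \<in> U"
  using submodule_add[OF assms(1,2,3) submodule_uminus[OF assms(1,2,4)]] by (simp add: a_minus_def)

lemma left_module_submoduleI:
  assumes "left_module R M" "H \<subseteq> carrier M" "\<zero>\<^bsub>M\<^esub> \<in> H"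
    "\<And>x y. x \<in> H \<Longrightarrow> y \<in> H \<Longrightarrow> x \<oplus>\<^bsub>M\<^esub> y \<in> H"
    "\<And>a x. a \<in> carrier R \<Longrightarrow> x \<in> H \<Longrightarrow> a \<odot>\<^bsub>M\<^esub> x \<in> H"
  shows "submodule H R M"
  using assms by (simp add: left_module.submodule_iff)

lemma left_module_submodule:
  assumes "left_module R M" "submodule U R M"
  shows "left_module R (M\<lparr>carrier := U\<rparr>)"
proof -
  interpret M: left_module R M by fact
  note s = submodule_zero[OF assms] submodule_add[OF assms] submodule_smult[OF assms]
    subsetD[OF submodule_subset[OF assms]]
  have "abelian_group (M\<lparr>carrier := U\<rparr>)"
  proof (rule abelian_groupI)
    show "\<exists>y\<in>carrier (M\<lparr>carrier := U\<rparr>). y \<oplus>\<^bsub>M\<lparr>carrier := U\<rparr>\<^esub> x = \<zero>\<^bsub>M\<lparr>carrier := U\<rparr>\<^esub>"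
      if "x \<in> carrier (M\<lparr>carrier := U\<rparr>)" for x
      using that submodule_uminus[OF assms, of x] by (auto simp: s M.M.l_neg intro!: bexI[of _ "\<ominus>\<^bsub>M\<^esub> x"])
  qed (auto simp: s M.M.a_ac)
  then show ?thesis
    by (intro left_module.intro left_module_axioms.intro M.R.ring_axioms)
      (auto simp: s M.smult_l_distr M.smult_r_distr M.smult_assoc1)
qed

lemma submodule_carrier: "left_module R M \<Longrightarrow> submodule (carrier M) R M"
proof -
  assume "left_module R M"
  then interpret M: left_module R M .
  show ?thesis by (rule left_module_submoduleI[OF M.left_module_axioms]) auto
qed

lemma submodule_singleton_zero: "left_module R M \<Longrightarrow> submodule {\<zero>\<^bsub>M\<^esub>} R M"
proof -
  assume "left_module R M"
  then interpret M: left_module R M .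
  show ?thesis by (rule left_module_submoduleI[OF M.left_module_axioms]) (auto simp: M.smult_zero_r)
qed

lemma submodule_Int:
  "left_module R M \<Longrightarrow> submodule U R M \<Longrightarrow> submodule V R M \<Longrightarrow> submodule (U \<inter> V) R M"
  by (auto simp: left_module.submodule_iff)

lemma set_add_iff: "x \<in> U <+>\<^bsub>M\<^esub> V \<longleftrightarrow> (\<exists>u\<in>U. \<exists>v\<in>V. x = u \<oplus>\<^bsub>M\<^esub> v)"
  by (auto simp: set_add_def set_mult_def)

lemma submodule_set_add:
  assumes "left_module R M" "submodule U R M" "submodule V R M"
  shows "submodule (U <+>\<^bsub>M\<^esub> V) R M"
proof (rule left_module_submoduleI[OF assms(1)])
  interpret M: left_module R M by fact
  note U = submodule_zero[OF assms(1,2)] submodule_add[OF assms(1,2)] submodule_smult[OF assms(1,2)]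
    subsetD[OF submodule_subset[OF assms(1,2)]]
  note V = submodule_zero[OF assms(1,3)] submodule_add[OF assms(1,3)] submodule_smult[OF assms(1,3)]
    subsetD[OF submodule_subset[OF assms(1,3)]]
  show "U <+>\<^bsub>M\<^esub> V \<subseteq> carrier M" using U(4) V(4) by (auto simp: set_add_iff)
  show "\<zero>\<^bsub>M\<^esub> \<in> U <+>\<^bsub>M\<^esub> V" using U(1) V(1) by (force simp: set_add_iff)
  fix x assume "x \<in> U <+>\<^bsub>M\<^esub> V"
  then obtain u v where uv: "u \<in> U" "v \<in> V" "x = u \<oplus>\<^bsub>M\<^esub> v" by (auto simp: set_add_iff)
  show "a \<odot>\<^bsub>M\<^esub> x \<in> U <+>\<^bsub>M\<^esub> V" if "a \<in> carrier R" for a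
    using uv that U(3)[of a u] V(3)[of a v] U(4)[of u] V(4)[of v]
    unfolding set_add_iff by (intro bexI[of _ "a \<odot>\<^bsub>M\<^esub> u"] bexI[of _ "a \<odot>\<^bsub>M\<^esub> v"]) (simp_all add: M.smult_r_distr)
  fix y assume "y \<in> U <+>\<^bsub>M\<^esub> V"
  then obtain u' v' where uv': "u' \<in> U" "v' \<in> V" "y = u' \<oplus>\<^bsub>M\<^esub> v'" by (auto simp: set_add_iff)
  have "x \<oplus>\<^bsub>M\<^esub> y = (u \<oplus>\<^bsub>M\<^esub> u') \<oplus>\<^bsub>M\<^esub> (v \<oplus>\<^bsub>M\<^esub> v')"
    using uv uv' U(4) V(4) by (simp add: M.M.a_ac)
  then show "x \<oplus>\<^bsub>M\<^esub> y \<in> U <+>\<^bsub>M\<^esub> V" using uv uv' U(2) V(2) unfolding set_add_iff by blast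
qed

lemma set_add_upper:
  assumes "left_module R M" "submodule U R M" "submodule V R M"
  shows "U \<subseteq> U <+>\<^bsub>M\<^esub> V" "V \<subseteq> U <+>\<^bsub>M\<^esub> V"
proof -
  interpret M: left_module R M by fact
  show "U \<subseteq> U <+>\<^bsub>M\<^esub> V"
    using submodule_zero[OF assms(1,3)] submodule_subset[OF assms(1,2)]
    by (force simp: set_add_iff)
  show "V \<subseteq> U <+>\<^bsub>M\<^esub> V"
    using submodule_zero[OF assms(1,2)] submodule_subset[OF assms(1,3)]
    by (force simp: set_add_iff)
qed

lemma submodule_image:
  assumes "left_module R M" "left_module R N" "f \<in> mod_hom R M N" "submodule U R M"
  shows "submodule (f ` U) R N"
proof (rule left_module_submoduleI[OF assms(2)])
  interpret M: left_module R M by fact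
  note U = submodule_zero[OF assms(1,4)] submodule_add[OF assms(1,4)] submodule_smult[OF assms(1,4)]
    subsetD[OF submodule_subset[OF assms(1,4)]]
  show "f ` U \<subseteq> carrier N" using U(4) mod_hom_closed[OF assms(3)] by auto
  show "\<zero>\<^bsub>N\<^esub> \<in> f ` U" using mod_hom_zero[OF assms(1-3)] U(1) by (metis imageI)
  show "x \<oplus>\<^bsub>N\<^esub> y \<in> f ` U" if "x \<in> f ` U" "y \<in> f ` U" for x y
    using that U(2,4) by (auto simp: mod_hom_add[OF assms(3), symmetric])
  show "a \<odot>\<^bsub>N\<^esub> x \<in> f ` U" if "a \<in> carrier R" "x \<in> f ` U" for a x
    using that U(3,4) by (auto simp: mod_hom_smult[OF assms(3), symmetric])
qed

lemma submodule_vimage: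
  assumes "left_module R M" "left_module R N" "f \<in> mod_hom R M N" "submodule U R N"
  shows "submodule {x \<in> carrier M. f x \<in> U} R M"
proof (rule left_module_submoduleI[OF assms(1)])
  interpret M: left_module R M by fact
  note U = submodule_zero[OF assms(2,4)] submodule_add[OF assms(2,4)] submodule_smult[OF assms(2,4)]
  show "\<zero>\<^bsub>M\<^esub> \<in> {x \<in> carrier M. f x \<in> U}" using mod_hom_zero[OF assms(1-3)] U(1) by simp
qed (use assms in \<open>auto simp: mod_hom_add[OF assms(3)] mod_hom_smult[OF assms(3)]
    submodule_add submodule_smult left_module.smult_closed
    abelian_groupE(1) left_module_def\<close>)

lemma submodule_kernel:
  assumes "left_module R M" "left_module R N" "f \<in> mod_hom R M N"
  shows "submodule {x \<in> carrier M. f x = \<zero>\<^bsub>N\<^esub>} R M"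
  using submodule_vimage[OF assms submodule_singleton_zero[OF assms(2)]] by simp

lemma left_module_diff_eq_zero:
  assumes "left_module R M" "x \<in> carrier M" "y \<in> carrier M"
  shows "x \<ominus>\<^bsub>M\<^esub> y = \<zero>\<^bsub>M\<^esub> \<longleftrightarrow> x = y"
proof -
  interpret M: left_module R M by fact
  show ?thesis using assms(2,3)
    by (metis M.M.add.inv_closed M.M.add.inv_equality M.M.minus_minus M.M.r_neg M.M.minus_eq)
qed

lemma (in abelian_group) diff_diff_cancel:
  assumes "x \<in> carrier G" "y \<in> carrier G" "z \<in> carrier G"
  shows "(x \<ominus> z) \<oplus> (\<ominus> (y \<ominus> z)) = x \<ominus> y"
proof -
  have "(x \<ominus> z) \<oplus> (\<ominus> (y \<ominus> z)) = x \<oplus> (\<ominus> z \<oplus> (z \<oplus> \<ominus> y))"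
    using assms by (simp add: a_minus_def minus_add a_assoc a_comm[of "\<ominus> y"])
  then show ?thesis using assms by (simp add: r_neg1 a_minus_def)
qed

lemma mod_hom_inj_iff:
  assumes "left_module R M" "left_module R N" "f \<in> mod_hom R M N"
  shows "inj_on f (carrier M) \<longleftrightarrow> (\<forall>x\<in>carrier M. f x = \<zero>\<^bsub>N\<^esub> \<longrightarrow> x = \<zero>\<^bsub>M\<^esub>)"
proof
  interpret M: left_module R M by fact
  interpret N: left_module R N by fact
  show "inj_on f (carrier M) \<Longrightarrow> \<forall>x\<in>carrier M. f x = \<zero>\<^bsub>N\<^esub> \<longrightarrow> x = \<zero>\<^bsub>M\<^esub>"
    using mod_hom_zero[OF assms] by (metis M.M.zero_closed inj_onD)
  assume *: "\<forall>x\<in>carrier M. f x = \<zero>\<^bsub>N\<^esub> \<longrightarrow> x = \<zero>\<^bsub>M\<^esub>"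
  show "inj_on f (carrier M)"
  proof (rule inj_onI)
    fix x y assume xy: "x \<in> carrier M" "y \<in> carrier M" "f x = f y"
    then have "f (x \<ominus>\<^bsub>M\<^esub> y) = \<zero>\<^bsub>N\<^esub>"
      using mod_hom_closed[OF assms(3)]
      by (simp add: a_minus_def mod_hom_add[OF assms(3)] mod_hom_minus[OF assms] N.M.r_neg)
    then have "x \<ominus>\<^bsub>M\<^esub> y = \<zero>\<^bsub>M\<^esub>" using * xy by simp
    then show "x = y" using xy by (simp add: left_module_diff_eq_zero[OF assms(1)])
  qed
qed

lemma mod_hom_inverse:
  assumes "left_module R M" "left_module R N" "f \<in> mod_hom R M N" "bij_betw f (carrier M) (carrier N)"
  shows "\<exists>g\<in>mod_hom R N M. (\<forall>x\<in>carrier M. g (f x) = x) \<and> (\<forall>y\<in>carrier N. f (g y) = y) \<and>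
    bij_betw g (carrier N) (carrier M)"
proof -
  interpret M: left_module R M by fact
  define g where "g = the_inv_into (carrier M) f"
  have inj: "inj_on f (carrier M)" and im: "f ` carrier M = carrier N"
    using assms(4) by (auto simp: bij_betw_def)
  have g1: "g (f x) = x" if "x \<in> carrier M" for x
    unfolding g_def by (rule the_inv_into_f_f[OF inj that])
  have g2: "f (g y) = y" "g y \<in> carrier M" if "y \<in> carrier N" for y
  proof -
    from that obtain x where "x \<in> carrier M" "y = f x" using im by blast
    then show "f (g y) = y" "g y \<in> carrier M" by (simp_all add: g1)
  qed
  let ?g = "\<lambda>y\<in>carrier N. g y"
  have "?g \<in> mod_hom R N M"
  proof (rule mod_hom_restrictI[OF assms(2)])
    fix x y assume xy: "x \<in> carrier N" "y \<in> carrier N"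
    have "x \<oplus>\<^bsub>N\<^esub> y = f (g x \<oplus>\<^bsub>M\<^esub> g y)" using xy g2 by (simp add: mod_hom_add[OF assms(3)])
    then show "g (x \<oplus>\<^bsub>N\<^esub> y) = g x \<oplus>\<^bsub>M\<^esub> g y" using xy g2 g1 by simp
  next
    fix a x assume ax: "a \<in> carrier R" "x \<in> carrier N"
    have "a \<odot>\<^bsub>N\<^esub> x = f (a \<odot>\<^bsub>M\<^esub> g x)" using ax g2 by (simp add: mod_hom_smult[OF assms(3)])
    then show "g (a \<odot>\<^bsub>N\<^esub> x) = a \<odot>\<^bsub>M\<^esub> g x" using ax g2 g1 by simp
  qed (use g2 in auto)
  moreover have "bij_betw ?g (carrier N) (carrier M)"
    by (rule bij_betw_byWitness[where f' = f]) (use g1 g2 im in auto)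
  ultimately show ?thesis using g1 g2 mod_hom_closed[OF assms(3)] by (intro bexI[of _ ?g]) auto
qed

text \<open>The quotient is realised on chosen representatives, so that the type of elements is kept.\<close>

lemma quotient_module:
  fixes M :: "('r, 'm, 'd) module_scheme"
  assumes "left_module R M" "submodule W R M"
  obtains Q :: "('r, 'm) module" and p where "left_module R Q" "p \<in> mod_hom R M Q"
    "p ` carrier M = carrier Q" "\<And>x. x \<in> carrier M \<Longrightarrow> p x = \<zero>\<^bsub>Q\<^esub> \<longleftrightarrow> x \<in> W"
proof -
  interpret M: left_module R M by fact
  note W = submodule_zero[OF assms] submodule_add[OF assms] submodule_smult[OF assms]
    submodule_uminus[OF assms] subsetD[OF submodule_subset[OF assms]]
  define c where "c x = (SOME y. y \<in> carrier M \<and> x \<ominus>\<^bsub>M\<^esub> y \<in> W)" for x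
  have c: "c x \<in> carrier M \<and> x \<ominus>\<^bsub>M\<^esub> c x \<in> W" if "x \<in> carrier M" for x
    unfolding c_def by (rule someI[of _ x]) (use that W(1) in \<open>simp add: a_minus_def M.M.r_neg\<close>)
  \<comment> \<open>\<open>SOME\<close> depends only on its predicate, and for x and y in one class
    modulo \<open>W\<close> the two predicates coincide. Hence \<open>c\<close> is constant on
    classes, and its image can serve as the set of cosets.\<close>
  have c_eq: "c x = c y" if xy: "x \<in> carrier M" "y \<in> carrier M" "x \<ominus>\<^bsub>M\<^esub> y \<in> W" for x y
  proof -
    have "x \<ominus>\<^bsub>M\<^esub> z = (x \<ominus>\<^bsub>M\<^esub> y) \<oplus>\<^bsub>M\<^esub> (y \<ominus>\<^bsub>M\<^esub> z)" if "z \<in> carrier M" for z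
      using xy that by (simp add: a_minus_def M.M.a_ac M.M.r_neg1 M.M.r_neg2)
    moreover have "y \<ominus>\<^bsub>M\<^esub> z = \<ominus>\<^bsub>M\<^esub> (x \<ominus>\<^bsub>M\<^esub> y) \<oplus>\<^bsub>M\<^esub> (x \<ominus>\<^bsub>M\<^esub> z)" if "z \<in> carrier M" for z
      using xy that by (simp add: a_minus_def M.M.a_ac M.M.r_neg1 M.M.r_neg2 M.M.minus_add)
    ultimately have "x \<ominus>\<^bsub>M\<^esub> z \<in> W \<longleftrightarrow> y \<ominus>\<^bsub>M\<^esub> z \<in> W" if "z \<in> carrier M" for z
      using that xy(3) W(2,4) by metis
    then have "(\<lambda>z. z \<in> carrier M \<and> x \<ominus>\<^bsub>M\<^esub> z \<in> W) = (\<lambda>z. z \<in> carrier M \<and> y \<ominus>\<^bsub>M\<^esub> z \<in> W)" by blast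
    then show ?thesis unfolding c_def by simp
  qed
  have c_iff: "c x = c y \<longleftrightarrow> x \<ominus>\<^bsub>M\<^esub> y \<in> W" if xy: "x \<in> carrier M" "y \<in> carrier M" for x y
  proof
    assume eq: "c x = c y"
    have "x \<ominus>\<^bsub>M\<^esub> y = (x \<ominus>\<^bsub>M\<^esub> c x) \<oplus>\<^bsub>M\<^esub> (\<ominus>\<^bsub>M\<^esub> (y \<ominus>\<^bsub>M\<^esub> c y))"
      using M.M.diff_diff_cancel[of x y "c y"] xy c[of y] eq by simp
    then show "x \<ominus>\<^bsub>M\<^esub> y \<in> W" using W(2,4) c xy by metis
  qed (use c_eq xy in blast)
  have c_add: "c (c x \<oplus>\<^bsub>M\<^esub> c y) = c (x \<oplus>\<^bsub>M\<^esub> y)" if "x \<in> carrier M" "y \<in> carrier M" for x y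
  proof -
    have "(x \<oplus>\<^bsub>M\<^esub> y) \<ominus>\<^bsub>M\<^esub> (c x \<oplus>\<^bsub>M\<^esub> c y) = (x \<ominus>\<^bsub>M\<^esub> c x) \<oplus>\<^bsub>M\<^esub> (y \<ominus>\<^bsub>M\<^esub> c y)"
      using that c[of x] c[of y] by (simp add: a_minus_def M.M.minus_add M.M.a_ac)
    then have "(x \<oplus>\<^bsub>M\<^esub> y) \<ominus>\<^bsub>M\<^esub> (c x \<oplus>\<^bsub>M\<^esub> c y) \<in> W" using c that W(2) by simp
    then show ?thesis using c_eq[of "x \<oplus>\<^bsub>M\<^esub> y" "c x \<oplus>\<^bsub>M\<^esub> c y"] c that by simp
  qed
  have neg: "\<ominus>\<^bsub>M\<^esub> (a \<odot>\<^bsub>M\<^esub> y) = a \<odot>\<^bsub>M\<^esub> (\<ominus>\<^bsub>M\<^esub> y)" if "a \<in> carrier R" "y \<in> carrier M" for a y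
    using mod_hom_uminus[OF assms(1,1) mod_hom_id[OF assms(1)], THEN mod_hom_smult, of a y] that by simp
  have c_smult: "c (a \<odot>\<^bsub>M\<^esub> c x) = c (a \<odot>\<^bsub>M\<^esub> x)" if "x \<in> carrier M" "a \<in> carrier R" for a x
  proof -
    have "a \<odot>\<^bsub>M\<^esub> x \<ominus>\<^bsub>M\<^esub> a \<odot>\<^bsub>M\<^esub> c x = a \<odot>\<^bsub>M\<^esub> (x \<ominus>\<^bsub>M\<^esub> c x)"
      using that c[of x] by (simp add: a_minus_def M.smult_r_distr neg)
    then have "a \<odot>\<^bsub>M\<^esub> x \<ominus>\<^bsub>M\<^esub> a \<odot>\<^bsub>M\<^esub> c x \<in> W" using c that W(3) by simp
    then show ?thesis using c_eq[of "a \<odot>\<^bsub>M\<^esub> x" "a \<odot>\<^bsub>M\<^esub> c x"] c that by simp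
  qed
  have c_idem: "c (c x) = c x" if "x \<in> carrier M" for x
    using c_eq[of x "c x"] c that by simp
  define Q :: "('r, 'm) module" where "Q =
    \<lparr>carrier = c ` carrier M, mult = (\<lambda>x y. x), one = c \<zero>\<^bsub>M\<^esub>, zero = c \<zero>\<^bsub>M\<^esub>,
     add = (\<lambda>x y. c (x \<oplus>\<^bsub>M\<^esub> y)), smult = (\<lambda>a x. c (a \<odot>\<^bsub>M\<^esub> x))\<rparr>"
  have c_add1: "c (c x \<oplus>\<^bsub>M\<^esub> y) = c (x \<oplus>\<^bsub>M\<^esub> y)" "c (y \<oplus>\<^bsub>M\<^esub> c x) = c (y \<oplus>\<^bsub>M\<^esub> x)"
    if "x \<in> carrier M" "y \<in> carrier M" for x y
    using c_add[of x y] c_add[of "c x" y] c_add[of y x] c_add[of y "c x"] that c[of x]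
    by (simp_all add: c_idem)
  have cl: "c x \<in> carrier M" if "x \<in> carrier M" for x using c that by blast
  have "abelian_group Q"
  proof (rule abelian_groupI)
    show "x \<oplus>\<^bsub>Q\<^esub> y = y \<oplus>\<^bsub>Q\<^esub> x" if "x \<in> carrier Q" "y \<in> carrier Q" for x y
    proof -
      from that have "x \<in> carrier M" "y \<in> carrier M" using cl by (auto simp: Q_def)
      then show ?thesis by (simp add: Q_def M.M.a_comm[of x y])
    qed
    show "\<exists>y\<in>carrier Q. y \<oplus>\<^bsub>Q\<^esub> x = \<zero>\<^bsub>Q\<^esub>" if "x \<in> carrier Q" for x
    proof -
      from that obtain u where "u \<in> carrier M" "x = c u" by (auto simp: Q_def)
      then show ?thesis
        by (intro bexI[of _ "c (\<ominus>\<^bsub>M\<^esub> u)"]) (auto simp: Q_def c_add M.M.l_neg)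
    qed
    show "x \<oplus>\<^bsub>Q\<^esub> y \<in> carrier Q" if "x \<in> carrier Q" "y \<in> carrier Q" for x y
      using that cl by (simp add: Q_def) (metis M.M.a_closed imageE imageI)
    show "\<zero>\<^bsub>Q\<^esub> \<in> carrier Q" by (simp add: Q_def)
    show "x \<oplus>\<^bsub>Q\<^esub> y \<oplus>\<^bsub>Q\<^esub> z = x \<oplus>\<^bsub>Q\<^esub> (y \<oplus>\<^bsub>Q\<^esub> z)"
      if "x \<in> carrier Q" "y \<in> carrier Q" "z \<in> carrier Q" for x y z
    proof -
      from that have "x \<in> carrier M" "y \<in> carrier M" "z \<in> carrier M" using cl by (auto simp: Q_def)
      then show ?thesis by (simp add: Q_def c_add1 M.M.a_assoc)
    qed
    show "\<zero>\<^bsub>Q\<^esub> \<oplus>\<^bsub>Q\<^esub> x = x" if "x \<in> carrier Q" for x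
    proof -
      from that obtain u where "u \<in> carrier M" "x = c u" by (auto simp: Q_def)
      then show ?thesis by (simp add: Q_def c_add)
    qed
  qed
  moreover have "left_module_axioms R Q"
  proof
    have x: "x \<in> carrier M" if "x \<in> carrier Q" for x using cl that by (auto simp: Q_def)
    show "a \<odot>\<^bsub>Q\<^esub> x \<in> carrier Q" if "a \<in> carrier R" "x \<in> carrier Q" for a x
      using that x by (simp add: Q_def)
    show "(a \<oplus>\<^bsub>R\<^esub> b) \<odot>\<^bsub>Q\<^esub> x = a \<odot>\<^bsub>Q\<^esub> x \<oplus>\<^bsub>Q\<^esub> b \<odot>\<^bsub>Q\<^esub> x"
      if "a \<in> carrier R" "b \<in> carrier R" "x \<in> carrier Q" for a b x
      using that(1,2) x[OF that(3)] by (simp add: Q_def c_add M.smult_l_distr)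
    show "a \<odot>\<^bsub>Q\<^esub> (x \<oplus>\<^bsub>Q\<^esub> y) = a \<odot>\<^bsub>Q\<^esub> x \<oplus>\<^bsub>Q\<^esub> a \<odot>\<^bsub>Q\<^esub> y"
      if "a \<in> carrier R" "x \<in> carrier Q" "y \<in> carrier Q" for a x y
      using that(1) x[OF that(2)] x[OF that(3)] by (simp add: Q_def c_add c_smult M.smult_r_distr)
    show "(a \<otimes>\<^bsub>R\<^esub> b) \<odot>\<^bsub>Q\<^esub> x = a \<odot>\<^bsub>Q\<^esub> (b \<odot>\<^bsub>Q\<^esub> x)"
      if "a \<in> carrier R" "b \<in> carrier R" "x \<in> carrier Q" for a b x
      using that(1,2) x[OF that(3)] by (simp add: Q_def c_smult M.smult_assoc1)
    show "\<one>\<^bsub>R\<^esub> \<odot>\<^bsub>Q\<^esub> x = x" if "x \<in> carrier Q" for x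
    proof -
      from that obtain u where "u \<in> carrier M" "x = c u" by (auto simp: Q_def)
      then show ?thesis by (simp add: Q_def c_smult)
    qed
  qed
  ultimately have "left_module R Q" by (intro left_module.intro M.R.ring_axioms)
  moreover have "(\<lambda>x\<in>carrier M. c x) \<in> mod_hom R M Q"
    using cl by (intro mod_hom_restrictI[OF assms(1)]) (auto simp: Q_def c_add c_smult)
  moreover have "c x = c \<zero>\<^bsub>M\<^esub> \<longleftrightarrow> x \<in> W" if "x \<in> carrier M" for x
    using c_iff[of x "\<zero>\<^bsub>M\<^esub>"] that M.M.minus_equality[of "\<zero>\<^bsub>M\<^esub>" "\<zero>\<^bsub>M\<^esub>"] by (simp add: a_minus_def)
  ultimately show ?thesis
    by (intro that[of Q "\<lambda>x\<in>carrier M. c x"]) (auto simp: Q_def)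
qed

text \<open>The elements are pairs, so the sum of two modules on lists is not itself a module on
  lists. The version that stays inside \<open>lmod\<close> is \<open>biproduct\<close>, obtained by
  copying.\<close>

definition dsum :: "('r, 'm, 'd) module_scheme \<Rightarrow> ('r, 'n, 'e) module_scheme \<Rightarrow> ('r, 'm \<times> 'n) module"
  where "dsum A B = \<lparr>carrier = carrier A \<times> carrier B, mult = (\<lambda>x y. x), one = (\<zero>\<^bsub>A\<^esub>, \<zero>\<^bsub>B\<^esub>),
    zero = (\<zero>\<^bsub>A\<^esub>, \<zero>\<^bsub>B\<^esub>), add = (\<lambda>x y. (fst x \<oplus>\<^bsub>A\<^esub> fst y, snd x \<oplus>\<^bsub>B\<^esub> snd y)),
    smult = (\<lambda>a x. (a \<odot>\<^bsub>A\<^esub> fst x, a \<odot>\<^bsub>B\<^esub> snd x))\<rparr>"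

lemma dsum_left_module:
  assumes "left_module R A" "left_module R B"
  shows "left_module R (dsum A B)"
proof -
  interpret A: left_module R A by fact
  interpret B: left_module R B by fact
  have "abelian_group (dsum A B)"
  proof (rule abelian_groupI)
    show "\<exists>y\<in>carrier (dsum A B). y \<oplus>\<^bsub>dsum A B\<^esub> x = \<zero>\<^bsub>dsum A B\<^esub>" if "x \<in> carrier (dsum A B)" for x
      using that by (intro bexI[of _ "(\<ominus>\<^bsub>A\<^esub> fst x, \<ominus>\<^bsub>B\<^esub> snd x)"])
        (auto simp: dsum_def A.M.l_neg B.M.l_neg)
  qed (auto simp: dsum_def A.M.a_ac B.M.a_ac)
  then show ?thesis
    by (intro left_module.intro left_module_axioms.intro A.R.ring_axioms)
      (auto simp: dsum_def A.smult_l_distr A.smult_r_distr A.smult_assoc1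
        B.smult_l_distr B.smult_r_distr B.smult_assoc1)
qed

lemma dsum_homs:
  assumes "left_module R A" "left_module R B"
  shows "(\<lambda>x\<in>carrier A. (x, \<zero>\<^bsub>B\<^esub>)) \<in> mod_hom R A (dsum A B)"
    "(\<lambda>y\<in>carrier B. (\<zero>\<^bsub>A\<^esub>, y)) \<in> mod_hom R B (dsum A B)"
    "(\<lambda>z\<in>carrier (dsum A B). fst z) \<in> mod_hom R (dsum A B) A"
    "(\<lambda>z\<in>carrier (dsum A B). snd z) \<in> mod_hom R (dsum A B) B"
proof -
  interpret A: left_module R A by fact
  interpret B: left_module R B by fact
  show "(\<lambda>x\<in>carrier A. (x, \<zero>\<^bsub>B\<^esub>)) \<in> mod_hom R A (dsum A B)"
    by (rule mod_hom_restrictI[OF assms(1)]) (auto simp: dsum_def B.smult_zero_r)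
  show "(\<lambda>y\<in>carrier B. (\<zero>\<^bsub>A\<^esub>, y)) \<in> mod_hom R B (dsum A B)"
    by (rule mod_hom_restrictI[OF assms(2)]) (auto simp: dsum_def A.smult_zero_r)
  show "(\<lambda>z\<in>carrier (dsum A B). fst z) \<in> mod_hom R (dsum A B) A"
    by (rule mod_hom_restrictI[OF dsum_left_module[OF assms]]) (auto simp: dsum_def)
  show "(\<lambda>z\<in>carrier (dsum A B). snd z) \<in> mod_hom R (dsum A B) B"
    by (rule mod_hom_restrictI[OF dsum_left_module[OF assms]]) (auto simp: dsum_def)
qed

section \<open>Length\<close>

text \<open>Along a chain with n strict inclusions the measure climbs by at least n. Upper bounds
  for a length come from such measures, without refining chains.\<close>

lemma module_length_bound:
  fixes b :: nat
  assumes mono: "\<And>U V. submodule U R M \<Longrightarrow> submodule V R M \<Longrightarrow> U \<subset> V \<Longrightarrow> \<mu> U < \<mu> V"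
    and le: "\<And>U. submodule U R M \<Longrightarrow> \<mu> U \<le> b"
  shows "module_length R M \<le> enat b"
  unfolding module_length_def
proof (rule Sup_least, clarify)
  fix n N assume N: "\<forall>i\<le>n. submodule (N i) R M" "\<forall>i<n. N i \<subset> N (Suc i)"
  have "i \<le> n \<Longrightarrow> i \<le> \<mu> (N i)" for i
  proof (induction i)
    case (Suc i)
    then have "\<mu> (N i) < \<mu> (N (Suc i))" using N by (intro mono) auto
    then show ?case using Suc by simp
  qed simp
  from this[of n] le[of "N n"] N show "enat n \<le> enat b" by (simp add: order_trans)
qed

text \<open>A finite supremum in \<open>enat\<close> is taken over a finite set, where it is a
  maximum; the set contains 0, so it is not empty.\<close>

lemma module_length_attained:
  assumes "left_module R M" "module_length R M = enat n"
  shows "\<exists>N. (\<forall>i\<le>n. submodule (N i) R M) \<and> (\<forall>i<n. N i \<subset> N (Suc i))"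
proof -
  let ?S = "{enat n | n. \<exists>N. (\<forall>i\<le>n. submodule (N i) R M) \<and> (\<forall>i<n. N i \<subset> N (Suc i))}"
  have "enat 0 \<in> ?S"
    using submodule_carrier[OF assms(1)] by (intro CollectI exI[of _ 0] exI[of _ "\<lambda>_. carrier M"]) auto
  moreover from this have "finite ?S"
    using assms(2) unfolding module_length_def Sup_enat_def by (auto split: if_splits)
  ultimately have "Sup ?S \<in> ?S" by (metis (lifting) Max_in Sup_enat_def empty_iff)
  then show ?thesis using assms(2) unfolding module_length_def by auto
qed

lemma module_length_ge:
  assumes "\<And>i. i \<le> n \<Longrightarrow> submodule (N i) R M" "\<And>i. i < n \<Longrightarrow> N i \<subset> N (Suc i)"
  shows "enat n \<le> module_length R M"
  unfolding module_length_def by (rule Sup_upper) (use assms in blast)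

lemma submodule_submodule_iff:
  assumes "left_module R M" "submodule U R M"
  shows "submodule H R (M\<lparr>carrier := U\<rparr>) \<longleftrightarrow> submodule H R M \<and> H \<subseteq> U"
  using left_module.submodule_iff[OF assms(1)] left_module.submodule_iff[OF left_module_submodule[OF assms]]
    submodule_subset[OF assms] by auto

text \<open>A natural number, so that it can be used as an induction measure and for least and
  greatest choices. It carries information only where \<open>U\<close> has finite length.\<close>

definition len :: "('r, 'c) ring_scheme \<Rightarrow> ('r, 'm, 'd) module_scheme \<Rightarrow> 'm set \<Rightarrow> nat"
  where "len R M U = the_enat (module_length R (M\<lparr>carrier := U\<rparr>))"

lemma finite_length_left_module: "finite_length_module R M \<Longrightarrow> left_module R M"
  by (simp add: finite_length_module_def)

lemma module_length_submodule_mono: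
  assumes "left_module R M" "submodule U R M" "submodule V R M" "U \<subseteq> V"
  shows "module_length R (M\<lparr>carrier := U\<rparr>) \<le> module_length R (M\<lparr>carrier := V\<rparr>)"
  unfolding module_length_def
proof (rule Sup_subset_mono, clarify)
  fix n N assume N: "\<forall>i\<le>n. submodule (N i) R (M\<lparr>carrier := U\<rparr>)" "\<forall>i<n. N i \<subset> N (Suc i)"
  then have "\<forall>i\<le>n. submodule (N i) R (M\<lparr>carrier := V\<rparr>)"
    using assms(4) by (simp add: submodule_submodule_iff[OF assms(1,2)] submodule_submodule_iff[OF assms(1,3)]) blast
  with N(2) show "\<exists>m. enat n = enat m \<and>
      (\<exists>N. (\<forall>i\<le>m. submodule (N i) R (M\<lparr>carrier := V\<rparr>)) \<and> (\<forall>i<m. N i \<subset> N (Suc i)))"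
    by blast
qed

lemma finite_length_submodule:
  assumes "finite_length_module R M" "submodule U R M"
  shows "finite_length_module R (M\<lparr>carrier := U\<rparr>)"
proof -
  note l = finite_length_left_module[OF assms(1)]
  have "module_length R (M\<lparr>carrier := U\<rparr>) \<le> module_length R M"
    using module_length_submodule_mono[OF l assms(2) submodule_carrier[OF l] submodule_subset[OF l assms(2)]]
    by simp
  then show ?thesis using assms(1) left_module_submodule[OF l assms(2)]
    unfolding finite_length_module_def by (meson order_le_less_trans)
qed

lemma enat_len:
  assumes "finite_length_module R (M\<lparr>carrier := U\<rparr>)"
  shows "module_length R (M\<lparr>carrier := U\<rparr>) = enat (len R M U)"
  using assms by (auto simp: len_def finite_length_module_def)

lemma enat_len_carrier:
  "finite_length_module R M \<Longrightarrow> module_length R M = enat (len R M (carrier M))"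
  using enat_len[where M = M and U = "carrier M"] by simp

text \<open>A longest chain in \<open>U\<close> is prolonged by \<open>V\<close>. Finite length is
  asked of \<open>V\<close> and not of the ambient module.\<close>

lemma len_strict_mono':
  assumes M: "left_module R M" and U: "submodule U R M" and V: "submodule V R M" and "U \<subset> V"
    and fl: "finite_length_module R (M\<lparr>carrier := V\<rparr>)"
  shows "len R M U < len R M V"
proof -
  have "finite_length_module R (M\<lparr>carrier := U\<rparr>)"
    using finite_length_submodule[OF fl, of U] submodule_submodule_iff[OF M V] U \<open>U \<subset> V\<close> by simp
  note l = enat_len[OF this]
  obtain N where N: "\<forall>i\<le>len R M U. submodule (N i) R (M\<lparr>carrier := U\<rparr>)"
    "\<forall>i<len R M U. N i \<subset> N (Suc i)"
    using module_length_attained[OF left_module_submodule[OF M U] l] by blast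
  let ?N = "\<lambda>i. if i \<le> len R M U then N i else V"
  have "enat (Suc (len R M U)) \<le> module_length R (M\<lparr>carrier := V\<rparr>)"
  proof (rule module_length_ge[where N = ?N])
    show "submodule (?N i) R (M\<lparr>carrier := V\<rparr>)" if "i \<le> Suc (len R M U)" for i
      using N(1) \<open>U \<subset> V\<close> V by (auto simp: submodule_submodule_iff[OF M U] submodule_submodule_iff[OF M V])
    show "?N i \<subset> ?N (Suc i)" if "i < Suc (len R M U)" for i
    proof (cases "i = len R M U")
      case True
      then have "N i \<subseteq> U" using N(1) by (simp add: submodule_submodule_iff[OF M U])
      then show ?thesis using True \<open>U \<subset> V\<close> by auto
    next
      case False
      then show ?thesis using that N by auto
    qed
  qed
  then show ?thesis unfolding enat_len[OF fl] by simp
qed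

lemma len_strict_mono:
  assumes "finite_length_module R M" "submodule U R M" "submodule V R M" "U \<subset> V"
  shows "len R M U < len R M V"
  using len_strict_mono'[OF finite_length_left_module[OF assms(1)] assms(2-4)
      finite_length_submodule[OF assms(1,3)]] .

lemma len_mono:
  assumes "finite_length_module R M" "submodule U R M" "submodule V R M" "U \<subseteq> V"
  shows "len R M U \<le> len R M V"
  using len_strict_mono[OF assms(1-3)] assms(4) by (cases "U = V") (auto simp: psubset_eq)

lemma len_le:
  assumes "finite_length_module R M" "submodule U R M"
  shows "len R M U \<le> len R M (carrier M)"
  using assms len_mono[OF assms(1,2) submodule_carrier] submodule_subset finite_length_left_module by blast

text \<open>Lengths of submodules are bounded, so one of greatest length with the property exists;
  strict monotonicity of \<open>len\<close> makes it maximal for inclusion.\<close>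

lemma submodule_maximal_exists:
  assumes "finite_length_module R M" "submodule U\<^sub>0 R M" "P U\<^sub>0"
  obtains U where "submodule U R M" "P U" "\<And>V. submodule V R M \<Longrightarrow> P V \<Longrightarrow> U \<subseteq> V \<Longrightarrow> V = U"
proof -
  obtain U where U: "submodule U R M \<and> P U"
    "\<forall>V. submodule V R M \<and> P V \<longrightarrow> len R M V \<le> len R M U"
    using ex_has_greatest_nat[of "\<lambda>U. submodule U R M \<and> P U" U\<^sub>0 "len R M" "Suc (len R M (carrier M))"]
      assms(2,3) len_le[OF assms(1)] le_imp_less_Suc by blast
  have "V = U" if "submodule V R M" "P V" "U \<subseteq> V" for V
    using len_strict_mono[OF assms(1), of U V] U that by fastforce
  then show ?thesis using U that by blast
qed

lemma submodule_minimal_exists: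
  assumes "finite_length_module R M" "submodule U\<^sub>0 R M" "P U\<^sub>0"
  obtains U where "submodule U R M" "P U" "\<And>V. submodule V R M \<Longrightarrow> P V \<Longrightarrow> V \<subseteq> U \<Longrightarrow> V = U"
proof -
  obtain U where U: "submodule U R M \<and> P U"
    "\<forall>V. submodule V R M \<and> P V \<longrightarrow> len R M U \<le> len R M V"
    using ex_has_least_nat[of "\<lambda>U. submodule U R M \<and> P U" U\<^sub>0 "len R M"] assms(2,3) by blast
  have "V = U" if "submodule V R M" "P V" "V \<subseteq> U" for V
    using len_strict_mono[OF assms(1), of V U] U that by fastforce
  then show ?thesis using U that by blast
qed

section \<open>Length under surjections, injections and extensions\<close>

lemma module_length_surj:
  assumes "left_module R M" "left_module R N" "f \<in> mod_hom R M N" "f ` carrier M = carrier N"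
  shows "module_length R N \<le> module_length R M"
  unfolding module_length_def
proof (rule Sup_subset_mono, clarify)
  fix n S assume S: "\<forall>i\<le>n. submodule (S i) R N" "\<forall>i<n. S i \<subset> S (Suc i)"
  define T where "T i = {x \<in> carrier M. f x \<in> S i}" for i
  have im: "f ` T i = S i" if "i \<le> n" for i
    using submodule_subset[OF assms(2), of "S i"] S(1) that assms(4) unfolding T_def by auto
  have "submodule (T i) R M" if "i \<le> n" for i
    unfolding T_def using submodule_vimage[OF assms(1-3)] S(1) that by blast
  moreover have "T i \<subset> T (Suc i)" if "i < n" for i
  proof -
    have "S i \<subseteq> S (Suc i)" using S(2) that by blast
    then have "T i \<subseteq> T (Suc i)" unfolding T_def by blast
    moreover have "T i \<noteq> T (Suc i)" using im[of i] im[of "Suc i"] S(2) that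
      by (metis Suc_leI less_imp_le_nat psubsetE subset_refl)
    ultimately show ?thesis by blast
  qed
  ultimately show "\<exists>m. enat n = enat m \<and>
      (\<exists>N. (\<forall>i\<le>m. submodule (N i) R M) \<and> (\<forall>i<m. N i \<subset> N (Suc i)))"
    by blast
qed

lemma finite_length_surj:
  assumes "finite_length_module R M" "left_module R N" "f \<in> mod_hom R M N" "f ` carrier M = carrier N"
  shows "finite_length_module R N"
  using module_length_surj[OF finite_length_left_module[OF assms(1)] assms(2-4)] assms(1,2)
  unfolding finite_length_module_def by (meson order_le_less_trans)

lemma module_length_inj:
  assumes "left_module R M" "left_module R N" "f \<in> mod_hom R M N" "inj_on f (carrier M)"
  shows "module_length R M \<le> module_length R N"
  unfolding module_length_def
proof (rule Sup_subset_mono, clarify)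
  fix n S assume S: "\<forall>i\<le>n. submodule (S i) R M" "\<forall>i<n. S i \<subset> S (Suc i)"
  have sub: "S i \<subseteq> carrier M" if "i \<le> n" for i
    using submodule_subset[OF assms(1)] S(1) that by blast
  have "submodule (f ` S i) R N" if "i \<le> n" for i
    using submodule_image[OF assms(1-3)] S(1) that by blast
  moreover have "f ` S i \<subset> f ` S (Suc i)" if "i < n" for i
    using inj_on_image_eq_iff[OF assms(4) sub sub, of i "Suc i"] that S(2) by auto
  ultimately show "\<exists>m. enat n = enat m \<and>
      (\<exists>T. (\<forall>i\<le>m. submodule (T i) R N) \<and> (\<forall>i<m. T i \<subset> T (Suc i)))"
    by (intro exI[of _ n] conjI exI[of _ "\<lambda>i. f ` S i"]) auto
qed

text \<open>A proper submodule is strictly shorter, so an injection between modules of equal length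
  cannot miss anything. Only one inequality is assumed, as injectivity supplies the other.\<close>

lemma inj_length_imp_surj:
  assumes "finite_length_module R M" "finite_length_module R N" "f \<in> mod_hom R M N"
    "inj_on f (carrier M)" "module_length R N \<le> module_length R M"
  shows "f ` carrier M = carrier N"
proof (rule ccontr)
  assume ne: "f ` carrier M \<noteq> carrier N"
  note lM = finite_length_left_module[OF assms(1)]
  note lN = finite_length_left_module[OF assms(2)]
  have s: "submodule (f ` carrier M) R N"
    by (rule submodule_image[OF lM lN assms(3) submodule_carrier[OF lM]])
  then have "f ` carrier M \<subset> carrier N" using ne submodule_subset[OF lN] by blast
  then have "len R N (f ` carrier M) < len R N (carrier N)"
    using len_strict_mono[OF assms(2) s submodule_carrier[OF lN]] by blast
  moreover have "f \<in> mod_hom R M (N\<lparr>carrier := f ` carrier M\<rparr>)"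
    using assms(3) by (auto simp: mod_hom_def PiE_def)
  then have "module_length R M \<le> module_length R (N\<lparr>carrier := f ` carrier M\<rparr>)"
    by (intro module_length_inj[OF lM left_module_submodule[OF lN s] _ assms(4)])
  then have "module_length R M \<le> enat (len R N (f ` carrier M))"
    using enat_len[OF finite_length_submodule[OF assms(2) s]] by simp
  ultimately show False using enat_len_carrier[OF assms(1)] enat_len_carrier[OF assms(2)] assms(5)
    by simp
qed

lemma finite_lengthI: "left_module R M \<Longrightarrow> module_length R M \<le> enat n \<Longrightarrow> finite_length_module R M"
  unfolding finite_length_module_def by (meson enat_ord_code(4) order_le_less_trans)

text \<open>When C lies strictly inside D, either their images under \<open>f\<close> differ or
  their intersections with the kernel do. The sum of the two lengths is therefore strictly
  increasing and bounded.\<close>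

lemma finite_length_extension:
  assumes M: "left_module R M" and N: "finite_length_module R N" and f: "f \<in> mod_hom R M N"
    and K: "finite_length_module R (M\<lparr>carrier := {x \<in> carrier M. f x = \<zero>\<^bsub>N\<^esub>}\<rparr>)"
  shows "finite_length_module R M"
proof -
  interpret M: left_module R M by fact
  note lN = finite_length_left_module[OF N]
  interpret N: left_module R N by (rule lN)
  let ?K = "{x \<in> carrier M. f x = \<zero>\<^bsub>N\<^esub>}"
  let ?MK = "M\<lparr>carrier := ?K\<rparr>"
  have sK: "submodule ?K R M" by (rule submodule_kernel[OF M lN f])
  let ?\<mu> = "\<lambda>C. len R ?MK (C \<inter> ?K) + len R N (f ` C)"
  have s1: "submodule (C \<inter> ?K) R ?MK" if "submodule C R M" for C
    unfolding submodule_submodule_iff[OF M sK] using submodule_Int[OF M that sK] by blast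
  have s2: "submodule (f ` C) R N" if "submodule C R M" for C
    by (rule submodule_image[OF M lN f that])
  have "module_length R M \<le> enat (len R ?MK (carrier ?MK) + len R N (carrier N))"
  proof (rule module_length_bound[where \<mu> = ?\<mu>])
    fix C D assume C: "submodule C R M" and D: "submodule D R M" and "C \<subset> D"
    have l1: "len R ?MK (C \<inter> ?K) \<le> len R ?MK (D \<inter> ?K)"
      using \<open>C \<subset> D\<close> by (intro len_mono[OF K] s1 C D) auto
    have l2: "len R N (f ` C) \<le> len R N (f ` D)"
      using \<open>C \<subset> D\<close> by (intro len_mono[OF N] s2 C D) auto
    obtain y where y: "y \<in> D" "y \<notin> C" using \<open>C \<subset> D\<close> by blast
    show "?\<mu> C < ?\<mu> D"
    proof (cases "f y \<in> f ` C")
      case True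
      \<comment> \<open>y and c have the same image, so y - c is in the kernel; it belongs to D but
        not to C, and the intersections with the kernel differ.\<close>
      then obtain c where c: "c \<in> C" "f y = f c" by blast
      have car: "y \<in> carrier M" "c \<in> carrier M" using submodule_subset[OF M] C D c y by auto
      have "y \<ominus>\<^bsub>M\<^esub> c \<in> D" using submodule_diff[OF M D] y c \<open>C \<subset> D\<close> by blast
      moreover have "f (y \<ominus>\<^bsub>M\<^esub> c) = \<zero>\<^bsub>N\<^esub>"
        using car c mod_hom_closed[OF f]
        by (simp add: a_minus_def mod_hom_add[OF f] mod_hom_minus[OF M lN f] N.M.r_neg)
      moreover have "y \<ominus>\<^bsub>M\<^esub> c \<notin> C"
      proof
        assume "y \<ominus>\<^bsub>M\<^esub> c \<in> C"
        then have "(y \<ominus>\<^bsub>M\<^esub> c) \<oplus>\<^bsub>M\<^esub> c \<in> C" using submodule_add[OF M C] c by blast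
        then show False using y car by (simp add: a_minus_def M.M.a_assoc M.M.l_neg)
      qed
      ultimately have "C \<inter> ?K \<subset> D \<inter> ?K" using car \<open>C \<subset> D\<close> by auto
      then have "len R ?MK (C \<inter> ?K) < len R ?MK (D \<inter> ?K)" by (intro len_strict_mono[OF K] s1 C D)
      then show ?thesis using l2 by simp
    next
      case False
      then have "f ` C \<subset> f ` D" using y \<open>C \<subset> D\<close> by blast
      then have "len R N (f ` C) < len R N (f ` D)" by (intro len_strict_mono[OF N] s2 C D)
      then show ?thesis using l1 by simp
    qed
  next
    fix C assume "submodule C R M"
    then show "?\<mu> C \<le> len R ?MK (carrier ?MK) + len R N (carrier N)"
      using len_le[OF K s1] len_le[OF N s2] by (simp add: add_mono)
  qed
  then show ?thesis by (rule finite_lengthI[OF M])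
qed

lemma finite_length_dsum:
  assumes "finite_length_module R A" "finite_length_module R B"
  shows "finite_length_module R (dsum A B)"
proof -
  note A = finite_length_left_module[OF assms(1)]
  note B = finite_length_left_module[OF assms(2)]
  interpret A: left_module R A by (rule A)
  interpret B: left_module R B by (rule B)
  let ?f = "\<lambda>z\<in>carrier (dsum A B). snd z"
  let ?K = "{x \<in> carrier (dsum A B). ?f x = \<zero>\<^bsub>B\<^esub>}"
  note sK = submodule_kernel[OF dsum_left_module[OF A B] B dsum_homs(4)[OF A B]]
  have "finite_length_module R (dsum A B\<lparr>carrier := ?K\<rparr>)"
    by (rule finite_length_surj[OF assms(1) left_module_submodule[OF dsum_left_module[OF A B] sK],
        where f = "\<lambda>x\<in>carrier A. (x, \<zero>\<^bsub>B\<^esub>)"])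
      (auto simp: dsum_def mod_hom_def B.smult_zero_r)
  then show ?thesis
    by (rule finite_length_extension[OF dsum_left_module[OF A B] assms(2) dsum_homs(4)[OF A B]])
qed

text \<open>The sum of two submodules is an image of their direct sum.\<close>

lemma finite_length_set_add:
  assumes M: "left_module R M" and U: "submodule U R M" and V: "submodule V R M"
    and fU: "finite_length_module R (M\<lparr>carrier := U\<rparr>)" and fV: "finite_length_module R (M\<lparr>carrier := V\<rparr>)"
  shows "finite_length_module R (M\<lparr>carrier := U <+>\<^bsub>M\<^esub> V\<rparr>)"
proof -
  interpret M: left_module R M by fact
  let ?D = "dsum (M\<lparr>carrier := U\<rparr>) (M\<lparr>carrier := V\<rparr>)"
  note uv = subsetD[OF submodule_subset[OF M U]] subsetD[OF submodule_subset[OF M V]]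
  have "(\<lambda>z\<in>carrier ?D. fst z \<oplus>\<^bsub>M\<^esub> snd z) \<in> mod_hom R ?D (M\<lparr>carrier := U <+>\<^bsub>M\<^esub> V\<rparr>)"
  proof (intro mod_hom_restrictI[OF dsum_left_module] fU[THEN finite_length_left_module]
      fV[THEN finite_length_left_module])
    fix z assume z: "z \<in> carrier ?D"
    then show "fst z \<oplus>\<^bsub>M\<^esub> snd z \<in> carrier (M\<lparr>carrier := U <+>\<^bsub>M\<^esub> V\<rparr>)"
      by (cases z) (simp add: dsum_def set_add_iff, blast)
  qed (use uv in \<open>auto simp: dsum_def M.M.a_ac M.smult_r_distr\<close>)
  moreover have "(\<lambda>z\<in>carrier ?D. fst z \<oplus>\<^bsub>M\<^esub> snd z) ` carrier ?D =
      carrier (M\<lparr>carrier := U <+>\<^bsub>M\<^esub> V\<rparr>)"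
  proof -
    have "(\<lambda>z\<in>carrier ?D. fst z \<oplus>\<^bsub>M\<^esub> snd z) ` carrier ?D =
        {u \<oplus>\<^bsub>M\<^esub> v | u v. u \<in> U \<and> v \<in> V}"
    proof (intro subset_antisym subsetI)
      fix x assume "x \<in> (\<lambda>z\<in>carrier ?D. fst z \<oplus>\<^bsub>M\<^esub> snd z) ` carrier ?D"
      then obtain z where "z \<in> carrier ?D" "x = fst z \<oplus>\<^bsub>M\<^esub> snd z" by auto
      then show "x \<in> {u \<oplus>\<^bsub>M\<^esub> v | u v. u \<in> U \<and> v \<in> V}"
        by (intro CollectI exI[of _ "fst z"] exI[of _ "snd z"]) (auto simp: dsum_def)
    next
      fix x assume "x \<in> {u \<oplus>\<^bsub>M\<^esub> v | u v. u \<in> U \<and> v \<in> V}"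
      then obtain u v where "u \<in> U" "v \<in> V" "x = u \<oplus>\<^bsub>M\<^esub> v" by blast
      then show "x \<in> (\<lambda>z\<in>carrier ?D. fst z \<oplus>\<^bsub>M\<^esub> snd z) ` carrier ?D"
        by (intro image_eqI[of _ _ "(u, v)"]) (auto simp: dsum_def)
    qed
    also have "\<dots> = U <+>\<^bsub>M\<^esub> V" unfolding set_eq_iff set_add_iff by blast
    finally show ?thesis by simp
  qed
  ultimately show ?thesis
    by (rule finite_length_surj[OF finite_length_dsum[OF fU fV]
          left_module_submodule[OF M submodule_set_add[OF M U V]]])
qed

text \<open>The hypothesis says that \<open>H'/H\<close> is simple or zero.\<close>

lemma module_length_step:
  assumes M: "left_module R M" and H: "submodule H R M" and H': "submodule H' R M" and "H \<subseteq> H'"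
    and simple: "\<And>x y. x \<in> H' \<Longrightarrow> x \<notin> H \<Longrightarrow> y \<in> H' \<Longrightarrow> \<exists>a\<in>carrier R. y \<ominus>\<^bsub>M\<^esub> a \<odot>\<^bsub>M\<^esub> x \<in> H"
    and l: "module_length R (M\<lparr>carrier := H\<rparr>) \<le> enat n"
  shows "module_length R (M\<lparr>carrier := H'\<rparr>) \<le> enat (Suc n)"
proof -
  interpret M: left_module R M by fact
  let ?N = "M\<lparr>carrier := H\<rparr>"
  have fl: "finite_length_module R ?N" by (rule finite_lengthI[OF left_module_submodule[OF M H] l])
  have ln: "len R ?N (carrier ?N) \<le> n" using l enat_len_carrier[OF fl] by simp
  note iff = submodule_submodule_iff[OF M H] submodule_submodule_iff[OF M H']
  have s: "submodule (C \<inter> H) R ?N" if "submodule C R (M\<lparr>carrier := H'\<rparr>)" for C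
    using that submodule_Int[OF M _ H, of C] unfolding iff by blast
  \<comment> \<open>A chain is measured by its intersection with \<open>H\<close>, plus 1 from the
    moment it leaves \<open>H\<close>. Once it has left, simplicity of \<open>H'/H\<close> allows
    growth only inside \<open>H\<close>.\<close>
  show ?thesis
  proof (rule module_length_bound[where \<mu> = "\<lambda>C. len R ?N (C \<inter> H) + (if C \<subseteq> H then 0 else 1)"])
    fix C D assume C: "submodule C R (M\<lparr>carrier := H'\<rparr>)" and D: "submodule D R (M\<lparr>carrier := H'\<rparr>)"
      and "C \<subset> D"
    have le: "len R ?N (C \<inter> H) \<le> len R ?N (D \<inter> H)"
      using \<open>C \<subset> D\<close> by (intro len_mono[OF fl] s C D) auto
    have C': "submodule C R M" and D': "submodule D R M" "D \<subseteq> H'" using C D unfolding iff by auto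
    show "len R ?N (C \<inter> H) + (if C \<subseteq> H then 0 else 1) < len R ?N (D \<inter> H) + (if D \<subseteq> H then 0 else 1)"
    proof (cases "C \<subseteq> H")
      case True
      have "len R ?N (C \<inter> H) < len R ?N (D \<inter> H)" if "D \<subseteq> H"
        using \<open>C \<subset> D\<close> that by (intro len_strict_mono[OF fl] s C D) auto
      then show ?thesis using le True by auto
    next
      case False
      then obtain x where x: "x \<in> C" "x \<notin> H" by blast
      obtain y where y: "y \<in> D" "y \<notin> C" using \<open>C \<subset> D\<close> by blast
      obtain a where a: "a \<in> carrier R" "y \<ominus>\<^bsub>M\<^esub> a \<odot>\<^bsub>M\<^esub> x \<in> H"
        using simple[of x y] x y D'(2) \<open>C \<subset> D\<close> by blast
      have ax: "a \<odot>\<^bsub>M\<^esub> x \<in> C" using submodule_smult[OF M C'] a x by blast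
      have car: "y \<in> carrier M" "a \<odot>\<^bsub>M\<^esub> x \<in> carrier M"
        using submodule_subset[OF M D'(1)] submodule_subset[OF M C'] ax y by auto
      have "y \<ominus>\<^bsub>M\<^esub> a \<odot>\<^bsub>M\<^esub> x \<in> D" using submodule_diff[OF M D'(1)] y ax \<open>C \<subset> D\<close> by blast
      moreover have "y \<ominus>\<^bsub>M\<^esub> a \<odot>\<^bsub>M\<^esub> x \<notin> C"
      proof
        assume "y \<ominus>\<^bsub>M\<^esub> a \<odot>\<^bsub>M\<^esub> x \<in> C"
        then have "(y \<ominus>\<^bsub>M\<^esub> a \<odot>\<^bsub>M\<^esub> x) \<oplus>\<^bsub>M\<^esub> a \<odot>\<^bsub>M\<^esub> x \<in> C" using submodule_add[OF M C'] ax by blast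
        then show False using y car by (simp add: a_minus_def M.M.a_assoc M.M.l_neg)
      qed
      ultimately have "C \<inter> H \<subset> D \<inter> H" using a(2) \<open>C \<subset> D\<close> by blast
      then have "len R ?N (C \<inter> H) < len R ?N (D \<inter> H)" by (intro len_strict_mono[OF fl] s C D)
      moreover have "\<not> D \<subseteq> H" using x \<open>C \<subset> D\<close> by blast
      ultimately show ?thesis by auto
    qed
  next
    fix C assume "submodule C R (M\<lparr>carrier := H'\<rparr>)"
    then show "len R ?N (C \<inter> H) + (if C \<subseteq> H then 0 else 1) \<le> Suc n"
      using len_le[OF fl s] ln by (auto intro: le_SucI order_trans)
  qed
qed

lemma module_length_zero:
  assumes "left_module R M" "carrier M = {\<zero>\<^bsub>M\<^esub>}"
  shows "module_length R M \<le> enat 0"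
proof (rule module_length_bound[where \<mu> = "\<lambda>_. 0"])
  have "U = {\<zero>\<^bsub>M\<^esub>}" if "submodule U R M" for U
    using submodule_subset[OF assms(1) that] submodule_zero[OF assms(1) that] assms(2) by auto
  then show "(0::nat) < 0" if "submodule U R M" "submodule V R M" "U \<subset> V" for U V
    by (metis that psubset_eq)
qed simp

section \<open>The regular module and commutative artinian rings\<close>

text \<open>For the algebra this is different from the record \<Lambda> itself, whose
  \<open>smult\<close> is the action of the base ring and not the product of \<Lambda>.\<close>

definition reg :: "('r, 'c) ring_scheme \<Rightarrow> ('r, 'r) module"
  where "reg R = \<lparr>carrier = carrier R, mult = mult R, one = one R, zero = zero R, add = add R, smult = mult R\<rparr>"

lemma reg_simps [simp]:
  "carrier (reg R) = carrier R" "zero (reg R) = zero R" "add (reg R) = add R" "smult (reg R) = mult R"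
  "reg R\<lparr>carrier := carrier R\<rparr> = reg R"
  by (simp_all add: reg_def)

lemma a_minus_reg: "x \<ominus>\<^bsub>reg R\<^esub> y = x \<ominus>\<^bsub>R\<^esub> y"
  by (simp add: a_minus_def a_inv_def m_inv_def)

lemma left_module_reg:
  assumes "ring R"
  shows "left_module R (reg R)"
proof -
  interpret ring R by fact
  have "abelian_group (reg R)"
    by (rule abelian_groupI) (auto simp: a_ac intro: l_neg)
  then show ?thesis
    by (intro left_module.intro left_module_axioms.intro assms) (auto simp: l_distr r_distr m_assoc)
qed

lemma (in left_module) mod_hom_reg:
  assumes "x \<in> carrier M"
  shows "(\<lambda>a\<in>carrier R. a \<odot>\<^bsub>M\<^esub> x) \<in> mod_hom R (reg R) M"
  using assms mod_hom_restrictI[OF left_module_reg[OF R.ring_axioms], of "\<lambda>a. a \<odot>\<^bsub>M\<^esub> x" M]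
  by (simp add: smult_l_distr smult_assoc1)

section \<open>The commutative case of the Hopkins-Levitzki theorem\<close>

context artinian_cring
begin

lemma submodule_reg_imp_ideal:
  assumes "submodule I R (reg R)"
  shows "ideal I R"
proof (rule idealI[OF ring_axioms])
  note I = submodule_subset[OF left_module_reg[OF ring_axioms] assms]
    submodule_smult[OF left_module_reg[OF ring_axioms] assms, simplified]
  interpret submodule I R "reg R" by (rule assms)
  show "subgroup I (add_monoid R)"
    using subgroup_axioms by (simp add: subgroup_def a_inv_def m_inv_def)
  show "x \<otimes> a \<in> I" "a \<otimes> x \<in> I" if "a \<in> I" "x \<in> carrier R" for a x
    using I that m_comm[of a x] by auto
qed

text \<open>Without a minimal member, dependent choice produces a strictly descending sequence of
  ideals. The predicate is arbitrary because the lemma is applied both to the ideals of infinite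
  length and to the ideals generated by the powers of one element.\<close>

lemma minimal_submodule_exists:
  assumes "P U\<^sub>0" "\<And>U. P U \<Longrightarrow> submodule U R (reg R)"
  shows "\<exists>U. P U \<and> (\<forall>V. P V \<and> V \<subseteq> U \<longrightarrow> V = U)"
proof (rule ccontr)
  assume "\<not> ?thesis"
  then have *: "\<exists>V. P V \<and> V \<subset> U" if "P U" for U using that by blast
  obtain f where f: "\<And>n. P (f n)" "\<And>n. f (Suc n) \<subset> f n"
    using dependent_nat_choice[of "\<lambda>_. P" "\<lambda>_ U V. V \<subset> U"] assms(1) * by metis
  then obtain N where "\<forall>n\<ge>N. f n = f N"
    using descending_chain[of f] submodule_reg_imp_ideal assms(2) by blast
  then have "f (Suc N) = f N" by (meson le_Suc_eq order_refl)
  then show False using f(2)[of N] by simp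
qed

text \<open>Let \<open>a\<close> be minimal among the ideals of infinite length. If multiplication
  by r on \<open>a\<close> had a proper kernel and a proper image, both would have finite length,
  and then so would \<open>a\<close>. So r acts as zero or surjectively, in fact as zero or
  invertibly, and \<open>a\<close> is a vector space over a field. A hyperplane \<open>W\<close> in
  it is proper, hence of finite length, and \<open>a\<close> is only one step longer.\<close>

lemma finite_length_reg: "finite_length_module R (reg R)"
proof (rule ccontr)
  note M = left_module_reg[OF ring_axioms]
  interpret M: left_module R "reg R" by (rule M)
  let ?sub = "\<lambda>U. submodule U R (reg R)" and ?fl = "\<lambda>U. finite_length_module R (reg R\<lparr>carrier := U\<rparr>)"
  assume "\<not> finite_length_module R (reg R)"
  then have "\<not> ?fl (carrier (reg R))" by simp
  then obtain a where a: "?sub a" "\<not> ?fl a" and min: "\<And>V. ?sub V \<Longrightarrow> \<not> ?fl V \<Longrightarrow> V \<subseteq> a \<Longrightarrow> V = a"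
    using minimal_submodule_exists[of "\<lambda>U. ?sub U \<and> \<not> ?fl U"] submodule_carrier[OF M] by metis
  have ac: "x \<in> carrier R" if "x \<in> a" for x using submodule_subset[OF M a(1)] that by auto
  have as: "r \<otimes> x \<in> a" if "r \<in> carrier R" "x \<in> a" for r x
    using submodule_smult[OF M a(1), of r x] that by simp
  let ?a = "reg R\<lparr>carrier := a\<rparr>"
  note A = left_module_submodule[OF M a(1)]
  note aiff = submodule_submodule_iff[OF M a(1)]
  have dich: "(\<forall>x\<in>a. r \<otimes> x = \<zero>) \<or> (\<forall>x\<in>a. \<exists>y\<in>a. x = r \<otimes> y)" if r: "r \<in> carrier R" for r
  proof -
    let ?h = "\<lambda>x\<in>carrier ?a. r \<otimes> x"
    have h: "?h \<in> mod_hom R ?a ?a"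
      by (rule mod_hom_restrictI[OF A]) (use r as ac m_lcomm in \<open>auto simp: r_distr\<close>)
    let ?K = "{x \<in> carrier ?a. ?h x = \<zero>\<^bsub>?a\<^esub>}"
    have K: "?sub ?K" "?K \<subseteq> a" using submodule_kernel[OF A A h] unfolding aiff by auto
    have I: "?sub (?h ` a)" "?h ` a \<subseteq> a"
      using submodule_image[OF A A h submodule_carrier[OF A]] unfolding aiff by auto
    have h': "?h \<in> mod_hom R ?a (?a\<lparr>carrier := ?h ` a\<rparr>)"
      using h by (auto simp: mod_hom_def)
    show ?thesis
    proof (cases "?K = a \<or> ?h ` a = a")
      case True
      then show ?thesis
      proof
        assume "?K = a"
        then have "\<And>x. x \<in> a \<Longrightarrow> x \<in> ?K" by simp
        then have "r \<otimes> x = \<zero>" if "x \<in> a" for x using that by fastforce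
        then show ?thesis by simp
      next
        assume "?h ` a = a"
        then have "\<forall>x\<in>a. \<exists>y\<in>a. x = ?h y" by blast
        then show ?thesis by auto
      qed
    next
      case False
      then have "?fl ?K" "?fl (?h ` a)" using min K I by blast+
      then have "?fl a" using finite_length_extension[OF A _ h'] by simp
      then show ?thesis using a by simp
    qed
  qed
  \<comment> \<open>The ideals r^n R become stationary, which yields s with r^n = r^(n+1) s. Every
    element of \<open>a\<close> is divisible by r^n, so s inverts r on \<open>a\<close>.\<close>
  have inv: "\<exists>s\<in>carrier R. \<forall>x\<in>a. s \<otimes> (r \<otimes> x) = x"
    if r: "r \<in> carrier R" and nz: "\<not> (\<forall>x\<in>a. r \<otimes> x = \<zero>)" for r
  proof -
    define pw where "pw n = (\<lambda>t. r [^] n \<otimes> t) ` carrier R" for n :: nat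
    define P where "P U \<longleftrightarrow> (\<exists>n. U = pw n)" for U
    have sub: "?sub U" if "P U" for U
    proof -
      from that obtain n where U: "U = pw n" by (auto simp: P_def)
      have "(\<lambda>t\<in>carrier (reg R). r [^] n \<otimes> t) \<in> mod_hom R (reg R) (reg R)"
        by (rule mod_hom_restrictI[OF M]) (use r m_lcomm in \<open>auto simp: r_distr\<close>)
      from submodule_image[OF M M this submodule_carrier[OF M]] show ?thesis by (simp add: U pw_def)
    qed
    have "P (pw 0)" by (auto simp: P_def)
    from minimal_submodule_exists[of P, OF this sub]
    obtain U where "P U" and U: "\<And>V. P V \<Longrightarrow> V \<subseteq> U \<Longrightarrow> V = U" by blast
    then obtain n where n: "U = pw n" by (auto simp: P_def)
    have "pw (Suc n) \<subseteq> pw n" using r by (auto simp: m_assoc pw_def)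
    then have "pw (Suc n) = pw n" using U[of "pw (Suc n)"] n by (auto simp: P_def)
    then have "(\<lambda>t. r [^] Suc n \<otimes> t) ` carrier R = (\<lambda>t. r [^] n \<otimes> t) ` carrier R"
      unfolding pw_def .
    moreover have "r [^] n \<in> (\<lambda>t. r [^] n \<otimes> t) ` carrier R"
      using r by (intro image_eqI[of _ _ \<one>]) auto
    ultimately obtain s where s: "s \<in> carrier R" "r [^] n = r [^] Suc n \<otimes> s" by auto
    have pow: "\<exists>y\<in>a. x = r [^] m \<otimes> y" if "x \<in> a" for x and m :: nat
      using that
    proof (induction m arbitrary: x)
      case 0
      then show ?case using ac by (intro bexI[of _ x]) auto
    next
      case (Suc m)
      then obtain y where y: "y \<in> a" "x = r [^] m \<otimes> y" by blast
      obtain z where "z \<in> a" "y = r \<otimes> z" using dich[OF r] nz y(1) by blast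
      then show ?case using y r ac by (intro bexI[of _ z]) (auto simp: m_assoc)
    qed
    have "s \<otimes> (r \<otimes> x) = x" if x: "x \<in> a" for x
    proof -
      obtain y where y: "y \<in> a" "x = r [^] n \<otimes> y" using pow[OF x] by blast
      have "s \<otimes> (r \<otimes> x) = (r [^] Suc n \<otimes> s) \<otimes> y" using r s(1) ac[OF y(1)]
        by (simp add: y(2) m_ac)
      then show ?thesis unfolding s(2)[symmetric] y(2)[symmetric] .
    qed
    then show ?thesis using s(1) by blast
  qed
  have "\<exists>x\<in>a. x \<noteq> \<zero>"
  proof (rule ccontr)
    assume none: "\<not> ?thesis"
    have "a = {\<zero>}"
    proof
      show "a \<subseteq> {\<zero>}" using none by blast
      show "{\<zero>} \<subseteq> a" using submodule_zero[OF M a(1)] by simp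
    qed
    then have "carrier ?a = {\<zero>\<^bsub>?a\<^esub>}" by simp
    from finite_lengthI[OF A module_length_zero[OF A this]] show False using a(2) by simp
  qed
  then obtain x where x: "x \<in> a" "x \<noteq> \<zero>" by blast
  \<comment> \<open>Zorn's lemma replaces a choice by length here, since \<open>a\<close> has
    infinite length. A union of a chain of submodules avoiding x still avoids x.\<close>
  define F where "F = {W. ?sub W \<and> W \<subseteq> a \<and> x \<notin> W}"
  have "\<exists>W\<in>F. \<forall>X\<in>F. W \<subseteq> X \<longrightarrow> X = W"
  proof (rule subset_Zorn_nonempty)
    show "F \<noteq> {}"
      using submodule_singleton_zero[OF M] submodule_zero[OF M a(1)] x by (auto simp: F_def)
    fix \<C> assume C: "\<C> \<noteq> {}" "subset.chain F \<C>"
    have sub: "?sub W" "W \<subseteq> a" "x \<notin> W" if "W \<in> \<C>" for W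
      using C(2) that by (auto simp: subset.chain_def F_def)
    have "?sub (\<Union>\<C>)"
    proof (rule left_module_submoduleI[OF M])
      show "\<Union>\<C> \<subseteq> carrier (reg R)" using sub(2) ac by auto
      show "\<zero>\<^bsub>reg R\<^esub> \<in> \<Union>\<C>" using C(1) submodule_zero[OF M sub(1)] by blast
      show "r \<odot>\<^bsub>reg R\<^esub> u \<in> \<Union>\<C>" if "r \<in> carrier R" "u \<in> \<Union>\<C>" for r u
        using that submodule_smult[OF M sub(1)] by blast
      fix u v assume "u \<in> \<Union>\<C>" "v \<in> \<Union>\<C>"
      then obtain U V where UV: "U \<in> \<C>" "V \<in> \<C>" "u \<in> U" "v \<in> V" by blast
      then have "U \<subseteq> V \<or> V \<subseteq> U" using C(2) by (auto simp: subset_chain_def)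
      then show "u \<oplus>\<^bsub>reg R\<^esub> v \<in> \<Union>\<C>"
        using UV submodule_add[OF M sub(1), of U u v] submodule_add[OF M sub(1), of V u v] by blast
    qed
    then show "\<Union>\<C> \<in> F" using sub(2,3) by (auto simp: F_def)
  qed
  then obtain W where W: "?sub W" "W \<subseteq> a" "x \<notin> W" and max: "\<And>X. ?sub X \<Longrightarrow> X \<subseteq> a \<Longrightarrow> x \<notin> X \<Longrightarrow> W \<subseteq> X \<Longrightarrow> X = W"
    by (auto simp: F_def)
  have Wc: "w \<in> carrier R" if "w \<in> W" for w using W(2) ac that by blast
  \<comment> \<open>\<open>W\<close> is maximal among the submodules of \<open>a\<close> without x,
    so y outside \<open>W\<close> gives x = w + c y. The scalar c does not annihilate
    \<open>a\<close>, as otherwise x = w would lie in \<open>W\<close>; hence it acts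
    invertibly.\<close>
  have span: "\<exists>c\<in>carrier R. x \<ominus> c \<otimes> y \<in> W \<and> (\<exists>s\<in>carrier R. \<forall>x\<in>a. s \<otimes> (c \<otimes> x) = x)"
    if y: "y \<in> a" "y \<notin> W" for y
  proof -
    let ?ky = "(\<lambda>t\<in>carrier R. t \<otimes> y) ` carrier R"
    have ky: "?sub ?ky"
      using submodule_image[OF M M M.mod_hom_reg[of y] submodule_carrier[OF M]] ac y by simp
    let ?X = "W <+>\<^bsub>reg R\<^esub> ?ky"
    have X: "?sub ?X" by (rule submodule_set_add[OF M W(1) ky])
    have "?X \<subseteq> a"
    proof
      fix z assume "z \<in> ?X"
      then obtain w t where "w \<in> W" "t \<in> carrier R" "z = w \<oplus> t \<otimes> y" unfolding set_add_iff by auto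
      then show "z \<in> a" using submodule_add[OF M a(1), of w "t \<otimes> y"] W(2) as y by auto
    qed
    moreover have "y \<in> ?X"
      using set_add_upper(2)[OF M W(1) ky] y ac by (auto intro!: subsetD[OF set_add_upper(2)[OF M W(1) ky]] image_eqI[of _ _ \<one>])
    ultimately have "x \<in> ?X" using max[OF X] set_add_upper(1)[OF M W(1) ky] y(2) by blast
    then obtain w c where wc: "w \<in> W" "c \<in> carrier R" "x = w \<oplus> c \<otimes> y" unfolding set_add_iff by auto
    have 1: "x \<ominus> c \<otimes> y = w" using wc ac[OF y(1)] Wc[OF wc(1)]
      by (simp add: a_minus_def a_assoc r_neg)
    have "\<not> (\<forall>z\<in>a. c \<otimes> z = \<zero>)" using wc W(3) y Wc by (metis r_zero)
    then show ?thesis using inv[OF wc(2)] 1 wc by blast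
  qed
  have "W \<noteq> a" using x W by blast
  then have flW: "?fl W" using min W by blast
  have "module_length R ?a \<le> enat (Suc (len R (reg R) W))"
  proof (rule module_length_step[OF M W(1) a(1) W(2)])
    show "module_length R (reg R\<lparr>carrier := W\<rparr>) \<le> enat (len R (reg R) W)"
      using enat_len[OF flW] by simp
    fix u y assume u: "u \<in> a" "u \<notin> W" and y: "y \<in> a"
    show "\<exists>b\<in>carrier R. y \<ominus>\<^bsub>reg R\<^esub> b \<odot>\<^bsub>reg R\<^esub> u \<in> W"
    proof (cases "y \<in> W")
      case True
      then show ?thesis using u ac Wc by (intro bexI[of _ \<zero>]) (auto simp: a_minus_reg minus_eq)
    next
      case False
      obtain c where c: "c \<in> carrier R" "x \<ominus> c \<otimes> u \<in> W" using span[OF u] by blast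
      obtain d s where d: "d \<in> carrier R" "x \<ominus> d \<otimes> y \<in> W" "s \<in> carrier R" "s \<otimes> (d \<otimes> y) = y"
        using span[OF y False] y by blast
      have car: "u \<in> carrier R" "y \<in> carrier R" "x \<in> carrier R" using u y x ac by auto
      \<comment> \<open>In the difference x cancels and d y - c u remains in \<open>W\<close>; the
        inverse \<open>s\<close> of \<open>d\<close> on \<open>a\<close> then puts y - s c u in
        \<open>W\<close>.\<close>
      have "(x \<ominus> c \<otimes> u) \<ominus>\<^bsub>reg R\<^esub> (x \<ominus> d \<otimes> y) \<in> W" by (rule submodule_diff[OF M W(1) c(2) d(2)])
      then have "s \<otimes> ((x \<ominus> c \<otimes> u) \<ominus> (x \<ominus> d \<otimes> y)) \<in> W"
        using submodule_smult[OF M W(1) d(3)] car c(1) d by (simp add: a_minus_reg)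
      moreover have "s \<otimes> ((x \<ominus> c \<otimes> u) \<ominus> (x \<ominus> d \<otimes> y)) = s \<otimes> (d \<otimes> y) \<ominus> (s \<otimes> c) \<otimes> u"
      proof -
        have 1: "(x \<ominus> p) \<ominus> (x \<ominus> q) = q \<ominus> p" if "p \<in> carrier R" "q \<in> carrier R" for p q
        proof -
          have "(x \<ominus> p) \<ominus> (x \<ominus> q) = (\<ominus> p \<oplus> x) \<oplus> (\<ominus> x \<oplus> q)"
            using that car by (simp add: minus_eq minus_add a_comm[of x "\<ominus> p"])
          also have "\<dots> = \<ominus> p \<oplus> q" using that car by (simp add: a_assoc r_neg2)
          finally show ?thesis using that by (simp add: minus_eq a_comm)
        qed
        have "s \<otimes> ((x \<ominus> c \<otimes> u) \<ominus> (x \<ominus> d \<otimes> y)) = s \<otimes> (d \<otimes> y \<ominus> c \<otimes> u)"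
          using car c(1) d(1) by (simp add: 1)
        then show ?thesis using car c(1) d(1,3) by (simp add: minus_eq r_distr m_assoc r_minus)
      qed
      ultimately have "y \<ominus> (s \<otimes> c) \<otimes> u \<in> W" using d(4) by simp
      then show ?thesis using c(1) d(3) by (intro bexI[of _ "s \<otimes> c"]) (simp_all add: a_minus_reg)
    qed
  qed
  from finite_lengthI[OF A this] show False using a(2) by simp
qed

end

section \<open>Modules of homomorphisms and restriction of scalars\<close>

text \<open>The scalars and their action are parameters, because the same additive group is needed
  over the base ring, over \<Lambda> acting through the first argument, and over an endomorphism
  ring acting through the second.\<close>

definition hom_mod ::
  "('r, 'c) ring_scheme \<Rightarrow> ('r, 'm, 'd) module_scheme \<Rightarrow> ('r, 'n, 'e) module_scheme \<Rightarrow>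
    ('s \<Rightarrow> ('m \<Rightarrow> 'n) \<Rightarrow> 'm \<Rightarrow> 'n) \<Rightarrow> ('s, 'm \<Rightarrow> 'n) module"
  where "hom_mod R A B act =
    \<lparr>carrier = mod_hom R A B, mult = (\<lambda>f g. f), one = (\<lambda>x\<in>carrier A. \<zero>\<^bsub>B\<^esub>),
     zero = (\<lambda>x\<in>carrier A. \<zero>\<^bsub>B\<^esub>), add = (\<lambda>f g. \<lambda>x\<in>carrier A. f x \<oplus>\<^bsub>B\<^esub> g x), smult = act\<rparr>"

lemma hom_mod_simps [simp]:
  "carrier (hom_mod R A B act) = mod_hom R A B"
  "\<zero>\<^bsub>hom_mod R A B act\<^esub> = (\<lambda>x\<in>carrier A. \<zero>\<^bsub>B\<^esub>)"
  "f \<oplus>\<^bsub>hom_mod R A B act\<^esub> g = (\<lambda>x\<in>carrier A. f x \<oplus>\<^bsub>B\<^esub> g x)"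
  "a \<odot>\<^bsub>hom_mod R A B act\<^esub> f = act a f"
  by (simp_all add: hom_mod_def)

lemma abelian_group_hom_mod:
  assumes "left_module R A" "left_module R B"
  shows "abelian_group (hom_mod R A B act)"
proof (rule abelian_groupI)
  interpret B: left_module R B by fact
  note c = mod_hom_closed[of _ R A B]
  show "\<exists>g\<in>carrier (hom_mod R A B act). g \<oplus>\<^bsub>hom_mod R A B act\<^esub> f = \<zero>\<^bsub>hom_mod R A B act\<^esub>"
    if "f \<in> carrier (hom_mod R A B act)" for f
    using that mod_hom_uminus[OF assms, of f] c
    by (intro bexI[of _ "\<lambda>x\<in>carrier A. \<ominus>\<^bsub>B\<^esub> f x"]) (auto simp: B.M.l_neg)
  show "\<zero>\<^bsub>hom_mod R A B act\<^esub> \<oplus>\<^bsub>hom_mod R A B act\<^esub> f = f"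
    if "f \<in> carrier (hom_mod R A B act)" for f
  proof -
    have "(\<lambda>x\<in>carrier A. \<zero>\<^bsub>B\<^esub> \<oplus>\<^bsub>B\<^esub> f x) = restrict f (carrier A)"
      using that c by (intro restrict_ext) auto
    then show ?thesis using that by (simp cong: restrict_cong)
  qed
  show "f \<oplus>\<^bsub>hom_mod R A B act\<^esub> g \<in> carrier (hom_mod R A B act)"
    if "f \<in> carrier (hom_mod R A B act)" "g \<in> carrier (hom_mod R A B act)" for f g
    using mod_hom_plus[OF assms, of f g] that by simp
  show "\<zero>\<^bsub>hom_mod R A B act\<^esub> \<in> carrier (hom_mod R A B act)"
    using mod_hom_const_zero[OF assms] by simp
  show "f \<oplus>\<^bsub>hom_mod R A B act\<^esub> g \<oplus>\<^bsub>hom_mod R A B act\<^esub> h =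
      f \<oplus>\<^bsub>hom_mod R A B act\<^esub> (g \<oplus>\<^bsub>hom_mod R A B act\<^esub> h)"
    if "f \<in> carrier (hom_mod R A B act)" "g \<in> carrier (hom_mod R A B act)"
      "h \<in> carrier (hom_mod R A B act)" for f g h
    using that c by (auto simp: B.M.a_assoc cong: restrict_cong)
  show "f \<oplus>\<^bsub>hom_mod R A B act\<^esub> g = g \<oplus>\<^bsub>hom_mod R A B act\<^esub> f"
    if "f \<in> carrier (hom_mod R A B act)" "g \<in> carrier (hom_mod R A B act)" for f g
    using that c by (auto simp: B.M.a_comm cong: restrict_cong)
qed

lemma left_module_hom_mod:
  assumes "left_module R A" "left_module R B" "ring S"
    and "\<And>a f. a \<in> carrier S \<Longrightarrow> f \<in> mod_hom R A B \<Longrightarrow> act a f \<in> mod_hom R A B"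
    and "\<And>a b f x. a \<in> carrier S \<Longrightarrow> b \<in> carrier S \<Longrightarrow> f \<in> mod_hom R A B \<Longrightarrow> x \<in> carrier A \<Longrightarrow>
      act (a \<oplus>\<^bsub>S\<^esub> b) f x = act a f x \<oplus>\<^bsub>B\<^esub> act b f x"
    and "\<And>a f g x. a \<in> carrier S \<Longrightarrow> f \<in> mod_hom R A B \<Longrightarrow> g \<in> mod_hom R A B \<Longrightarrow> x \<in> carrier A \<Longrightarrow>
      act a (\<lambda>x\<in>carrier A. f x \<oplus>\<^bsub>B\<^esub> g x) x = act a f x \<oplus>\<^bsub>B\<^esub> act a g x"
    and "\<And>a b f x. a \<in> carrier S \<Longrightarrow> b \<in> carrier S \<Longrightarrow> f \<in> mod_hom R A B \<Longrightarrow> x \<in> carrier A \<Longrightarrow>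
      act (a \<otimes>\<^bsub>S\<^esub> b) f x = act a (act b f) x"
    and "\<And>f x. f \<in> mod_hom R A B \<Longrightarrow> x \<in> carrier A \<Longrightarrow> act \<one>\<^bsub>S\<^esub> f x = f x"
  shows "left_module S (hom_mod R A B act)"
proof (intro left_module.intro left_module_axioms.intro assms(3) abelian_group_hom_mod[OF assms(1,2)])
  interpret S: ring S by fact
  note p = mod_hom_plus[OF assms(1,2)]
  fix a b f g
  show "a \<odot>\<^bsub>hom_mod R A B act\<^esub> f \<in> carrier (hom_mod R A B act)"
    if "a \<in> carrier S" "f \<in> carrier (hom_mod R A B act)" using that assms(4) by simp
  show "(a \<oplus>\<^bsub>S\<^esub> b) \<odot>\<^bsub>hom_mod R A B act\<^esub> f =
      a \<odot>\<^bsub>hom_mod R A B act\<^esub> f \<oplus>\<^bsub>hom_mod R A B act\<^esub> b \<odot>\<^bsub>hom_mod R A B act\<^esub> f"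
    if "a \<in> carrier S" "b \<in> carrier S" "f \<in> carrier (hom_mod R A B act)"
  proof -
    have f: "f \<in> mod_hom R A B" using that by simp
    have "act (a \<oplus>\<^bsub>S\<^esub> b) f = (\<lambda>x\<in>carrier A. act a f x \<oplus>\<^bsub>B\<^esub> act b f x)"
      by (rule mod_hom_eqI[OF assms(4) p[OF assms(4,4)]]) (use f that(1,2) assms(5) in auto)
    then show ?thesis by (simp only: hom_mod_simps)
  qed
  show "a \<odot>\<^bsub>hom_mod R A B act\<^esub> (f \<oplus>\<^bsub>hom_mod R A B act\<^esub> g) =
      a \<odot>\<^bsub>hom_mod R A B act\<^esub> f \<oplus>\<^bsub>hom_mod R A B act\<^esub> a \<odot>\<^bsub>hom_mod R A B act\<^esub> g"
    if "a \<in> carrier S" "f \<in> carrier (hom_mod R A B act)" "g \<in> carrier (hom_mod R A B act)"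
  proof -
    have f: "f \<in> mod_hom R A B" "g \<in> mod_hom R A B" using that by auto
    have "act a (\<lambda>x\<in>carrier A. f x \<oplus>\<^bsub>B\<^esub> g x) = (\<lambda>x\<in>carrier A. act a f x \<oplus>\<^bsub>B\<^esub> act a g x)"
      by (rule mod_hom_eqI[OF assms(4)[OF _ p] p[OF assms(4,4)]]) (use f that(1) assms(6) in auto)
    then show ?thesis by (simp only: hom_mod_simps)
  qed
  show "(a \<otimes>\<^bsub>S\<^esub> b) \<odot>\<^bsub>hom_mod R A B act\<^esub> f = a \<odot>\<^bsub>hom_mod R A B act\<^esub> (b \<odot>\<^bsub>hom_mod R A B act\<^esub> f)"
    if "a \<in> carrier S" "b \<in> carrier S" "f \<in> carrier (hom_mod R A B act)"
  proof -
    have f: "f \<in> mod_hom R A B" using that by simp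
    have "act (a \<otimes>\<^bsub>S\<^esub> b) f = act a (act b f)"
      by (rule mod_hom_eqI[OF assms(4) assms(4)[OF _ assms(4)]]) (use f that(1,2) assms(7) in auto)
    then show ?thesis by (simp only: hom_mod_simps)
  qed
  show "\<one>\<^bsub>S\<^esub> \<odot>\<^bsub>hom_mod R A B act\<^esub> f = f" if "f \<in> carrier (hom_mod R A B act)"
    using that mod_hom_eqI[OF assms(4)[OF S.one_closed], of f f] assms(8)[of f] by simp
qed

text \<open>Fewer submodules mean shorter chains. The two modules may be over different rings; they
  are compared through their submodules alone, as sets over a common type of elements.\<close>

lemma module_length_restrict:
  assumes "\<And>U. submodule U R M \<Longrightarrow> submodule U K N"
  shows "module_length R M \<le> module_length K N"
  unfolding module_length_def by (rule Sup_subset_mono) (use assms in blast)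

text \<open>A span is a finite sum of cyclic submodules, so it is enough to control those over
  \<open>K\<close>. \<open>M\<close> and \<open>N\<close> are one abelian group with scalars from
  two rings.\<close>

lemma finite_length_lspan:
  assumes M: "left_module R M" and N: "left_module K N"
    and eq: "carrier N = carrier M" "\<zero>\<^bsub>N\<^esub> = \<zero>\<^bsub>M\<^esub>" "add N = add M"
    and cyc: "\<And>x. x \<in> carrier M \<Longrightarrow> submodule ((\<lambda>a. a \<odot>\<^bsub>M\<^esub> x) ` carrier R) K N \<and>
      finite_length_module K (N\<lparr>carrier := (\<lambda>a. a \<odot>\<^bsub>M\<^esub> x) ` carrier R\<rparr>)"
    and xs: "set xs \<subseteq> carrier M"
  shows "submodule (left_module.lspan R M xs) K N \<and>
    finite_length_module K (N\<lparr>carrier := left_module.lspan R M xs\<rparr>)"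
proof -
  interpret M: left_module R M by fact
  show ?thesis using xs
  proof (induction xs)
    case Nil
    have "module_length K (N\<lparr>carrier := {\<zero>\<^bsub>N\<^esub>}\<rparr>) \<le> enat 0"
      by (rule module_length_zero[OF left_module_submodule[OF N submodule_singleton_zero[OF N]]]) simp
    then show ?case using submodule_singleton_zero[OF N] eq(2)
        finite_lengthI[OF left_module_submodule[OF N submodule_singleton_zero[OF N]]]
      by (simp add: M.lspan_Nil)
  next
    case (Cons x xs)
    have "M.lspan (x # xs) = (\<lambda>a. a \<odot>\<^bsub>M\<^esub> x) ` carrier R <+>\<^bsub>N\<^esub> M.lspan xs"
      unfolding set_eq_iff set_add_iff M.lspan_Cons eq(3) by blast
    then show ?case using Cons cyc[of x] submodule_set_add[OF N] finite_length_set_add[OF N] by simp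
  qed
qed

lemma (in artinian_cring) finite_length_if_generated:
  assumes M: "left_module R M" and "set xs \<subseteq> carrier M"
  shows "finite_length_module R (M\<lparr>carrier := left_module.lspan R M xs\<rparr>)"
proof -
  interpret M: left_module R M by fact
  have "submodule ((\<lambda>a. a \<odot>\<^bsub>M\<^esub> x) ` carrier R) R M \<and>
      finite_length_module R (M\<lparr>carrier := (\<lambda>a. a \<odot>\<^bsub>M\<^esub> x) ` carrier R\<rparr>)" if x: "x \<in> carrier M" for x
  proof -
    note reg = left_module_reg[OF ring_axioms]
    let ?f = "\<lambda>a\<in>carrier R. a \<odot>\<^bsub>M\<^esub> x"
    note f = M.mod_hom_reg[OF x]
    have im: "?f ` carrier R = (\<lambda>a. a \<odot>\<^bsub>M\<^esub> x) ` carrier R" by simp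
    have s: "submodule ((\<lambda>a. a \<odot>\<^bsub>M\<^esub> x) ` carrier R) R M"
      using submodule_image[OF reg M f submodule_carrier[OF reg]] by simp
    have "?f \<in> mod_hom R (reg R) (M\<lparr>carrier := (\<lambda>a. a \<odot>\<^bsub>M\<^esub> x) ` carrier R\<rparr>)"
      using f by (auto simp: mod_hom_def)
    then show ?thesis
      using s finite_length_surj[OF finite_length_reg left_module_submodule[OF M s]] by auto
  qed
  from finite_length_lspan[OF M M _ _ _ this assms(2)] show ?thesis by simp
qed

text \<open>Restriction of scalars along a \<mapsto> a 1, the structure map of the algebra. On
  \<open>reg \<Lambda>\<close> it reproduces the given action of the base ring on \<Lambda>.\<close>

definition kmod :: "('k, 'a, 'd) module_scheme \<Rightarrow> ('a, 'm, 'e) module_scheme \<Rightarrow> ('k, 'm) module"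
  where "kmod \<Lambda> X = \<lparr>carrier = carrier X, mult = mult X, one = one X, zero = zero X, add = add X,
    smult = (\<lambda>a x. (a \<odot>\<^bsub>\<Lambda>\<^esub> \<one>\<^bsub>\<Lambda>\<^esub>) \<odot>\<^bsub>X\<^esub> x)\<rparr>"

lemma kmod_simps [simp]:
  "carrier (kmod \<Lambda> X) = carrier X" "zero (kmod \<Lambda> X) = zero X" "add (kmod \<Lambda> X) = add X"
  "a \<odot>\<^bsub>kmod \<Lambda> X\<^esub> x = (a \<odot>\<^bsub>\<Lambda>\<^esub> \<one>\<^bsub>\<Lambda>\<^esub>) \<odot>\<^bsub>X\<^esub> x"
  by (simp_all add: kmod_def)

context artin_algebra
begin

lemma unit_smult_closed [simp, intro]: "a \<in> carrier k \<Longrightarrow> a \<odot>\<^bsub>\<Lambda>\<^esub> \<one>\<^bsub>\<Lambda>\<^esub> \<in> carrier \<Lambda>"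
  by simp

lemma unit_smult_mult:
  assumes "a \<in> carrier k" "x \<in> carrier \<Lambda>"
  shows "(a \<odot>\<^bsub>\<Lambda>\<^esub> \<one>\<^bsub>\<Lambda>\<^esub>) \<otimes>\<^bsub>\<Lambda>\<^esub> x = a \<odot>\<^bsub>\<Lambda>\<^esub> x" "x \<otimes>\<^bsub>\<Lambda>\<^esub> (a \<odot>\<^bsub>\<Lambda>\<^esub> \<one>\<^bsub>\<Lambda>\<^esub>) = a \<odot>\<^bsub>\<Lambda>\<^esub> x"
  using assms smult_mult_left[of a "\<one>\<^bsub>\<Lambda>\<^esub>" x] smult_mult_right[of a x "\<one>\<^bsub>\<Lambda>\<^esub>"] by simp_all

lemma unit_smult_prod:
  "a \<in> carrier k \<Longrightarrow> b \<in> carrier k \<Longrightarrow>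
    (a \<otimes>\<^bsub>k\<^esub> b) \<odot>\<^bsub>\<Lambda>\<^esub> \<one>\<^bsub>\<Lambda>\<^esub> = (a \<odot>\<^bsub>\<Lambda>\<^esub> \<one>\<^bsub>\<Lambda>\<^esub>) \<otimes>\<^bsub>\<Lambda>\<^esub> (b \<odot>\<^bsub>\<Lambda>\<^esub> \<one>\<^bsub>\<Lambda>\<^esub>)"
  by (simp add: unit_smult_mult(1) smult_assoc1)

lemma left_module_kmod:
  assumes "left_module \<Lambda> X"
  shows "left_module k (kmod \<Lambda> X)"
proof -
  interpret X: left_module \<Lambda> X by fact
  have "abelian_group (kmod \<Lambda> X)"
    by (rule abelian_groupI) (auto simp: X.M.a_ac intro: X.M.l_neg)
  then show ?thesis
    by (intro left_module.intro left_module_axioms.intro ring_axioms)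
      (auto simp: smult_l_distr unit_smult_prod X.smult_l_distr X.smult_r_distr X.smult_assoc1)
qed

lemma submodule_kmod:
  assumes "left_module \<Lambda> X" "submodule U \<Lambda> X"
  shows "submodule U k (kmod \<Lambda> X)"
  using submodule_subset[OF assms] submodule_zero[OF assms] submodule_add[OF assms] submodule_smult[OF assms]
  by (intro left_module_submoduleI left_module_kmod assms(1)) auto

lemma mod_hom_kmod:
  assumes "left_module \<Lambda> X" "f \<in> mod_hom \<Lambda> X Y"
  shows "f \<in> mod_hom k (kmod \<Lambda> X) (kmod \<Lambda> Y)"
  using assms by (auto simp: mod_hom_def)

lemma kmod_submodule: "kmod \<Lambda> (X\<lparr>carrier := U\<rparr>) = kmod \<Lambda> X\<lparr>carrier := U\<rparr>"
  by (simp add: kmod_def)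

lemma left_module_reg_algebra: "left_module \<Lambda> (reg \<Lambda>)"
  by (rule left_module_reg[OF \<Lambda>.ring_axioms])

text \<open>Finite generation of \<Lambda> is combined with the finite length of \<open>k\<close>.
  That hypothesis speaks of submodules of the record \<Lambda>, so the span, computed in
  \<open>kmod \<Lambda> (reg \<Lambda>)\<close>, has to be recognised as one of them.\<close>

lemma finite_length_kmod_reg: "finite_length_module k (kmod \<Lambda> (reg \<Lambda>))"
proof -
  let ?M = "kmod \<Lambda> (reg \<Lambda>)"
  note M = left_module_kmod[OF left_module_reg_algebra]
  interpret KM: left_module k ?M by (rule M)
  obtain S where S: "finite S" "S \<subseteq> carrier \<Lambda>"
    "\<And>H. submodule H k \<Lambda> \<Longrightarrow> S \<subseteq> H \<Longrightarrow> H = carrier \<Lambda>"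
    using finitely_generated by blast
  obtain xs where xs: "set xs = S" using finite_list[OF S(1)] by blast
  have sxs: "set xs \<subseteq> carrier ?M" using S(2) xs by simp
  have "S \<subseteq> KM.lspan xs"
  proof -
    have "set ys \<subseteq> KM.lspan ys" if "set ys \<subseteq> carrier ?M" for ys
      using that
    proof (induction ys)
      case (Cons y ys)
      then have y: "y \<in> carrier ?M" and ys: "set ys \<subseteq> KM.lspan ys" "set ys \<subseteq> carrier ?M" by auto
      have "y \<in> KM.lspan (y # ys)"
        unfolding KM.lspan_Cons using y submodule_zero[OF M KM.lspan_submodule[OF ys(2)]]
        by (intro CollectI exI[of _ "\<one>\<^bsub>k\<^esub>"] exI[of _ "\<zero>\<^bsub>\<Lambda>\<^esub>"]) auto
      moreover have "KM.lspan ys \<subseteq> KM.lspan (y # ys)"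
        using KM.lspan_psubset[OF ys(2) y] KM.lspan_Cons[of y ys] submodule_add[OF M KM.lspan_submodule[OF ys(2)]]
        submodule_smult[OF M KM.lspan_submodule[OF ys(2)]] y
      proof (cases "y \<in> KM.lspan ys")
        case True
        show ?thesis
        proof
          fix z assume z: "z \<in> KM.lspan ys"
          then have "z \<in> carrier ?M" using submodule_subset[OF M KM.lspan_submodule[OF ys(2)]] by blast
          then show "z \<in> KM.lspan (y # ys)" unfolding KM.lspan_Cons using z y
            by (intro CollectI exI[of _ "\<zero>\<^bsub>k\<^esub>"] exI[of _ z] conjI) (use KM.smult_zero_l[of y] in auto)
        qed
      qed (use KM.lspan_psubset[OF ys(2) y] in blast)
      ultimately show ?case using ys(1) by auto
    qed simp
    then show ?thesis using sxs xs by blast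
  qed
  moreover have "submodule (KM.lspan xs) k \<Lambda>"
  proof -
    have "submodule (KM.lspan xs) k ?M" by (rule KM.lspan_submodule[OF sxs])
    note s = submodule_subset[OF M this] submodule_zero[OF M this] submodule_add[OF M this]
      submodule_smult[OF M this]
    interpret L: left_module k \<Lambda>
      by (intro left_module.intro left_module_axioms.intro ring_axioms M.abelian_group_axioms)
        (auto simp: smult_l_distr smult_r_distr smult_assoc1)
    show ?thesis
    proof (rule left_module_submoduleI[OF L.left_module_axioms])
      show "a \<odot>\<^bsub>\<Lambda>\<^esub> x \<in> KM.lspan xs" if "a \<in> carrier k" "x \<in> KM.lspan xs" for a x
      proof -
        have "x \<in> carrier \<Lambda>" using s(1) that(2) by auto
        then show ?thesis using s(4)[OF that] that(1) by (simp add: unit_smult_mult)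
      qed
    qed (use s in auto)
  qed
  ultimately have "KM.lspan xs = carrier ?M" using S(3) by simp
  then show ?thesis using finite_length_if_generated[OF M sxs] by (simp add: kmod_def)
qed

text \<open>Submodules over \<Lambda> are submodules over \<open>k\<close>, which settles one
  direction. For the other, a module of finite length is finitely generated, and each cyclic
  submodule is an image of \<Lambda>, which has finite length over \<open>k\<close>.\<close>

lemma finite_length_kmod_iff:
  assumes X: "left_module \<Lambda> X"
  shows "finite_length_module k (kmod \<Lambda> X) \<longleftrightarrow> finite_length_module \<Lambda> X"
proof
  assume "finite_length_module k (kmod \<Lambda> X)"
  moreover have "module_length \<Lambda> X \<le> module_length k (kmod \<Lambda> X)"
    by (rule module_length_restrict[OF submodule_kmod[OF X]])
  ultimately show "finite_length_module \<Lambda> X"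
    using X unfolding finite_length_module_def by (meson order_le_less_trans)
next
  assume fl: "finite_length_module \<Lambda> X"
  interpret X: left_module \<Lambda> X by fact
  obtain xs where xs: "set xs \<subseteq> carrier X" "X.lspan xs = carrier X"
    using X.finite_length_imp_generated fl by (auto simp: finite_length_module_def)
  have "submodule ((\<lambda>a. a \<odot>\<^bsub>X\<^esub> x) ` carrier \<Lambda>) k (kmod \<Lambda> X) \<and>
      finite_length_module k (kmod \<Lambda> X\<lparr>carrier := (\<lambda>a. a \<odot>\<^bsub>X\<^esub> x) ` carrier \<Lambda>\<rparr>)"
    if x: "x \<in> carrier X" for x
  proof -
    let ?f = "\<lambda>a\<in>carrier \<Lambda>. a \<odot>\<^bsub>X\<^esub> x"
    note f = X.mod_hom_reg[OF x]
    have s: "submodule ((\<lambda>a. a \<odot>\<^bsub>X\<^esub> x) ` carrier \<Lambda>) \<Lambda> X"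
      using submodule_image[OF left_module_reg_algebra X f submodule_carrier[OF left_module_reg_algebra]] by simp
    note s' = submodule_kmod[OF X s]
    have "?f \<in> mod_hom \<Lambda> (reg \<Lambda>) (X\<lparr>carrier := (\<lambda>a. a \<odot>\<^bsub>X\<^esub> x) ` carrier \<Lambda>\<rparr>)"
      using f by (auto simp: mod_hom_def)
    from mod_hom_kmod[OF left_module_reg_algebra this]
    have "?f \<in> mod_hom k (kmod \<Lambda> (reg \<Lambda>)) (kmod \<Lambda> X\<lparr>carrier := (\<lambda>a. a \<odot>\<^bsub>X\<^esub> x) ` carrier \<Lambda>\<rparr>)"
      by (simp add: kmod_submodule)
    from finite_length_surj[OF finite_length_kmod_reg left_module_submodule[OF left_module_kmod[OF X] s'] this]
    show ?thesis using s' by simp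
  qed
  from finite_length_lspan[OF X left_module_kmod[OF X] _ _ _ this xs(1)]
  show "finite_length_module k (kmod \<Lambda> X)" using xs(2) by (simp add: kmod_def)
qed

lemma finite_length_reg_algebra: "finite_length_module \<Lambda> (reg \<Lambda>)"
  using finite_length_kmod_iff[OF left_module_reg_algebra] finite_length_kmod_reg by simp

lemma mod_hom_unit_smult:
  assumes "left_module \<Lambda> A" "left_module \<Lambda> B" "f \<in> mod_hom \<Lambda> A B" "a \<in> carrier k"
  shows "(\<lambda>x\<in>carrier A. (a \<odot>\<^bsub>\<Lambda>\<^esub> \<one>\<^bsub>\<Lambda>\<^esub>) \<odot>\<^bsub>B\<^esub> f x) \<in> mod_hom \<Lambda> A B"
proof -
  interpret B: left_module \<Lambda> B by fact
  note c = mod_hom_closed[OF assms(3)]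
  show ?thesis
    using c assms(4) by (intro mod_hom_restrictI[OF assms(1)])
      (auto simp: mod_hom_add[OF assms(3)] mod_hom_smult[OF assms(3)] B.smult_r_distr
        B.smult_assoc1[symmetric] unit_smult_mult)
qed

text \<open>Evaluation at generators \<open>x\<^sub>1, \<dots>, x\<^sub>n\<close> of \<open>A\<close> filters \<open>Hom(A, B)\<close> by kernels of maps to \<open>B\<close>.\<close>

lemma finite_length_hom_mod:
  assumes A: "finite_length_module \<Lambda> A" and B: "finite_length_module \<Lambda> B"
    and S: "left_module S (hom_mod \<Lambda> A B act)"
    and compat: "\<And>a. a \<in> carrier k \<Longrightarrow>
      \<exists>s\<in>carrier S. \<forall>f\<in>mod_hom \<Lambda> A B. act s f = (\<lambda>x\<in>carrier A. (a \<odot>\<^bsub>\<Lambda>\<^esub> \<one>\<^bsub>\<Lambda>\<^esub>) \<odot>\<^bsub>B\<^esub> f x)"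
  shows "finite_length_module S (hom_mod \<Lambda> A B act)"
proof -
  note lA = finite_length_left_module[OF A]
  note lB = finite_length_left_module[OF B]
  interpret A: left_module \<Lambda> A by (rule lA)
  interpret B: left_module \<Lambda> B by (rule lB)
  let ?H = "hom_mod \<Lambda> A B (\<lambda>a f. \<lambda>x\<in>carrier A. (a \<odot>\<^bsub>\<Lambda>\<^esub> \<one>\<^bsub>\<Lambda>\<^esub>) \<odot>\<^bsub>B\<^esub> f x) :: ('k, _) module"
  have H: "left_module k ?H"
  proof (intro left_module_hom_mod lA lB ring_axioms)
    show "(\<lambda>x\<in>carrier A. (a \<odot>\<^bsub>\<Lambda>\<^esub> \<one>\<^bsub>\<Lambda>\<^esub>) \<odot>\<^bsub>B\<^esub> f x) \<in> mod_hom \<Lambda> A B"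
      if "a \<in> carrier k" "f \<in> mod_hom \<Lambda> A B" for a f
      by (rule mod_hom_unit_smult[OF lA lB that(2,1)])
    note c = mod_hom_closed[of _ \<Lambda> A B]
    show "(\<lambda>x\<in>carrier A. ((a \<oplus>\<^bsub>k\<^esub> b) \<odot>\<^bsub>\<Lambda>\<^esub> \<one>\<^bsub>\<Lambda>\<^esub>) \<odot>\<^bsub>B\<^esub> f x) x =
      (\<lambda>x\<in>carrier A. (a \<odot>\<^bsub>\<Lambda>\<^esub> \<one>\<^bsub>\<Lambda>\<^esub>) \<odot>\<^bsub>B\<^esub> f x) x \<oplus>\<^bsub>B\<^esub> (\<lambda>x\<in>carrier A. (b \<odot>\<^bsub>\<Lambda>\<^esub> \<one>\<^bsub>\<Lambda>\<^esub>) \<odot>\<^bsub>B\<^esub> f x) x"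
      if "a \<in> carrier k" "b \<in> carrier k" "f \<in> mod_hom \<Lambda> A B" "x \<in> carrier A" for a b f x
      using that c[of f x] by (simp add: smult_l_distr B.smult_l_distr)
    show "(\<lambda>x\<in>carrier A. (a \<odot>\<^bsub>\<Lambda>\<^esub> \<one>\<^bsub>\<Lambda>\<^esub>) \<odot>\<^bsub>B\<^esub> (\<lambda>x\<in>carrier A. f x \<oplus>\<^bsub>B\<^esub> g x) x) x =
      (\<lambda>x\<in>carrier A. (a \<odot>\<^bsub>\<Lambda>\<^esub> \<one>\<^bsub>\<Lambda>\<^esub>) \<odot>\<^bsub>B\<^esub> f x) x \<oplus>\<^bsub>B\<^esub> (\<lambda>x\<in>carrier A. (a \<odot>\<^bsub>\<Lambda>\<^esub> \<one>\<^bsub>\<Lambda>\<^esub>) \<odot>\<^bsub>B\<^esub> g x) x"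
      if "a \<in> carrier k" "f \<in> mod_hom \<Lambda> A B" "g \<in> mod_hom \<Lambda> A B" "x \<in> carrier A" for a f g x
      using that c[of f x] c[of g x] by (simp add: B.smult_r_distr)
    show "(\<lambda>x\<in>carrier A. ((a \<otimes>\<^bsub>k\<^esub> b) \<odot>\<^bsub>\<Lambda>\<^esub> \<one>\<^bsub>\<Lambda>\<^esub>) \<odot>\<^bsub>B\<^esub> f x) x =
      (\<lambda>x\<in>carrier A. (a \<odot>\<^bsub>\<Lambda>\<^esub> \<one>\<^bsub>\<Lambda>\<^esub>) \<odot>\<^bsub>B\<^esub> (\<lambda>x\<in>carrier A. (b \<odot>\<^bsub>\<Lambda>\<^esub> \<one>\<^bsub>\<Lambda>\<^esub>) \<odot>\<^bsub>B\<^esub> f x) x) x"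
      if "a \<in> carrier k" "b \<in> carrier k" "f \<in> mod_hom \<Lambda> A B" "x \<in> carrier A" for a b f x
      using that c[of f x] by (simp add: unit_smult_prod B.smult_assoc1)
    show "(\<lambda>x\<in>carrier A. (\<one>\<^bsub>k\<^esub> \<odot>\<^bsub>\<Lambda>\<^esub> \<one>\<^bsub>\<Lambda>\<^esub>) \<odot>\<^bsub>B\<^esub> f x) x = f x"
      if "f \<in> mod_hom \<Lambda> A B" "x \<in> carrier A" for f x
      using that c[of f x] by simp
  qed
  \<comment> \<open>By \<open>compat\<close> the action of \<open>S\<close> contains that of
    \<open>k\<close>, so submodules over \<open>S\<close> are submodules over \<open>k\<close>, and
    finite length over \<open>k\<close> is enough.\<close>
  have "module_length S (hom_mod \<Lambda> A B act) \<le> module_length k ?H"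
  proof (rule module_length_restrict)
    fix U assume "submodule U S (hom_mod \<Lambda> A B act)"
    note u = submodule_subset[OF S this] submodule_zero[OF S this] submodule_add[OF S this]
      submodule_smult[OF S this]
    show "submodule U k ?H"
    proof (rule left_module_submoduleI[OF H])
      show "U \<subseteq> carrier ?H" using u(1) by simp
      show "\<zero>\<^bsub>?H\<^esub> \<in> U" using u(2) by simp
      show "f \<oplus>\<^bsub>?H\<^esub> g \<in> U" if "f \<in> U" "g \<in> U" for f g using u(3)[OF that] by simp
      show "a \<odot>\<^bsub>?H\<^esub> f \<in> U" if a: "a \<in> carrier k" and f: "f \<in> U" for a f
      proof -
        obtain s where s: "s \<in> carrier S"
          "\<And>f. f \<in> mod_hom \<Lambda> A B \<Longrightarrow> act s f = (\<lambda>x\<in>carrier A. (a \<odot>\<^bsub>\<Lambda>\<^esub> \<one>\<^bsub>\<Lambda>\<^esub>) \<odot>\<^bsub>B\<^esub> f x)"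
          using compat[OF a] by blast
        have "f \<in> mod_hom \<Lambda> A B" using u(1) f by auto
        from s(2)[OF this] show ?thesis using u(4)[OF s(1) f] by simp
      qed
    qed
  qed
  moreover have "finite_length_module k ?H"
  proof -
    define K where "K xs = {f \<in> mod_hom \<Lambda> A B. \<forall>x\<in>set xs. f x = \<zero>\<^bsub>B\<^esub>}" for xs
    have K: "submodule (K xs) k ?H" if "set xs \<subseteq> carrier A" for xs
    proof (rule left_module_submoduleI[OF H])
      show "a \<odot>\<^bsub>?H\<^esub> f \<in> K xs" if a: "a \<in> carrier k" and f: "f \<in> K xs" for a f
      proof -
        have f': "f \<in> mod_hom \<Lambda> A B" "\<And>x. x \<in> set xs \<Longrightarrow> f x = \<zero>\<^bsub>B\<^esub>" using f by (auto simp: K_def)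
        have "\<forall>x\<in>set xs. (\<lambda>x\<in>carrier A. (a \<odot>\<^bsub>\<Lambda>\<^esub> \<one>\<^bsub>\<Lambda>\<^esub>) \<odot>\<^bsub>B\<^esub> f x) x = \<zero>\<^bsub>B\<^esub>"
          using f'(2) a \<open>set xs \<subseteq> carrier A\<close> by (auto simp: B.smult_zero_r)
        with mod_hom_unit_smult[OF lA lB f'(1) a] show ?thesis
          unfolding hom_mod_simps K_def by blast
      qed
    qed (use that mod_hom_const_zero[OF lA lB] mod_hom_plus[OF lA lB] in \<open>auto simp: K_def subset_iff\<close>)
    have step: "finite_length_module k (?H\<lparr>carrier := K xs\<rparr>)"
      if "finite_length_module k (?H\<lparr>carrier := K (x # xs)\<rparr>)" "x \<in> carrier A" "set xs \<subseteq> carrier A" for x xs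
    proof (rule finite_length_extension)
      show "left_module k (?H\<lparr>carrier := K xs\<rparr>)" by (rule left_module_submodule[OF H K[OF that(3)]])
      show "finite_length_module k (kmod \<Lambda> B)" using B finite_length_kmod_iff[OF lB] by simp
      show "(\<lambda>f\<in>carrier (?H\<lparr>carrier := K xs\<rparr>). f x) \<in> mod_hom k (?H\<lparr>carrier := K xs\<rparr>) (kmod \<Lambda> B)"
        using that(2) mod_hom_closed[of _ \<Lambda> A B]
        by (intro mod_hom_restrictI[OF left_module_submodule[OF H K[OF that(3)]]]) (auto simp: K_def)
      have "{f \<in> carrier (?H\<lparr>carrier := K xs\<rparr>). (\<lambda>f\<in>carrier (?H\<lparr>carrier := K xs\<rparr>). f x) f = \<zero>\<^bsub>kmod \<Lambda> B\<^esub>} =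
          K (x # xs)"
        by (auto simp: K_def)
      then show "finite_length_module k (?H\<lparr>carrier := K xs\<rparr>\<lparr>carrier := {f \<in> carrier (?H\<lparr>carrier := K xs\<rparr>).
          (\<lambda>f\<in>carrier (?H\<lparr>carrier := K xs\<rparr>). f x) f = \<zero>\<^bsub>kmod \<Lambda> B\<^esub>}\<rparr>)"
        using that(1) by simp
    qed
    have all: "finite_length_module k (?H\<lparr>carrier := K []\<rparr>)"
      if "finite_length_module k (?H\<lparr>carrier := K xs\<rparr>)" "set xs \<subseteq> carrier A" for xs
      using that by (induction xs) (auto intro: step)
    obtain xs where xs: "set xs \<subseteq> carrier A" "A.lspan xs = carrier A"
      using A.finite_length_imp_generated A by (auto simp: finite_length_module_def)
    have "K xs = {\<zero>\<^bsub>?H\<^esub>}"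
    proof
      show "{\<zero>\<^bsub>?H\<^esub>} \<subseteq> K xs" using submodule_zero[OF H K[OF xs(1)]] by simp
      show "K xs \<subseteq> {\<zero>\<^bsub>?H\<^esub>}"
      proof
        fix f assume "f \<in> K xs"
        then have f: "f \<in> mod_hom \<Lambda> A B" "\<forall>x\<in>set xs. f x = \<zero>\<^bsub>B\<^esub>" by (auto simp: K_def)
        have "\<forall>y\<in>A.lspan ys. f y = \<zero>\<^bsub>B\<^esub>" if "set ys \<subseteq> set xs" for ys
          using that
        proof (induction ys)
          case Nil
          then show ?case using mod_hom_zero[OF lA lB f(1)] by (simp add: A.lspan_Nil)
        next
          case (Cons y ys)
          then have y: "y \<in> carrier A" "f y = \<zero>\<^bsub>B\<^esub>" and ys: "set ys \<subseteq> carrier A" using xs(1) f(2) by auto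
          show ?case
          proof
            fix z assume "z \<in> A.lspan (y # ys)"
            then obtain r u where ru: "r \<in> carrier \<Lambda>" "u \<in> A.lspan ys" "z = r \<odot>\<^bsub>A\<^esub> y \<oplus>\<^bsub>A\<^esub> u"
              unfolding A.lspan_Cons by blast
            moreover have "u \<in> carrier A" using submodule_subset[OF lA A.lspan_submodule[OF ys]] ru(2) by blast
            ultimately show "f z = \<zero>\<^bsub>B\<^esub>"
              using y Cons by (simp add: mod_hom_add[OF f(1)] mod_hom_smult[OF f(1)] B.smult_zero_r)
          qed
        qed
        then have "\<forall>y\<in>carrier A. f y = \<zero>\<^bsub>B\<^esub>" using xs(2) by auto
        then show "f \<in> {\<zero>\<^bsub>?H\<^esub>}" using mod_hom_eqI[OF f(1) mod_hom_const_zero[OF lA lB]] by simp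
      qed
    qed
    then have "finite_length_module k (?H\<lparr>carrier := K xs\<rparr>)"
      using left_module_submodule[OF H K[OF xs(1)]]
      by (intro finite_lengthI[OF _ module_length_zero]) auto
    then have "finite_length_module k (?H\<lparr>carrier := K []\<rparr>)" using all xs(1) by blast
    moreover have "?H\<lparr>carrier := K []\<rparr> = ?H" by (simp add: K_def hom_mod_def)
    ultimately show ?thesis by simp
  qed
  ultimately show ?thesis using S unfolding finite_length_module_def by (meson order_le_less_trans)
qed

end

section \<open>The dualizing module of a commutative artinian ring\<close>

lemma mod_hom_diff:
  assumes "left_module R M" "left_module R N" "f \<in> mod_hom R M N" "x \<in> carrier M" "y \<in> carrier M"
  shows "f (x \<ominus>\<^bsub>M\<^esub> y) = f x \<ominus>\<^bsub>N\<^esub> f y"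
proof -
  interpret M: left_module R M by fact
  show ?thesis using assms by (simp add: a_minus_def mod_hom_add[OF assms(3)] mod_hom_minus)
qed

text \<open>Maximality is expressed by elements: whatever lies outside is invertible modulo
  \<open>m\<close>. This is the form in which it acts on elements of a socle.\<close>

definition max_ideal :: "('r, 'c) ring_scheme \<Rightarrow> 'r set \<Rightarrow> bool"
  where "max_ideal R m \<longleftrightarrow> submodule m R (reg R) \<and> \<one>\<^bsub>R\<^esub> \<notin> m \<and>
    (\<forall>a\<in>carrier R. a \<notin> m \<longrightarrow> (\<exists>c\<in>carrier R. \<one>\<^bsub>R\<^esub> \<ominus>\<^bsub>R\<^esub> c \<otimes>\<^bsub>R\<^esub> a \<in> m))"

text \<open>Every simple module occurs at most once in the socle of \<open>J\<close>.\<close>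

definition multfree_socle :: "('r, 'c) ring_scheme \<Rightarrow> ('r, 'm, 'd) module_scheme \<Rightarrow> bool"
  where "multfree_socle R J \<longleftrightarrow> (\<forall>m. max_ideal R m \<longrightarrow> (\<forall>x\<in>carrier J. \<forall>y\<in>carrier J.
    x \<noteq> \<zero>\<^bsub>J\<^esub> \<longrightarrow> (\<forall>a\<in>m. a \<odot>\<^bsub>J\<^esub> x = \<zero>\<^bsub>J\<^esub>) \<longrightarrow> (\<forall>a\<in>m. a \<odot>\<^bsub>J\<^esub> y = \<zero>\<^bsub>J\<^esub>) \<longrightarrow>
      (\<exists>c\<in>carrier R. y = c \<odot>\<^bsub>J\<^esub> x)))"

text \<open>The Matlis dual once \<open>J\<close> is the dualizing module. \<open>J\<close> stays a
  parameter because length estimates for this dual are used to show that a longest \<open>J\<close>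
  exists.\<close>

definition dual :: "('r, 'c) ring_scheme \<Rightarrow> ('r, 'n, 'e) module_scheme \<Rightarrow> ('r, 'm, 'd) module_scheme \<Rightarrow>
    ('r, 'm \<Rightarrow> 'n) module"
  where "dual R J V = hom_mod R V J (\<lambda>a f. \<lambda>x\<in>carrier V. a \<odot>\<^bsub>J\<^esub> f x)"

text \<open>The maximum of length is taken over modules on lists only;
  \<open>dualizing_module_maximal\<close> extends it to all types of elements, as is needed for the
  pairs and quotients constructed from \<open>J\<close>.\<close>

definition dualizing_module :: "('r, 'c) ring_scheme \<Rightarrow> 'r lmod"
  where "dualizing_module R = (SOME J. finite_length_module R J \<and> multfree_socle R J \<and>
    (\<forall>N :: 'r lmod. finite_length_module R N \<longrightarrow> multfree_socle R N \<longrightarrow> module_length R N \<le> module_length R J))"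

lemma dual_simps [simp]:
  "carrier (dual R J V) = mod_hom R V J"
  "\<zero>\<^bsub>dual R J V\<^esub> = (\<lambda>x\<in>carrier V. \<zero>\<^bsub>J\<^esub>)"
  "f \<oplus>\<^bsub>dual R J V\<^esub> g = (\<lambda>x\<in>carrier V. f x \<oplus>\<^bsub>J\<^esub> g x)"
  "a \<odot>\<^bsub>dual R J V\<^esub> f = (\<lambda>x\<in>carrier V. a \<odot>\<^bsub>J\<^esub> f x)"
  by (simp_all only: dual_def hom_mod_simps)

text \<open>Elements killed by a maximal ideal go to elements killed by it, where one is a multiple
  of the other; injectivity brings the relation back.\<close>

lemma multfree_socle_inj:
  assumes "left_module R M" "left_module R N" "f \<in> mod_hom R M N" "inj_on f (carrier M)" "multfree_socle R N"
  shows "multfree_socle R M"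
  unfolding multfree_socle_def
proof (intro allI impI ballI)
  interpret M: left_module R M by fact
  fix m x y
  assume m: "max_ideal R m" and xy: "x \<in> carrier M" "y \<in> carrier M" "x \<noteq> \<zero>\<^bsub>M\<^esub>"
    and kx: "\<forall>a\<in>m. a \<odot>\<^bsub>M\<^esub> x = \<zero>\<^bsub>M\<^esub>" and ky: "\<forall>a\<in>m. a \<odot>\<^bsub>M\<^esub> y = \<zero>\<^bsub>M\<^esub>"
  have "m \<subseteq> carrier R"
    using m submodule_subset[OF left_module_reg[OF M.R.ring_axioms]] by (auto simp: max_ideal_def)
  then have kill: "\<forall>a\<in>m. a \<odot>\<^bsub>N\<^esub> f z = \<zero>\<^bsub>N\<^esub>" if "z \<in> carrier M" "\<forall>a\<in>m. a \<odot>\<^bsub>M\<^esub> z = \<zero>\<^bsub>M\<^esub>" for z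
    using that mod_hom_smult[OF assms(3)] mod_hom_zero[OF assms(1-3)] by (metis subsetD)
  have "f x \<noteq> \<zero>\<^bsub>N\<^esub>" using mod_hom_inj_iff[OF assms(1-3)] assms(4) xy by blast
  then obtain c where c: "c \<in> carrier R" "f y = c \<odot>\<^bsub>N\<^esub> f x"
    using assms(5) m kill[OF xy(1) kx] kill[OF xy(2) ky] mod_hom_closed[OF assms(3)] xy
    unfolding multfree_socle_def by blast
  then have "f y = f (c \<odot>\<^bsub>M\<^esub> x)" using mod_hom_smult[OF assms(3)] xy by simp
  then have "y = c \<odot>\<^bsub>M\<^esub> x" using assms(4) xy c(1) by (meson M.smult_closed inj_onD)
  then show "\<exists>c\<in>carrier R. y = c \<odot>\<^bsub>M\<^esub> x" using c(1) by blast
qed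

context artinian_cring
begin

section \<open>Matlis duality over a commutative artinian ring\<close>

lemma left_module_reg': "left_module R (reg R)"
  by (rule left_module_reg[OF ring_axioms])

text \<open>Finite length of the ring provides \<open>m\<close>, maximal among the ideals that
  contain \<open>I\<close> and avoid 1. For a outside \<open>m\<close> the larger ideal m + R a
  contains 1.\<close>

lemma max_ideal_exists:
  assumes "submodule I R (reg R)" "\<one> \<notin> I"
  shows "\<exists>m. max_ideal R m \<and> I \<subseteq> m"
proof -
  note M = left_module_reg'
  obtain m where m': "submodule m R (reg R)" "I \<subseteq> m \<and> \<one> \<notin> m"
    and max': "\<And>V. submodule V R (reg R) \<Longrightarrow> I \<subseteq> V \<and> \<one> \<notin> V \<Longrightarrow> m \<subseteq> V \<Longrightarrow> V = m"
    by (rule submodule_maximal_exists[OF finite_length_reg assms(1), of "\<lambda>V. I \<subseteq> V \<and> \<one> \<notin> V"])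
      (use assms(2) in auto)
  note m = m'(1) conjunct1[OF m'(2)] conjunct2[OF m'(2)]
  have max: "V = m" if "submodule V R (reg R)" "I \<subseteq> V" "\<one> \<notin> V" "m \<subseteq> V" for V
    by (rule max'[OF that(1) conjI[OF that(2,3)] that(4)])
  have "\<exists>c\<in>carrier R. \<one> \<ominus> c \<otimes> a \<in> m" if a: "a \<in> carrier R" "a \<notin> m" for a
  proof -
    interpret M: left_module R "reg R" by (rule M)
    let ?A = "(\<lambda>t\<in>carrier R. t \<otimes> a) ` carrier R"
    have A: "submodule ?A R (reg R)"
      using submodule_image[OF M M M.mod_hom_reg[of a] submodule_carrier[OF M]] a by simp
    let ?X = "m <+>\<^bsub>reg R\<^esub> ?A"
    have X: "submodule ?X R (reg R)" by (rule submodule_set_add[OF M m(1) A])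
    have "a \<in> ?A" using a by (intro image_eqI[of _ _ \<one>]) auto
    then have "?X \<noteq> m" using a(2) set_add_upper(2)[OF M m(1) A] by blast
    then have "\<one> \<in> ?X" using max[OF X] m(2) set_add_upper(1)[OF M m(1) A] by blast
    then obtain u c where uc: "u \<in> m" "c \<in> carrier R" "\<one> = u \<oplus> c \<otimes> a" unfolding set_add_iff by auto
    have "u \<in> carrier R" using submodule_subset[OF M m(1)] uc(1) by auto
    then have "\<one> \<ominus> c \<otimes> a = u" using uc a by (simp add: minus_eq a_assoc r_neg)
    then show ?thesis using uc by blast
  qed
  then show ?thesis using m unfolding max_ideal_def by blast
qed

lemma left_module_dual:
  assumes V: "left_module R V" and J: "left_module R J"
  shows "left_module R (dual R J V)"
  unfolding dual_def
proof (intro left_module_hom_mod V J ring_axioms)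
  interpret J: left_module R J by (rule J)
  note c = mod_hom_closed[of _ R V J]
  show "(\<lambda>x\<in>carrier V. a \<odot>\<^bsub>J\<^esub> f x) \<in> mod_hom R V J" if "a \<in> carrier R" "f \<in> mod_hom R V J" for a f
    using that c m_comm by (intro mod_hom_restrictI[OF V])
      (auto simp: mod_hom_add[OF that(2)] mod_hom_smult[OF that(2)] J.smult_r_distr J.smult_assoc1[symmetric])
  show "(\<lambda>x\<in>carrier V. (a \<oplus> b) \<odot>\<^bsub>J\<^esub> f x) x =
      (\<lambda>x\<in>carrier V. a \<odot>\<^bsub>J\<^esub> f x) x \<oplus>\<^bsub>J\<^esub> (\<lambda>x\<in>carrier V. b \<odot>\<^bsub>J\<^esub> f x) x"
    if "a \<in> carrier R" "b \<in> carrier R" "f \<in> mod_hom R V J" "x \<in> carrier V" for a b f x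
    using that c[of f x] by (simp add: J.smult_l_distr)
  show "(\<lambda>x\<in>carrier V. a \<odot>\<^bsub>J\<^esub> (\<lambda>x\<in>carrier V. f x \<oplus>\<^bsub>J\<^esub> g x) x) x =
      (\<lambda>x\<in>carrier V. a \<odot>\<^bsub>J\<^esub> f x) x \<oplus>\<^bsub>J\<^esub> (\<lambda>x\<in>carrier V. a \<odot>\<^bsub>J\<^esub> g x) x"
    if "a \<in> carrier R" "f \<in> mod_hom R V J" "g \<in> mod_hom R V J" "x \<in> carrier V" for a f g x
    using that c[of f x] c[of g x] by (simp add: J.smult_r_distr)
  show "(\<lambda>x\<in>carrier V. (a \<otimes> b) \<odot>\<^bsub>J\<^esub> f x) x =
      (\<lambda>x\<in>carrier V. a \<odot>\<^bsub>J\<^esub> (\<lambda>x\<in>carrier V. b \<odot>\<^bsub>J\<^esub> f x) x) x"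
    if "a \<in> carrier R" "b \<in> carrier R" "f \<in> mod_hom R V J" "x \<in> carrier V" for a b f x
    using that c[of f x] by (simp add: J.smult_assoc1)
  show "(\<lambda>x\<in>carrier V. \<one> \<odot>\<^bsub>J\<^esub> f x) x = f x" if "f \<in> mod_hom R V J" "x \<in> carrier V" for f x
    using that c[of f x] by simp
qed

lemma mod_hom_eval:
  assumes V: "left_module R V" and J: "left_module R J" and v: "v \<in> carrier V"
  shows "(\<lambda>f\<in>carrier (dual R J V). f v) \<in> mod_hom R (dual R J V) J"
  using v mod_hom_closed[of _ R V J]
  by (intro mod_hom_restrictI[OF left_module_dual[OF V J]]) auto

text \<open>The annihilators \<open>ann U\<close> filter the dual. If U' is minimal above U, then
  U'/U is R/m for a maximal ideal m, and a map vanishing on U is determined modulo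
  \<open>ann U'\<close> by its value at one element x of U' outside U. Such values are killed by m,
  and the multiplicity free socle makes them multiples of any nonzero one. So the dual grows by at
  most one step for each step in \<open>V\<close>.\<close>

lemma module_length_dual:
  assumes V: "finite_length_module R V" and J: "left_module R J" and mf: "multfree_socle R J"
  shows "module_length R (dual R J V) \<le> module_length R V"
proof -
  note lV = finite_length_left_module[OF V]
  interpret V: left_module R V by (rule lV)
  interpret J: left_module R J by (rule J)
  let ?D = "dual R J V"
  note D = left_module_dual[OF lV J]
  interpret D: left_module R ?D by (rule D)
  define ann where "ann U = {f \<in> mod_hom R V J. \<forall>x\<in>U. f x = \<zero>\<^bsub>J\<^esub>}" for U
  have ann: "submodule (ann U) R ?D" if U: "U \<subseteq> carrier V" for U
  proof (rule left_module_submoduleI[OF D])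
    show "ann U \<subseteq> carrier ?D" by (auto simp: ann_def)
    show "\<zero>\<^bsub>?D\<^esub> \<in> ann U" using D.zero_closed U by (auto simp: ann_def)
    show "f \<oplus>\<^bsub>?D\<^esub> g \<in> ann U" if f: "f \<in> ann U" and g: "g \<in> ann U" for f g
      using D.M.a_closed[of f g] f g U by (auto simp: ann_def)
    show "a \<odot>\<^bsub>?D\<^esub> f \<in> ann U" if a: "a \<in> carrier R" and f: "f \<in> ann U" for a f
    proof -
      have "a \<odot>\<^bsub>?D\<^esub> f \<in> mod_hom R V J" using D.smult_closed[of a f] a f by (simp add: ann_def)
      moreover have "\<forall>x\<in>U. (a \<odot>\<^bsub>?D\<^esub> f) x = \<zero>\<^bsub>J\<^esub>" using f a U by (auto simp: ann_def J.smult_zero_r)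
      ultimately show ?thesis unfolding ann_def by blast
    qed
  qed
  \<comment> \<open>The induction descends from U = V. The case U = 0 is the claim, because every
    homomorphism vanishes at 0.\<close>
  have "module_length R (?D\<lparr>carrier := ann U\<rparr>) \<le> enat (len R V (carrier V) - len R V U)"
    if "submodule U R V" for U
    using that
  proof (induction "len R V (carrier V) - len R V U" arbitrary: U rule: less_induct)
    case (less U)
    note U = less.prems
    note Us = submodule_subset[OF lV U]
    show ?case
    proof (cases "U = carrier V")
      case True
      have "ann U = {\<zero>\<^bsub>?D\<^esub>}"
      proof
        show "{\<zero>\<^bsub>?D\<^esub>} \<subseteq> ann U" using submodule_zero[OF D ann[OF Us]] by simp
        show "ann U \<subseteq> {\<zero>\<^bsub>?D\<^esub>}"
        proof
          fix f assume "f \<in> ann U"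
          then show "f \<in> {\<zero>\<^bsub>?D\<^esub>}"
            using mod_hom_eqI[of f R V J "\<zero>\<^bsub>?D\<^esub>" J] D.zero_closed by (simp add: ann_def True)
        qed
      qed
      then have "module_length R (?D\<lparr>carrier := ann U\<rparr>) \<le> enat 0"
        by (intro module_length_zero[OF left_module_submodule[OF D ann[OF Us]]]) simp
      then show ?thesis by (simp add: zero_enat_def[symmetric])
    next
      case False
      then have "U \<subset> carrier V" using Us by blast
      obtain U' where U': "submodule U' R V" "U \<subset> U'"
        and min: "\<And>W. submodule W R V \<Longrightarrow> U \<subset> W \<Longrightarrow> W \<subseteq> U' \<Longrightarrow> W = U'"
        by (rule submodule_minimal_exists[OF V submodule_carrier[OF lV], of "\<lambda>W. U \<subset> W", OF \<open>U \<subset> carrier V\<close>])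
          (rule that)
      note U's = submodule_subset[OF lV U'(1)]
      obtain x where x: "x \<in> U'" "x \<notin> U" using U'(2) by blast
      then have xV: "x \<in> carrier V" using U's by blast
      have span: "\<exists>u\<in>U. \<exists>c\<in>carrier R. y = u \<oplus>\<^bsub>V\<^esub> c \<odot>\<^bsub>V\<^esub> z"
        if z: "z \<in> U'" "z \<notin> U" and y: "y \<in> U'" for y z
      proof -
        have zV: "z \<in> carrier V" using z U's by blast
        let ?Z = "(\<lambda>a\<in>carrier R. a \<odot>\<^bsub>V\<^esub> z) ` carrier R"
        have Z: "submodule ?Z R V"
          using submodule_image[OF left_module_reg' lV V.mod_hom_reg[OF zV] submodule_carrier[OF left_module_reg']] by simp
        have "z \<in> ?Z" using zV by (intro image_eqI[of _ _ \<one>]) auto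
        then have "U \<subset> U <+>\<^bsub>V\<^esub> ?Z" using set_add_upper[OF lV U Z] z(2) by blast
        moreover have "U <+>\<^bsub>V\<^esub> ?Z \<subseteq> U'"
        proof
          fix w assume "w \<in> U <+>\<^bsub>V\<^esub> ?Z"
          then obtain u a where "u \<in> U" "a \<in> carrier R" "w = u \<oplus>\<^bsub>V\<^esub> a \<odot>\<^bsub>V\<^esub> z" unfolding set_add_iff by auto
          then show "w \<in> U'" using submodule_add[OF lV U'(1)] submodule_smult[OF lV U'(1) _ z(1)] U'(2) by blast
        qed
        ultimately have "y \<in> U <+>\<^bsub>V\<^esub> ?Z" using min[OF submodule_set_add[OF lV U Z]] y by blast
        then show ?thesis unfolding set_add_iff by auto
      qed
      \<comment> \<open>The annihilator of x modulo U. It is maximal by minimality of U': for a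
        outside it, a x again generates U' over U, so x = u + c a x, and 1 - c a lies in
        \<open>m\<close>.\<close>
      define m where "m = {a \<in> carrier R. a \<odot>\<^bsub>V\<^esub> x \<in> U}"
      have m: "max_ideal R m" unfolding max_ideal_def
      proof (intro conjI ballI impI)
        show "submodule m R (reg R)"
          using submodule_vimage[OF left_module_reg' lV V.mod_hom_reg[OF xV] U] by (simp add: m_def cong: conj_cong)
        show "\<one> \<notin> m" using x xV by (simp add: m_def)
        fix a assume a: "a \<in> carrier R" "a \<notin> m"
        have "a \<odot>\<^bsub>V\<^esub> x \<notin> U" "a \<odot>\<^bsub>V\<^esub> x \<in> U'" using a submodule_smult[OF lV U'(1) a(1) x(1)] by (auto simp: m_def)
        from span[OF this(2,1) x(1)] obtain u c
          where uc: "u \<in> U" "c \<in> carrier R" "x = u \<oplus>\<^bsub>V\<^esub> c \<odot>\<^bsub>V\<^esub> (a \<odot>\<^bsub>V\<^esub> x)" by blast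
        have uV: "u \<in> carrier V" using uc(1) Us by blast
        have "(\<one> \<ominus> c \<otimes> a) \<odot>\<^bsub>V\<^esub> x = x \<oplus>\<^bsub>V\<^esub> (\<ominus> (c \<otimes> a)) \<odot>\<^bsub>V\<^esub> x"
          using a(1) uc(2) xV by (simp add: minus_eq V.smult_l_distr)
        also have "(\<ominus> (c \<otimes> a)) \<odot>\<^bsub>V\<^esub> x = \<ominus>\<^bsub>V\<^esub> (c \<odot>\<^bsub>V\<^esub> (a \<odot>\<^bsub>V\<^esub> x))"
        proof -
          have "(\<ominus> (c \<otimes> a)) \<odot>\<^bsub>V\<^esub> x = (\<ominus> \<one>) \<odot>\<^bsub>V\<^esub> ((c \<otimes> a) \<odot>\<^bsub>V\<^esub> x)"
            using a(1) uc(2) xV by (simp add: V.smult_assoc1[symmetric] l_minus)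
          then show ?thesis using a(1) uc(2) xV by (simp add: V.smult_minus_one V.smult_assoc1)
        qed
        also have "x \<oplus>\<^bsub>V\<^esub> \<ominus>\<^bsub>V\<^esub> (c \<odot>\<^bsub>V\<^esub> (a \<odot>\<^bsub>V\<^esub> x)) = u"
        proof -
          have "x \<oplus>\<^bsub>V\<^esub> \<ominus>\<^bsub>V\<^esub> (c \<odot>\<^bsub>V\<^esub> (a \<odot>\<^bsub>V\<^esub> x)) =
              u \<oplus>\<^bsub>V\<^esub> c \<odot>\<^bsub>V\<^esub> (a \<odot>\<^bsub>V\<^esub> x) \<oplus>\<^bsub>V\<^esub> \<ominus>\<^bsub>V\<^esub> (c \<odot>\<^bsub>V\<^esub> (a \<odot>\<^bsub>V\<^esub> x))" using uc(3) by simp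
          then show ?thesis using a(1) uc(2) xV uV by (simp add: V.M.a_assoc V.M.r_neg)
        qed
        finally show "\<exists>c\<in>carrier R. \<one> \<ominus> c \<otimes> a \<in> m" using a(1) uc by (intro bexI[of _ c]) (auto simp: m_def)
      qed
      have zero_iff: "f \<in> ann U' \<longleftrightarrow> f x = \<zero>\<^bsub>J\<^esub>" if f: "f \<in> ann U" for f
      proof
        have fh: "f \<in> mod_hom R V J" using f by (simp add: ann_def)
        assume fx: "f x = \<zero>\<^bsub>J\<^esub>"
        have "f y = \<zero>\<^bsub>J\<^esub>" if y: "y \<in> U'" for y
        proof -
          obtain u c where uc: "u \<in> U" "c \<in> carrier R" "y = u \<oplus>\<^bsub>V\<^esub> c \<odot>\<^bsub>V\<^esub> x" using span[OF x y] by blast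
          have "u \<in> carrier V" "f u = \<zero>\<^bsub>J\<^esub>" using uc(1) Us f by (auto simp: ann_def)
          then show ?thesis
            using uc xV fx by (simp add: mod_hom_add[OF fh] mod_hom_smult[OF fh] J.smult_zero_r)
        qed
        then show "f \<in> ann U'" using fh by (simp add: ann_def)
      qed (use x in \<open>simp add: ann_def\<close>)
      have killed: "\<forall>a\<in>m. a \<odot>\<^bsub>J\<^esub> f x = \<zero>\<^bsub>J\<^esub>" if f: "f \<in> ann U" for f
      proof
        fix a assume a: "a \<in> m"
        have fh: "f \<in> mod_hom R V J" using f by (simp add: ann_def)
        have "f (a \<odot>\<^bsub>V\<^esub> x) = a \<odot>\<^bsub>J\<^esub> f x" using a xV by (simp add: mod_hom_smult[OF fh] m_def)
        moreover have "f (a \<odot>\<^bsub>V\<^esub> x) = \<zero>\<^bsub>J\<^esub>" using a f by (simp add: m_def ann_def)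
        ultimately show "a \<odot>\<^bsub>J\<^esub> f x = \<zero>\<^bsub>J\<^esub>" by simp
      qed
      have lt: "len R V U < len R V U'" by (rule len_strict_mono[OF V U U'])
      have le: "len R V U' \<le> len R V (carrier V)" by (rule len_le[OF V U'(1)])
      have "module_length R (?D\<lparr>carrier := ann U'\<rparr>) \<le> enat (len R V (carrier V) - len R V U')"
        using less.hyps[OF _ U'(1)] lt le by simp
      then have "module_length R (?D\<lparr>carrier := ann U\<rparr>) \<le> enat (Suc (len R V (carrier V) - len R V U'))"
      proof (rule module_length_step[OF D ann[OF U's] ann[OF Us], rotated 2])
        show "ann U' \<subseteq> ann U" using U'(2) by (auto simp: ann_def)
        fix f g assume f: "f \<in> ann U" "f \<notin> ann U'" and g: "g \<in> ann U"
        have h: "f \<in> mod_hom R V J" "g \<in> mod_hom R V J" using f g by (auto simp: ann_def)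
        have "f x \<noteq> \<zero>\<^bsub>J\<^esub>" using zero_iff f by blast
        then obtain c where c: "c \<in> carrier R" "g x = c \<odot>\<^bsub>J\<^esub> f x"
          using mf m killed[OF f(1)] killed[OF g] mod_hom_closed[OF h(1) xV] mod_hom_closed[OF h(2) xV]
          unfolding multfree_socle_def by blast
        have cf: "c \<odot>\<^bsub>?D\<^esub> f \<in> ann U" using submodule_smult[OF D ann[OF Us] c(1) f(1)] .
        have d: "g \<ominus>\<^bsub>?D\<^esub> c \<odot>\<^bsub>?D\<^esub> f \<in> ann U" by (rule submodule_diff[OF D ann[OF Us] g cf])
        have car: "g \<in> carrier ?D" "c \<odot>\<^bsub>?D\<^esub> f \<in> carrier ?D" "g \<ominus>\<^bsub>?D\<^esub> c \<odot>\<^bsub>?D\<^esub> f \<in> carrier ?D"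
          using g cf d unfolding ann_def dual_simps(1) by blast+
        have "(g \<ominus>\<^bsub>?D\<^esub> c \<odot>\<^bsub>?D\<^esub> f) x = g x \<ominus>\<^bsub>J\<^esub> (c \<odot>\<^bsub>?D\<^esub> f) x"
          using mod_hom_diff[OF D J mod_hom_eval[OF lV J xV] car(1,2)] car by (simp del: dual_simps)
        also have "\<dots> = \<zero>\<^bsub>J\<^esub>"
          using c xV mod_hom_closed[OF h(1) xV] by (simp add: a_minus_def J.M.r_neg)
        finally have "g \<ominus>\<^bsub>?D\<^esub> c \<odot>\<^bsub>?D\<^esub> f \<in> ann U'" using zero_iff[OF d] by blast
        then show "\<exists>a\<in>carrier R. g \<ominus>\<^bsub>?D\<^esub> a \<odot>\<^bsub>?D\<^esub> f \<in> ann U'" using c(1) by blast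
      qed
      then show ?thesis using lt le by (elim order_trans) simp
    qed
  qed
  from this[OF submodule_singleton_zero[OF lV]]
  have "module_length R (?D\<lparr>carrier := ann {\<zero>\<^bsub>V\<^esub>}\<rparr>) \<le> enat (len R V (carrier V))"
    by (elim order_trans) simp
  moreover have "ann {\<zero>\<^bsub>V\<^esub>} = carrier ?D" using mod_hom_zero[OF lV J] by (auto simp: ann_def)
  moreover have "?D\<lparr>carrier := carrier ?D\<rparr> = ?D" by (simp add: dual_def hom_mod_def)
  ultimately show ?thesis using enat_len_carrier[OF V] by (simp del: dual_simps)
qed

text \<open>\<open>J \<cong> Hom(R, J)\<close>, filtered along a composition series of \<open>R\<close>.\<close>

lemma module_length_multfree_socle:
  assumes J: "left_module R J" and mf: "multfree_socle R J"
  shows "module_length R J \<le> module_length R (reg R)"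
proof -
  interpret J: left_module R J by (rule J)
  let ?D = "dual R J (reg R)"
  note D = left_module_dual[OF left_module_reg' J]
  let ?f = "\<lambda>j\<in>carrier J. \<lambda>a\<in>carrier R. a \<odot>\<^bsub>J\<^esub> j"
  have f: "?f \<in> mod_hom R J ?D"
  proof (rule mod_hom_restrictI[OF J])
    show "(\<lambda>a\<in>carrier R. a \<odot>\<^bsub>J\<^esub> j) \<in> carrier ?D" if "j \<in> carrier J" for j
      using J.mod_hom_reg[OF that] by simp
    show "(\<lambda>a\<in>carrier R. a \<odot>\<^bsub>J\<^esub> (i \<oplus>\<^bsub>J\<^esub> j)) =
        (\<lambda>a\<in>carrier R. a \<odot>\<^bsub>J\<^esub> i) \<oplus>\<^bsub>?D\<^esub> (\<lambda>a\<in>carrier R. a \<odot>\<^bsub>J\<^esub> j)"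
      if "i \<in> carrier J" "j \<in> carrier J" for i j
      using that by (auto simp: J.smult_r_distr cong: restrict_cong)
    show "(\<lambda>a\<in>carrier R. a \<odot>\<^bsub>J\<^esub> (b \<odot>\<^bsub>J\<^esub> j)) = b \<odot>\<^bsub>?D\<^esub> (\<lambda>a\<in>carrier R. a \<odot>\<^bsub>J\<^esub> j)"
      if "b \<in> carrier R" "j \<in> carrier J" for b j
    proof -
      have "a \<odot>\<^bsub>J\<^esub> (b \<odot>\<^bsub>J\<^esub> j) = b \<odot>\<^bsub>J\<^esub> (a \<odot>\<^bsub>J\<^esub> j)" if "a \<in> carrier R" for a
        using that \<open>b \<in> carrier R\<close> \<open>j \<in> carrier J\<close> J.smult_assoc1[of a b j] J.smult_assoc1[of b a j] m_comm[of a b]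
        by simp
      then show ?thesis by (auto cong: restrict_cong)
    qed
  qed
  have "inj_on ?f (carrier J)"
  proof (rule inj_onI)
    fix i j assume ij: "i \<in> carrier J" "j \<in> carrier J" "?f i = ?f j"
    then have "(\<lambda>a\<in>carrier R. a \<odot>\<^bsub>J\<^esub> i) \<one> = (\<lambda>a\<in>carrier R. a \<odot>\<^bsub>J\<^esub> j) \<one>" by simp
    then show "i = j" using ij(1,2) by simp
  qed
  from module_length_inj[OF J D f this] module_length_dual[OF finite_length_reg J mf]
  show ?thesis by (rule order_trans)
qed

text \<open>The length of the ring bounds all candidates and the zero module is one, so a longest
  candidate exists. A candidate with other elements is copied to lists, where neither its length
  drops nor its socle changes.\<close>

lemma dualizing_module:
  shows finite_length_dualizing_module: "finite_length_module R (dualizing_module R)"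
    and multfree_socle_dualizing_module: "multfree_socle R (dualizing_module R)"
    and dualizing_module_maximal: "left_module R N \<Longrightarrow> multfree_socle R N \<Longrightarrow>
      module_length R N \<le> module_length R (dualizing_module R)"
proof -
  let ?P = "\<lambda>J :: 'a lmod. finite_length_module R J \<and> multfree_socle R J"
  have zero: "\<exists>J. ?P J"
  proof -
    have l: "left_module R (reg R\<lparr>carrier := {\<zero>\<^bsub>reg R\<^esub>}\<rparr>)"
      by (rule left_module_submodule[OF left_module_reg' submodule_singleton_zero[OF left_module_reg']])
    then have "finite_length_module R (reg R\<lparr>carrier := {\<zero>\<^bsub>reg R\<^esub>}\<rparr>)"
      by (intro finite_lengthI[OF l module_length_zero[OF l]]) simp
    from finite_length_module_on_lists[OF this] obtain Y :: "'a lmod" and f where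
      Y: "finite_length_module R Y" and f: "bij_betw f {\<zero>} (carrier Y)"
      unfolding mod_iso_def by auto
    have "\<zero>\<^bsub>Y\<^esub> \<in> carrier Y"
      using submodule_zero[OF finite_length_left_module submodule_carrier[OF finite_length_left_module], OF Y Y] .
    moreover have "carrier Y = {f \<zero>}" using bij_betw_imp_surj_on[OF f] by simp
    ultimately have "carrier Y = {\<zero>\<^bsub>Y\<^esub>}" by simp
    then have "multfree_socle R Y" by (auto simp: multfree_socle_def)
    then show ?thesis using Y by blast
  qed
  have bound: "the_enat (module_length R J) < Suc (len R (reg R) (carrier R))" if "?P J" for J
    using module_length_multfree_socle[of J] that finite_length_left_module[of R J]
      enat_len_carrier[OF finite_length_reg] enat_len_carrier[of R J] by simp
  obtain J\<^sub>0 where "?P J\<^sub>0" using zero ..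
  from ex_has_greatest_nat[of ?P, OF this, of "\<lambda>J. the_enat (module_length R J)" "Suc (len R (reg R) (carrier R))"] bound
  obtain J where J: "?P J" "\<forall>N. ?P N \<longrightarrow> the_enat (module_length R N) \<le> the_enat (module_length R J)" by metis
  have "module_length R N \<le> module_length R J" if "?P N" for N
    using J(2)[rule_format, OF that] enat_len_carrier[of R N] enat_len_carrier[of R J] that J(1) by simp
  then have "finite_length_module R J \<and> multfree_socle R J \<and>
      (\<forall>N :: 'a lmod. finite_length_module R N \<longrightarrow> multfree_socle R N \<longrightarrow> module_length R N \<le> module_length R J)"
    using J(1) by simp
  then have d': "finite_length_module R (dualizing_module R) \<and> multfree_socle R (dualizing_module R) \<and>
      (\<forall>N :: 'a lmod. finite_length_module R N \<longrightarrow> multfree_socle R N \<longrightarrow>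
        module_length R N \<le> module_length R (dualizing_module R))"
    unfolding dualizing_module_def by (rule someI)
  note d = conjunct1[OF d'] conjunct1[OF conjunct2[OF d']] conjunct2[OF conjunct2[OF d'], rule_format]
  show "finite_length_module R (dualizing_module R)" "multfree_socle R (dualizing_module R)" by (rule d)+
  assume N: "left_module R N" "multfree_socle R N"
  have "finite_length_module R N"
    using module_length_multfree_socle[OF N] enat_len_carrier[OF finite_length_reg] finite_lengthI[OF N(1)] by simp
  from finite_length_module_on_lists[OF this] obtain Y :: "'a lmod" and f where
    Y: "finite_length_module R Y" "f \<in> mod_hom R N Y" "bij_betw f (carrier N) (carrier Y)"
    unfolding mod_iso_def by blast
  note lY = finite_length_left_module[OF Y(1)]
  obtain g where g: "g \<in> mod_hom R Y N" "bij_betw g (carrier Y) (carrier N)"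
    using mod_hom_inverse[OF N(1) lY Y(2,3)] by blast
  have "multfree_socle R Y"
    by (rule multfree_socle_inj[OF lY N(1) g(1) bij_betw_imp_inj_on[OF g(2)] N(2)])
  then have "module_length R Y \<le> module_length R (dualizing_module R)" using d(3) Y(1) by blast
  moreover have "module_length R N \<le> module_length R Y"
    by (rule module_length_inj[OF N(1) lY Y(2) bij_betw_imp_inj_on[OF Y(3)]])
  ultimately show "module_length R N \<le> module_length R (dualizing_module R)" by (rule order_trans[rotated])
qed

lemma left_module_dualizing_module: "left_module R (dualizing_module R)"
  by (rule finite_length_left_module[OF finite_length_dualizing_module])

lemma max_ideal_subset: "max_ideal R m \<Longrightarrow> a \<in> m \<Longrightarrow> a \<in> carrier R"
  using submodule_subset[OF left_module_reg'] by (auto simp: max_ideal_def)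

lemma max_ideal_eq:
  assumes m: "max_ideal R m" and n: "max_ideal R n" and sub: "n \<subseteq> m"
  shows "n = m"
proof (rule ccontr)
  assume "n \<noteq> m"
  then obtain a where a: "a \<in> m" "a \<notin> n" using sub by blast
  have aR: "a \<in> carrier R" using max_ideal_subset[OF m a(1)] .
  obtain c where c: "c \<in> carrier R" "\<one> \<ominus> c \<otimes> a \<in> n" using n a(2) aR unfolding max_ideal_def by blast
  have ms: "submodule m R (reg R)" "\<one> \<notin> m" using m by (auto simp: max_ideal_def)
  have "c \<otimes> a \<in> m" using submodule_smult[OF left_module_reg' ms(1) c(1) a(1)] by simp
  then have "(\<one> \<ominus> c \<otimes> a) \<oplus> c \<otimes> a \<in> m"
    using submodule_add[OF left_module_reg' ms(1)] c(2) sub by auto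
  then show False using ms(2) aR c(1) by (simp add: minus_eq a_assoc l_neg)
qed

text \<open>Otherwise \<open>J \<oplus> R/m\<close> would still have multiplicity free socle.\<close>

lemma dualizing_module_socle:
  assumes m: "max_ideal R m"
  shows "\<exists>j\<in>carrier (dualizing_module R). j \<noteq> \<zero>\<^bsub>dualizing_module R\<^esub> \<and>
    (\<forall>a\<in>m. a \<odot>\<^bsub>dualizing_module R\<^esub> j = \<zero>\<^bsub>dualizing_module R\<^esub>)"
proof (rule ccontr)
  let ?J = "dualizing_module R"
  assume "\<not> ?thesis"
  then have none: "j = \<zero>\<^bsub>?J\<^esub>" if "j \<in> carrier ?J" "\<forall>a\<in>m. a \<odot>\<^bsub>?J\<^esub> j = \<zero>\<^bsub>?J\<^esub>" for j
    using that by blast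
  note J = left_module_dualizing_module
  interpret J: left_module R ?J by (rule J)
  have ms: "submodule m R (reg R)" "\<one> \<notin> m" using m by (auto simp: max_ideal_def)
  \<comment> \<open>\<open>T\<close> is R/m. Each nonzero element generates it, and \<open>m\<close>
    is the only maximal ideal that kills a nonzero element.\<close>
  obtain T :: "('a, 'a) module" and p where T: "left_module R T" "p \<in> mod_hom R (reg R) T"
    "p ` carrier R = carrier T" "\<And>x. x \<in> carrier R \<Longrightarrow> p x = \<zero>\<^bsub>T\<^esub> \<longleftrightarrow> x \<in> m"
    using quotient_module[OF left_module_reg' ms(1)] by (metis reg_simps(1))
  interpret T: left_module R T by (rule T(1))
  have Tmem: "\<exists>r\<in>carrier R. t = p r" if "t \<in> carrier T" for t using that T(3) by blast
  have Tsm: "p (a \<otimes> r) = a \<odot>\<^bsub>T\<^esub> p r" if "a \<in> carrier R" "r \<in> carrier R" for a r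
    using mod_hom_smult[OF T(2), of a r] that by simp
  have simple: "\<exists>c\<in>carrier R. t' = c \<odot>\<^bsub>T\<^esub> t"
    if t: "t \<in> carrier T" "t' \<in> carrier T" "t \<noteq> \<zero>\<^bsub>T\<^esub>" for t t'
  proof -
    obtain r r' where r: "r \<in> carrier R" "t = p r" "r' \<in> carrier R" "t' = p r'" using Tmem t by metis
    then have "r \<notin> m" using T(4) t(3) by blast
    then obtain c where c: "c \<in> carrier R" "\<one> \<ominus> c \<otimes> r \<in> m" using m r unfolding max_ideal_def by blast
    then have "r' \<otimes> (\<one> \<ominus> c \<otimes> r) \<in> m" using submodule_smult[OF left_module_reg' ms(1) r(3)] by simp
    moreover have "r' \<otimes> (\<one> \<ominus> c \<otimes> r) = r' \<ominus>\<^bsub>reg R\<^esub> (r' \<otimes> c) \<otimes> r"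
      using r c(1) by (simp add: a_minus_reg minus_eq r_distr m_assoc r_minus)
    ultimately have "p (r' \<ominus>\<^bsub>reg R\<^esub> (r' \<otimes> c) \<otimes> r) = \<zero>\<^bsub>T\<^esub>"
      using T(4) r c(1) by (simp add: a_minus_reg)
    then have "p r' = p ((r' \<otimes> c) \<otimes> r)"
      using mod_hom_diff[OF left_module_reg' T(1,2), of r' "(r' \<otimes> c) \<otimes> r"] r c(1)
        left_module_diff_eq_zero[OF T(1), of "p r'" "p ((r' \<otimes> c) \<otimes> r)"] mod_hom_closed[OF T(2)] by simp
    then show ?thesis using Tsm[of "r' \<otimes> c" r] r c(1) by (intro bexI[of _ "r' \<otimes> c"]) auto
  qed
  have char: "m' = m" if m': "max_ideal R m'" and t: "t \<in> carrier T" "t \<noteq> \<zero>\<^bsub>T\<^esub>" "\<forall>a\<in>m'. a \<odot>\<^bsub>T\<^esub> t = \<zero>\<^bsub>T\<^esub>" for m' t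
  proof (rule max_ideal_eq[OF m m'], rule subsetI)
    fix a assume a: "a \<in> m'"
    have aR: "a \<in> carrier R" by (rule max_ideal_subset[OF m' a])
    have "p \<one> \<in> carrier T" using mod_hom_closed[OF T(2), of \<one>] by simp
    then obtain c where c: "c \<in> carrier R" "p \<one> = c \<odot>\<^bsub>T\<^esub> t" using simple[OF t(1) _ t(2)] by blast
    have "p a = a \<odot>\<^bsub>T\<^esub> p \<one>" using Tsm[OF aR one_closed] aR by simp
    also have "\<dots> = c \<odot>\<^bsub>T\<^esub> (a \<odot>\<^bsub>T\<^esub> t)"
      using c aR t(1) T.smult_assoc1[of a c t] T.smult_assoc1[of c a t] m_comm[of a c] by simp
    also have "\<dots> = \<zero>\<^bsub>T\<^esub>" using t(3) a c(1) by (simp add: T.smult_zero_r)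
    finally show "a \<in> m" using T(4) aR by blast
  qed
  let ?N = "dsum T ?J"
  note N = dsum_left_module[OF T(1) J]
  have "multfree_socle R ?N"
    unfolding multfree_socle_def
  proof (intro allI impI ballI)
    fix m' x y
    assume m': "max_ideal R m'" and x: "x \<in> carrier ?N" and y: "y \<in> carrier ?N" and nz: "x \<noteq> \<zero>\<^bsub>?N\<^esub>"
      and kx: "\<forall>a\<in>m'. a \<odot>\<^bsub>?N\<^esub> x = \<zero>\<^bsub>?N\<^esub>" and ky: "\<forall>a\<in>m'. a \<odot>\<^bsub>?N\<^esub> y = \<zero>\<^bsub>?N\<^esub>"
    obtain t j s i where xy: "x = (t, j)" "y = (s, i)" by (cases x, cases y)
    have car: "t \<in> carrier T" "j \<in> carrier ?J" "s \<in> carrier T" "i \<in> carrier ?J"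
      using x y xy by (auto simp: dsum_def)
    have k: "\<forall>a\<in>m'. a \<odot>\<^bsub>T\<^esub> t = \<zero>\<^bsub>T\<^esub>" "\<forall>a\<in>m'. a \<odot>\<^bsub>?J\<^esub> j = \<zero>\<^bsub>?J\<^esub>"
      "\<forall>a\<in>m'. a \<odot>\<^bsub>T\<^esub> s = \<zero>\<^bsub>T\<^esub>" "\<forall>a\<in>m'. a \<odot>\<^bsub>?J\<^esub> i = \<zero>\<^bsub>?J\<^esub>"
      using kx ky xy by (auto simp: dsum_def)
    \<comment> \<open>Either both components in \<open>T\<close> vanish and the claim is that for
      \<open>J\<close>; or m' = m, and then both components in \<open>J\<close> vanish, since by
      assumption no nonzero element of \<open>J\<close> is killed by \<open>m\<close>.\<close>
    show "\<exists>c\<in>carrier R. y = c \<odot>\<^bsub>?N\<^esub> x"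
    proof (cases "t = \<zero>\<^bsub>T\<^esub> \<and> s = \<zero>\<^bsub>T\<^esub>")
      case True
      then have "j \<noteq> \<zero>\<^bsub>?J\<^esub>" using nz xy by (auto simp: dsum_def)
      then obtain c where "c \<in> carrier R" "i = c \<odot>\<^bsub>?J\<^esub> j"
        using multfree_socle_dualizing_module m' car k unfolding multfree_socle_def by blast
      then show ?thesis using True xy by (intro bexI[of _ c]) (auto simp: dsum_def T.smult_zero_r)
    next
      case False
      then have "m' = m" using char[OF m'] car k by blast
      then have ji: "j = \<zero>\<^bsub>?J\<^esub>" "i = \<zero>\<^bsub>?J\<^esub>" using none car k by auto
      then have "t \<noteq> \<zero>\<^bsub>T\<^esub>" using nz xy by (auto simp: dsum_def)
      then obtain c where "c \<in> carrier R" "s = c \<odot>\<^bsub>T\<^esub> t" using simple car by blast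
      then show ?thesis using ji xy by (intro bexI[of _ c]) (auto simp: dsum_def J.smult_zero_r)
    qed
  qed
  from dualizing_module_maximal[OF N this]
  have le: "module_length R ?N \<le> module_length R ?J" .
  then have "finite_length_module R ?N"
    using finite_lengthI[OF N] enat_len_carrier[OF finite_length_dualizing_module] by simp
  \<comment> \<open>T \<oplus> J is no longer than \<open>J\<close>, so the inclusion of
    \<open>J\<close> is onto and \<open>T\<close> would be zero, although 1 is not in
    \<open>m\<close>.\<close>
  from inj_length_imp_surj[OF finite_length_dualizing_module this dsum_homs(2)[OF T(1) J] _ le]
  have "(\<lambda>y\<in>carrier ?J. (\<zero>\<^bsub>T\<^esub>, y)) ` carrier ?J = carrier ?N" by (auto simp: inj_on_def)
  moreover have "(p \<one>, \<zero>\<^bsub>?J\<^esub>) \<in> carrier ?N" using mod_hom_closed[OF T(2), of \<one>] by (simp add: dsum_def)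
  ultimately have "p \<one> = \<zero>\<^bsub>T\<^esub>" by auto
  then show False using T(4) ms(2) by blast
qed

text \<open>For \<open>v \<noteq> 0\<close> killed by \<open>m\<close> modulo \<open>mv\<close> and \<open>j \<in> J\<close> killed by \<open>m\<close>, glue \<open>V\<close> and \<open>J\<close> along
  \<open>v \<mapsto> j\<close> and divide by a submodule maximal with zero intersection with \<open>J\<close>. The quotient has
  multiplicity free socle, so it is no longer than \<open>J\<close> and hence equal to \<open>J\<close>.\<close>

lemma dualizing_module_cogenerator:
  fixes V :: "('a, 'm, 'd) module_scheme"
  assumes V: "finite_length_module R V" and v: "v \<in> carrier V" "v \<noteq> \<zero>\<^bsub>V\<^esub>"
  shows "\<exists>f\<in>mod_hom R V (dualizing_module R). f v \<noteq> \<zero>\<^bsub>dualizing_module R\<^esub>"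
proof -
  let ?J = "dualizing_module R"
  note lV = finite_length_left_module[OF V]
  note fJ = finite_length_dualizing_module
  note J = left_module_dualizing_module
  interpret V: left_module R V by (rule lV)
  interpret J: left_module R ?J by (rule J)
  have "submodule {a \<in> carrier (reg R). (\<lambda>a\<in>carrier R. a \<odot>\<^bsub>V\<^esub> v) a = \<zero>\<^bsub>V\<^esub>} R (reg R)"
    by (rule submodule_kernel[OF left_module_reg' lV V.mod_hom_reg[OF v(1)]])
  moreover have "\<one> \<notin> {a \<in> carrier (reg R). (\<lambda>a\<in>carrier R. a \<odot>\<^bsub>V\<^esub> v) a = \<zero>\<^bsub>V\<^esub>}" using v by simp
  \<comment> \<open>\<open>m\<close> contains the annihilator of v, so for j killed by
    \<open>m\<close> the assignment a v \<mapsto> a j is well defined on R v.\<close>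
  ultimately obtain m where m: "max_ideal R m"
    and sub: "{a \<in> carrier (reg R). (\<lambda>a\<in>carrier R. a \<odot>\<^bsub>V\<^esub> v) a = \<zero>\<^bsub>V\<^esub>} \<subseteq> m"
    using max_ideal_exists by blast
  have annv: "a \<in> m" if "a \<in> carrier R" "a \<odot>\<^bsub>V\<^esub> v = \<zero>\<^bsub>V\<^esub>" for a
    by (rule subsetD[OF sub]) (use that in simp)
  obtain j where j: "j \<in> carrier ?J" "j \<noteq> \<zero>\<^bsub>?J\<^esub>" "\<And>a. a \<in> m \<Longrightarrow> a \<odot>\<^bsub>?J\<^esub> j = \<zero>\<^bsub>?J\<^esub>"
    using dualizing_module_socle[OF m] by blast
  let ?D = "dsum V ?J"
  note D = dsum_left_module[OF lV J]
  note fD = finite_length_dsum[OF V fJ]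
  interpret D: left_module R ?D by (rule D)
  have pj: "(v, \<ominus>\<^bsub>?J\<^esub> j) \<in> carrier ?D" using v j(1) by (simp add: dsum_def)
  \<comment> \<open>Dividing by the multiples of (v, -j) identifies v with j. These multiples meet
    \<open>J\<close> in zero: if a v = 0 then a is in \<open>m\<close>, so a j = 0.\<close>
  let ?G = "(\<lambda>a\<in>carrier R. a \<odot>\<^bsub>?D\<^esub> (v, \<ominus>\<^bsub>?J\<^esub> j)) ` carrier R"
  have G: "submodule ?G R ?D"
    using submodule_image[OF left_module_reg' D D.mod_hom_reg[OF pj] submodule_carrier[OF left_module_reg']] by simp
  have neg: "a \<odot>\<^bsub>?J\<^esub> (\<ominus>\<^bsub>?J\<^esub> j) = \<ominus>\<^bsub>?J\<^esub> (a \<odot>\<^bsub>?J\<^esub> j)" if "a \<in> carrier R" for a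
    using mod_hom_minus[OF left_module_reg' J J.mod_hom_reg[OF j(1)], of a] that j(1)
      J.smult_assoc1[of a "\<ominus> \<one>" j] J.smult_assoc1[of "\<ominus> \<one>" a j] m_comm[of a "\<ominus> \<one>"]
    by (simp add: J.smult_minus_one)
  have GJ: "\<forall>i. (\<zero>\<^bsub>V\<^esub>, i) \<in> ?G \<longrightarrow> i = \<zero>\<^bsub>?J\<^esub>"
  proof (intro allI impI)
    fix i assume "(\<zero>\<^bsub>V\<^esub>, i) \<in> ?G"
    then obtain a where a: "a \<in> carrier R" "a \<odot>\<^bsub>V\<^esub> v = \<zero>\<^bsub>V\<^esub>" "i = a \<odot>\<^bsub>?J\<^esub> (\<ominus>\<^bsub>?J\<^esub> j)" by (auto simp: dsum_def)
    have "\<ominus>\<^bsub>?J\<^esub> \<zero>\<^bsub>?J\<^esub> = \<zero>\<^bsub>?J\<^esub>" using J.M.minus_equality[of "\<zero>\<^bsub>?J\<^esub>" "\<zero>\<^bsub>?J\<^esub>"] by simp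
    then show "i = \<zero>\<^bsub>?J\<^esub>" using a neg j(3)[OF annv[OF a(1,2)]] by simp
  qed
  \<comment> \<open>Maximality of \<open>Z\<close> makes the image of \<open>J\<close> an essential
    submodule of the quotient, which is what limits the socle of the quotient.\<close>
  obtain Z where Z: "submodule Z R ?D" and Z': "?G \<subseteq> Z \<and> (\<forall>i. (\<zero>\<^bsub>V\<^esub>, i) \<in> Z \<longrightarrow> i = \<zero>\<^bsub>?J\<^esub>)"
    and max: "\<And>W. submodule W R ?D \<Longrightarrow> ?G \<subseteq> W \<and> (\<forall>i. (\<zero>\<^bsub>V\<^esub>, i) \<in> W \<longrightarrow> i = \<zero>\<^bsub>?J\<^esub>) \<Longrightarrow> Z \<subseteq> W \<Longrightarrow> W = Z"
    by (rule submodule_maximal_exists[OF fD G, of "\<lambda>W. ?G \<subseteq> W \<and> (\<forall>i. (\<zero>\<^bsub>V\<^esub>, i) \<in> W \<longrightarrow> i = \<zero>\<^bsub>?J\<^esub>)",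
          OF conjI[OF subset_refl GJ]]) (rule that)
  note ZG = conjunct1[OF Z'] and ZJ = conjunct2[OF Z', rule_format]
  obtain N :: "('a, 'm \<times> 'a list) module" and p where N: "left_module R N" and p: "p \<in> mod_hom R ?D N"
    "p ` carrier ?D = carrier N" and p0': "\<forall>x\<in>carrier ?D. p x = \<zero>\<^bsub>N\<^esub> \<longleftrightarrow> x \<in> Z"
    using quotient_module[OF D Z] by metis
  note p0 = p0'[rule_format]
  interpret N: left_module R N by (rule N)
  let ?\<iota> = "\<lambda>y\<in>carrier ?J. (\<zero>\<^bsub>V\<^esub>, y)"
  note \<iota> = dsum_homs(2)[OF lV J]
  let ?i = "\<lambda>y\<in>carrier ?J. p (?\<iota> y)"
  have i: "?i \<in> mod_hom R ?J N" by (rule mod_hom_comp[OF J \<iota> p(1)])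
  have inD: "(\<zero>\<^bsub>V\<^esub>, y) \<in> carrier ?D" if "y \<in> carrier ?J" for y using that by (simp add: dsum_def)
  have i0: "y = \<zero>\<^bsub>?J\<^esub>" if "y \<in> carrier ?J" "?i y = \<zero>\<^bsub>N\<^esub>" for y
    using that p0[OF inD[OF that(1)]] ZJ[of y] by simp
  then have inj: "inj_on ?i (carrier ?J)" using mod_hom_inj_iff[OF J N i] by blast
  have essential: "\<exists>c\<in>carrier R. \<exists>y\<in>carrier ?J. y \<noteq> \<zero>\<^bsub>?J\<^esub> \<and> c \<odot>\<^bsub>N\<^esub> x = ?i y"
    if x: "x \<in> carrier N" "x \<noteq> \<zero>\<^bsub>N\<^esub>" for x
  proof -
    obtain d where d: "d \<in> carrier ?D" "x = p d" using x(1) p(2) by blast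
    have dZ: "d \<notin> Z" using p0 d x(2) by blast
    let ?A = "(\<lambda>a\<in>carrier R. a \<odot>\<^bsub>?D\<^esub> d) ` carrier R"
    have A: "submodule ?A R ?D"
      using submodule_image[OF left_module_reg' D D.mod_hom_reg[OF d(1)] submodule_carrier[OF left_module_reg']] by simp
    have "d \<in> ?A" using d(1) by (intro image_eqI[of _ _ \<one>]) auto
    then have "Z <+>\<^bsub>?D\<^esub> ?A \<noteq> Z" using dZ set_add_upper(2)[OF D Z A] by blast
    moreover have "Z \<subseteq> Z <+>\<^bsub>?D\<^esub> ?A" by (rule set_add_upper(1)[OF D Z A])
    ultimately have "\<not> (\<forall>i. (\<zero>\<^bsub>V\<^esub>, i) \<in> Z <+>\<^bsub>?D\<^esub> ?A \<longrightarrow> i = \<zero>\<^bsub>?J\<^esub>)"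
      using max[OF submodule_set_add[OF D Z A]] ZG by blast
    then obtain y where y: "(\<zero>\<^bsub>V\<^esub>, y) \<in> Z <+>\<^bsub>?D\<^esub> ?A" "y \<noteq> \<zero>\<^bsub>?J\<^esub>" by blast
    obtain z a where za: "z \<in> Z" "a \<in> carrier R" "(\<zero>\<^bsub>V\<^esub>, y) = z \<oplus>\<^bsub>?D\<^esub> a \<odot>\<^bsub>?D\<^esub> d"
      using y(1) unfolding set_add_iff by auto
    have zD: "z \<in> carrier ?D" using submodule_subset[OF D Z] za(1) by blast
    have "(\<zero>\<^bsub>V\<^esub>, y) \<in> carrier ?D" using zD za d(1) by simp
    then have yJ: "y \<in> carrier ?J" by (simp add: dsum_def)
    have "?i y = p (z \<oplus>\<^bsub>?D\<^esub> a \<odot>\<^bsub>?D\<^esub> d)" using yJ za(3) by simp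
    also have "\<dots> = a \<odot>\<^bsub>N\<^esub> x"
      using zD za(1,2) d p0[OF zD] x(1) by (simp add: mod_hom_add[OF p(1)] mod_hom_smult[OF p(1)])
    finally show ?thesis using za(2) yJ y(2) by metis
  qed
  \<comment> \<open>By essentiality nonzero multiples c x and d y lie in \<open>J\<close>. Both are
    killed by m', so d y is a multiple of c x there. As d is invertible modulo m', which kills y,
    the element y itself is a multiple of x.\<close>
  have mf: "multfree_socle R N" unfolding multfree_socle_def
  proof (intro allI impI ballI)
    fix m' x y
    assume m': "max_ideal R m'" and x: "x \<in> carrier N" "x \<noteq> \<zero>\<^bsub>N\<^esub>" and y: "y \<in> carrier N"
      and kx: "\<forall>a\<in>m'. a \<odot>\<^bsub>N\<^esub> x = \<zero>\<^bsub>N\<^esub>" and ky: "\<forall>a\<in>m'. a \<odot>\<^bsub>N\<^esub> y = \<zero>\<^bsub>N\<^esub>"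
    have killed: "\<forall>a\<in>m'. a \<odot>\<^bsub>?J\<^esub> w = \<zero>\<^bsub>?J\<^esub>"
      if w: "w \<in> carrier ?J" and c: "c \<in> carrier R" and u: "u \<in> carrier N" "\<forall>a\<in>m'. a \<odot>\<^bsub>N\<^esub> u = \<zero>\<^bsub>N\<^esub>"
        and eq: "c \<odot>\<^bsub>N\<^esub> u = ?i w" for w c u
    proof
      fix a assume a: "a \<in> m'"
      have aR: "a \<in> carrier R" by (rule max_ideal_subset[OF m' a])
      have "?i (a \<odot>\<^bsub>?J\<^esub> w) = a \<odot>\<^bsub>N\<^esub> (c \<odot>\<^bsub>N\<^esub> u)" unfolding mod_hom_smult[OF i aR w] eq ..
      also have "\<dots> = c \<odot>\<^bsub>N\<^esub> (a \<odot>\<^bsub>N\<^esub> u)"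
        using N.smult_assoc1[of a c u] N.smult_assoc1[of c a u] m_comm[of a c] aR c u(1) by simp
      also have "\<dots> = \<zero>\<^bsub>N\<^esub>" using u(2) a c by (simp add: N.smult_zero_r)
      finally show "a \<odot>\<^bsub>?J\<^esub> w = \<zero>\<^bsub>?J\<^esub>" using i0[of "a \<odot>\<^bsub>?J\<^esub> w"] aR w by blast
    qed
    show "\<exists>c\<in>carrier R. y = c \<odot>\<^bsub>N\<^esub> x"
    proof (cases "y = \<zero>\<^bsub>N\<^esub>")
      case True
      then show ?thesis using x(1) by (intro bexI[of _ \<zero>]) (auto simp: N.smult_zero_l)
    next
      case False
      obtain c w where c: "c \<in> carrier R" "w \<in> carrier ?J" "w \<noteq> \<zero>\<^bsub>?J\<^esub>" "c \<odot>\<^bsub>N\<^esub> x = ?i w"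
        using essential[OF x] by blast
      obtain d u where d: "d \<in> carrier R" "u \<in> carrier ?J" "u \<noteq> \<zero>\<^bsub>?J\<^esub>" "d \<odot>\<^bsub>N\<^esub> y = ?i u"
        using essential[OF y False] by blast
      obtain e where e: "e \<in> carrier R" "u = e \<odot>\<^bsub>?J\<^esub> w"
        using multfree_socle_dualizing_module m' c(2,3) d(2) killed[OF c(2,1) x(1) kx c(4)]
          killed[OF d(2,1) y ky d(4)] unfolding multfree_socle_def by blast
      have "d \<notin> m'"
      proof
        assume "d \<in> m'"
        then have "?i u = \<zero>\<^bsub>N\<^esub>" using ky d(4) by simp
        then show False using i0[OF d(2)] d(3) by blast
      qed
      then obtain f where f: "f \<in> carrier R" "\<one> \<ominus> f \<otimes> d \<in> m'" using m' d(1) unfolding max_ideal_def by blast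
      have "\<zero>\<^bsub>N\<^esub> = (\<one> \<ominus> f \<otimes> d) \<odot>\<^bsub>N\<^esub> y" using ky f(2) by simp
      then have "(f \<otimes> d) \<odot>\<^bsub>N\<^esub> y = (\<one> \<ominus> f \<otimes> d) \<odot>\<^bsub>N\<^esub> y \<oplus>\<^bsub>N\<^esub> (f \<otimes> d) \<odot>\<^bsub>N\<^esub> y" using f(1) d(1) y by simp
      also have "\<dots> = ((\<one> \<ominus> f \<otimes> d) \<oplus> f \<otimes> d) \<odot>\<^bsub>N\<^esub> y"
        using f(1) d(1) y by (simp add: N.smult_l_distr)
      also have "(\<one> \<ominus> f \<otimes> d) \<oplus> f \<otimes> d = \<one>" using f(1) d(1) by (simp add: minus_eq a_assoc l_neg)
      finally have "y = f \<odot>\<^bsub>N\<^esub> (d \<odot>\<^bsub>N\<^esub> y)" using y f(1) d(1) by (simp add: N.smult_assoc1)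
      also have "d \<odot>\<^bsub>N\<^esub> y = e \<odot>\<^bsub>N\<^esub> (c \<odot>\<^bsub>N\<^esub> x)" unfolding d(4) c(4) e(2) mod_hom_smult[OF i e(1) c(2)] ..
      finally have "y = (f \<otimes> (e \<otimes> c)) \<odot>\<^bsub>N\<^esub> x" using f(1) e(1) c(1) x(1) by (simp add: N.smult_assoc1)
      then show ?thesis using f(1) e(1) c(1) by (intro bexI[of _ "f \<otimes> (e \<otimes> c)"]) auto
    qed
  qed
  have "?i ` carrier ?J = carrier N"
    by (rule inj_length_imp_surj[OF fJ finite_length_surj[OF fD N p] i inj dualizing_module_maximal[OF N mf]])
  then have "bij_betw ?i (carrier ?J) (carrier N)" using inj by (simp add: bij_betw_def)
  from mod_hom_inverse[OF J N i this] obtain g where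
    g: "g \<in> mod_hom R N ?J" "\<And>y. y \<in> carrier ?J \<Longrightarrow> g (?i y) = y" by blast
  \<comment> \<open>The composite V \<rightarrow> V \<oplus> J \<rightarrow> N followed by the
    inverse of J \<rightarrow> N. It sends v to j, because v and j are identified in N.\<close>
  let ?f = "\<lambda>w\<in>carrier V. g ((\<lambda>w\<in>carrier V. p ((\<lambda>x\<in>carrier V. (x, \<zero>\<^bsub>?J\<^esub>)) w)) w)"
  have f: "?f \<in> mod_hom R V ?J"
    by (rule mod_hom_comp[OF lV mod_hom_comp[OF lV dsum_homs(1)[OF lV J] p(1)] g(1)])
  have "p (v, \<zero>\<^bsub>?J\<^esub>) = p (\<zero>\<^bsub>V\<^esub>, j)"
  proof -
    have "(v, \<ominus>\<^bsub>?J\<^esub> j) \<in> ?G" using pj by (intro image_eqI[of _ _ \<one>]) auto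
    then have z: "p (v, \<ominus>\<^bsub>?J\<^esub> j) = \<zero>\<^bsub>N\<^esub>" using ZG p0[OF pj] by blast
    have "(v, \<zero>\<^bsub>?J\<^esub>) = (v, \<ominus>\<^bsub>?J\<^esub> j) \<oplus>\<^bsub>?D\<^esub> (\<zero>\<^bsub>V\<^esub>, j)" using v(1) j(1) by (simp add: dsum_def J.M.l_neg)
    then have "p (v, \<zero>\<^bsub>?J\<^esub>) = p (v, \<ominus>\<^bsub>?J\<^esub> j) \<oplus>\<^bsub>N\<^esub> p (\<zero>\<^bsub>V\<^esub>, j)"
      using mod_hom_add[OF p(1) pj inD[OF j(1)]] by simp
    then show ?thesis using z mod_hom_closed[OF p(1) inD[OF j(1)]] by simp
  qed
  then have "?f v = g (?i j)" using v(1) j(1) by simp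
  then have "?f v \<noteq> \<zero>\<^bsub>?J\<^esub>" unfolding g(2)[OF j(1)] using j(2) by blast
  then show ?thesis using f by blast
qed

text \<open>Evaluation from \<open>V\<close> to its double dual is injective by the cogenerator
  property, and two applications of \<open>module_length_dual\<close> show that the double dual is
  no longer than \<open>V\<close>. Hence evaluation is onto.\<close>

lemma dualizing_module_reflexive:
  assumes V: "finite_length_module R V" and F: "F \<in> mod_hom R (dual R (dualizing_module R) V) (dualizing_module R)"
  shows "\<exists>v\<in>carrier V. \<forall>f\<in>mod_hom R V (dualizing_module R). F f = f v"
proof -
  let ?J = "dualizing_module R"
  note lV = finite_length_left_module[OF V]
  note J = left_module_dualizing_module
  interpret V: left_module R V by (rule lV)
  let ?D = "dual R ?J V"
  let ?DD = "dual R ?J ?D"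
  note D = left_module_dual[OF lV J]
  note DD = left_module_dual[OF D J]
  let ?ev = "\<lambda>v\<in>carrier V. \<lambda>f\<in>carrier ?D. f v"
  have ev: "?ev \<in> mod_hom R V ?DD"
  proof (rule mod_hom_restrictI[OF lV])
    show "(\<lambda>f\<in>carrier ?D. f v) \<in> carrier ?DD" if "v \<in> carrier V" for v
      using mod_hom_eval[OF lV J that] by simp
    show "(\<lambda>f\<in>carrier ?D. f (v \<oplus>\<^bsub>V\<^esub> w)) = (\<lambda>f\<in>carrier ?D. f v) \<oplus>\<^bsub>?DD\<^esub> (\<lambda>f\<in>carrier ?D. f w)"
      if "v \<in> carrier V" "w \<in> carrier V" for v w
      using that by (auto simp: mod_hom_add[of _ R V ?J] cong: restrict_cong)
    show "(\<lambda>f\<in>carrier ?D. f (a \<odot>\<^bsub>V\<^esub> v)) = a \<odot>\<^bsub>?DD\<^esub> (\<lambda>f\<in>carrier ?D. f v)"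
      if "a \<in> carrier R" "v \<in> carrier V" for a v
      using that by (auto simp: mod_hom_smult[of _ R V ?J] cong: restrict_cong)
  qed
  have "inj_on ?ev (carrier V)" unfolding mod_hom_inj_iff[OF lV DD ev]
  proof (intro ballI impI)
    fix v assume v: "v \<in> carrier V" and e: "?ev v = \<zero>\<^bsub>?DD\<^esub>"
    have "f v = \<zero>\<^bsub>?J\<^esub>" if "f \<in> mod_hom R V ?J" for f
      using fun_cong[OF e, of f] that v by simp
    then show "v = \<zero>\<^bsub>V\<^esub>" using dualizing_module_cogenerator[OF V v] by blast
  qed
  note l = module_length_dual[OF V J multfree_socle_dualizing_module]
  have fD: "finite_length_module R ?D"
    using l enat_len_carrier[OF V] by (intro finite_lengthI[OF D]) simp
  note l' = order_trans[OF module_length_dual[OF fD J multfree_socle_dualizing_module] l]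
  have fDD: "finite_length_module R ?DD"
    using l' enat_len_carrier[OF V] by (intro finite_lengthI[OF DD]) simp
  from inj_length_imp_surj[OF V fDD ev \<open>inj_on ?ev (carrier V)\<close> l']
  have "F \<in> ?ev ` carrier V" using F by simp
  then obtain v where "v \<in> carrier V" "F = (\<lambda>f\<in>carrier ?D. f v)" by auto
  then show ?thesis by (intro bexI[of _ v]) auto
qed

end

section \<open>The dual of the regular bimodule\<close>

text \<open>\<open>C\<close> is the left module \<open>D(\<Lambda>\<^sub>\<Lambda>)\<close> and \<open>\<rho>\<close> its right \<open>\<Lambda>\<close>-action.\<close>

locale algebra_dual = artin_algebra k \<Lambda>
  for k :: "('k, 'c) ring_scheme" (structure) and \<Lambda> :: "('k, 'a, 'd) module_scheme" (structure) +
  fixes C :: "'a lmod" and \<rho> :: "'a \<Rightarrow> 'a list \<Rightarrow> 'a list"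
  assumes C_finite_length: "finite_length_module \<Lambda> C"
    and C_cogenerator: "\<lbrakk>finite_length_module \<Lambda> (X :: 'a lmod); x \<in> carrier X; x \<noteq> \<zero>\<^bsub>X\<^esub>\<rbrakk> \<Longrightarrow>
      \<exists>h\<in>mod_hom \<Lambda> X C. h x \<noteq> \<zero>\<^bsub>C\<^esub>"
    and \<rho>_hom: "l \<in> carrier \<Lambda> \<Longrightarrow> \<rho> l \<in> mod_hom \<Lambda> C C"
    and \<rho>_add: "\<lbrakk>l \<in> carrier \<Lambda>; m \<in> carrier \<Lambda>; c \<in> carrier C\<rbrakk> \<Longrightarrow> \<rho> (l \<oplus>\<^bsub>\<Lambda>\<^esub> m) c = \<rho> l c \<oplus>\<^bsub>C\<^esub> \<rho> m c"
    and \<rho>_mult: "\<lbrakk>l \<in> carrier \<Lambda>; m \<in> carrier \<Lambda>; c \<in> carrier C\<rbrakk> \<Longrightarrow> \<rho> (l \<otimes>\<^bsub>\<Lambda>\<^esub> m) c = \<rho> m (\<rho> l c)"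
    and \<rho>_one: "c \<in> carrier C \<Longrightarrow> \<rho> \<one>\<^bsub>\<Lambda>\<^esub> c = c"
    and \<rho>_scalar: "\<lbrakk>a \<in> carrier k; c \<in> carrier C\<rbrakk> \<Longrightarrow> \<rho> (a \<odot>\<^bsub>\<Lambda>\<^esub> \<one>\<^bsub>\<Lambda>\<^esub>) c = (a \<odot>\<^bsub>\<Lambda>\<^esub> \<one>\<^bsub>\<Lambda>\<^esub>) \<odot>\<^bsub>C\<^esub> c"
    and \<rho>_surj: "h \<in> mod_hom \<Lambda> C C \<Longrightarrow> \<exists>l\<in>carrier \<Lambda>. h = \<rho> l"
    and \<rho>_inj: "\<lbrakk>l \<in> carrier \<Lambda>; \<And>c. c \<in> carrier C \<Longrightarrow> \<rho> l c = \<zero>\<^bsub>C\<^esub>\<rbrakk> \<Longrightarrow> l = \<zero>\<^bsub>\<Lambda>\<^esub>"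

text \<open>\<open>D\<close> is Hom(\<Lambda>, J) over the base ring with (l f)(x) = f(x l), and the
  right action is (f l)(x) = f(l x). It is a cogenerator because \<open>J\<close> is one, by
  adjunction; its endomorphisms come from \<Lambda> by reflexivity of \<Lambda> over the base ring.
  In the end everything is moved to a copy \<open>C\<close> on lists.\<close>

lemma (in artin_algebra) algebra_dual_exists: "\<exists>C \<rho>. algebra_dual k \<Lambda> C \<rho>"
proof -
  let ?V = "kmod \<Lambda> (reg \<Lambda>)" and ?J = "dualizing_module k"
  note R = left_module_reg_algebra
  note V = left_module_kmod[OF R]
  note J = left_module_dualizing_module
  interpret V: left_module k ?V by (rule V)
  interpret J: left_module k ?J by (rule J)
  define D :: "('a, _) module" where "D = hom_mod k ?V ?J (\<lambda>l f. \<lambda>x\<in>carrier \<Lambda>. f (x \<otimes>\<^bsub>\<Lambda>\<^esub> l))"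
  have D_simps: "carrier D = mod_hom k ?V ?J" "\<zero>\<^bsub>D\<^esub> = (\<lambda>x\<in>carrier \<Lambda>. \<zero>\<^bsub>?J\<^esub>)"
    "\<And>f g. f \<oplus>\<^bsub>D\<^esub> g = (\<lambda>x\<in>carrier \<Lambda>. f x \<oplus>\<^bsub>?J\<^esub> g x)"
    "\<And>l f. l \<odot>\<^bsub>D\<^esub> f = (\<lambda>x\<in>carrier \<Lambda>. f (x \<otimes>\<^bsub>\<Lambda>\<^esub> l))"
    unfolding D_def by (simp_all only: hom_mod_simps kmod_simps reg_simps)
  have Vadd: "f (x \<oplus>\<^bsub>\<Lambda>\<^esub> y) = f x \<oplus>\<^bsub>?J\<^esub> f y"
    if "f \<in> mod_hom k ?V ?J" "x \<in> carrier \<Lambda>" "y \<in> carrier \<Lambda>" for f x y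
    using mod_hom_add[OF that(1), of x y] that by simp
  have Vsm: "f (a \<odot>\<^bsub>\<Lambda>\<^esub> x) = a \<odot>\<^bsub>?J\<^esub> f x"
    if "f \<in> mod_hom k ?V ?J" "a \<in> carrier k" "x \<in> carrier \<Lambda>" for f x a
    using mod_hom_smult[OF that(1), of a x] that by (simp add: unit_smult_mult)
  have Vc: "f x \<in> carrier ?J" if "f \<in> mod_hom k ?V ?J" "x \<in> carrier \<Lambda>" for f x
    using mod_hom_closed[OF that(1), of x] that by simp
  have VI: "(\<lambda>x\<in>carrier \<Lambda>. t x) \<in> mod_hom k ?V ?J"
    if "\<And>x. x \<in> carrier \<Lambda> \<Longrightarrow> t x \<in> carrier ?J"
      "\<And>x y. x \<in> carrier \<Lambda> \<Longrightarrow> y \<in> carrier \<Lambda> \<Longrightarrow> t (x \<oplus>\<^bsub>\<Lambda>\<^esub> y) = t x \<oplus>\<^bsub>?J\<^esub> t y"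
      "\<And>a x. a \<in> carrier k \<Longrightarrow> x \<in> carrier \<Lambda> \<Longrightarrow> t (a \<odot>\<^bsub>\<Lambda>\<^esub> x) = a \<odot>\<^bsub>?J\<^esub> t x" for t
    using mod_hom_restrictI[OF V, of t ?J] that by (simp add: unit_smult_mult)
  have right: "(\<lambda>x\<in>carrier \<Lambda>. f (x \<otimes>\<^bsub>\<Lambda>\<^esub> l)) \<in> mod_hom k ?V ?J"
    if "l \<in> carrier \<Lambda>" "f \<in> mod_hom k ?V ?J" for l f
    by (rule VI) (use that Vc in \<open>simp_all add: \<Lambda>.l_distr Vadd smult_mult_left Vsm\<close>)
  have left: "(\<lambda>x\<in>carrier \<Lambda>. f (l \<otimes>\<^bsub>\<Lambda>\<^esub> x)) \<in> mod_hom k ?V ?J"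
    if "l \<in> carrier \<Lambda>" "f \<in> mod_hom k ?V ?J" for l f
    by (rule VI) (use that Vc in \<open>simp_all add: \<Lambda>.r_distr Vadd smult_mult_right Vsm\<close>)
  have lD: "left_module \<Lambda> D" unfolding D_def
  proof (intro left_module_hom_mod V J \<Lambda>.ring_axioms)
    show "(\<lambda>x\<in>carrier \<Lambda>. f (x \<otimes>\<^bsub>\<Lambda>\<^esub> l)) \<in> mod_hom k ?V ?J" if "l \<in> carrier \<Lambda>" "f \<in> mod_hom k ?V ?J" for l f
      by (rule right[OF that])
  qed (simp_all add: Vadd \<Lambda>.r_distr \<Lambda>.m_assoc)
  interpret D: left_module \<Lambda> D by (rule lD)
  have ldual: "left_module k (dual k ?J ?V)" by (rule left_module_dual[OF V J])
  have fdual: "module_length k (dual k ?J ?V) \<le> module_length k ?V"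
    by (rule module_length_dual[OF finite_length_kmod_reg J multfree_socle_dualizing_module])
  have "module_length \<Lambda> D \<le> module_length k (dual k ?J ?V)"
  proof (rule module_length_restrict)
    fix U assume U: "submodule U \<Lambda> D"
    note u = submodule_subset[OF lD U] submodule_zero[OF lD U] submodule_add[OF lD U] submodule_smult[OF lD U]
    show "submodule U k (dual k ?J ?V)"
    proof (rule left_module_submoduleI[OF ldual])
      show "U \<subseteq> carrier (dual k ?J ?V)" using u(1) by (simp add: D_simps)
      show "\<zero>\<^bsub>dual k ?J ?V\<^esub> \<in> U" using u(2) by (simp add: D_simps)
      show "f \<oplus>\<^bsub>dual k ?J ?V\<^esub> g \<in> U" if "f \<in> U" "g \<in> U" for f g
        using u(3)[OF that] by (simp add: D_simps)
      show "a \<odot>\<^bsub>dual k ?J ?V\<^esub> f \<in> U" if a: "a \<in> carrier k" and f: "f \<in> U" for a f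
      proof -
        have fh: "f \<in> mod_hom k ?V ?J" using u(1) f by (auto simp: D_simps)
        have "a \<odot>\<^bsub>dual k ?J ?V\<^esub> f = (a \<odot>\<^bsub>\<Lambda>\<^esub> \<one>\<^bsub>\<Lambda>\<^esub>) \<odot>\<^bsub>D\<^esub> f"
          unfolding D_simps dual_simps using a by (auto simp: unit_smult_mult Vsm[OF fh] cong: restrict_cong)
        then show ?thesis using u(4)[OF unit_smult_closed[OF a] f] by simp
      qed
    qed
  qed
  with fdual have "module_length \<Lambda> D \<le> module_length k ?V" by (rule order_trans[rotated])
  then have fD: "finite_length_module \<Lambda> D"
    using enat_len_carrier[OF finite_length_kmod_reg] by (intro finite_lengthI[OF lD]) simp
  have cogen: "\<exists>h\<in>mod_hom \<Lambda> X D. h x \<noteq> \<zero>\<^bsub>D\<^esub>"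
    if X: "finite_length_module \<Lambda> X" and x: "x \<in> carrier X" "x \<noteq> \<zero>\<^bsub>X\<^esub>" for X :: "'a lmod" and x
  proof -
    note lX = finite_length_left_module[OF X]
    interpret X: left_module \<Lambda> X by (rule lX)
    obtain f where f: "f \<in> mod_hom k (kmod \<Lambda> X) ?J" "f x \<noteq> \<zero>\<^bsub>?J\<^esub>"
      using dualizing_module_cogenerator[of "kmod \<Lambda> X" x] finite_length_kmod_iff[OF lX] X x by auto
    have fa: "f (y \<oplus>\<^bsub>X\<^esub> z) = f y \<oplus>\<^bsub>?J\<^esub> f z" if "y \<in> carrier X" "z \<in> carrier X" for y z
      using mod_hom_add[OF f(1), of y z] that by simp
    have fs: "f ((a \<odot>\<^bsub>\<Lambda>\<^esub> \<one>\<^bsub>\<Lambda>\<^esub>) \<odot>\<^bsub>X\<^esub> y) = a \<odot>\<^bsub>?J\<^esub> f y" if "y \<in> carrier X" "a \<in> carrier k" for y a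
      using mod_hom_smult[OF f(1), of a y] that by simp
    have fc: "f y \<in> carrier ?J" if "y \<in> carrier X" for y using mod_hom_closed[OF f(1), of y] that by simp
    \<comment> \<open>The adjoint of f. Evaluating its values at 1 gives back f, so it does not kill
      x.\<close>
    let ?h = "\<lambda>y\<in>carrier X. \<lambda>l\<in>carrier \<Lambda>. f (l \<odot>\<^bsub>X\<^esub> y)"
    have eta: "a \<odot>\<^bsub>\<Lambda>\<^esub> l = (a \<odot>\<^bsub>\<Lambda>\<^esub> \<one>\<^bsub>\<Lambda>\<^esub>) \<otimes>\<^bsub>\<Lambda>\<^esub> l" if "a \<in> carrier k" "l \<in> carrier \<Lambda>" for a l
      using that by (simp add: unit_smult_mult)
    have sm: "(a \<odot>\<^bsub>\<Lambda>\<^esub> l) \<odot>\<^bsub>X\<^esub> y = (a \<odot>\<^bsub>\<Lambda>\<^esub> \<one>\<^bsub>\<Lambda>\<^esub>) \<odot>\<^bsub>X\<^esub> (l \<odot>\<^bsub>X\<^esub> y)"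
      if "a \<in> carrier k" "l \<in> carrier \<Lambda>" "y \<in> carrier X" for a l y
      using X.smult_assoc1[of "a \<odot>\<^bsub>\<Lambda>\<^esub> \<one>\<^bsub>\<Lambda>\<^esub>" l y] that unfolding eta[OF that(1,2)] by blast
    have "?h \<in> mod_hom \<Lambda> X D"
    proof (rule mod_hom_restrictI[OF lX])
      show "(\<lambda>l\<in>carrier \<Lambda>. f (l \<odot>\<^bsub>X\<^esub> y)) \<in> carrier D" if "y \<in> carrier X" for y
        unfolding D_simps
      proof (rule VI)
        show "f (l \<odot>\<^bsub>X\<^esub> y) \<in> carrier ?J" if "l \<in> carrier \<Lambda>" for l
          using fc[OF X.smult_closed[OF that \<open>y \<in> carrier X\<close>]] .
        show "f ((l \<oplus>\<^bsub>\<Lambda>\<^esub> m) \<odot>\<^bsub>X\<^esub> y) = f (l \<odot>\<^bsub>X\<^esub> y) \<oplus>\<^bsub>?J\<^esub> f (m \<odot>\<^bsub>X\<^esub> y)"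
          if "l \<in> carrier \<Lambda>" "m \<in> carrier \<Lambda>" for l m
          using that \<open>y \<in> carrier X\<close> by (simp add: X.smult_l_distr fa)
        show "f ((a \<odot>\<^bsub>\<Lambda>\<^esub> l) \<odot>\<^bsub>X\<^esub> y) = a \<odot>\<^bsub>?J\<^esub> f (l \<odot>\<^bsub>X\<^esub> y)"
          if "a \<in> carrier k" "l \<in> carrier \<Lambda>" for a l
          unfolding sm[OF that \<open>y \<in> carrier X\<close>] by (rule fs[OF X.smult_closed[OF that(2) \<open>y \<in> carrier X\<close>] that(1)])
      qed
      show "(\<lambda>l\<in>carrier \<Lambda>. f (l \<odot>\<^bsub>X\<^esub> (y \<oplus>\<^bsub>X\<^esub> z))) =
          (\<lambda>l\<in>carrier \<Lambda>. f (l \<odot>\<^bsub>X\<^esub> y)) \<oplus>\<^bsub>D\<^esub> (\<lambda>l\<in>carrier \<Lambda>. f (l \<odot>\<^bsub>X\<^esub> z))"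
        if "y \<in> carrier X" "z \<in> carrier X" for y z
        unfolding D_simps using that by (auto simp: X.smult_r_distr fa cong: restrict_cong)
      show "(\<lambda>l\<in>carrier \<Lambda>. f (l \<odot>\<^bsub>X\<^esub> (m \<odot>\<^bsub>X\<^esub> y))) = m \<odot>\<^bsub>D\<^esub> (\<lambda>l\<in>carrier \<Lambda>. f (l \<odot>\<^bsub>X\<^esub> y))"
        if "m \<in> carrier \<Lambda>" "y \<in> carrier X" for m y
        unfolding D_simps using that by (auto simp: X.smult_assoc1 cong: restrict_cong)
    qed
    moreover have "?h x \<noteq> \<zero>\<^bsub>D\<^esub>"
    proof
      assume "?h x = \<zero>\<^bsub>D\<^esub>"
      then have "?h x \<one>\<^bsub>\<Lambda>\<^esub> = \<zero>\<^bsub>D\<^esub> \<one>\<^bsub>\<Lambda>\<^esub>" by simp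
      then show False using x f(2) by (simp add: D_simps)
    qed
    ultimately show ?thesis by blast
  qed
  define r where "r l f = (\<lambda>x\<in>carrier \<Lambda>. f (l \<otimes>\<^bsub>\<Lambda>\<^esub> x))" for l and f :: "'a \<Rightarrow> 'k list"
  have r_closed: "r l f \<in> carrier D" if "l \<in> carrier \<Lambda>" "f \<in> carrier D" for l f
    using left that by (simp add: r_def D_simps)
  have r_add: "r l (f \<oplus>\<^bsub>D\<^esub> g) = r l f \<oplus>\<^bsub>D\<^esub> r l g" if "l \<in> carrier \<Lambda>" for l f g
    using that unfolding D_simps by (auto simp: r_def cong: restrict_cong)
  have r_smult: "r l (m \<odot>\<^bsub>D\<^esub> f) = m \<odot>\<^bsub>D\<^esub> r l f" if "l \<in> carrier \<Lambda>" "m \<in> carrier \<Lambda>" for l m f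
    using that unfolding D_simps by (auto simp: r_def \<Lambda>.m_assoc cong: restrict_cong)
  have r_surj: "\<exists>l\<in>carrier \<Lambda>. \<forall>f\<in>carrier D. F f = r l f" if F: "F \<in> mod_hom \<Lambda> D D" for F
  proof -
    have Fc: "F f \<in> mod_hom k ?V ?J" if "f \<in> mod_hom k ?V ?J" for f
      using mod_hom_closed[OF F, of f] that by (simp add: D_simps)
    \<comment> \<open>The functional f \<mapsto> (F f)(1) on the dual of \<Lambda> is evaluation at
      some l by reflexivity. Linearity of F then gives (F f)(x) = (x F f)(1) = (F (x f))(1) = (x
      f)(l) = f(l x).\<close>
    have "(\<lambda>f\<in>carrier (dual k ?J ?V). F f \<one>\<^bsub>\<Lambda>\<^esub>) \<in> mod_hom k (dual k ?J ?V) ?J"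
    proof (rule mod_hom_restrictI[OF ldual])
      show "F f \<one>\<^bsub>\<Lambda>\<^esub> \<in> carrier ?J" if "f \<in> carrier (dual k ?J ?V)" for f
        using Vc[OF Fc, of f "\<one>\<^bsub>\<Lambda>\<^esub>"] that by simp
      show "F (f \<oplus>\<^bsub>dual k ?J ?V\<^esub> g) \<one>\<^bsub>\<Lambda>\<^esub> = F f \<one>\<^bsub>\<Lambda>\<^esub> \<oplus>\<^bsub>?J\<^esub> F g \<one>\<^bsub>\<Lambda>\<^esub>"
        if "f \<in> carrier (dual k ?J ?V)" "g \<in> carrier (dual k ?J ?V)" for f g
        using mod_hom_add[OF F, of f g] that by (simp add: D_simps)
      show "F (a \<odot>\<^bsub>dual k ?J ?V\<^esub> f) \<one>\<^bsub>\<Lambda>\<^esub> = a \<odot>\<^bsub>?J\<^esub> F f \<one>\<^bsub>\<Lambda>\<^esub>"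
        if a: "a \<in> carrier k" and f: "f \<in> carrier (dual k ?J ?V)" for a f
      proof -
        have fh: "f \<in> mod_hom k ?V ?J" using f by simp
        have "a \<odot>\<^bsub>dual k ?J ?V\<^esub> f = (a \<odot>\<^bsub>\<Lambda>\<^esub> \<one>\<^bsub>\<Lambda>\<^esub>) \<odot>\<^bsub>D\<^esub> f"
          unfolding D_simps dual_simps using a by (auto simp: unit_smult_mult Vsm[OF fh] cong: restrict_cong)
        then have "F (a \<odot>\<^bsub>dual k ?J ?V\<^esub> f) = (a \<odot>\<^bsub>\<Lambda>\<^esub> \<one>\<^bsub>\<Lambda>\<^esub>) \<odot>\<^bsub>D\<^esub> F f"
          using mod_hom_smult[OF F unit_smult_closed[OF a]] f by (simp add: D_simps(1))
        then show ?thesis using a by (simp add: D_simps(4) unit_smult_mult Vsm[OF Fc[OF fh]])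
      qed
    qed
    from dualizing_module_reflexive[OF finite_length_kmod_reg this]
    obtain l where l: "l \<in> carrier \<Lambda>" "\<forall>f\<in>mod_hom k ?V ?J. F f \<one>\<^bsub>\<Lambda>\<^esub> = f l" by auto
    have "F f = r l f" if f: "f \<in> carrier D" for f
    proof (rule mod_hom_eqI[of _ k ?V ?J _ ?J])
      show "F f \<in> mod_hom k ?V ?J" "r l f \<in> mod_hom k ?V ?J"
        using Fc f r_closed[OF l(1) f] by (simp_all add: D_simps)
      fix x assume "x \<in> carrier ?V"
      then have x: "x \<in> carrier \<Lambda>" by simp
      have "F f x = (x \<odot>\<^bsub>D\<^esub> F f) \<one>\<^bsub>\<Lambda>\<^esub>" using x by (simp add: D_simps)
      also have "\<dots> = F (x \<odot>\<^bsub>D\<^esub> f) \<one>\<^bsub>\<Lambda>\<^esub>" using mod_hom_smult[OF F x f] by simp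
      also have "\<dots> = (x \<odot>\<^bsub>D\<^esub> f) l" using l(2) D.smult_closed[OF x f] by (simp only: D_simps(1))
      also have "\<dots> = r l f x" using x l(1) by (simp add: D_simps r_def)
      finally show "F f x = r l f x" .
    qed
    then show ?thesis using l(1) by blast
  qed
  from finite_length_module_on_lists[OF fD] obtain C :: "'a lmod" and e where
    C: "finite_length_module \<Lambda> C" "e \<in> mod_hom \<Lambda> D C" "bij_betw e (carrier D) (carrier C)"
    unfolding mod_iso_def by blast
  note lC = finite_length_left_module[OF C(1)]
  interpret C: left_module \<Lambda> C by (rule lC)
  obtain g where g: "g \<in> mod_hom \<Lambda> C D" "\<And>f. f \<in> carrier D \<Longrightarrow> g (e f) = f" "\<And>c. c \<in> carrier C \<Longrightarrow> e (g c) = c"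
    using mod_hom_inverse[OF lD lC C(2,3)] by blast
  note gc = mod_hom_closed[OF g(1)] and ec = mod_hom_closed[OF C(2)]
  have e0: "f = \<zero>\<^bsub>D\<^esub>" if "f \<in> carrier D" "e f = \<zero>\<^bsub>C\<^esub>" for f
    using g(2)[OF that(1)] that(2) mod_hom_zero[OF lC lD g(1)] by simp
  define \<rho> where "\<rho> l = (\<lambda>c\<in>carrier C. e (r l (g c)))" for l
  have "algebra_dual k \<Lambda> C \<rho>"
  proof (intro algebra_dual.intro algebra_dual_axioms.intro artin_algebra_axioms C(1))
    show "\<exists>h\<in>mod_hom \<Lambda> X C. h x \<noteq> \<zero>\<^bsub>C\<^esub>"
      if X: "finite_length_module \<Lambda> X" and x: "x \<in> carrier X" "x \<noteq> \<zero>\<^bsub>X\<^esub>" for X :: "'a lmod" and x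
    proof -
      obtain h where h: "h \<in> mod_hom \<Lambda> X D" "h x \<noteq> \<zero>\<^bsub>D\<^esub>" using cogen[OF X x] by blast
      have "(\<lambda>y\<in>carrier X. e (h y)) \<in> mod_hom \<Lambda> X C"
        by (rule mod_hom_comp[OF finite_length_left_module[OF X] h(1) C(2)])
      moreover have "e (h x) \<noteq> \<zero>\<^bsub>C\<^esub>" using e0[OF mod_hom_closed[OF h(1) x(1)]] h(2) by blast
      ultimately show ?thesis using x(1) by (intro bexI[of _ "\<lambda>y\<in>carrier X. e (h y)"]) auto
    qed
    show "\<rho> l \<in> mod_hom \<Lambda> C C" if l: "l \<in> carrier \<Lambda>" for l
      unfolding \<rho>_def
      by (rule mod_hom_restrictI[OF lC])
        (use l gc r_closed[OF l] ec in \<open>simp_all add: mod_hom_add[OF g(1)] mod_hom_smult[OF g(1)] r_add r_smult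
          mod_hom_add[OF C(2)] mod_hom_smult[OF C(2)]\<close>)
    show "\<rho> (l \<oplus>\<^bsub>\<Lambda>\<^esub> m) c = \<rho> l c \<oplus>\<^bsub>C\<^esub> \<rho> m c"
      if l: "l \<in> carrier \<Lambda>" and m: "m \<in> carrier \<Lambda>" and c: "c \<in> carrier C" for l m c
    proof -
      have h: "g c \<in> mod_hom k ?V ?J" using gc[OF c] by (simp add: D_simps)
      have "r (l \<oplus>\<^bsub>\<Lambda>\<^esub> m) (g c) = r l (g c) \<oplus>\<^bsub>D\<^esub> r m (g c)"
        using l m by (auto simp: r_def D_simps(3) \<Lambda>.l_distr Vadd[OF h] cong: restrict_cong)
      then show ?thesis
        using c mod_hom_add[OF C(2) r_closed[OF l gc[OF c]] r_closed[OF m gc[OF c]]] by (simp add: \<rho>_def)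
    qed
    show "\<rho> (l \<otimes>\<^bsub>\<Lambda>\<^esub> m) c = \<rho> m (\<rho> l c)"
      if l: "l \<in> carrier \<Lambda>" and m: "m \<in> carrier \<Lambda>" and c: "c \<in> carrier C" for l m c
    proof -
      have "r (l \<otimes>\<^bsub>\<Lambda>\<^esub> m) (g c) = r m (r l (g c))"
        using l m by (auto simp: r_def \<Lambda>.m_assoc cong: restrict_cong)
      then show ?thesis using c g(2)[OF r_closed[OF l gc[OF c]]] ec[OF r_closed[OF l gc[OF c]]] by (simp add: \<rho>_def)
    qed
    have rV: "r l f x = f (l \<otimes>\<^bsub>\<Lambda>\<^esub> x)" if "x \<in> carrier \<Lambda>" for l f x using that by (simp add: r_def)
    show "\<rho> \<one>\<^bsub>\<Lambda>\<^esub> c = c" if c: "c \<in> carrier C" for c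
    proof -
      have h: "g c \<in> mod_hom k ?V ?J" using gc[OF c] by (simp add: D_simps)
      have "r \<one>\<^bsub>\<Lambda>\<^esub> (g c) = g c"
        by (rule mod_hom_eqI[of _ k ?V ?J _ ?J]) (use h r_closed[OF \<Lambda>.one_closed gc[OF c]] in \<open>simp_all add: D_simps rV\<close>)
      then show ?thesis using c g(3) by (simp add: \<rho>_def)
    qed
    show "\<rho> (a \<odot>\<^bsub>\<Lambda>\<^esub> \<one>\<^bsub>\<Lambda>\<^esub>) c = (a \<odot>\<^bsub>\<Lambda>\<^esub> \<one>\<^bsub>\<Lambda>\<^esub>) \<odot>\<^bsub>C\<^esub> c" if a: "a \<in> carrier k" and c: "c \<in> carrier C" for a c
    proof -
      have "r (a \<odot>\<^bsub>\<Lambda>\<^esub> \<one>\<^bsub>\<Lambda>\<^esub>) (g c) = (a \<odot>\<^bsub>\<Lambda>\<^esub> \<one>\<^bsub>\<Lambda>\<^esub>) \<odot>\<^bsub>D\<^esub> g c"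
        using a by (auto simp: r_def D_simps(4) unit_smult_mult cong: restrict_cong)
      then show ?thesis
        using a c g(3) mod_hom_smult[OF C(2) unit_smult_closed[OF a] gc[OF c]] by (simp add: \<rho>_def)
    qed
    show "\<exists>l\<in>carrier \<Lambda>. h = \<rho> l" if h: "h \<in> mod_hom \<Lambda> C C" for h
    proof -
      let ?F = "\<lambda>f\<in>carrier D. g ((\<lambda>f\<in>carrier D. h (e f)) f)"
      have "?F \<in> mod_hom \<Lambda> D D" by (rule mod_hom_comp[OF lD mod_hom_comp[OF lD C(2) h] g(1)])
      from r_surj[OF this] obtain l where l: "l \<in> carrier \<Lambda>" "\<And>f. f \<in> carrier D \<Longrightarrow> ?F f = r l f" by blast
      have "h c = e (r l (g c))" if c: "c \<in> carrier C" for c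
      proof -
        have "r l (g c) = g (h c)" using l(2)[OF gc[OF c]] gc[OF c] g(3)[OF c] by simp
        then show ?thesis using g(3)[OF mod_hom_closed[OF h c]] by simp
      qed
      then have "h = \<rho> l"
        using mod_hom_extensional[OF h] by (intro extensionalityI[of _ "carrier C"]) (auto simp: \<rho>_def)
      then show ?thesis using l(1) by blast
    qed
    show "l = \<zero>\<^bsub>\<Lambda>\<^esub>" if l: "l \<in> carrier \<Lambda>" and z: "\<And>c. c \<in> carrier C \<Longrightarrow> \<rho> l c = \<zero>\<^bsub>C\<^esub>" for l
    proof (rule ccontr)
      assume "l \<noteq> \<zero>\<^bsub>\<Lambda>\<^esub>"
      \<comment> \<open>Some functional f is nonzero at l, and f(l) is the value at 1 of
        \<open>r l f\<close>.\<close>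
      then obtain f where f: "f \<in> mod_hom k ?V ?J" "f l \<noteq> \<zero>\<^bsub>?J\<^esub>"
        using dualizing_module_cogenerator[OF finite_length_kmod_reg, of l] l by auto
      have fD': "f \<in> carrier D" using f(1) by (simp add: D_simps)
      have "e (r l f) = \<zero>\<^bsub>C\<^esub>" using z[OF ec[OF fD']] ec[OF fD'] g(2)[OF fD'] by (simp add: \<rho>_def)
      then have "r l f = \<zero>\<^bsub>D\<^esub>" using e0[OF r_closed[OF l fD']] by blast
      then have "r l f \<one>\<^bsub>\<Lambda>\<^esub> = \<zero>\<^bsub>D\<^esub> \<one>\<^bsub>\<Lambda>\<^esub>" by simp
      then show False using f(2) l by (simp add: D_simps rV)
    qed
  qed
  then show ?thesis by blast
qed

section \<open>Additive closures\<close>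

text \<open>\<open>thru R S A B\<close> is the ideal of homomorphisms that are finite sums of homomorphisms factoring
  through members of \<open>S\<close>. A module lies in \<open>add S\<close> iff its identity belongs to this ideal.\<close>

inductive_set thru :: "('r, 'c) ring_scheme \<Rightarrow> 'r lmod set \<Rightarrow> 'r lmod \<Rightarrow> 'r lmod \<Rightarrow> ('r list \<Rightarrow> 'r list) set"
  for R S A B where
  thru_zero: "(\<lambda>x\<in>carrier A. \<zero>\<^bsub>B\<^esub>) \<in> thru R S A B"
| thru_step: "\<lbrakk>h \<in> thru R S A B; C \<in> S; f \<in> mod_hom R A C; g \<in> mod_hom R C B; left_module R C\<rbrakk> \<Longrightarrow>
    (\<lambda>x\<in>carrier A. h x \<oplus>\<^bsub>B\<^esub> g (f x)) \<in> thru R S A B"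

definition in_add :: "('r, 'c) ring_scheme \<Rightarrow> 'r lmod set \<Rightarrow> 'r lmod \<Rightarrow> bool"
  where "in_add R S A \<longleftrightarrow> (\<lambda>x\<in>carrier A. x) \<in> thru R S A A"

section \<open>Ideal properties of \<open>thru\<close> and closure properties of
  \<open>in_add\<close>\<close>

lemma thru_mod_hom:
  assumes "left_module R A" "left_module R B" "h \<in> thru R S A B"
  shows "h \<in> mod_hom R A B"
  using assms(3)
proof (induction rule: thru.induct)
  case thru_zero
  then show ?case by (rule mod_hom_const_zero[OF assms(1,2)])
next
  case (thru_step h C f g)
  have eq: "(\<lambda>x\<in>carrier A. h x \<oplus>\<^bsub>B\<^esub> (\<lambda>x\<in>carrier A. g (f x)) x) = (\<lambda>x\<in>carrier A. h x \<oplus>\<^bsub>B\<^esub> g (f x))"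
    by (intro restrict_ext) simp
  show ?case
    using mod_hom_plus[OF assms(1,2) thru_step.IH mod_hom_comp[OF assms(1) thru_step(3,4)]]
    unfolding eq .
qed

lemma thru_single:
  assumes "left_module R B" "C \<in> S" "f \<in> mod_hom R A C" "g \<in> mod_hom R C B" "left_module R C"
  shows "(\<lambda>x\<in>carrier A. g (f x)) \<in> thru R S A B"
proof -
  interpret B: left_module R B by fact
  have eq: "(\<lambda>x\<in>carrier A. (\<lambda>x\<in>carrier A. \<zero>\<^bsub>B\<^esub>) x \<oplus>\<^bsub>B\<^esub> g (f x)) = (\<lambda>x\<in>carrier A. g (f x))"
    using mod_hom_closed[OF assms(3)] mod_hom_closed[OF assms(4)] by (intro restrict_ext) simp
  show ?thesis using thru_step[OF thru_zero assms(2-5)] unfolding eq .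
qed

lemma thru_add:
  assumes A: "left_module R A" and B: "left_module R B" and h: "h \<in> thru R S A B" and h': "h' \<in> thru R S A B"
  shows "(\<lambda>x\<in>carrier A. h x \<oplus>\<^bsub>B\<^esub> h' x) \<in> thru R S A B"
  using h'
proof (induction rule: thru.induct)
  interpret B: left_module R B by fact
  note hh = thru_mod_hom[OF A B h]
  case thru_zero
  have "(\<lambda>x\<in>carrier A. h x \<oplus>\<^bsub>B\<^esub> (\<lambda>x\<in>carrier A. \<zero>\<^bsub>B\<^esub>) x) = restrict h (carrier A)"
    using mod_hom_closed[OF hh] by (intro restrict_ext) simp
  then show ?case using hh h by simp
next
  interpret B: left_module R B by fact
  note hh = thru_mod_hom[OF A B h]
  case (thru_step h' C f g)
  note h'h = thru_mod_hom[OF A B thru_step(1)]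
  have eq: "(\<lambda>x\<in>carrier A. (\<lambda>x\<in>carrier A. h x \<oplus>\<^bsub>B\<^esub> h' x) x \<oplus>\<^bsub>B\<^esub> g (f x)) =
      (\<lambda>x\<in>carrier A. h x \<oplus>\<^bsub>B\<^esub> (\<lambda>x\<in>carrier A. h' x \<oplus>\<^bsub>B\<^esub> g (f x)) x)"
    using mod_hom_closed[OF hh] mod_hom_closed[OF h'h] mod_hom_closed[OF thru_step(3)] mod_hom_closed[OF thru_step(4)]
    by (intro restrict_ext) (simp add: B.M.a_assoc)
  show ?case using thru.thru_step[OF thru_step.IH thru_step(2-5)] unfolding eq .
qed

lemma thru_comp_left:
  assumes A: "left_module R A" and B: "left_module R B" and B': "left_module R B'"
    and h: "h \<in> thru R S A B" and p: "p \<in> mod_hom R B B'"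
  shows "(\<lambda>x\<in>carrier A. p (h x)) \<in> thru R S A B'"
  using h
proof (induction rule: thru.induct)
  case thru_zero
  have eq: "(\<lambda>x\<in>carrier A. p ((\<lambda>x\<in>carrier A. \<zero>\<^bsub>B\<^esub>) x)) = (\<lambda>x\<in>carrier A. \<zero>\<^bsub>B'\<^esub>)"
    using mod_hom_zero[OF B B' p] by (intro restrict_ext) simp
  show ?case unfolding eq by (rule thru.thru_zero)
next
  case (thru_step h C f g)
  note c = mod_hom_closed[OF thru_mod_hom[OF A B thru_step(1)]] mod_hom_closed[OF thru_step(3)] mod_hom_closed[OF thru_step(4)]
  have eq: "(\<lambda>x\<in>carrier A. p ((\<lambda>x\<in>carrier A. h x \<oplus>\<^bsub>B\<^esub> g (f x)) x)) =
      (\<lambda>x\<in>carrier A. (\<lambda>x\<in>carrier A. p (h x)) x \<oplus>\<^bsub>B'\<^esub> (\<lambda>c\<in>carrier C. p (g c)) (f x))"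
    using c by (intro restrict_ext) (simp add: mod_hom_add[OF p])
  show ?case unfolding eq
    by (rule thru.thru_step[OF thru_step.IH thru_step(2,3) mod_hom_comp[OF thru_step(5,4) p] thru_step(5)])
qed

lemma thru_comp_right:
  assumes A: "left_module R A" and A': "left_module R A'" and h: "h \<in> thru R S A B" and q: "q \<in> mod_hom R A' A"
  shows "(\<lambda>x\<in>carrier A'. h (q x)) \<in> thru R S A' B"
  using h
proof (induction rule: thru.induct)
  case thru_zero
  have eq: "(\<lambda>x\<in>carrier A'. (\<lambda>x\<in>carrier A. \<zero>\<^bsub>B\<^esub>) (q x)) = (\<lambda>x\<in>carrier A'. \<zero>\<^bsub>B\<^esub>)"
    using mod_hom_closed[OF q] by (intro restrict_ext) simp
  show ?case unfolding eq by (rule thru.thru_zero)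
next
  case (thru_step h C f g)
  have eq: "(\<lambda>x\<in>carrier A'. (\<lambda>x\<in>carrier A. h x \<oplus>\<^bsub>B\<^esub> g (f x)) (q x)) =
      (\<lambda>x\<in>carrier A'. (\<lambda>x\<in>carrier A'. h (q x)) x \<oplus>\<^bsub>B\<^esub> g ((\<lambda>x\<in>carrier A'. f (q x)) x))"
    using mod_hom_closed[OF q] by (intro restrict_ext) simp
  show ?case unfolding eq
    by (rule thru.thru_step[OF thru_step.IH thru_step(2) mod_hom_comp[OF A' q thru_step(3)] thru_step(4,5)])
qed

text \<open>The maps in \<open>thru\<close> are closed under composition on either side, so the
  identity at one end brings in every map.\<close>

lemma thru_of_in_add:
  assumes A: "left_module R A" and B: "left_module R B" and f: "f \<in> mod_hom R A B"
  shows "in_add R S A \<Longrightarrow> f \<in> thru R S A B" "in_add R S B \<Longrightarrow> f \<in> thru R S A B"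
proof -
  have "(\<lambda>x\<in>carrier A. f ((\<lambda>x\<in>carrier A. x) x)) = restrict f (carrier A)"
    by (intro restrict_ext) simp
  then show "in_add R S A \<Longrightarrow> f \<in> thru R S A B"
    unfolding in_add_def using thru_comp_left[OF A A B _ f] mod_hom_restrict[OF f] by metis
  have "(\<lambda>x\<in>carrier A. (\<lambda>y\<in>carrier B. y) (f x)) = restrict f (carrier A)"
    using mod_hom_closed[OF f] by (intro restrict_ext) simp
  then show "in_add R S B \<Longrightarrow> f \<in> thru R S A B"
    unfolding in_add_def using thru_comp_right[OF B A _ f] mod_hom_restrict[OF f] by metis
qed

lemma thru_trans:
  assumes A: "left_module R A" and B: "left_module R B" and S: "\<And>C. C \<in> S \<Longrightarrow> in_add R S' C"
    and h: "h \<in> thru R S A B"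
  shows "h \<in> thru R S' A B"
  using h
proof (induction rule: thru.induct)
  case thru_zero
  then show ?case by (rule thru.thru_zero)
next
  case (thru_step h C f g)
  note c = mod_hom_closed[OF thru_step(3)]
  have "f \<in> thru R S' A C" by (rule thru_of_in_add(2)[OF A thru_step(5,3) S[OF thru_step(2)]])
  from thru_comp_left[OF A thru_step(5) B this thru_step(4)]
  have "(\<lambda>x\<in>carrier A. g (f x)) \<in> thru R S' A B" .
  note sum = thru_add[OF A B thru_step.IH this]
  have eq: "(\<lambda>x\<in>carrier A. h x \<oplus>\<^bsub>B\<^esub> (\<lambda>x\<in>carrier A. g (f x)) x) = (\<lambda>x\<in>carrier A. h x \<oplus>\<^bsub>B\<^esub> g (f x))"
    by (intro restrict_ext) simp
  show ?case using sum unfolding eq .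
qed

lemma in_add_trans:
  assumes "left_module R A" "\<And>C. C \<in> S \<Longrightarrow> in_add R S' C" "in_add R S A"
  shows "in_add R S' A"
  using thru_trans[OF assms(1,1,2)] assms(3) unfolding in_add_def by blast

lemma in_add_member:
  assumes "left_module R C" "C \<in> S"
  shows "in_add R S C"
proof -
  have eq: "(\<lambda>x\<in>carrier C. (\<lambda>x\<in>carrier C. x) ((\<lambda>x\<in>carrier C. x) x)) = (\<lambda>x\<in>carrier C. x)"
    by (intro restrict_ext) simp
  show ?thesis
    using thru_single[OF assms mod_hom_id[OF assms(1)] mod_hom_id[OF assms(1)] assms(1)] unfolding eq in_add_def .
qed

lemma in_add_mono:
  assumes "left_module R A" "S \<subseteq> S'" "\<And>C. C \<in> S \<Longrightarrow> left_module R C" "in_add R S A"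
  shows "in_add R S' A"
  by (rule in_add_trans[OF assms(1) _ assms(4)]) (use in_add_member assms(2,3) in blast)

lemma in_add_retract:
  assumes A: "left_module R A" and B: "left_module R B" and f: "f \<in> mod_hom R A B" and g: "g \<in> mod_hom R B A"
    and gf: "\<And>x. x \<in> carrier A \<Longrightarrow> g (f x) = x" and "in_add R S B"
  shows "in_add R S A"
proof -
  have "(\<lambda>x\<in>carrier A. g (f x)) = (\<lambda>x\<in>carrier A. x)" using gf by (intro restrict_ext) simp
  moreover have "(\<lambda>x\<in>carrier A. g (f x)) \<in> thru R S A A"
    using thru_comp_left[OF A B A thru_of_in_add(2)[OF A B f assms(6)] g] .
  ultimately show ?thesis unfolding in_add_def by metis
qed

lemma in_add_zero:
  assumes "left_module R A" "carrier A = {\<zero>\<^bsub>A\<^esub>}"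
  shows "in_add R S A"
proof -
  have eq: "(\<lambda>x\<in>carrier A. \<zero>\<^bsub>A\<^esub>) = (\<lambda>x\<in>carrier A. x)" using assms(2) by (intro restrict_ext) simp
  show ?thesis using thru_zero[of A A R S] unfolding in_add_def eq .
qed

lemma in_add_sum:
  assumes P: "left_module R P" and A: "left_module R A" and B: "left_module R B"
    and i: "i \<in> mod_hom R A P" and j: "j \<in> mod_hom R B P" and p: "p \<in> mod_hom R P A" and q: "q \<in> mod_hom R P B"
    and id: "\<And>z. z \<in> carrier P \<Longrightarrow> i (p z) \<oplus>\<^bsub>P\<^esub> j (q z) = z"
    and "in_add R S A" "in_add R S B"
  shows "in_add R S P"
proof -
  have eq: "(\<lambda>z\<in>carrier P. (\<lambda>z\<in>carrier P. i (p z)) z \<oplus>\<^bsub>P\<^esub> (\<lambda>z\<in>carrier P. j (q z)) z) = (\<lambda>z\<in>carrier P. z)"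
    using id by (intro restrict_ext) simp
  have 1: "(\<lambda>z\<in>carrier P. i (p z)) \<in> thru R S P P"
    by (rule thru_comp_left[OF P A P thru_of_in_add(2)[OF P A p assms(9)] i])
  have 2: "(\<lambda>z\<in>carrier P. j (q z)) \<in> thru R S P P"
    by (rule thru_comp_left[OF P B P thru_of_in_add(2)[OF P B q assms(10)] j])
  show ?thesis using thru_add[OF P P 1 2] unfolding eq in_add_def .
qed

text \<open>A direct sum described by its four maps, with all three modules on lists. The copy of
  the pairs that realises it is thus confined to \<open>biproduct_exists\<close>.\<close>

definition biproduct :: "('r, 'c) ring_scheme \<Rightarrow> 'r lmod \<Rightarrow> 'r lmod \<Rightarrow> 'r lmod \<Rightarrow>
    ('r list \<Rightarrow> 'r list) \<Rightarrow> ('r list \<Rightarrow> 'r list) \<Rightarrow> ('r list \<Rightarrow> 'r list) \<Rightarrow> ('r list \<Rightarrow> 'r list) \<Rightarrow> bool"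
  where "biproduct R A B P i j p q \<longleftrightarrow> finite_length_module R P \<and>
    i \<in> mod_hom R A P \<and> j \<in> mod_hom R B P \<and> p \<in> mod_hom R P A \<and> q \<in> mod_hom R P B \<and>
    (\<forall>x\<in>carrier A. p (i x) = x \<and> q (i x) = \<zero>\<^bsub>B\<^esub>) \<and> (\<forall>y\<in>carrier B. p (j y) = \<zero>\<^bsub>A\<^esub> \<and> q (j y) = y) \<and>
    (\<forall>z\<in>carrier P. i (p z) \<oplus>\<^bsub>P\<^esub> j (q z) = z)"

lemma biproduct_exists:
  fixes A B :: "'r lmod"
  assumes "finite_length_module R A" "finite_length_module R B"
  shows "\<exists>P i j p q. biproduct R A B P i j p q"
proof -
  note A = finite_length_left_module[OF assms(1)]
  note B = finite_length_left_module[OF assms(2)]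
  interpret A: left_module R A by (rule A)
  interpret B: left_module R B by (rule B)
  let ?D = "dsum A B"
  note D = dsum_left_module[OF A B]
  obtain P :: "'r lmod" and e where P: "finite_length_module R P" "e \<in> mod_hom R ?D P"
    "bij_betw e (carrier ?D) (carrier P)"
    using finite_length_module_on_lists[OF finite_length_dsum[OF assms]] unfolding mod_iso_def by blast
  note lP = finite_length_left_module[OF P(1)]
  obtain g where g: "g \<in> mod_hom R P ?D" "\<forall>x\<in>carrier ?D. g (e x) = x" "\<forall>y\<in>carrier P. e (g y) = y"
    using mod_hom_inverse[OF D lP P(2,3)] by blast
  let ?i = "\<lambda>x\<in>carrier A. e ((\<lambda>x\<in>carrier A. (x, \<zero>\<^bsub>B\<^esub>)) x)"
  let ?j = "\<lambda>y\<in>carrier B. e ((\<lambda>y\<in>carrier B. (\<zero>\<^bsub>A\<^esub>, y)) y)"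
  let ?p = "\<lambda>z\<in>carrier P. (\<lambda>z\<in>carrier ?D. fst z) (g z)"
  let ?q = "\<lambda>z\<in>carrier P. (\<lambda>z\<in>carrier ?D. snd z) (g z)"
  note h = mod_hom_comp[OF A dsum_homs(1)[OF A B] P(2)] mod_hom_comp[OF B dsum_homs(2)[OF A B] P(2)]
    mod_hom_comp[OF lP g(1) dsum_homs(3)[OF A B]] mod_hom_comp[OF lP g(1) dsum_homs(4)[OF A B]]
  have d: "(x, y) \<in> carrier ?D \<longleftrightarrow> x \<in> carrier A \<and> y \<in> carrier B" for x y by (simp add: dsum_def)
  note gc = mod_hom_closed[OF g(1)] and ec = mod_hom_closed[OF P(2)]
  have "biproduct R A B P ?i ?j ?p ?q" unfolding biproduct_def
  proof (intro conjI ballI P(1) h)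
    fix x assume x: "x \<in> carrier A"
    then have "(x, \<zero>\<^bsub>B\<^esub>) \<in> carrier ?D" by (simp add: d)
    then show "?p (?i x) = x" "?q (?i x) = \<zero>\<^bsub>B\<^esub>" using x g(2) ec by simp_all
  next
    fix y assume y: "y \<in> carrier B"
    then have "(\<zero>\<^bsub>A\<^esub>, y) \<in> carrier ?D" by (simp add: d)
    then show "?p (?j y) = \<zero>\<^bsub>A\<^esub>" "?q (?j y) = y" using y g(2) ec by simp_all
  next
    fix z assume z: "z \<in> carrier P"
    obtain x y where xy: "g z = (x, y)" by (cases "g z")
    have xyD: "x \<in> carrier A" "y \<in> carrier B" using gc[OF z] unfolding xy d by auto
    have "?i (?p z) \<oplus>\<^bsub>P\<^esub> ?j (?q z) = e (x, \<zero>\<^bsub>B\<^esub>) \<oplus>\<^bsub>P\<^esub> e (\<zero>\<^bsub>A\<^esub>, y)"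
      using z xyD by (simp add: xy d)
    also have "\<dots> = e ((x, \<zero>\<^bsub>B\<^esub>) \<oplus>\<^bsub>?D\<^esub> (\<zero>\<^bsub>A\<^esub>, y))"
      using xyD by (simp add: mod_hom_add[OF P(2)] d)
    also have "\<dots> = e (g z)" using xyD by (simp add: xy dsum_def)
    finally show "?i (?p z) \<oplus>\<^bsub>P\<^esub> ?j (?q z) = z" using g(3) z by simp
  qed
  then show ?thesis by blast
qed

lemma biproduct_in_add:
  assumes "biproduct R A B P i j p q" "left_module R A" "left_module R B" "in_add R S A" "in_add R S B"
  shows "in_add R S P"
  using assms in_add_sum[of R P A B i j p q S] finite_length_left_module[of R P] unfolding biproduct_def by blast

lemma biproduct_summands_in_add:
  assumes "biproduct R A B P i j p q" "left_module R A" "left_module R B"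
  shows "in_add R {P} A" "in_add R {P} B"
proof -
  note b = assms(1)[unfolded biproduct_def]
  have P: "left_module R P" using b finite_length_left_module by blast
  have s: "in_add R {P} P" by (rule in_add_member[OF P]) simp
  show "in_add R {P} A" by (rule in_add_retract[OF assms(2) P _ _ _ s, of i p]) (use b in auto)
  show "in_add R {P} B" by (rule in_add_retract[OF assms(3) P _ _ _ s, of j q]) (use b in auto)
qed

lemma zero_module_exists:
  fixes R :: "('r, 'c) ring_scheme"
  assumes "ring R"
  shows "\<exists>Z :: 'r lmod. finite_length_module R Z \<and> carrier Z = {\<zero>\<^bsub>Z\<^esub>}"
proof -
  note M = left_module_reg[OF assms]
  note l = left_module_submodule[OF M submodule_singleton_zero[OF M]]
  have "finite_length_module R (reg R\<lparr>carrier := {\<zero>\<^bsub>reg R\<^esub>}\<rparr>)"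
    by (intro finite_lengthI[OF l module_length_zero[OF l]]) simp
  from finite_length_module_on_lists[OF this] obtain Y :: "'r lmod" and f where
    Y: "finite_length_module R Y" and f: "bij_betw f {\<zero>\<^bsub>R\<^esub>} (carrier Y)"
    unfolding mod_iso_def by auto
  have "\<zero>\<^bsub>Y\<^esub> \<in> carrier Y"
    using submodule_zero[OF finite_length_left_module submodule_carrier[OF finite_length_left_module], OF Y Y] .
  moreover have "carrier Y = {f \<zero>\<^bsub>R\<^esub>}" using bij_betw_imp_surj_on[OF f] by simp
  ultimately have "carrier Y = {\<zero>\<^bsub>Y\<^esub>}" by simp
  with Y show ?thesis by (intro exI[of _ Y] conjI)
qed

text \<open>\<open>M\<close> is the direct sum of the members of \<open>S\<close>. All that is kept
  of it is that \<open>{M}\<close> and \<open>S\<close> have the same additive closure.\<close>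

lemma finite_sum_exists:
  fixes S :: "'r lmod set"
  assumes "ring R" "finite S" "\<And>C. C \<in> S \<Longrightarrow> finite_length_module R C"
  shows "\<exists>M :: 'r lmod. finite_length_module R M \<and> (\<forall>C\<in>S. in_add R {M} C) \<and> in_add R S M"
  using assms(2,3)
proof (induction S rule: finite_induct)
  case empty
  obtain Z :: "'r lmod" where Z: "finite_length_module R Z" "carrier Z = {\<zero>\<^bsub>Z\<^esub>}"
    using zero_module_exists[OF assms(1)] by auto
  show ?case using Z in_add_zero[OF finite_length_left_module[OF Z(1)] Z(2)] by (intro exI[of _ Z]) simp
next
  case (insert C S)
  then obtain M :: "'r lmod" where M: "finite_length_module R M" "\<forall>C\<in>S. in_add R {M} C" "in_add R S M" by auto
  have C: "finite_length_module R C" using insert by simp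
  note lM = finite_length_left_module[OF M(1)]
  note lC = finite_length_left_module[OF C]
  have lS: "left_module R X" if "X \<in> insert C S" for X using insert.prems[OF that] finite_length_left_module by blast
  obtain P i j p q where P: "biproduct R M C P i j p q" using biproduct_exists[OF M(1) C] by blast
  have fP: "finite_length_module R P" using P by (simp add: biproduct_def)
  note lP = finite_length_left_module[OF fP]
  have "in_add R {P} X" if "X \<in> insert C S" for X
  proof (cases "X = C")
    case False
    then have "in_add R {M} X" using M(2) that by blast
    then show ?thesis
      using in_add_trans[OF lS[OF that], of "{M}" "{P}"] biproduct_summands_in_add(1)[OF P lM lC] lM by blast
  qed (use biproduct_summands_in_add(2)[OF P lM lC] in simp)
  moreover have "in_add R (insert C S) P"
    using biproduct_in_add[OF P lM lC] in_add_mono[OF lM _ _ M(3), of "insert C S"] in_add_member[OF lC, of "insert C S"] lS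
    by blast
  ultimately show ?case using fP by blast
qed

text \<open>Stated for single elements rather than by an embedding into a power; for modules of
  finite length an embedding into a member of add C is supplied by
  \<open>cogenerated_embedding\<close>.\<close>

definition cogenerated :: "('r, 'c) ring_scheme \<Rightarrow> 'r lmod \<Rightarrow> 'r lmod \<Rightarrow> bool"
  where "cogenerated R C X \<longleftrightarrow> (\<forall>x\<in>carrier X. x \<noteq> \<zero>\<^bsub>X\<^esub> \<longrightarrow> (\<exists>f\<in>mod_hom R X C. f x \<noteq> \<zero>\<^bsub>C\<^esub>))"

text \<open>The trace of \<open>C\<close> in \<open>X\<close> is all of \<open>X\<close>.
  Quantifying over the submodules that contain all images of \<open>C\<close> avoids finite sums of
  maps.\<close>

definition generated :: "('r, 'c) ring_scheme \<Rightarrow> 'r lmod \<Rightarrow> 'r lmod \<Rightarrow> bool"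
  where "generated R C X \<longleftrightarrow> (\<forall>U. submodule U R X \<longrightarrow> (\<forall>f\<in>mod_hom R C X. f ` carrier C \<subseteq> U) \<longrightarrow> U = carrier X)"

text \<open>Among the maps to members of add C take one whose kernel has least length. If x is a
  nonzero element of the kernel, a map to \<open>C\<close> that does not kill x can be added as a
  further component, which makes the kernel smaller.\<close>

lemma cogenerated_embedding:
  fixes X C :: "'r lmod"
  assumes X: "finite_length_module R X" and C: "finite_length_module R C" and co: "cogenerated R C X"
  obtains P f where "finite_length_module R P" "in_add R {C} P" "f \<in> mod_hom R X P" "inj_on f (carrier X)"
proof -
  note lX = finite_length_left_module[OF X]
  note lC = finite_length_left_module[OF C]
  interpret X: left_module R X by (rule lX)
  interpret C: left_module R C by (rule lC)
  let ?Q = "\<lambda>(P, f). finite_length_module R P \<and> in_add R {C} P \<and> f \<in> mod_hom R X P"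
  let ?K = "\<lambda>(P :: 'r lmod, f). {x \<in> carrier X. f x = \<zero>\<^bsub>P\<^esub>}"
  obtain Z :: "'r lmod" where Z: "finite_length_module R Z" "carrier Z = {\<zero>\<^bsub>Z\<^esub>}"
    using zero_module_exists[OF X.R.ring_axioms] by auto
  have "?Q (Z, \<lambda>x\<in>carrier X. \<zero>\<^bsub>Z\<^esub>)"
    using Z(1) in_add_zero[OF finite_length_left_module[OF Z(1)] Z(2)]
      mod_hom_const_zero[OF lX finite_length_left_module[OF Z(1)]] by simp
  from ex_has_least_nat[of ?Q, OF this, of "\<lambda>pf. len R X (?K pf)"]
  obtain P f where P: "finite_length_module R P" "in_add R {C} P" "f \<in> mod_hom R X P"
    and least: "\<And>P' f'. ?Q (P', f') \<Longrightarrow> len R X (?K (P, f)) \<le> len R X (?K (P', f'))" by auto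
  note lP = finite_length_left_module[OF P(1)]
  interpret P: left_module R P by (rule lP)
  have "x = \<zero>\<^bsub>X\<^esub>" if x: "x \<in> carrier X" "f x = \<zero>\<^bsub>P\<^esub>" for x
  proof (rule ccontr)
    assume "x \<noteq> \<zero>\<^bsub>X\<^esub>"
    then obtain h where h: "h \<in> mod_hom R X C" "h x \<noteq> \<zero>\<^bsub>C\<^esub>" using co x unfolding cogenerated_def by blast
    obtain P' i j p q where b: "biproduct R P C P' i j p q" using biproduct_exists[OF P(1) C] by blast
    note b' = b[unfolded biproduct_def]
    have fP': "finite_length_module R P'" using b' by blast
    note lP' = finite_length_left_module[OF fP']
    have ij: "i \<in> mod_hom R P P'" "j \<in> mod_hom R C P'" "p \<in> mod_hom R P' P" "q \<in> mod_hom R P' C" using b' by auto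
    let ?f = "\<lambda>y\<in>carrier X. (\<lambda>y\<in>carrier X. i (f y)) y \<oplus>\<^bsub>P'\<^esub> (\<lambda>y\<in>carrier X. j (h y)) y"
    have f': "?f \<in> mod_hom R X P'"
      by (rule mod_hom_plus[OF lX lP' mod_hom_comp[OF lX P(3) ij(1)] mod_hom_comp[OF lX h(1) ij(2)]])
    have "in_add R {C} P'"
      by (rule biproduct_in_add[OF b lP lC P(2) in_add_member[OF lC]]) simp
    then have Q': "?Q (P', ?f)" unfolding prod.case using fP' f' by (intro conjI)
    have le: "len R X (?K (P, f)) \<le> len R X (?K (P', ?f))" by (rule least[OF Q'])
    have comp: "p (?f y) = f y" "q (?f y) = h y" if y: "y \<in> carrier X" for y
    proof -
      note c = mod_hom_closed[OF P(3) y] mod_hom_closed[OF h(1) y]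
      note c' = mod_hom_closed[OF ij(1) c(1)] mod_hom_closed[OF ij(2) c(2)]
      have pq: "p (i (f y)) = f y" "q (i (f y)) = \<zero>\<^bsub>C\<^esub>" "p (j (h y)) = \<zero>\<^bsub>P\<^esub>" "q (j (h y)) = h y"
        using b' c by blast+
      show "p (?f y) = f y" using y c(1) by (simp add: mod_hom_add[OF ij(3) c'] pq)
      show "q (?f y) = h y" using y c(2) by (simp add: mod_hom_add[OF ij(4) c'] pq)
    qed
    have z: "p \<zero>\<^bsub>P'\<^esub> = \<zero>\<^bsub>P\<^esub>" "q \<zero>\<^bsub>P'\<^esub> = \<zero>\<^bsub>C\<^esub>"
      by (rule mod_hom_zero[OF lP' lP ij(3)], rule mod_hom_zero[OF lP' lC ij(4)])
    have "?K (P', ?f) \<subseteq> ?K (P, f)"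
    proof
      fix y assume "y \<in> ?K (P', ?f)"
      then have y: "y \<in> carrier X" "?f y = \<zero>\<^bsub>P'\<^esub>" by auto
      have "f y = \<zero>\<^bsub>P\<^esub>" using comp(1)[OF y(1)] z(1) unfolding y(2) by simp
      then show "y \<in> ?K (P, f)" using y(1) by simp
    qed
    moreover have "x \<notin> ?K (P', ?f)"
    proof
      assume "x \<in> ?K (P', ?f)"
      then have "?f x = \<zero>\<^bsub>P'\<^esub>" by auto
      then show False using comp(2)[OF x(1)] z(2) h(2) by metis
    qed
    moreover have "x \<in> ?K (P, f)" using x by simp
    ultimately have "?K (P', ?f) \<subset> ?K (P, f)" by blast
    moreover have "submodule (?K (P, f)) R X" "submodule (?K (P', ?f)) R X"
      using submodule_kernel[OF lX lP P(3)] submodule_kernel[OF lX lP' f'] by simp_all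
    ultimately have "len R X (?K (P', ?f)) < len R X (?K (P, f))" using len_strict_mono[OF X] by blast
    then show False using le by simp
  qed
  then have "inj_on f (carrier X)" unfolding mod_hom_inj_iff[OF lX lP P(3)] by blast
  with P show ?thesis by (rule that)
qed

text \<open>Dual to the embedding: when the image has greatest length, it contains the image of
  every map from \<open>C\<close>, since such a map could be added as a further component.\<close>

lemma generated_surjection:
  fixes X C :: "'r lmod"
  assumes X: "finite_length_module R X" and C: "finite_length_module R C" and ge: "generated R C X"
  obtains P f where "finite_length_module R P" "in_add R {C} P" "f \<in> mod_hom R P X" "f ` carrier P = carrier X"
proof -
  note lX = finite_length_left_module[OF X]
  note lC = finite_length_left_module[OF C]
  interpret X: left_module R X by (rule lX)
  interpret C: left_module R C by (rule lC)
  let ?Q = "\<lambda>(P, f). finite_length_module R P \<and> in_add R {C} P \<and> f \<in> mod_hom R P X"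
  let ?I = "\<lambda>(P :: 'r lmod, f). f ` carrier P"
  obtain Z :: "'r lmod" where Z: "finite_length_module R Z" "carrier Z = {\<zero>\<^bsub>Z\<^esub>}"
    using zero_module_exists[OF X.R.ring_axioms] by auto
  have Q0: "?Q (Z, \<lambda>x\<in>carrier Z. \<zero>\<^bsub>X\<^esub>)"
    using Z(1) in_add_zero[OF finite_length_left_module[OF Z(1)] Z(2)]
      mod_hom_const_zero[OF finite_length_left_module[OF Z(1)] lX] by simp
  have sub: "submodule (f ` carrier P) R X" if "?Q (P, f)" for P f
  proof -
    have Pf: "finite_length_module R P" "f \<in> mod_hom R P X" using that by simp_all
    note lP = finite_length_left_module[OF Pf(1)]
    show ?thesis by (rule submodule_image[OF lP lX Pf(2) submodule_carrier[OF lP]])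
  qed
  have "\<forall>pf. ?Q pf \<longrightarrow> len R X (?I pf) < Suc (len R X (carrier X))"
    using len_le[OF X sub] by (auto simp: less_Suc_eq_le)
  from ex_has_greatest_nat[of ?Q, OF Q0 this]
  obtain P f where P: "finite_length_module R P" "in_add R {C} P" "f \<in> mod_hom R P X"
    and greatest: "\<And>P' f'. ?Q (P', f') \<Longrightarrow> len R X (?I (P', f')) \<le> len R X (?I (P, f))" by auto
  note lP = finite_length_left_module[OF P(1)]
  interpret P: left_module R P by (rule lP)
  have "h ` carrier C \<subseteq> f ` carrier P" if h: "h \<in> mod_hom R C X" for h
  proof (rule ccontr)
    assume n: "\<not> h ` carrier C \<subseteq> f ` carrier P"
    obtain P' i j p q where b: "biproduct R P C P' i j p q" using biproduct_exists[OF P(1) C] by blast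
    note b' = b[unfolded biproduct_def]
    have fP': "finite_length_module R P'" using b' by blast
    note lP' = finite_length_left_module[OF fP']
    have ij: "i \<in> mod_hom R P P'" "j \<in> mod_hom R C P'" "p \<in> mod_hom R P' P" "q \<in> mod_hom R P' C" using b' by auto
    let ?f = "\<lambda>y\<in>carrier P'. (\<lambda>y\<in>carrier P'. f (p y)) y \<oplus>\<^bsub>X\<^esub> (\<lambda>y\<in>carrier P'. h (q y)) y"
    have f': "?f \<in> mod_hom R P' X"
      by (rule mod_hom_plus[OF lP' lX mod_hom_comp[OF lP' ij(3) P(3)] mod_hom_comp[OF lP' ij(4) h]])
    have "in_add R {C} P'"
      by (rule biproduct_in_add[OF b lP lC P(2) in_add_member[OF lC]]) simp
    then have Q': "?Q (P', ?f)" unfolding prod.case using fP' f' by (intro conjI)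
    have fi: "?f (i y) = f y" if "y \<in> carrier P" for y
    proof -
      have "p (i y) = y" "q (i y) = \<zero>\<^bsub>C\<^esub>" using b' that by blast+
      then show ?thesis
        using mod_hom_closed[OF ij(1) that] mod_hom_zero[OF lC lX h] mod_hom_closed[OF P(3) that] by simp
    qed
    have fj: "?f (j y) = h y" if "y \<in> carrier C" for y
    proof -
      have "p (j y) = \<zero>\<^bsub>P\<^esub>" "q (j y) = y" using b' that by blast+
      then show ?thesis
        using mod_hom_closed[OF ij(2) that] mod_hom_zero[OF lP lX P(3)] mod_hom_closed[OF h that] by simp
    qed
    have "f ` carrier P \<subseteq> ?f ` carrier P'"
    proof
      fix x assume "x \<in> f ` carrier P"
      then obtain y where "y \<in> carrier P" "x = f y" by blast
      then show "x \<in> ?f ` carrier P'" using fi mod_hom_closed[OF ij(1)] by (intro image_eqI[of _ _ "i y"]) simp_all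
    qed
    moreover have "h ` carrier C \<subseteq> ?f ` carrier P'"
    proof
      fix x assume "x \<in> h ` carrier C"
      then obtain y where "y \<in> carrier C" "x = h y" by blast
      then show "x \<in> ?f ` carrier P'" using fj mod_hom_closed[OF ij(2)] by (intro image_eqI[of _ _ "j y"]) simp_all
    qed
    ultimately have "f ` carrier P \<subset> ?f ` carrier P'" using n by blast
    then have "len R X (f ` carrier P) < len R X (?f ` carrier P')"
      using len_strict_mono[OF X sub sub[OF Q']] P by blast
    moreover have "len R X (?f ` carrier P') \<le> len R X (f ` carrier P)"
      using greatest[OF Q'] by (simp only: prod.case)
    ultimately show False by simp
  qed
  moreover have "submodule (f ` carrier P) R X" using sub P by simp
  ultimately have "f ` carrier P = carrier X" using ge unfolding generated_def by blast
  with P show ?thesis by (rule that)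
qed

section \<open>Indecomposable modules\<close>

lemma mod_hom_funpow:
  assumes "left_module R N" "t \<in> mod_hom R N N"
  shows "(\<lambda>x\<in>carrier N. (t ^^ n) x) \<in> mod_hom R N N"
proof (induction n)
  case 0
  show ?case using mod_hom_id[OF assms(1)] by (simp only: funpow_0)
next
  case (Suc n)
  have eq: "(\<lambda>x\<in>carrier N. t ((\<lambda>x\<in>carrier N. (t ^^ n) x) x)) = (\<lambda>x\<in>carrier N. (t ^^ Suc n) x)"
    by (intro restrict_ext) simp
  show ?case using mod_hom_comp[OF assms(1) Suc.IH assms(2)] unfolding eq .
qed

lemma inj_endomorphism_bij:
  assumes "finite_length_module R N" "t \<in> mod_hom R N N" "inj_on t (carrier N)"
  shows "bij_betw t (carrier N) (carrier N)"
  using inj_length_imp_surj[OF assms(1,1,2,3) order_refl] assms(3) by (simp add: bij_betw_def)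

text \<open>Fitting's lemma: for large n the module is the direct sum of the image and the kernel of
  t^n, so one of them is zero.\<close>

lemma indecomposable_nilpotent_or_bij:
  assumes ind: "indecomposable R N" and t: "t \<in> mod_hom R N N" and nb: "\<not> bij_betw t (carrier N) (carrier N)"
  shows "\<exists>n. \<forall>x\<in>carrier N. (t ^^ n) x = \<zero>\<^bsub>N\<^esub>"
proof -
  have fl: "finite_length_module R N"
    and dec: "\<And>U V. direct_sum_decomp R N U V \<Longrightarrow> U = {\<zero>\<^bsub>N\<^esub>} \<or> V = {\<zero>\<^bsub>N\<^esub>}"
    using ind by (auto simp: indecomposable_def)
  note l = finite_length_left_module[OF fl]
  interpret N: left_module R N by (rule l)
  define T where "T n = (\<lambda>x\<in>carrier N. (t ^^ n) x)" for n
  have T: "T n \<in> mod_hom R N N" for n unfolding T_def by (rule mod_hom_funpow[OF l t])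
  have Tc: "T n x \<in> carrier N" if "x \<in> carrier N" for n x by (rule mod_hom_closed[OF T that])
  have Tadd: "T (m + n) x = T m (T n x)" if "x \<in> carrier N" for m n x
  proof -
    have "(t ^^ n) x \<in> carrier N" using Tc[OF that, of n] that by (simp add: T_def)
    then show ?thesis using that by (simp add: T_def funpow_add)
  qed
  define I where "I n = T n ` carrier N" for n
  define K where "K n = {x \<in> carrier N. T n x = \<zero>\<^bsub>N\<^esub>}" for n
  have sI: "submodule (I n) R N" for n unfolding I_def by (rule submodule_image[OF l l T submodule_carrier[OF l]])
  have sK: "submodule (K n) R N" for n unfolding K_def by (rule submodule_kernel[OF l l T])
  have I_anti: "I (n + m) \<subseteq> I n" for n m 
  proof
    fix y assume "y \<in> I (n + m)"
    then obtain x where "x \<in> carrier N" "y = T n (T m x)" using Tadd by (auto simp: I_def)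
    then show "y \<in> I n" using Tc by (auto simp: I_def)
  qed
  have K_mono: "K n \<subseteq> K (m + n)" for n m 
  proof
    fix x assume "x \<in> K n"
    then have x: "x \<in> carrier N" "T n x = \<zero>\<^bsub>N\<^esub>" by (auto simp: K_def)
    then have "T (m + n) x = \<zero>\<^bsub>N\<^esub>" using Tadd[OF x(1), of m n] mod_hom_zero[OF l l T] by simp
    then show "x \<in> K (m + n)" using x(1) by (simp add: K_def)
  qed
  obtain U where "submodule U R N" and U: "U \<in> range I"
    "\<And>V. submodule V R N \<Longrightarrow> V \<in> range I \<Longrightarrow> V \<subseteq> U \<Longrightarrow> V = U"
    by (rule submodule_minimal_exists[OF fl sI[of 0], where P = "\<lambda>U. U \<in> range I", OF rangeI]) (rule that)
  then obtain n1 where n1: "U = I n1" by blast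
  obtain W where "submodule W R N" and W: "W \<in> range K"
    "\<And>V. submodule V R N \<Longrightarrow> V \<in> range K \<Longrightarrow> W \<subseteq> V \<Longrightarrow> V = W"
    by (rule submodule_maximal_exists[OF fl sK[of 0], where P = "\<lambda>U. U \<in> range K", OF rangeI]) (rule that)
  then obtain n2 where n2: "W = K n2" by blast
  \<comment> \<open>Beyond both points of stabilisation, so that t^n and t^(2n) have the same image
    and the same kernel; a successor, so that t x = 0 implies t^n x = 0.\<close>
  define n where "n = Suc (n1 + n2)"
  have I_stable: "I m = I n1" if "n1 \<le> m" for m
  proof -
    obtain j where "m = n1 + j" using \<open>n1 \<le> m\<close> le_Suc_ex by blast
    then show ?thesis using U(2)[OF sI[of m] rangeI] I_anti[of n1 j] n1 by simp
  qed
  have K_stable: "K m = K n2" if "n2 \<le> m" for m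
  proof -
    obtain j where "m = j + n2" using \<open>n2 \<le> m\<close> by (metis add.commute le_Suc_ex)
    then show ?thesis using W(2)[OF sK[of m] rangeI] K_mono[of n2 j] n2 by simp
  qed
  have In: "I (n + n) = I n" using I_stable[of n] I_stable[of "n + n"] by (simp add: n_def)
  have Kn: "K (n + n) = K n" using K_stable[of n] K_stable[of "n + n"] by (simp add: n_def)
  have "direct_sum_decomp R N (I n) (K n)"
    unfolding direct_sum_decomp_def
  proof (intro conjI sI sK)
    show "I n \<inter> K n = {\<zero>\<^bsub>N\<^esub>}"
    proof
      show "{\<zero>\<^bsub>N\<^esub>} \<subseteq> I n \<inter> K n" using submodule_zero[OF l sI] submodule_zero[OF l sK] by blast
      show "I n \<inter> K n \<subseteq> {\<zero>\<^bsub>N\<^esub>}"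
      proof
        fix x assume x: "x \<in> I n \<inter> K n"
        then obtain y where y: "y \<in> carrier N" "x = T n y" by (auto simp: I_def)
        then have "y \<in> K (n + n)" using x Tadd[of y n n] by (simp add: K_def)
        then show "x \<in> {\<zero>\<^bsub>N\<^esub>}" using y(2) unfolding Kn by (simp add: K_def)
      qed
    qed
    show "I n <+>\<^bsub>N\<^esub> K n = carrier N"
    proof
      show "I n <+>\<^bsub>N\<^esub> K n \<subseteq> carrier N" by (rule submodule_subset[OF l submodule_set_add[OF l sI sK]])
      show "carrier N \<subseteq> I n <+>\<^bsub>N\<^esub> K n"
      proof
        fix x assume x: "x \<in> carrier N"
        have "T n x \<in> I (n + n)" unfolding In using x by (simp add: I_def)
        then obtain y where y: "y \<in> carrier N" "T n x = T n (T n y)" using Tadd by (auto simp: I_def)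
        have "x \<ominus>\<^bsub>N\<^esub> T n y \<in> K n"
          using x y Tc left_module_diff_eq_zero[OF l] mod_hom_diff[OF l l T, of x "T n y" n] by (simp add: K_def a_minus_def)
        moreover have "T n y \<in> I n" using y by (simp add: I_def)
        moreover have "x = T n y \<oplus>\<^bsub>N\<^esub> (x \<ominus>\<^bsub>N\<^esub> T n y)"
          using x Tc[OF y(1), of n] N.M.a_comm[of "T n y" "x \<ominus>\<^bsub>N\<^esub> T n y"]
          by (simp add: a_minus_def N.M.a_assoc N.M.l_neg)
        ultimately show "x \<in> I n <+>\<^bsub>N\<^esub> K n" unfolding set_add_iff by blast
      qed
    qed
  qed
  then consider "I n = {\<zero>\<^bsub>N\<^esub>}" | "K n = {\<zero>\<^bsub>N\<^esub>}" using dec by blast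
  then show ?thesis
  proof cases
    case 1
    have "(t ^^ n) x = \<zero>\<^bsub>N\<^esub>" if x: "x \<in> carrier N" for x
    proof -
      have "T n x \<in> I n" using x by (simp add: I_def)
      then show ?thesis using x 1 by (simp add: T_def)
    qed
    then show ?thesis by blast
  next
    case 2
    have "x = \<zero>\<^bsub>N\<^esub>" if x: "x \<in> carrier N" "t x = \<zero>\<^bsub>N\<^esub>" for x
    proof -
      have "T n x = T (n1 + n2) (T 1 x)" using Tadd[OF x(1), of "n1 + n2" 1] by (simp add: n_def)
      also have "T 1 x = \<zero>\<^bsub>N\<^esub>" using x by (simp add: T_def)
      also have "T (n1 + n2) \<zero>\<^bsub>N\<^esub> = \<zero>\<^bsub>N\<^esub>" by (rule mod_hom_zero[OF l l T])
      finally have "x \<in> K n" using x(1) by (simp add: K_def)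
      then show ?thesis using 2 by blast
    qed
    then have "inj_on t (carrier N)" unfolding mod_hom_inj_iff[OF l l t] by blast
    then show ?thesis using inj_endomorphism_bij[OF fl t] nb by blast
  qed
qed

text \<open>Let \<open>u\<close> be the inverse of the sum. If \<open>g\<close> is not bijective,
  then u g is not bijective either and so is nilpotent. On the kernel of \<open>f\<close> it is the
  identity, which forces this kernel to be zero.\<close>

lemma indecomposable_local:
  assumes ind: "indecomposable R N" and f: "f \<in> mod_hom R N N" and g: "g \<in> mod_hom R N N"
    and b: "bij_betw (\<lambda>x\<in>carrier N. f x \<oplus>\<^bsub>N\<^esub> g x) (carrier N) (carrier N)"
  shows "bij_betw f (carrier N) (carrier N) \<or> bij_betw g (carrier N) (carrier N)"
proof (rule disjCI)
  assume ng: "\<not> bij_betw g (carrier N) (carrier N)"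
  have fl: "finite_length_module R N" using ind by (simp add: indecomposable_def)
  note l = finite_length_left_module[OF fl]
  interpret N: left_module R N by (rule l)
  obtain u where u: "u \<in> mod_hom R N N" "\<And>x. x \<in> carrier N \<Longrightarrow> u ((\<lambda>x\<in>carrier N. f x \<oplus>\<^bsub>N\<^esub> g x) x) = x"
    using mod_hom_inverse[OF l l mod_hom_plus[OF l l f g] b] by blast
  let ?t = "\<lambda>x\<in>carrier N. u (g x)"
  have t: "?t \<in> mod_hom R N N" by (rule mod_hom_comp[OF l g u(1)])
  have "\<not> bij_betw ?t (carrier N) (carrier N)"
  proof
    assume "bij_betw ?t (carrier N) (carrier N)"
    then have i: "inj_on ?t (carrier N)" by (simp add: bij_betw_def)
    have "inj_on g (carrier N)"
      by (rule inj_onI, rule inj_onD[OF i]) simp_all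
    then show False using inj_endomorphism_bij[OF fl g] ng by blast
  qed
  from indecomposable_nilpotent_or_bij[OF ind t this]
  obtain n where n: "\<forall>x\<in>carrier N. (?t ^^ n) x = \<zero>\<^bsub>N\<^esub>" by blast
  have "x = \<zero>\<^bsub>N\<^esub>" if x: "x \<in> carrier N" "f x = \<zero>\<^bsub>N\<^esub>" for x
  proof -
    have "?t x = x" using u(2)[OF x(1)] x mod_hom_closed[OF g x(1)] by simp
    then have "(?t ^^ m) x = x" for m by (induction m) simp_all
    then show ?thesis using n x(1) by metis
  qed
  then have "inj_on f (carrier N)" unfolding mod_hom_inj_iff[OF l l f] by blast
  then show "bij_betw f (carrier N) (carrier N)" by (rule inj_endomorphism_bij[OF fl f])
qed

text \<open>The identity of \<open>N\<close> is a sum of maps through members of \<open>S\<close>.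
  Since the endomorphism ring is local, one summand g f is bijective, and then the image of f is a
  complement of the kernel of g.\<close>

lemma indecomposable_in_add_summand:
  assumes ind: "indecomposable R N" and N: "in_add R S N"
  shows "\<exists>C\<in>S. direct_summand R N C"
proof -
  have fl: "finite_length_module R N" and nz: "carrier N \<noteq> {\<zero>\<^bsub>N\<^esub>}" using ind by (auto simp: indecomposable_def)
  note l = finite_length_left_module[OF fl]
  interpret N: left_module R N by (rule l)
  \<comment> \<open>Generalised from the identity to any bijective map in the ideal, so that the
    induction can discard one summand at a time.\<close>
  have "\<exists>C\<in>S. left_module R C \<and> (\<exists>f\<in>mod_hom R N C. \<exists>g\<in>mod_hom R C N. bij_betw (\<lambda>x\<in>carrier N. g (f x)) (carrier N) (carrier N))"
    if "\<theta> \<in> thru R S N N" "bij_betw \<theta> (carrier N) (carrier N)" for \<theta>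
    using that
  proof (induction rule: thru.induct)
    case thru_zero
    then have "(\<lambda>x\<in>carrier N. \<zero>\<^bsub>N\<^esub>) ` carrier N = carrier N" by (rule bij_betw_imp_surj_on)
    then have "carrier N \<subseteq> {\<zero>\<^bsub>N\<^esub>}" by auto
    then have "carrier N = {\<zero>\<^bsub>N\<^esub>}" using N.M.zero_closed by blast
    then show ?case using nz by simp
  next
    case (thru_step h C f g)
    have eq: "(\<lambda>x\<in>carrier N. h x \<oplus>\<^bsub>N\<^esub> g (f x)) = (\<lambda>x\<in>carrier N. h x \<oplus>\<^bsub>N\<^esub> (\<lambda>x\<in>carrier N. g (f x)) x)"
      by (intro restrict_ext) simp
    from indecomposable_local[OF ind thru_mod_hom[OF l l thru_step(1)] mod_hom_comp[OF l thru_step(3,4)]]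
    consider "bij_betw h (carrier N) (carrier N)" | "bij_betw (\<lambda>x\<in>carrier N. g (f x)) (carrier N) (carrier N)"
      using thru_step.prems unfolding eq by blast
    then show ?case
    proof cases
      case 1
      then show ?thesis by (rule thru_step.IH)
    next
      case 2
      then show ?thesis using thru_step(2-5) by blast
    qed
  qed
  moreover have "bij_betw (\<lambda>x\<in>carrier N. x) (carrier N) (carrier N)" by (auto simp: bij_betw_def inj_on_def)
  ultimately obtain C f g where C: "C \<in> S" "left_module R C" and f: "f \<in> mod_hom R N C" and g: "g \<in> mod_hom R C N"
    and w: "bij_betw (\<lambda>x\<in>carrier N. g (f x)) (carrier N) (carrier N)"
    using N unfolding in_add_def by blast
  interpret C: left_module R C by (rule C(2))
  have winj: "inj_on (\<lambda>x\<in>carrier N. g (f x)) (carrier N)" and wsurj: "(\<lambda>x\<in>carrier N. g (f x)) ` carrier N = carrier N"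
    using w by (auto simp: bij_betw_def)
  have finj: "inj_on f (carrier N)"
    by (rule inj_onI, rule inj_onD[OF winj]) simp_all
  let ?U = "f ` carrier N" and ?V = "{c \<in> carrier C. g c = \<zero>\<^bsub>N\<^esub>}"
  have sU: "submodule ?U R C" by (rule submodule_image[OF l C(2) f submodule_carrier[OF l]])
  have sV: "submodule ?V R C" by (rule submodule_kernel[OF C(2) l g])
  have "direct_sum_decomp R C ?U ?V" unfolding direct_sum_decomp_def
  proof (intro conjI sU sV)
    show "?U \<inter> ?V = {\<zero>\<^bsub>C\<^esub>}"
    proof
      show "{\<zero>\<^bsub>C\<^esub>} \<subseteq> ?U \<inter> ?V" using submodule_zero[OF C(2) sU] submodule_zero[OF C(2) sV] by blast
      show "?U \<inter> ?V \<subseteq> {\<zero>\<^bsub>C\<^esub>}"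
      proof
        fix c assume "c \<in> ?U \<inter> ?V"
        then obtain x where x: "x \<in> carrier N" "c = f x" "g (f x) = \<zero>\<^bsub>N\<^esub>" by auto
        have "(\<lambda>x\<in>carrier N. g (f x)) x = \<zero>\<^bsub>N\<^esub>" using x by simp
        then have "x = \<zero>\<^bsub>N\<^esub>"
          using winj x(1) unfolding mod_hom_inj_iff[OF l l mod_hom_comp[OF l f g]] by blast
        then show "c \<in> {\<zero>\<^bsub>C\<^esub>}" using x(2) mod_hom_zero[OF l C(2) f] by simp
      qed
    qed
    show "?U <+>\<^bsub>C\<^esub> ?V = carrier C"
    proof
      show "?U <+>\<^bsub>C\<^esub> ?V \<subseteq> carrier C" by (rule submodule_subset[OF C(2) submodule_set_add[OF C(2) sU sV]])
      show "carrier C \<subseteq> ?U <+>\<^bsub>C\<^esub> ?V"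
      proof
        fix c assume c: "c \<in> carrier C"
        have "g c \<in> (\<lambda>x\<in>carrier N. g (f x)) ` carrier N" unfolding wsurj by (rule mod_hom_closed[OF g c])
        then obtain x where x: "x \<in> carrier N" "g c = g (f x)" by auto
        have fx: "f x \<in> carrier C" by (rule mod_hom_closed[OF f x(1)])
        have "g (c \<ominus>\<^bsub>C\<^esub> f x) = \<zero>\<^bsub>N\<^esub>"
          using mod_hom_diff[OF C(2) l g c fx] x(2) mod_hom_closed[OF g fx] left_module_diff_eq_zero[OF l] by simp
        then have "c \<ominus>\<^bsub>C\<^esub> f x \<in> ?V" using c fx by (simp add: a_minus_def)
        moreover have "c = f x \<oplus>\<^bsub>C\<^esub> (c \<ominus>\<^bsub>C\<^esub> f x)"
          using c fx C.M.a_comm[of "f x" "c \<ominus>\<^bsub>C\<^esub> f x"] by (simp add: a_minus_def C.M.a_assoc C.M.l_neg)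
        ultimately show "c \<in> ?U <+>\<^bsub>C\<^esub> ?V" unfolding set_add_iff using x(1) by blast
      qed
    qed
  qed
  moreover have "mod_iso R N (C\<lparr>carrier := ?U\<rparr>)"
  proof -
    have "f \<in> mod_hom R N (C\<lparr>carrier := ?U\<rparr>)" using f by (auto simp: mod_hom_def PiE_def)
    moreover have "bij_betw f (carrier N) (carrier (C\<lparr>carrier := ?U\<rparr>))" using finj by (simp add: bij_betw_def)
    ultimately show ?thesis unfolding mod_iso_def by blast
  qed
  ultimately show ?thesis unfolding direct_summand_def using C(1) by blast
qed

section \<open>Reduction of add S to indecomposable modules\<close>

lemma in_add_direct_sum_decomp:
  fixes X :: "'r lmod"
  assumes X: "left_module R X" and d: "direct_sum_decomp R X U V"
    and "in_add R S (X\<lparr>carrier := U\<rparr>)" "in_add R S (X\<lparr>carrier := V\<rparr>)"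
  shows "in_add R S X"
proof -
  interpret X: left_module R X by (rule X)
  have sU: "submodule U R X" and sV: "submodule V R X" and int: "U \<inter> V = {\<zero>\<^bsub>X\<^esub>}" and sum: "U <+>\<^bsub>X\<^esub> V = carrier X"
    using d by (auto simp: direct_sum_decomp_def)
  let ?U = "X\<lparr>carrier := U\<rparr>" and ?V = "X\<lparr>carrier := V\<rparr>"
  note lU = left_module_submodule[OF X sU]
  note lV = left_module_submodule[OF X sV]
  note us = subsetD[OF submodule_subset[OF X sU]] and vs = subsetD[OF submodule_subset[OF X sV]]
  let ?D = "dsum ?U ?V"
  note D = dsum_left_module[OF lU lV]
  let ?s = "\<lambda>z\<in>carrier ?D. fst z \<oplus>\<^bsub>X\<^esub> snd z"
  have s: "?s \<in> mod_hom R ?D X"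
    using us vs by (intro mod_hom_restrictI[OF D]) (auto simp: dsum_def X.M.a_ac X.smult_r_distr)
  have "inj_on ?s (carrier ?D)" unfolding mod_hom_inj_iff[OF D X s]
  proof (intro ballI impI)
    fix z assume z: "z \<in> carrier ?D" "?s z = \<zero>\<^bsub>X\<^esub>"
    obtain u v where uv: "z = (u, v)" by (cases z)
    have m: "u \<in> U" "v \<in> V" "u \<oplus>\<^bsub>X\<^esub> v = \<zero>\<^bsub>X\<^esub>" using z uv by (auto simp: dsum_def)
    have "u = \<ominus>\<^bsub>X\<^esub> v" using m us vs by (metis X.M.minus_equality)
    then have "u \<in> V" using submodule_uminus[OF X sV m(2)] by simp
    then have u: "u = \<zero>\<^bsub>X\<^esub>" using m(1) int by blast
    then have "v = \<zero>\<^bsub>X\<^esub>" using m vs by simp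
    then show "z = \<zero>\<^bsub>?D\<^esub>" using u uv by (simp add: dsum_def)
  qed
  moreover have "?s ` carrier ?D = carrier X"
  proof
    show "?s ` carrier ?D \<subseteq> carrier X" using mod_hom_closed[OF s] by blast
    show "carrier X \<subseteq> ?s ` carrier ?D"
    proof
      fix x assume "x \<in> carrier X"
      then obtain u v where "u \<in> U" "v \<in> V" "x = u \<oplus>\<^bsub>X\<^esub> v" unfolding sum[symmetric] set_add_iff by blast
      then show "x \<in> ?s ` carrier ?D" by (intro image_eqI[of _ _ "(u, v)"]) (auto simp: dsum_def)
    qed
  qed
  ultimately have "bij_betw ?s (carrier ?D) (carrier X)" by (simp add: bij_betw_def)
  from mod_hom_inverse[OF D X s this] obtain g where
    g: "g \<in> mod_hom R X ?D" "\<And>x. x \<in> carrier X \<Longrightarrow> ?s (g x) = x" by blast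
  have i: "(\<lambda>x\<in>carrier ?U. x) \<in> mod_hom R ?U X"
    by (rule mod_hom_restrictI[OF lU]) (use us in auto)
  have j: "(\<lambda>x\<in>carrier ?V. x) \<in> mod_hom R ?V X"
    by (rule mod_hom_restrictI[OF lV]) (use vs in auto)
  show ?thesis
  proof (rule in_add_sum[OF X lU lV i j mod_hom_comp[OF X g(1) dsum_homs(3)[OF lU lV]]
        mod_hom_comp[OF X g(1) dsum_homs(4)[OF lU lV]] _ assms(3,4)])
    fix x assume x: "x \<in> carrier X"
    have gx: "g x \<in> carrier ?D" by (rule mod_hom_closed[OF g(1) x])
    then have "fst (g x) \<in> U" "snd (g x) \<in> V" by (auto simp: dsum_def)
    then show "(\<lambda>x\<in>carrier ?U. x) ((\<lambda>x\<in>carrier X. (\<lambda>z\<in>carrier ?D. fst z) (g x)) x) \<oplus>\<^bsub>X\<^esub>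
        (\<lambda>x\<in>carrier ?V. x) ((\<lambda>x\<in>carrier X. (\<lambda>z\<in>carrier ?D. snd z) (g x)) x) = x"
      using g(2)[OF x] x gx by simp
  qed
qed

text \<open>Induction on length through proper direct summands. \<open>P\<close> has to pass to
  submodules because the summands must satisfy it again; in the application it is cogeneration by a
  fixed module.\<close>

lemma in_add_if_indecomposables:
  fixes X :: "'r lmod"
  assumes X: "finite_length_module R X" "P X"
    and hered: "\<And>X U. finite_length_module R X \<Longrightarrow> P X \<Longrightarrow> submodule U R X \<Longrightarrow> P (X\<lparr>carrier := U\<rparr>)"
    and ind: "\<And>N. indecomposable R N \<Longrightarrow> P N \<Longrightarrow> in_add R S N"
  shows "in_add R S X"
  using X
proof (induction "len R X (carrier X)" arbitrary: X rule: less_induct)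
  case less
  note l = finite_length_left_module[OF less.prems(1)]
  show ?case
  proof (cases "carrier X = {\<zero>\<^bsub>X\<^esub>} \<or> indecomposable R X")
    case True
    then show ?thesis using in_add_zero[OF l] ind[OF _ less.prems(2)] by blast
  next
    case False
    then obtain U V where d: "direct_sum_decomp R X U V" and nz: "U \<noteq> {\<zero>\<^bsub>X\<^esub>}" "V \<noteq> {\<zero>\<^bsub>X\<^esub>}"
      using less.prems(1) unfolding indecomposable_def by blast
    have sU: "submodule U R X" and sV: "submodule V R X" and int: "U \<inter> V = {\<zero>\<^bsub>X\<^esub>}"
      using d by (auto simp: direct_sum_decomp_def)
    note sub = submodule_subset[OF l sU] submodule_subset[OF l sV]
    have "U \<noteq> carrier X" "V \<noteq> carrier X" using int nz sub by blast+
    then have lt: "len R X U < len R X (carrier X)" "len R X V < len R X (carrier X)"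
      using len_strict_mono[OF less.prems(1) sU submodule_carrier[OF l]]
        len_strict_mono[OF less.prems(1) sV submodule_carrier[OF l]] sub by blast+
    have leq: "len R (X\<lparr>carrier := W\<rparr>) (carrier (X\<lparr>carrier := W\<rparr>)) = len R X W" for W by (simp add: len_def)
    show ?thesis
      by (rule in_add_direct_sum_decomp[OF l d])
        (rule less.hyps[unfolded leq, OF _ finite_length_submodule[OF less.prems(1)] hered[OF less.prems]];
          use lt sU sV leq in simp)+
  qed
qed

lemma cogenerated_submodule:
  assumes "cogenerated R C X" "left_module R X" "submodule U R X"
  shows "cogenerated R C (X\<lparr>carrier := U\<rparr>)"
  unfolding cogenerated_def
proof (intro ballI impI)
  fix x assume x: "x \<in> carrier (X\<lparr>carrier := U\<rparr>)" "x \<noteq> \<zero>\<^bsub>X\<lparr>carrier := U\<rparr>\<^esub>"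
  have xX: "x \<in> carrier X" using x(1) submodule_subset[OF assms(2,3)] by auto
  then obtain f where f: "f \<in> mod_hom R X C" "f x \<noteq> \<zero>\<^bsub>C\<^esub>" using assms(1) x(2) unfolding cogenerated_def by auto
  have "(\<lambda>y\<in>carrier (X\<lparr>carrier := U\<rparr>). f y) \<in> mod_hom R (X\<lparr>carrier := U\<rparr>) C"
    using submodule_subset[OF assms(2,3)] mod_hom_closed[OF f(1)]
    by (intro mod_hom_restrictI[OF left_module_submodule[OF assms(2,3)]])
      (auto simp: mod_hom_add[OF f(1)] mod_hom_smult[OF f(1)] subset_iff)
  then show "\<exists>f\<in>mod_hom R (X\<lparr>carrier := U\<rparr>) C. f x \<noteq> \<zero>\<^bsub>C\<^esub>"
    using f(2) x(1) by (intro bexI) auto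
qed

section \<open>Global dimension of endomorphism rings\<close>

text \<open>The universal property of a quotient, phrased for any surjection with known kernel since
  quotients occur only in this form. Preimages are chosen, and the condition on kernels makes the
  choice irrelevant.\<close>

lemma mod_hom_factor:
  assumes M: "left_module R M" and N: "left_module R N" and L: "left_module R L"
    and b: "b \<in> mod_hom R M N" "b ` carrier M = carrier N" and f: "f \<in> mod_hom R M L"
    and k: "\<And>x. x \<in> carrier M \<Longrightarrow> b x = \<zero>\<^bsub>N\<^esub> \<Longrightarrow> f x = \<zero>\<^bsub>L\<^esub>"
  shows "\<exists>g\<in>mod_hom R N L. \<forall>x\<in>carrier M. g (b x) = f x"
proof -
  interpret M: left_module R M by (rule M)
  interpret L: left_module R L by (rule L)
  define s where "s y = (SOME x. x \<in> carrier M \<and> b x = y)" for y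
  have s: "s y \<in> carrier M \<and> b (s y) = y" if "y \<in> carrier N" for y
  proof -
    have "\<exists>x. x \<in> carrier M \<and> b x = y" using that unfolding b(2)[symmetric] by blast
    then show ?thesis unfolding s_def by (rule someI_ex)
  qed
  have eq: "f x = f x'" if "x \<in> carrier M" "x' \<in> carrier M" "b x = b x'" for x x'
  proof -
    have "b (x \<ominus>\<^bsub>M\<^esub> x') = \<zero>\<^bsub>N\<^esub>"
      using mod_hom_diff[OF M N b(1) that(1,2)] that(3) left_module_diff_eq_zero[OF N] mod_hom_closed[OF b(1) that(2)] by simp
    then have "f (x \<ominus>\<^bsub>M\<^esub> x') = \<zero>\<^bsub>L\<^esub>" using k that by (simp add: a_minus_def)
    then show ?thesis
      using mod_hom_diff[OF M L f that(1,2)] left_module_diff_eq_zero[OF L] mod_hom_closed[OF f] that by simp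
  qed
  have g: "f (s (b x)) = f x" if "x \<in> carrier M" for x
    using eq[of "s (b x)" x] s[OF mod_hom_closed[OF b(1) that]] that by blast
  have "(\<lambda>y\<in>carrier N. f (s y)) \<in> mod_hom R N L"
  proof (rule mod_hom_restrictI[OF N])
    show "f (s y) \<in> carrier L" if "y \<in> carrier N" for y using mod_hom_closed[OF f] s[OF that] by blast
    show "f (s (y \<oplus>\<^bsub>N\<^esub> z)) = f (s y) \<oplus>\<^bsub>L\<^esub> f (s z)" if y: "y \<in> carrier N" and z: "z \<in> carrier N" for y z
    proof -
      have m: "s y \<in> carrier M" "s z \<in> carrier M" using s[OF y] s[OF z] by auto
      have "f (s (b (s y \<oplus>\<^bsub>M\<^esub> s z))) = f (s y \<oplus>\<^bsub>M\<^esub> s z)" by (rule g) (use m in simp)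
      then show ?thesis using s[OF y] s[OF z] by (simp add: mod_hom_add[OF b(1) m] mod_hom_add[OF f m])
    qed
    show "f (s (a \<odot>\<^bsub>N\<^esub> y)) = a \<odot>\<^bsub>L\<^esub> f (s y)" if a: "a \<in> carrier R" and y: "y \<in> carrier N" for a y
    proof -
      have m: "s y \<in> carrier M" using s[OF y] by auto
      have "f (s (b (a \<odot>\<^bsub>M\<^esub> s y))) = f (a \<odot>\<^bsub>M\<^esub> s y)" by (rule g) (use m a in simp)
      then show ?thesis using s[OF y] by (simp add: mod_hom_smult[OF b(1) a m] mod_hom_smult[OF f a m])
    qed
  qed
  then show ?thesis using g mod_hom_closed[OF b(1)] by (intro bexI[of _ "\<lambda>y\<in>carrier N. f (s y)"]) auto
qed

section \<open>Projective modules and resolutions of length three\<close>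

lemma projective_mod_iso:
  assumes P: "projective_mod R P" and Q: "left_module R Q"
    and f: "f \<in> mod_hom R P Q" "bij_betw f (carrier P) (carrier Q)"
  shows "projective_mod R Q"
proof -
  have fP: "finite_length_module R P" using P by (simp add: projective_mod_def)
  note lP = finite_length_left_module[OF fP]
  obtain g where g: "g \<in> mod_hom R Q P" "\<And>y. y \<in> carrier Q \<Longrightarrow> f (g y) = y"
    using mod_hom_inverse[OF lP Q f] by blast
  have fQ: "finite_length_module R Q"
    by (rule finite_length_surj[OF fP Q f(1)]) (use f(2) in \<open>simp add: bij_betw_def\<close>)
  have "\<exists>h\<in>mod_hom R Q A. \<forall>x\<in>carrier Q. s (h x) = t x"
    if A: "finite_length_module R A" and B: "finite_length_module R B" and s: "s \<in> mod_hom R A B"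
      and t: "t \<in> mod_hom R Q B" and surj: "s ` carrier A = carrier B" for A B :: "('a, 'a list) module" and s t
  proof -
    have "(\<lambda>x\<in>carrier P. t (f x)) \<in> mod_hom R P B" by (rule mod_hom_comp[OF lP f(1) t])
    then obtain h where h: "h \<in> mod_hom R P A" "\<forall>x\<in>carrier P. s (h x) = (\<lambda>x\<in>carrier P. t (f x)) x"
      using P A B s surj unfolding projective_mod_def by blast
    have "(\<lambda>y\<in>carrier Q. h (g y)) \<in> mod_hom R Q A" by (rule mod_hom_comp[OF Q g(1) h(1)])
    moreover have "\<forall>y\<in>carrier Q. s ((\<lambda>y\<in>carrier Q. h (g y)) y) = t y"
      using h(2) g(2) mod_hom_closed[OF g(1)] by simp
    ultimately show ?thesis by blast
  qed
  then show ?thesis unfolding projective_mod_def using fQ by blast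
qed

lemma projective_mod_zero:
  assumes "finite_length_module R P" "carrier P = {\<zero>\<^bsub>P\<^esub>}"
  shows "projective_mod R P"
proof -
  note l = finite_length_left_module[OF assms(1)]
  have "\<exists>h\<in>mod_hom R P A. \<forall>x\<in>carrier P. s (h x) = t x"
    if A: "finite_length_module R A" and B: "finite_length_module R B" and s: "s \<in> mod_hom R A B"
      and t: "t \<in> mod_hom R P B" for A B :: "('a, 'a list) module" and s t
  proof -
    note lA = finite_length_left_module[OF A] and lB = finite_length_left_module[OF B]
    show ?thesis
      using mod_hom_zero[OF lA lB s] mod_hom_zero[OF l lB t] assms(2)
      by (intro bexI[OF _ mod_hom_const_zero[OF l lA]]) simp
  qed
  then show ?thesis unfolding projective_mod_def using assms(1) by blast
qed

text \<open>The terms of a \<open>projective_resolution\<close> must be modules on lists, whereas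
  the projectives over an endomorphism ring arise as sets of functions. Both copying maps are kept
  in order to conjugate differentials.\<close>

lemma projective_mod_on_lists:
  fixes P :: "('r, 'm, 'd) module_scheme"
  assumes P: "projective_mod R P"
  obtains Q :: "'r lmod" and f g where "projective_mod R Q" "f \<in> mod_hom R P Q" "g \<in> mod_hom R Q P"
    "\<And>x. x \<in> carrier P \<Longrightarrow> g (f x) = x" "\<And>y. y \<in> carrier Q \<Longrightarrow> f (g y) = y"
proof -
  have fP: "finite_length_module R P" using P by (simp add: projective_mod_def)
  note lP = finite_length_left_module[OF fP]
  obtain Q :: "'r lmod" and f where Q: "finite_length_module R Q"
    and f: "f \<in> mod_hom R P Q" "bij_betw f (carrier P) (carrier Q)"
    using finite_length_module_on_lists[OF fP] unfolding mod_iso_def by blast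
  note lQ = finite_length_left_module[OF Q]
  obtain g where g: "g \<in> mod_hom R Q P" "\<forall>x\<in>carrier P. g (f x) = x" "\<forall>y\<in>carrier Q. f (g y) = y"
    using mod_hom_inverse[OF lP lQ f] by blast
  show ?thesis
  proof (rule that)
    show "projective_mod R Q" by (rule projective_mod_iso[OF P lQ f])
    show "f \<in> mod_hom R P Q" by (rule f(1))
    show "g \<in> mod_hom R Q P" by (rule g(1))
    show "g (f x) = x" if "x \<in> carrier P" for x using g(2) that by simp
    show "f (g y) = y" if "y \<in> carrier Q" for y using g(3) that by simp
  qed
qed

lemma image_conjugate:
  assumes d: "d \<in> mod_hom R A B" and a: "a' \<in> mod_hom R A' A" "a \<in> mod_hom R A A'" "\<And>x. x \<in> carrier A \<Longrightarrow> a' (a x) = x"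
  shows "(\<lambda>x\<in>carrier A'. b (d (a' x))) ` carrier A' = b ` d ` carrier A"
proof
  show "(\<lambda>x\<in>carrier A'. b (d (a' x))) ` carrier A' \<subseteq> b ` d ` carrier A"
    using mod_hom_closed[OF a(1)] by auto
  show "b ` d ` carrier A \<subseteq> (\<lambda>x\<in>carrier A'. b (d (a' x))) ` carrier A'"
  proof clarify
    fix x assume "x \<in> carrier A"
    then show "b (d x) \<in> (\<lambda>x\<in>carrier A'. b (d (a' x))) ` carrier A'"
      using mod_hom_closed[OF a(2)] a(3) by (intro image_eqI[of _ _ "a x"]) auto
  qed
qed

text \<open>Exactness is given for projectives over an arbitrary type. Each is replaced by its copy
  on lists, the differentials are conjugated by the copying maps, and zero modules continue the
  sequence beyond degree 3.\<close>

lemma proj_dim_le_3: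
  fixes Z :: "('r, 'm, 'd) module_scheme" and Q0 Q1 Q2 Q3 :: "('r, 'n) module"
  assumes R: "ring R" and Z: "left_module R Z"
    and Q: "projective_mod R Q0" "projective_mod R Q1" "projective_mod R Q2" "projective_mod R Q3"
    and F: "F0 \<in> mod_hom R Q0 Z" "F1 \<in> mod_hom R Q1 Q0" "F2 \<in> mod_hom R Q2 Q1" "F3 \<in> mod_hom R Q3 Q2"
    and ex: "F0 ` carrier Q0 = carrier Z" "F1 ` carrier Q1 = {x \<in> carrier Q0. F0 x = \<zero>\<^bsub>Z\<^esub>}"
      "F2 ` carrier Q2 = {x \<in> carrier Q1. F1 x = \<zero>\<^bsub>Q0\<^esub>}" "F3 ` carrier Q3 = {x \<in> carrier Q2. F2 x = \<zero>\<^bsub>Q1\<^esub>}"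
      "inj_on F3 (carrier Q3)"
  shows "proj_dim R Z \<le> 3"
proof -
  have lQ: "left_module R Q0" "left_module R Q1" "left_module R Q2" "left_module R Q3"
    using Q by (auto simp: projective_mod_def intro: finite_length_left_module)
  obtain P0 :: "'r lmod" and a0 b0 where P0: "projective_mod R P0" "a0 \<in> mod_hom R Q0 P0" "b0 \<in> mod_hom R P0 Q0"
    "\<And>x. x \<in> carrier Q0 \<Longrightarrow> b0 (a0 x) = x" "\<And>y. y \<in> carrier P0 \<Longrightarrow> a0 (b0 y) = y"
    by (rule projective_mod_on_lists[OF Q(1)]) (rule that)
  obtain P1 :: "'r lmod" and a1 b1 where P1: "projective_mod R P1" "a1 \<in> mod_hom R Q1 P1" "b1 \<in> mod_hom R P1 Q1"
    "\<And>x. x \<in> carrier Q1 \<Longrightarrow> b1 (a1 x) = x" "\<And>y. y \<in> carrier P1 \<Longrightarrow> a1 (b1 y) = y"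
    by (rule projective_mod_on_lists[OF Q(2)]) (rule that)
  obtain P2 :: "'r lmod" and a2 b2 where P2: "projective_mod R P2" "a2 \<in> mod_hom R Q2 P2" "b2 \<in> mod_hom R P2 Q2"
    "\<And>x. x \<in> carrier Q2 \<Longrightarrow> b2 (a2 x) = x" "\<And>y. y \<in> carrier P2 \<Longrightarrow> a2 (b2 y) = y"
    by (rule projective_mod_on_lists[OF Q(3)]) (rule that)
  obtain P3 :: "'r lmod" and a3 b3 where P3: "projective_mod R P3" "a3 \<in> mod_hom R Q3 P3" "b3 \<in> mod_hom R P3 Q3"
    "\<And>x. x \<in> carrier Q3 \<Longrightarrow> b3 (a3 x) = x" "\<And>y. y \<in> carrier P3 \<Longrightarrow> a3 (b3 y) = y"
    by (rule projective_mod_on_lists[OF Q(4)]) (rule that)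
  have lP: "left_module R P0" "left_module R P1" "left_module R P2" "left_module R P3"
    using P0(1) P1(1) P2(1) P3(1) by (auto simp: projective_mod_def intro: finite_length_left_module)
  obtain N :: "'r lmod" where N: "finite_length_module R N" "carrier N = {\<zero>\<^bsub>N\<^esub>}"
    using zero_module_exists[OF R] by auto
  note lN = finite_length_left_module[OF N(1)]
  define e0 where "e0 = (\<lambda>x\<in>carrier P0. F0 (b0 x))"
  define d0 where "d0 = (\<lambda>x\<in>carrier P1. a0 (F1 (b1 x)))"
  define d1 where "d1 = (\<lambda>x\<in>carrier P2. a1 (F2 (b2 x)))"
  define d2 where "d2 = (\<lambda>x\<in>carrier P3. a2 (F3 (b3 x)))"
  have conj: "(\<lambda>x\<in>carrier A'. b (d (a' x))) \<in> mod_hom R A' B'"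
    if "left_module R A'" "a' \<in> mod_hom R A' A" "d \<in> mod_hom R A B" "b \<in> mod_hom R B B'"
    for A' B' :: "'r lmod" and A B :: "('r, 'n) module" and a' d b
  proof -
    have eq: "(\<lambda>x\<in>carrier A'. b ((\<lambda>x\<in>carrier A'. d (a' x)) x)) = (\<lambda>x\<in>carrier A'. b (d (a' x)))"
      by (intro restrict_ext) simp
    show ?thesis using mod_hom_comp[OF that(1) mod_hom_comp[OF that(1,2,3)] that(4)] unfolding eq .
  qed
  have e0: "e0 \<in> mod_hom R P0 Z" unfolding e0_def by (rule mod_hom_comp[OF lP(1) P0(3) F(1)])
  have d0: "d0 \<in> mod_hom R P1 P0" unfolding d0_def by (rule conj[OF lP(2) P1(3) F(2) P0(2)])
  have d1: "d1 \<in> mod_hom R P2 P1" unfolding d1_def by (rule conj[OF lP(3) P2(3) F(3) P1(2)])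
  have d2: "d2 \<in> mod_hom R P3 P2" unfolding d2_def by (rule conj[OF lP(4) P3(3) F(4) P2(2)])
  have a_inj: "a x = \<zero>\<^bsub>B'\<^esub> \<longleftrightarrow> x = \<zero>\<^bsub>B\<^esub>"
    if "left_module R B" "left_module R B'" "a \<in> mod_hom R B B'" "b \<in> mod_hom R B' B"
      "\<And>x. x \<in> carrier B \<Longrightarrow> b (a x) = x" "x \<in> carrier B"
    for B :: "('r, 'n) module" and B' :: "'r lmod" and a b x
    using mod_hom_zero[OF that(1,2,3)] mod_hom_zero[OF that(2,1,4)] that(5,6) by metis
  have ker: "{y \<in> carrier A'. d (b y) = z} = a ` {x \<in> carrier A. d x = z}"
    if "a \<in> mod_hom R A A'" "b \<in> mod_hom R A' A" "\<And>x. x \<in> carrier A \<Longrightarrow> b (a x) = x"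
      "\<And>y. y \<in> carrier A' \<Longrightarrow> a (b y) = y"
    for A :: "('r, 'n) module" and A' :: "'r lmod" and a b z and d :: "'n \<Rightarrow> 'z"
  proof
    show "{y \<in> carrier A'. d (b y) = z} \<subseteq> a ` {x \<in> carrier A. d x = z}"
    proof
      fix y assume "y \<in> {y \<in> carrier A'. d (b y) = z}"
      then show "y \<in> a ` {x \<in> carrier A. d x = z}"
        using that(4) mod_hom_closed[OF that(2)] by (intro image_eqI[of _ _ "b y"]) auto
    qed
    show "a ` {x \<in> carrier A. d x = z} \<subseteq> {y \<in> carrier A'. d (b y) = z}"
      using that(3) mod_hom_closed[OF that(1)] by auto
  qed
  have x0: "e0 ` carrier P0 = carrier Z"
    using image_conjugate[OF F(1) P0(3,2,4), of "\<lambda>x. x"] ex(1) by (simp add: e0_def)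
  have x1: "d0 ` carrier P1 = {x \<in> carrier P0. e0 x = \<zero>\<^bsub>Z\<^esub>}"
  proof -
    have "d0 ` carrier P1 = a0 ` {x \<in> carrier Q0. F0 x = \<zero>\<^bsub>Z\<^esub>}"
      using image_conjugate[OF F(2) P1(3,2,4), of a0] ex(2) by (simp add: d0_def)
    also have "\<dots> = {x \<in> carrier P0. F0 (b0 x) = \<zero>\<^bsub>Z\<^esub>}" by (rule ker[OF P0(2-5), symmetric])
    also have "\<dots> = {x \<in> carrier P0. e0 x = \<zero>\<^bsub>Z\<^esub>}" by (auto simp: e0_def)
    finally show ?thesis .
  qed
  have x2: "d1 ` carrier P2 = {x \<in> carrier P1. d0 x = \<zero>\<^bsub>P0\<^esub>}"
  proof -
    have "d1 ` carrier P2 = a1 ` {x \<in> carrier Q1. F1 x = \<zero>\<^bsub>Q0\<^esub>}"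
      using image_conjugate[OF F(3) P2(3,2,4), of a1] ex(3) by (simp add: d1_def)
    also have "\<dots> = {x \<in> carrier P1. F1 (b1 x) = \<zero>\<^bsub>Q0\<^esub>}" by (rule ker[OF P1(2-5), symmetric])
    also have "\<dots> = {x \<in> carrier P1. d0 x = \<zero>\<^bsub>P0\<^esub>}"
      using a_inj[OF lQ(1) lP(1) P0(2,3,4)] mod_hom_closed[OF F(2) mod_hom_closed[OF P1(3)]]
      by (intro Collect_cong conj_cong refl) (simp add: d0_def)
    finally show ?thesis .
  qed
  have x3: "d2 ` carrier P3 = {x \<in> carrier P2. d1 x = \<zero>\<^bsub>P1\<^esub>}"
  proof -
    have "d2 ` carrier P3 = a2 ` {x \<in> carrier Q2. F2 x = \<zero>\<^bsub>Q1\<^esub>}"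
      using image_conjugate[OF F(4) P3(3,2,4), of a2] ex(4) by (simp add: d2_def)
    also have "\<dots> = {x \<in> carrier P2. F2 (b2 x) = \<zero>\<^bsub>Q1\<^esub>}" by (rule ker[OF P2(2-5), symmetric])
    also have "\<dots> = {x \<in> carrier P2. d1 x = \<zero>\<^bsub>P1\<^esub>}"
      using a_inj[OF lQ(2) lP(2) P1(2,3,4)] mod_hom_closed[OF F(3) mod_hom_closed[OF P2(3)]]
      by (intro Collect_cong conj_cong refl) (simp add: d1_def)
    finally show ?thesis .
  qed
  \<comment> \<open>Injectivity of \<open>F3\<close> becomes exactness in degree 3, where the
    incoming map starts at a zero module.\<close>
  have x4: "{\<zero>\<^bsub>P3\<^esub>} = {x \<in> carrier P3. d2 x = \<zero>\<^bsub>P2\<^esub>}"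
  proof
    show "{\<zero>\<^bsub>P3\<^esub>} \<subseteq> {x \<in> carrier P3. d2 x = \<zero>\<^bsub>P2\<^esub>}"
      using submodule_zero[OF lP(4) submodule_carrier[OF lP(4)]] mod_hom_zero[OF lP(4,3) d2] by simp
    show "{x \<in> carrier P3. d2 x = \<zero>\<^bsub>P2\<^esub>} \<subseteq> {\<zero>\<^bsub>P3\<^esub>}"
    proof
      fix x assume "x \<in> {x \<in> carrier P3. d2 x = \<zero>\<^bsub>P2\<^esub>}"
      then have x: "x \<in> carrier P3" "a2 (F3 (b3 x)) = \<zero>\<^bsub>P2\<^esub>" by (auto simp: d2_def)
      have b3x: "b3 x \<in> carrier Q3" by (rule mod_hom_closed[OF P3(3) x(1)])
      have "F3 (b3 x) = \<zero>\<^bsub>Q2\<^esub>" using a_inj[OF lQ(3) lP(3) P2(2,3,4) mod_hom_closed[OF F(4) b3x]] x(2) by blast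
      then have "b3 x = \<zero>\<^bsub>Q3\<^esub>" using ex(5) b3x unfolding mod_hom_inj_iff[OF lQ(4,3) F(4)] by blast
      then have "x = a3 \<zero>\<^bsub>Q3\<^esub>" using P3(5)[OF x(1)] by simp
      then show "x \<in> {\<zero>\<^bsub>P3\<^esub>}" using mod_hom_zero[OF lQ(4) lP(4) P3(2)] by simp
    qed
  qed
  define P where "P i = (if i = 0 then P0 else if i = 1 then P1 else if i = 2 then P2 else if i = 3 then P3 else N)" for i :: nat
  define d where "d i = (if i = 0 then d0 else if i = 1 then d1 else if i = 2 then d2
    else (\<lambda>x\<in>carrier (P (Suc i)). \<zero>\<^bsub>P i\<^esub>))" for i :: nat
  have P_simps: "P 0 = P0" "P (Suc 0) = P1" "P 2 = P2" "P (Suc (Suc 0)) = P2" "P 3 = P3"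
    "P (Suc (Suc (Suc 0))) = P3" "\<And>i. 3 < i \<Longrightarrow> P i = N" by (auto simp: P_def)
  have d_simps: "d 0 = d0" "d (Suc 0) = d1" "d (Suc (Suc 0)) = d2"
    "\<And>i. 2 < i \<Longrightarrow> d i = (\<lambda>x\<in>carrier (P (Suc i)). \<zero>\<^bsub>P i\<^esub>)" by (auto simp: d_def)
  have lPi: "left_module R (P i)" for i using lP lN by (simp add: P_def)
  have three: "i = 0 \<or> i = Suc 0 \<or> i = Suc (Suc 0) \<or> 2 < i" for i :: nat by arith
  have "projective_resolution R Z 3 P d e0"
    unfolding projective_resolution_def
  proof (intro conjI allI impI)
    show "projective_mod R (P i)" for i
      using P0(1) P1(1) P2(1) P3(1) projective_mod_zero[OF N] by (simp add: P_def)
    show "carrier (P i) = {\<zero>\<^bsub>P i\<^esub>}" if "3 < i" for i using that N(2) by (simp add: P_simps)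
    show "e0 \<in> mod_hom R (P 0) Z" using e0 by (simp add: P_simps)
    show "d i \<in> mod_hom R (P (Suc i)) (P i)" for i
      using three[of i] d0 d1 d2 mod_hom_const_zero[OF lPi[of "Suc i"] lPi[of i]]
      by (elim disjE) (simp_all only: d_simps P_simps)
    show "e0 ` carrier (P 0) = carrier Z" using x0 by (simp add: P_simps)
    show "d 0 ` carrier (P 1) = {x \<in> carrier (P 0). e0 x = \<zero>\<^bsub>Z\<^esub>}" using x1 by (simp add: P_simps d_simps)
    show "d (Suc i) ` carrier (P (Suc (Suc i))) = {x \<in> carrier (P (Suc i)). d i x = \<zero>\<^bsub>P i\<^esub>}" for i
    proof (cases "2 \<le> i")
      case True
      then have "P (Suc (Suc i)) = N" "d (Suc i) = (\<lambda>x\<in>carrier N. \<zero>\<^bsub>P (Suc i)\<^esub>)" by (simp_all add: P_simps d_simps)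
      then have im: "d (Suc i) ` carrier (P (Suc (Suc i))) = {\<zero>\<^bsub>P (Suc i)\<^esub>}" using N(2) by simp
      show ?thesis
      proof (cases "i = 2")
        case True
        then have "i = Suc (Suc 0)" by simp
        then show ?thesis unfolding im using x4 by (simp only: P_simps d_simps)
      next
        case False
        then have i: "2 < i" using \<open>2 \<le> i\<close> by simp
        then have "P (Suc i) = N" by (simp add: P_simps)
        then show ?thesis unfolding im d_simps(4)[OF i] using N(2) by auto
      qed
    next
      case False
      then have "i = 0 \<or> i = Suc 0" by arith
      then show ?thesis
      proof
        assume i: "i = 0"
        show ?thesis using x2 by (simp only: i P_simps d_simps)
      next
        assume i: "i = Suc 0"
        show ?thesis using x3 by (simp only: i P_simps d_simps)
      qed
    qed
  qed
  then have "proj_dim R Z \<le> enat 3" unfolding proj_dim_def by (intro Inf_lower) blast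
  then show ?thesis by (simp add: numeral_eq_enat)
qed

section \<open>Maps into M as left modules over End(M)\<close>

definition hom_into :: "('r, 'c) ring_scheme \<Rightarrow> 'r lmod \<Rightarrow> 'r lmod \<Rightarrow> ('r list \<Rightarrow> 'r list, 'r list \<Rightarrow> 'r list) module"
  where "hom_into R M A = hom_mod R A M (\<lambda>e f. \<lambda>x\<in>carrier A. e (f x))"

lemma hom_into_simps [simp]:
  "carrier (hom_into R M A) = mod_hom R A M"
  "\<zero>\<^bsub>hom_into R M A\<^esub> = (\<lambda>x\<in>carrier A. \<zero>\<^bsub>M\<^esub>)"
  "f \<oplus>\<^bsub>hom_into R M A\<^esub> g = (\<lambda>x\<in>carrier A. f x \<oplus>\<^bsub>M\<^esub> g x)"
  "e \<odot>\<^bsub>hom_into R M A\<^esub> f = (\<lambda>x\<in>carrier A. e (f x))"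
  by (simp_all only: hom_into_def hom_mod_simps)

lemma End_ring_simps [simp]:
  "carrier (End_ring R M) = mod_hom R M M"
  "\<zero>\<^bsub>End_ring R M\<^esub> = (\<lambda>x\<in>carrier M. \<zero>\<^bsub>M\<^esub>)"
  "\<one>\<^bsub>End_ring R M\<^esub> = (\<lambda>x\<in>carrier M. x)"
  "f \<oplus>\<^bsub>End_ring R M\<^esub> g = (\<lambda>x\<in>carrier M. f x \<oplus>\<^bsub>M\<^esub> g x)"
  "f \<otimes>\<^bsub>End_ring R M\<^esub> g = (\<lambda>x\<in>carrier M. f (g x))"
  by (simp_all add: End_ring_def compose_def)

lemma ring_End_ring:
  assumes M: "left_module R M"
  shows "ring (End_ring R M)"
proof (rule ringI)
  interpret M: left_module R M by (rule M)
  note c = mod_hom_closed[of _ R M M]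
  have "abelian_group (hom_mod R M M (\<lambda>_ f. f))" by (rule abelian_group_hom_mod[OF M M])
  then interpret H: abelian_group "hom_mod R M M (\<lambda>_ f. f)" .
  show "abelian_group (End_ring R M)"
  proof (rule abelian_groupI)
    show "f \<oplus>\<^bsub>End_ring R M\<^esub> g \<in> carrier (End_ring R M)"
      if "f \<in> carrier (End_ring R M)" "g \<in> carrier (End_ring R M)" for f g
      using H.a_closed[of f g] that by simp
    show "\<zero>\<^bsub>End_ring R M\<^esub> \<in> carrier (End_ring R M)" using H.zero_closed by simp
    show "f \<oplus>\<^bsub>End_ring R M\<^esub> g \<oplus>\<^bsub>End_ring R M\<^esub> h = f \<oplus>\<^bsub>End_ring R M\<^esub> (g \<oplus>\<^bsub>End_ring R M\<^esub> h)"
      if "f \<in> carrier (End_ring R M)" "g \<in> carrier (End_ring R M)" "h \<in> carrier (End_ring R M)" for f g h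
      using H.a_assoc[of f g h] that unfolding hom_mod_simps End_ring_simps by blast
    show "f \<oplus>\<^bsub>End_ring R M\<^esub> g = g \<oplus>\<^bsub>End_ring R M\<^esub> f"
      if "f \<in> carrier (End_ring R M)" "g \<in> carrier (End_ring R M)" for f g
      using H.a_comm[of f g] that unfolding hom_mod_simps End_ring_simps by blast
    show "\<zero>\<^bsub>End_ring R M\<^esub> \<oplus>\<^bsub>End_ring R M\<^esub> f = f" if "f \<in> carrier (End_ring R M)" for f
      using H.l_zero[of f] that unfolding hom_mod_simps End_ring_simps by blast
    show "\<exists>g\<in>carrier (End_ring R M). g \<oplus>\<^bsub>End_ring R M\<^esub> f = \<zero>\<^bsub>End_ring R M\<^esub>"
      if "f \<in> carrier (End_ring R M)" for f
      using H.add.l_inv_ex[of f] that unfolding hom_mod_simps End_ring_simps by (auto simp: hom_mod_def)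
  qed
  show "monoid (End_ring R M)"
  proof (rule monoidI)
    show "f \<otimes>\<^bsub>End_ring R M\<^esub> g \<in> carrier (End_ring R M)"
      if "f \<in> carrier (End_ring R M)" "g \<in> carrier (End_ring R M)" for f g
      using mod_hom_comp[OF M, of g M f M] that by simp
    show "\<one>\<^bsub>End_ring R M\<^esub> \<in> carrier (End_ring R M)" using mod_hom_id[OF M] by simp
    show "f \<otimes>\<^bsub>End_ring R M\<^esub> g \<otimes>\<^bsub>End_ring R M\<^esub> h = f \<otimes>\<^bsub>End_ring R M\<^esub> (g \<otimes>\<^bsub>End_ring R M\<^esub> h)"
      if "f \<in> carrier (End_ring R M)" "g \<in> carrier (End_ring R M)" "h \<in> carrier (End_ring R M)" for f g h
      unfolding End_ring_simps using that c by (intro restrict_ext) simp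
    show "\<one>\<^bsub>End_ring R M\<^esub> \<otimes>\<^bsub>End_ring R M\<^esub> f = f" if f: "f \<in> carrier (End_ring R M)" for f
    proof -
      have "\<one>\<^bsub>End_ring R M\<^esub> \<otimes>\<^bsub>End_ring R M\<^esub> f = restrict f (carrier M)"
        unfolding End_ring_simps using f c by (intro restrict_ext) simp
      then show ?thesis using f mod_hom_restrict[of f R M M] by simp
    qed
    show "f \<otimes>\<^bsub>End_ring R M\<^esub> \<one>\<^bsub>End_ring R M\<^esub> = f" if f: "f \<in> carrier (End_ring R M)" for f
    proof -
      have "f \<otimes>\<^bsub>End_ring R M\<^esub> \<one>\<^bsub>End_ring R M\<^esub> = restrict f (carrier M)"
        unfolding End_ring_simps by (intro restrict_ext) simp
      then show ?thesis using f mod_hom_restrict[of f R M M] by simp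
    qed
  qed
  show "(f \<oplus>\<^bsub>End_ring R M\<^esub> g) \<otimes>\<^bsub>End_ring R M\<^esub> h = f \<otimes>\<^bsub>End_ring R M\<^esub> h \<oplus>\<^bsub>End_ring R M\<^esub> g \<otimes>\<^bsub>End_ring R M\<^esub> h"
    if "f \<in> carrier (End_ring R M)" "g \<in> carrier (End_ring R M)" "h \<in> carrier (End_ring R M)" for f g h
    unfolding End_ring_simps using that c by (intro restrict_ext) simp
  show "h \<otimes>\<^bsub>End_ring R M\<^esub> (f \<oplus>\<^bsub>End_ring R M\<^esub> g) = h \<otimes>\<^bsub>End_ring R M\<^esub> f \<oplus>\<^bsub>End_ring R M\<^esub> h \<otimes>\<^bsub>End_ring R M\<^esub> g"
    if "f \<in> carrier (End_ring R M)" "g \<in> carrier (End_ring R M)" "h \<in> carrier (End_ring R M)" for f g h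
    unfolding End_ring_simps using that c by (intro restrict_ext) (simp add: mod_hom_add[of h R M M])
qed

lemma left_module_hom_into:
  assumes A: "left_module R A" and M: "left_module R M"
  shows "left_module (End_ring R M) (hom_into R M A)"
  unfolding hom_into_def
proof (intro left_module_hom_mod A M ring_End_ring)
  note c = mod_hom_closed[of _ R A M]
  show "(\<lambda>x\<in>carrier A. e (f x)) \<in> mod_hom R A M" if "e \<in> carrier (End_ring R M)" "f \<in> mod_hom R A M" for e f
    using mod_hom_comp[OF A that(2), of e M] that(1) by simp
qed (use mod_hom_closed[of _ R A M] in \<open>simp_all add: mod_hom_add[of _ R M M]\<close>)

text \<open>The \<open>f\<close> below is \<open>End(M)\<close>-linear, so its value on maps factoring through \<open>M\<close> is determined by
  finitely many elements.\<close>

lemma hom_into_lift: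
  assumes A: "left_module R A" and M: "left_module R M"
    and X: "left_module (End_ring R M) X" and Y: "left_module (End_ring R M) Y"
    and g: "g \<in> mod_hom (End_ring R M) X Y" "g ` carrier X = carrier Y"
    and f: "f \<in> mod_hom (End_ring R M) (hom_into R M A) Y"
    and \<theta>: "\<theta> \<in> thru R {M} A A"
  shows "\<exists>L\<in>mod_hom (End_ring R M) (hom_into R M A) X.
    \<forall>\<phi>\<in>mod_hom R A M. g (L \<phi>) = f (\<lambda>x\<in>carrier A. \<phi> (\<theta> x))"
  using \<theta>
proof (induction rule: thru.induct)
  let ?E = "End_ring R M" and ?H = "hom_into R M A"
  note H = left_module_hom_into[OF A M]
  interpret X: left_module ?E X by (rule X)
  interpret Y: left_module ?E Y by (rule Y)
  case thru_zero
  have "(\<lambda>x\<in>carrier A. \<phi> ((\<lambda>x\<in>carrier A. \<zero>\<^bsub>A\<^esub>) x)) = \<zero>\<^bsub>?H\<^esub>" if "\<phi> \<in> mod_hom R A M" for \<phi>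
    unfolding hom_into_simps using mod_hom_zero[OF A M that] by (intro restrict_ext) simp
  then have "\<forall>\<phi>\<in>mod_hom R A M. g ((\<lambda>\<phi>\<in>carrier ?H. \<zero>\<^bsub>X\<^esub>) \<phi>) = f (\<lambda>x\<in>carrier A. \<phi> ((\<lambda>x\<in>carrier A. \<zero>\<^bsub>A\<^esub>) x))"
    using mod_hom_zero[OF X Y g(1)] mod_hom_zero[OF H Y f] by simp
  then show ?case using mod_hom_const_zero[OF H X] by blast
next
  let ?E = "End_ring R M" and ?H = "hom_into R M A"
  note H = left_module_hom_into[OF A M]
  interpret M: left_module R M by (rule M)
  interpret X: left_module ?E X by (rule X)
  interpret Y: left_module ?E Y by (rule Y)
  case (thru_step h C f' g')
  have C: "C = M" using thru_step(2) by simp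
  note h = thru_mod_hom[OF A A thru_step(1)]
  have f': "f' \<in> mod_hom R A M" and g': "g' \<in> mod_hom R M A" using thru_step(3,4) C by auto
  obtain L where L: "L \<in> mod_hom ?E ?H X" "\<And>\<phi>. \<phi> \<in> mod_hom R A M \<Longrightarrow> g (L \<phi>) = f (\<lambda>x\<in>carrier A. \<phi> (h x))"
    using thru_step.IH by blast
  have "f f' \<in> g ` carrier X" unfolding g(2) using mod_hom_closed[OF f, of f'] f' by simp
  \<comment> \<open>The new summand \<phi> g' f' is the multiple of f' by the endomorphism
    \<open>e \<phi>\<close> = \<phi> g'. As b lies over the value of f at f', adding
    \<open>e \<phi>\<close> times b to the previous lift lifts the new summand.\<close>
  then obtain b where b: "b \<in> carrier X" "g b = f f'" by auto
  define e where "e \<phi> = (\<lambda>m\<in>carrier M. \<phi> (g' m))" for \<phi> :: "'a list \<Rightarrow> 'a list"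
  have eE: "e \<phi> \<in> carrier ?E" if "\<phi> \<in> mod_hom R A M" for \<phi>
    unfolding e_def End_ring_simps by (rule mod_hom_comp[OF M g' that])
  let ?L = "\<lambda>\<phi>\<in>carrier ?H. L \<phi> \<oplus>\<^bsub>X\<^esub> e \<phi> \<odot>\<^bsub>X\<^esub> b"
  have "?L \<in> mod_hom ?E ?H X"
  proof (rule mod_hom_restrictI[OF H])
    show "L \<phi> \<oplus>\<^bsub>X\<^esub> e \<phi> \<odot>\<^bsub>X\<^esub> b \<in> carrier X" if "\<phi> \<in> carrier ?H" for \<phi>
      using that mod_hom_closed[OF L(1) that] eE[of \<phi>] b(1) by simp
    show "L (\<phi> \<oplus>\<^bsub>?H\<^esub> \<psi>) \<oplus>\<^bsub>X\<^esub> e (\<phi> \<oplus>\<^bsub>?H\<^esub> \<psi>) \<odot>\<^bsub>X\<^esub> b =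
      (L \<phi> \<oplus>\<^bsub>X\<^esub> e \<phi> \<odot>\<^bsub>X\<^esub> b) \<oplus>\<^bsub>X\<^esub> (L \<psi> \<oplus>\<^bsub>X\<^esub> e \<psi> \<odot>\<^bsub>X\<^esub> b)"
      if p: "\<phi> \<in> carrier ?H" "\<psi> \<in> carrier ?H" for \<phi> \<psi>
    proof -
      have p': "\<phi> \<in> mod_hom R A M" "\<psi> \<in> mod_hom R A M" using p by auto
      have "e (\<phi> \<oplus>\<^bsub>?H\<^esub> \<psi>) = e \<phi> \<oplus>\<^bsub>?E\<^esub> e \<psi>"
        unfolding e_def End_ring_simps hom_into_simps using mod_hom_closed[OF g'] by (intro restrict_ext) simp
      moreover have "(e \<phi> \<oplus>\<^bsub>?E\<^esub> e \<psi>) \<odot>\<^bsub>X\<^esub> b = e \<phi> \<odot>\<^bsub>X\<^esub> b \<oplus>\<^bsub>X\<^esub> e \<psi> \<odot>\<^bsub>X\<^esub> b"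
        by (rule X.smult_l_distr[OF eE[OF p'(1)] eE[OF p'(2)] b(1)])
      moreover have "L (\<phi> \<oplus>\<^bsub>?H\<^esub> \<psi>) = L \<phi> \<oplus>\<^bsub>X\<^esub> L \<psi>" by (rule mod_hom_add[OF L(1) p])
      ultimately show ?thesis
        using mod_hom_closed[OF L(1) p(1)] mod_hom_closed[OF L(1) p(2)] X.smult_closed[OF eE[OF p'(1)] b(1)]
          X.smult_closed[OF eE[OF p'(2)] b(1)] by (simp only: X.M.a_ac X.M.a_closed)
    qed
    show "L (r \<odot>\<^bsub>?H\<^esub> \<phi>) \<oplus>\<^bsub>X\<^esub> e (r \<odot>\<^bsub>?H\<^esub> \<phi>) \<odot>\<^bsub>X\<^esub> b = r \<odot>\<^bsub>X\<^esub> (L \<phi> \<oplus>\<^bsub>X\<^esub> e \<phi> \<odot>\<^bsub>X\<^esub> b)"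
      if r: "r \<in> carrier ?E" and p: "\<phi> \<in> carrier ?H" for r \<phi>
    proof -
      have p': "\<phi> \<in> mod_hom R A M" using p by auto
      have "e (r \<odot>\<^bsub>?H\<^esub> \<phi>) = r \<otimes>\<^bsub>?E\<^esub> e \<phi>"
        unfolding e_def End_ring_simps hom_into_simps using mod_hom_closed[OF g'] by (intro restrict_ext) simp
      moreover have "(r \<otimes>\<^bsub>?E\<^esub> e \<phi>) \<odot>\<^bsub>X\<^esub> b = r \<odot>\<^bsub>X\<^esub> (e \<phi> \<odot>\<^bsub>X\<^esub> b)" by (rule X.smult_assoc1[OF r eE[OF p'] b(1)])
      moreover have "L (r \<odot>\<^bsub>?H\<^esub> \<phi>) = r \<odot>\<^bsub>X\<^esub> L \<phi>" by (rule mod_hom_smult[OF L(1) r p])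
      ultimately show ?thesis
        using X.smult_r_distr[OF r mod_hom_closed[OF L(1) p] X.smult_closed[OF eE[OF p'] b(1)]] by (simp only:)
    qed
  qed
  moreover have "g (?L \<phi>) = f (\<lambda>x\<in>carrier A. \<phi> ((\<lambda>x\<in>carrier A. h x \<oplus>\<^bsub>A\<^esub> g' (f' x)) x))" if p: "\<phi> \<in> mod_hom R A M" for \<phi>
  proof -
    have pH: "\<phi> \<in> carrier ?H" "f' \<in> carrier ?H" using p f' by auto
    have hH: "(\<lambda>x\<in>carrier A. \<phi> (h x)) \<in> carrier ?H" using mod_hom_comp[OF A h p] by (simp only: hom_into_simps)
    have eH: "e \<phi> \<odot>\<^bsub>?H\<^esub> f' \<in> carrier ?H"
      using left_module.smult_closed[OF H eE[OF p] pH(2)] .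
    have "(\<lambda>x\<in>carrier A. \<phi> ((\<lambda>x\<in>carrier A. h x \<oplus>\<^bsub>A\<^esub> g' (f' x)) x)) =
        (\<lambda>x\<in>carrier A. \<phi> (h x)) \<oplus>\<^bsub>?H\<^esub> e \<phi> \<odot>\<^bsub>?H\<^esub> f'"
      unfolding hom_into_simps e_def
      using mod_hom_closed[OF h] mod_hom_closed[OF f'] mod_hom_closed[OF g']
      by (intro restrict_ext) (simp add: mod_hom_add[OF p])
    then have "f (\<lambda>x\<in>carrier A. \<phi> ((\<lambda>x\<in>carrier A. h x \<oplus>\<^bsub>A\<^esub> g' (f' x)) x)) =
        f (\<lambda>x\<in>carrier A. \<phi> (h x)) \<oplus>\<^bsub>Y\<^esub> e \<phi> \<odot>\<^bsub>Y\<^esub> f f'"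
      using mod_hom_add[OF f hH eH] mod_hom_smult[OF f eE[OF p] pH(2)] by (simp only:)
    also have "\<dots> = g (L \<phi>) \<oplus>\<^bsub>Y\<^esub> g (e \<phi> \<odot>\<^bsub>X\<^esub> b)"
      using L(2)[OF p] mod_hom_smult[OF g(1) eE[OF p] b(1)] b(2) by (simp only:)
    also have "\<dots> = g (L \<phi> \<oplus>\<^bsub>X\<^esub> e \<phi> \<odot>\<^bsub>X\<^esub> b)"
      by (rule mod_hom_add[OF g(1) mod_hom_closed[OF L(1) pH(1)] X.smult_closed[OF eE[OF p] b(1)], symmetric])
    finally show ?thesis using pH(1) by (simp only: restrict_apply if_True)
  qed
  ultimately show ?case by blast
qed

text \<open>The argument of Yoneda's lemma: for B in add M the identity is a sum of maps g' f'
  through \<open>M\<close>, and u is the sum of the maps g' (G f'). The map \<open>\<theta>\<close>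
  stands for the identity of \<open>B\<close>, which cannot itself be the subject of the
  induction.\<close>

lemma hom_into_full:
  assumes A: "left_module R A" and B: "left_module R B" and M: "left_module R M"
    and G: "G \<in> mod_hom (End_ring R M) (hom_into R M B) (hom_into R M A)"
    and \<theta>: "\<theta> \<in> thru R {M} B B"
  shows "\<exists>u\<in>mod_hom R A B. \<forall>\<phi>\<in>mod_hom R B M. \<forall>x\<in>carrier A. G (\<lambda>y\<in>carrier B. \<phi> (\<theta> y)) x = \<phi> (u x)"
  using \<theta>
proof (induction rule: thru.induct)
  note H = left_module_hom_into[OF A M] left_module_hom_into[OF B M]
  case thru_zero
  have "G (\<lambda>y\<in>carrier B. \<phi> ((\<lambda>y\<in>carrier B. \<zero>\<^bsub>B\<^esub>) y)) x = \<phi> ((\<lambda>x\<in>carrier A. \<zero>\<^bsub>B\<^esub>) x)"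
    if p: "\<phi> \<in> mod_hom R B M" and x: "x \<in> carrier A" for \<phi> x
  proof -
    have "(\<lambda>y\<in>carrier B. \<phi> ((\<lambda>y\<in>carrier B. \<zero>\<^bsub>B\<^esub>) y)) = \<zero>\<^bsub>hom_into R M B\<^esub>"
      unfolding hom_into_simps using mod_hom_zero[OF B M p] by (intro restrict_ext) simp
    then have "G (\<lambda>y\<in>carrier B. \<phi> ((\<lambda>y\<in>carrier B. \<zero>\<^bsub>B\<^esub>) y)) x = \<zero>\<^bsub>hom_into R M A\<^esub> x"
      using mod_hom_zero[OF H(2,1) G] by (simp only:)
    then show ?thesis using x mod_hom_zero[OF B M p] by simp
  qed
  then show ?case using mod_hom_const_zero[OF A B] by blast
next
  let ?E = "End_ring R M"
  note H = left_module_hom_into[OF A M] left_module_hom_into[OF B M]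
  case (thru_step h C f' g')
  have C: "C = M" using thru_step(2) by simp
  note h = thru_mod_hom[OF B B thru_step(1)]
  have f': "f' \<in> mod_hom R B M" and g': "g' \<in> mod_hom R M B" using thru_step(3,4) C by auto
  obtain u where u: "u \<in> mod_hom R A B"
    "\<And>\<phi> x. \<phi> \<in> mod_hom R B M \<Longrightarrow> x \<in> carrier A \<Longrightarrow> G (\<lambda>y\<in>carrier B. \<phi> (h y)) x = \<phi> (u x)"
    using thru_step.IH by blast
  have Gf: "G f' \<in> mod_hom R A M" using mod_hom_closed[OF G, of f'] f' by simp
  let ?u = "\<lambda>x\<in>carrier A. u x \<oplus>\<^bsub>B\<^esub> (\<lambda>x\<in>carrier A. g' (G f' x)) x"
  have "?u \<in> mod_hom R A B" by (rule mod_hom_plus[OF A B u(1) mod_hom_comp[OF A Gf g']])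
  moreover have "G (\<lambda>y\<in>carrier B. \<phi> ((\<lambda>y\<in>carrier B. h y \<oplus>\<^bsub>B\<^esub> g' (f' y)) y)) x = \<phi> (?u x)"
    if p: "\<phi> \<in> mod_hom R B M" and x: "x \<in> carrier A" for \<phi> x
  proof -
    let ?e = "\<lambda>m\<in>carrier M. \<phi> (g' m)"
    have e: "?e \<in> carrier ?E" using mod_hom_comp[OF M g' p] by (simp only: End_ring_simps)
    have f'H: "f' \<in> carrier (hom_into R M B)" using f' by simp
    have hH: "(\<lambda>y\<in>carrier B. \<phi> (h y)) \<in> carrier (hom_into R M B)"
      using mod_hom_comp[OF B h p] by (simp only: hom_into_simps)
    have eH: "?e \<odot>\<^bsub>hom_into R M B\<^esub> f' \<in> carrier (hom_into R M B)"
      by (rule left_module.smult_closed[OF H(2) e f'H])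
    have "(\<lambda>y\<in>carrier B. \<phi> ((\<lambda>y\<in>carrier B. h y \<oplus>\<^bsub>B\<^esub> g' (f' y)) y)) =
        (\<lambda>y\<in>carrier B. \<phi> (h y)) \<oplus>\<^bsub>hom_into R M B\<^esub> ?e \<odot>\<^bsub>hom_into R M B\<^esub> f'"
      unfolding hom_into_simps using mod_hom_closed[OF h] mod_hom_closed[OF f'] mod_hom_closed[OF g']
      by (intro restrict_ext) (simp add: mod_hom_add[OF p])
    then have "G (\<lambda>y\<in>carrier B. \<phi> ((\<lambda>y\<in>carrier B. h y \<oplus>\<^bsub>B\<^esub> g' (f' y)) y)) =
        G (\<lambda>y\<in>carrier B. \<phi> (h y)) \<oplus>\<^bsub>hom_into R M A\<^esub> ?e \<odot>\<^bsub>hom_into R M A\<^esub> G f'"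
      using mod_hom_add[OF G hH eH] mod_hom_smult[OF G e f'H] by (simp only:)
    then have "G (\<lambda>y\<in>carrier B. \<phi> ((\<lambda>y\<in>carrier B. h y \<oplus>\<^bsub>B\<^esub> g' (f' y)) y)) x =
        (G (\<lambda>y\<in>carrier B. \<phi> (h y)) \<oplus>\<^bsub>hom_into R M A\<^esub> ?e \<odot>\<^bsub>hom_into R M A\<^esub> G f') x" by (rule fun_cong)
    also have "\<dots> = \<phi> (u x) \<oplus>\<^bsub>M\<^esub> \<phi> (g' (G f' x))"
      using x mod_hom_closed[OF Gf x] u(2)[OF p x] by simp
    also have "\<dots> = \<phi> (u x \<oplus>\<^bsub>B\<^esub> g' (G f' x))"
      by (rule mod_hom_add[OF p mod_hom_closed[OF u(1) x] mod_hom_closed[OF g' mod_hom_closed[OF Gf x]], symmetric])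
    finally show ?thesis using x by simp
  qed
  ultimately show ?case by blast
qed

lemma hom_into_precompose:
  assumes A: "left_module R A" and B: "left_module R B" and M: "left_module R M" and u: "u \<in> mod_hom R A B"
  shows "(\<lambda>\<phi>\<in>carrier (hom_into R M B). \<lambda>x\<in>carrier A. \<phi> (u x)) \<in> mod_hom (End_ring R M) (hom_into R M B) (hom_into R M A)"
proof (rule mod_hom_restrictI[OF left_module_hom_into[OF B M]])
  show "(\<lambda>x\<in>carrier A. \<phi> (u x)) \<in> carrier (hom_into R M A)" if "\<phi> \<in> carrier (hom_into R M B)" for \<phi>
    using mod_hom_comp[OF A u, of \<phi> M] that by (simp only: hom_into_simps)
  show "(\<lambda>x\<in>carrier A. (\<phi> \<oplus>\<^bsub>hom_into R M B\<^esub> \<psi>) (u x)) =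
    (\<lambda>x\<in>carrier A. \<phi> (u x)) \<oplus>\<^bsub>hom_into R M A\<^esub> (\<lambda>x\<in>carrier A. \<psi> (u x))"
    if "\<phi> \<in> carrier (hom_into R M B)" "\<psi> \<in> carrier (hom_into R M B)" for \<phi> \<psi>
    unfolding hom_into_simps using mod_hom_closed[OF u] by (intro restrict_ext) simp
  show "(\<lambda>x\<in>carrier A. (e \<odot>\<^bsub>hom_into R M B\<^esub> \<phi>) (u x)) = e \<odot>\<^bsub>hom_into R M A\<^esub> (\<lambda>x\<in>carrier A. \<phi> (u x))"
    if "e \<in> carrier (End_ring R M)" "\<phi> \<in> carrier (hom_into R M B)" for e \<phi>
    unfolding hom_into_simps using mod_hom_closed[OF u] by (intro restrict_ext) simp
qed

context artin_algebra
begin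

lemma finite_length_hom_into:
  assumes A: "finite_length_module \<Lambda> A" and M: "finite_length_module \<Lambda> M"
  shows "finite_length_module (End_ring \<Lambda> M) (hom_into \<Lambda> M A)"
proof -
  note lA = finite_length_left_module[OF A] and lM = finite_length_left_module[OF M]
  interpret M: left_module \<Lambda> M by (rule lM)
  show ?thesis unfolding hom_into_def
  proof (rule finite_length_hom_mod[OF A M left_module_hom_into[OF lA lM, unfolded hom_into_def]])
    fix a assume a: "a \<in> carrier k"
    let ?s = "\<lambda>x\<in>carrier M. (a \<odot>\<^bsub>\<Lambda>\<^esub> \<one>\<^bsub>\<Lambda>\<^esub>) \<odot>\<^bsub>M\<^esub> (\<lambda>x\<in>carrier M. x) x"
    have "?s \<in> carrier (End_ring \<Lambda> M)"
      using mod_hom_unit_smult[OF lM lM mod_hom_id[OF lM] a] by (simp only: End_ring_simps)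
    moreover have "(\<lambda>x\<in>carrier A. ?s (f x)) = (\<lambda>x\<in>carrier A. (a \<odot>\<^bsub>\<Lambda>\<^esub> \<one>\<^bsub>\<Lambda>\<^esub>) \<odot>\<^bsub>M\<^esub> f x)"
      if "f \<in> mod_hom \<Lambda> A M" for f
      using mod_hom_closed[OF that] by (intro restrict_ext) simp
    ultimately show "\<exists>s\<in>carrier (End_ring \<Lambda> M). \<forall>f\<in>mod_hom \<Lambda> A M.
        (\<lambda>x\<in>carrier A. s (f x)) = (\<lambda>x\<in>carrier A. (a \<odot>\<^bsub>\<Lambda>\<^esub> \<one>\<^bsub>\<Lambda>\<^esub>) \<odot>\<^bsub>M\<^esub> f x)" by blast
  qed
qed

lemma projective_hom_into:
  assumes A: "finite_length_module \<Lambda> A" and M: "finite_length_module \<Lambda> M" and add: "in_add \<Lambda> {M} A"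
  shows "projective_mod (End_ring \<Lambda> M) (hom_into \<Lambda> M A)"
proof -
  note lA = finite_length_left_module[OF A] and lM = finite_length_left_module[OF M]
  have "\<exists>h\<in>mod_hom (End_ring \<Lambda> M) (hom_into \<Lambda> M A) X. \<forall>\<phi>\<in>carrier (hom_into \<Lambda> M A). g (h \<phi>) = f \<phi>"
    if X: "finite_length_module (End_ring \<Lambda> M) X" and Y: "finite_length_module (End_ring \<Lambda> M) Y"
      and g: "g \<in> mod_hom (End_ring \<Lambda> M) X Y" and f: "f \<in> mod_hom (End_ring \<Lambda> M) (hom_into \<Lambda> M A) Y"
      and surj: "g ` carrier X = carrier Y" for X Y :: "('a list \<Rightarrow> 'a list) lmod" and g f
  proof -
    have eq: "(\<lambda>x\<in>carrier A. \<phi> ((\<lambda>x\<in>carrier A. x) x)) = \<phi>" if "\<phi> \<in> mod_hom \<Lambda> A M" for \<phi>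
    proof -
      have "(\<lambda>x\<in>carrier A. \<phi> ((\<lambda>x\<in>carrier A. x) x)) = restrict \<phi> (carrier A)" by (intro restrict_ext) simp
      then show ?thesis using mod_hom_restrict[OF that] by (simp only:)
    qed
    from hom_into_lift[OF lA lM finite_length_left_module[OF X] finite_length_left_module[OF Y] g surj f add[unfolded in_add_def]]
    obtain L where "L \<in> mod_hom (End_ring \<Lambda> M) (hom_into \<Lambda> M A) X"
      "\<forall>\<phi>\<in>mod_hom \<Lambda> A M. g (L \<phi>) = f (\<lambda>x\<in>carrier A. \<phi> ((\<lambda>x\<in>carrier A. x) x))" by blast
    then show ?thesis by (intro bexI[of _ L]) (auto simp only: eq hom_into_simps)
  qed
  then show ?thesis unfolding projective_mod_def using finite_length_hom_into[OF A M] by blast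
qed

text \<open>Hom(M, M) is free of rank one over its endomorphism ring. So one copy of
  \<open>M\<close> is added for each generator z of \<open>Z\<close>, and a map \<phi> contributes
  its component on the new copy, an endomorphism of \<open>M\<close>, applied to z.\<close>

lemma hom_into_surjection:
  fixes M :: "'a lmod" and Z :: "('a list \<Rightarrow> 'a list, 'z, 'e) module_scheme"
  assumes M: "finite_length_module \<Lambda> M" and Z: "finite_length_module (End_ring \<Lambda> M) Z"
  shows "\<exists>A F. finite_length_module \<Lambda> A \<and> in_add \<Lambda> {M} A \<and>
    F \<in> mod_hom (End_ring \<Lambda> M) (hom_into \<Lambda> M A) Z \<and> F ` carrier (hom_into \<Lambda> M A) = carrier Z"
proof -
  let ?E = "End_ring \<Lambda> M"
  note lM = finite_length_left_module[OF M] and lZ = finite_length_left_module[OF Z]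
  interpret M: left_module \<Lambda> M by (rule lM)
  interpret Z: left_module ?E Z by (rule lZ)
  have "\<exists>A F. finite_length_module \<Lambda> A \<and> in_add \<Lambda> {M} A \<and>
    F \<in> mod_hom ?E (hom_into \<Lambda> M A) Z \<and> Z.lspan zs \<subseteq> F ` carrier (hom_into \<Lambda> M A)"
    if "set zs \<subseteq> carrier Z" for zs
    using that
  proof (induction zs)
    case Nil
    obtain N :: "'a lmod" where N: "finite_length_module \<Lambda> N" "carrier N = {\<zero>\<^bsub>N\<^esub>}"
      using zero_module_exists[OF \<Lambda>.ring_axioms] by auto
    note lN = finite_length_left_module[OF N(1)]
    note H = left_module_hom_into[OF lN lM]
    have "\<zero>\<^bsub>Z\<^esub> \<in> (\<lambda>_\<in>carrier (hom_into \<Lambda> M N). \<zero>\<^bsub>Z\<^esub>) ` carrier (hom_into \<Lambda> M N)"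
      using submodule_zero[OF H submodule_carrier[OF H]] by (intro image_eqI[of _ _ "\<zero>\<^bsub>hom_into \<Lambda> M N\<^esub>"]) simp_all
    then show ?case unfolding Z.lspan_Nil
      using N(1) in_add_zero[OF lN N(2)] mod_hom_const_zero[OF H lZ] by blast
  next
    case (Cons z zs)
    then have z: "z \<in> carrier Z" and zs: "set zs \<subseteq> carrier Z" by auto
    obtain A F where A: "finite_length_module \<Lambda> A" "in_add \<Lambda> {M} A" and F: "F \<in> mod_hom ?E (hom_into \<Lambda> M A) Z"
      and im: "Z.lspan zs \<subseteq> F ` carrier (hom_into \<Lambda> M A)"
      using Cons.IH[OF zs] by blast
    note lA = finite_length_left_module[OF A(1)]
    obtain P i j p q where b: "biproduct \<Lambda> A M P i j p q" using biproduct_exists[OF A(1) M] by blast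
    note b' = b[unfolded biproduct_def]
    have fP: "finite_length_module \<Lambda> P" using b' by blast
    note lP = finite_length_left_module[OF fP]
    have ij: "i \<in> mod_hom \<Lambda> A P" "j \<in> mod_hom \<Lambda> M P" "p \<in> mod_hom \<Lambda> P A" "q \<in> mod_hom \<Lambda> P M" using b' by auto
    have pi: "p (i x) = x" "q (i x) = \<zero>\<^bsub>M\<^esub>" if "x \<in> carrier A" for x using b' that by blast+
    have pj: "p (j x) = \<zero>\<^bsub>A\<^esub>" "q (j x) = x" if "x \<in> carrier M" for x using b' that by blast+
    have addP: "in_add \<Lambda> {M} P" by (rule biproduct_in_add[OF b lA lM A(2) in_add_member[OF lM]]) simp
    let ?H = "hom_into \<Lambda> M P"
    note H = left_module_hom_into[OF lP lM]
    let ?i = "\<lambda>\<phi>\<in>carrier ?H. \<lambda>x\<in>carrier A. \<phi> (i x)" and ?j = "\<lambda>\<phi>\<in>carrier ?H. \<lambda>m\<in>carrier M. \<phi> (j m)"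
    note i' = hom_into_precompose[OF lA lP lM ij(1)] and j' = hom_into_precompose[OF lM lP lM ij(2)]
    have "(\<lambda>e\<in>carrier (hom_into \<Lambda> M M). e \<odot>\<^bsub>Z\<^esub> z) \<in> mod_hom ?E (hom_into \<Lambda> M M) Z"
    proof (rule mod_hom_restrictI[OF left_module_hom_into[OF lM lM]])
      show "e \<odot>\<^bsub>Z\<^esub> z \<in> carrier Z" if "e \<in> carrier (hom_into \<Lambda> M M)" for e
        using Z.smult_closed[of e z] that z by simp
      show "(e \<oplus>\<^bsub>hom_into \<Lambda> M M\<^esub> e') \<odot>\<^bsub>Z\<^esub> z = e \<odot>\<^bsub>Z\<^esub> z \<oplus>\<^bsub>Z\<^esub> e' \<odot>\<^bsub>Z\<^esub> z"
        if "e \<in> carrier (hom_into \<Lambda> M M)" "e' \<in> carrier (hom_into \<Lambda> M M)" for e e'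
        using Z.smult_l_distr[of e e' z] that z unfolding End_ring_simps hom_into_simps by blast
      show "(r \<odot>\<^bsub>hom_into \<Lambda> M M\<^esub> e) \<odot>\<^bsub>Z\<^esub> z = r \<odot>\<^bsub>Z\<^esub> (e \<odot>\<^bsub>Z\<^esub> z)"
        if "r \<in> carrier ?E" "e \<in> carrier (hom_into \<Lambda> M M)" for r e
        using Z.smult_assoc1[of r e z] that z unfolding End_ring_simps hom_into_simps by blast
    qed
    note Fz = mod_hom_comp[OF H j' this] and Fi = mod_hom_comp[OF H i' F]
    let ?F = "\<lambda>\<phi>\<in>carrier ?H. (\<lambda>\<phi>\<in>carrier ?H. F (?i \<phi>)) \<phi> \<oplus>\<^bsub>Z\<^esub>
      (\<lambda>\<phi>\<in>carrier ?H. (\<lambda>e\<in>carrier (hom_into \<Lambda> M M). e \<odot>\<^bsub>Z\<^esub> z) (?j \<phi>)) \<phi>"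
    have F': "?F \<in> mod_hom ?E ?H Z" by (rule mod_hom_plus[OF H lZ Fi Fz])
    note sim = submodule_image[OF H lZ F' submodule_carrier[OF H]]
    have F_eq: "?F \<phi> = F (\<lambda>x\<in>carrier A. \<phi> (i x)) \<oplus>\<^bsub>Z\<^esub> (\<lambda>m\<in>carrier M. \<phi> (j m)) \<odot>\<^bsub>Z\<^esub> z"
      if "\<phi> \<in> mod_hom \<Lambda> P M" for \<phi>
      using that mod_hom_comp[OF lM ij(2) that] by (simp only: hom_into_simps restrict_apply if_True)
    have "F \<psi> \<in> ?F ` carrier ?H" if psi: "\<psi> \<in> mod_hom \<Lambda> A M" for \<psi>
    proof -
      let ?\<phi> = "\<lambda>x\<in>carrier P. \<psi> (p x)"
      have phi: "?\<phi> \<in> mod_hom \<Lambda> P M" by (rule mod_hom_comp[OF lP ij(3) psi])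
      have "(\<lambda>x\<in>carrier A. ?\<phi> (i x)) = restrict \<psi> (carrier A)"
        using mod_hom_closed[OF ij(1)] by (intro restrict_ext) (simp add: pi)
      then have 1: "(\<lambda>x\<in>carrier A. ?\<phi> (i x)) = \<psi>" using mod_hom_restrict[OF psi] by (simp only:)
      have 2: "(\<lambda>m\<in>carrier M. ?\<phi> (j m)) = \<zero>\<^bsub>?E\<^esub>"
        unfolding End_ring_simps using mod_hom_closed[OF ij(2)] mod_hom_zero[OF lA lM psi] by (intro restrict_ext) (simp add: pj)
      have "?F ?\<phi> = F \<psi> \<oplus>\<^bsub>Z\<^esub> \<zero>\<^bsub>?E\<^esub> \<odot>\<^bsub>Z\<^esub> z" unfolding F_eq[OF phi] 1 2 ..
      also have "\<dots> = F \<psi>" using mod_hom_closed[OF F, of \<psi>] psi z by (simp del: End_ring_simps add: Z.smult_zero_l)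
      finally show ?thesis using phi by (intro image_eqI[of _ _ ?\<phi>]) (simp_all only: hom_into_simps)
    qed
    then have sub: "Z.lspan zs \<subseteq> ?F ` carrier ?H" using im by auto
    have "z \<in> ?F ` carrier ?H"
    proof -
      have 1: "(\<lambda>x\<in>carrier A. q (i x)) = \<zero>\<^bsub>hom_into \<Lambda> M A\<^esub>"
        unfolding hom_into_simps by (intro restrict_ext) (simp add: pi)
      have 2: "(\<lambda>m\<in>carrier M. q (j m)) = \<one>\<^bsub>?E\<^esub>" unfolding End_ring_simps by (intro restrict_ext) (simp add: pj)
      have "?F q = F \<zero>\<^bsub>hom_into \<Lambda> M A\<^esub> \<oplus>\<^bsub>Z\<^esub> \<one>\<^bsub>?E\<^esub> \<odot>\<^bsub>Z\<^esub> z" unfolding F_eq[OF ij(4)] 1 2 ..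
      also have "\<dots> = z" unfolding mod_hom_zero[OF left_module_hom_into[OF lA lM] lZ F] using z
        by (simp del: End_ring_simps)
      finally show ?thesis using ij(4) by (intro image_eqI[of _ _ q]) (simp_all only: hom_into_simps)
    qed
    note zF = this
    have "Z.lspan (z # zs) \<subseteq> ?F ` carrier ?H"
    proof
      fix w assume "w \<in> Z.lspan (z # zs)"
      then obtain r y where r: "r \<in> carrier ?E" and y: "y \<in> Z.lspan zs" and w: "w = r \<odot>\<^bsub>Z\<^esub> z \<oplus>\<^bsub>Z\<^esub> y"
        unfolding Z.lspan_Cons by (elim CollectE exE conjE)
      show "w \<in> ?F ` carrier ?H"
        unfolding w by (rule submodule_add[OF lZ sim submodule_smult[OF lZ sim r zF] subsetD[OF sub y]])
    qed
    then show ?case by (intro exI[of _ P] exI[of _ ?F] conjI fP addP F')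
  qed
  moreover obtain zs where zs: "set zs \<subseteq> carrier Z" "Z.lspan zs = carrier Z"
    using Z.finite_length_imp_generated Z by (auto simp: finite_length_module_def)
  ultimately obtain A F where A: "finite_length_module \<Lambda> A" "in_add \<Lambda> {M} A"
    and F: "F \<in> mod_hom ?E (hom_into \<Lambda> M A) Z" and sub: "carrier Z \<subseteq> F ` carrier (hom_into \<Lambda> M A)"
    by (metis (no_types, lifting))
  have "F ` carrier (hom_into \<Lambda> M A) \<subseteq> carrier Z" using mod_hom_closed[OF F] by (rule image_subsetI)
  with sub have "F ` carrier (hom_into \<Lambda> M A) = carrier Z" by (rule subset_antisym[rotated])
  then show ?thesis by (intro exI[of _ A] exI[of _ F] conjI A F)
qed

end

context artin_algebra
begin

text \<open>A resolution of \<open>Z\<close> begins with Hom(A, M) and Hom(B, M). The differential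
  between them is precomposition with some u: A \<rightarrow> B, so its kernel is Hom(X, M) for the
  cokernel X of u. In \<open>crit\<close> the extension property makes Hom(M', M) \<rightarrow>
  Hom(X, M) onto, and its kernel is Hom(M'', M) because M'' is the cokernel of a.\<close>

lemma gldim_End_ring_le_3:
  fixes M :: "'a lmod"
  assumes M: "finite_length_module \<Lambda> M"
    and crit: "\<And>X :: 'a lmod. finite_length_module \<Lambda> X \<Longrightarrow>
      \<exists>M' M'' a b. finite_length_module \<Lambda> M' \<and> finite_length_module \<Lambda> M'' \<and> in_add \<Lambda> {M} M' \<and> in_add \<Lambda> {M} M'' \<and>
        a \<in> mod_hom \<Lambda> X M' \<and> b \<in> mod_hom \<Lambda> M' M'' \<and> b ` carrier M' = carrier M'' \<and>
        (\<forall>y\<in>carrier M'. b y = \<zero>\<^bsub>M''\<^esub> \<longleftrightarrow> y \<in> a ` carrier X) \<and>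
        (\<forall>f\<in>mod_hom \<Lambda> X M. \<exists>f'\<in>mod_hom \<Lambda> M' M. \<forall>x\<in>carrier X. f' (a x) = f x)"
  shows "gldim (End_ring \<Lambda> M) \<le> 3"
  unfolding gldim_def
proof (rule SUP_least)
  let ?E = "End_ring \<Lambda> M" and ?H = "hom_into \<Lambda> M"
  fix Z :: "('a list \<Rightarrow> 'a list) lmod" assume "Z \<in> {Z. finite_length_module ?E Z}"
  then have Z: "finite_length_module ?E Z" by simp
  note lM = finite_length_left_module[OF M] and lZ = finite_length_left_module[OF Z]
  obtain A F where A: "finite_length_module \<Lambda> A" "in_add \<Lambda> {M} A" and F: "F \<in> mod_hom ?E (?H A) Z"
    "F ` carrier (?H A) = carrier Z"
    using hom_into_surjection[OF M Z] by (elim exE conjE)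
  note lA = finite_length_left_module[OF A(1)]
  note HA = left_module_hom_into[OF lA lM]
  let ?K = "{\<phi> \<in> carrier (?H A). F \<phi> = \<zero>\<^bsub>Z\<^esub>}"
  have sK: "submodule ?K ?E (?H A)" by (rule submodule_kernel[OF HA lZ F(1)])
  obtain B G where B: "finite_length_module \<Lambda> B" "in_add \<Lambda> {M} B"
    and G: "G \<in> mod_hom ?E (?H B) (?H A\<lparr>carrier := ?K\<rparr>)"
      "G ` carrier (?H B) = carrier (?H A\<lparr>carrier := ?K\<rparr>)"
    using hom_into_surjection[OF M finite_length_submodule[OF finite_length_hom_into[OF A(1) M] sK]]
    by (elim exE conjE)
  note lB = finite_length_left_module[OF B(1)]
  note HB = left_module_hom_into[OF lB lM]
  have G1: "G \<in> mod_hom ?E (?H B) (?H A)"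
    using G(1) by (auto simp: mod_hom_def PiE_def Pi_def simp del: hom_into_simps End_ring_simps)
  have G2: "G ` carrier (?H B) = ?K" using G(2) by simp
  obtain u where u: "u \<in> mod_hom \<Lambda> A B"
    "\<forall>\<phi>\<in>mod_hom \<Lambda> B M. \<forall>x\<in>carrier A. G (\<lambda>y\<in>carrier B. \<phi> ((\<lambda>y\<in>carrier B. y) y)) x = \<phi> (u x)"
    using hom_into_full[OF lA lB lM G1 B(2)[unfolded in_add_def]] by blast
  have Gu: "G \<phi> x = \<phi> (u x)" if p: "\<phi> \<in> mod_hom \<Lambda> B M" and x: "x \<in> carrier A" for \<phi> x
  proof -
    have "(\<lambda>y\<in>carrier B. \<phi> ((\<lambda>y\<in>carrier B. y) y)) = restrict \<phi> (carrier B)" by (intro restrict_ext) simp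
    then have "(\<lambda>y\<in>carrier B. \<phi> ((\<lambda>y\<in>carrier B. y) y)) = \<phi>" using mod_hom_restrict[OF p] by (simp only:)
    then show ?thesis using u(2) p x by metis
  qed
  have G0: "G \<phi> = \<zero>\<^bsub>?H A\<^esub> \<longleftrightarrow> (\<forall>x\<in>carrier A. \<phi> (u x) = \<zero>\<^bsub>M\<^esub>)" if p: "\<phi> \<in> mod_hom \<Lambda> B M" for \<phi>
  proof
    assume g: "G \<phi> = \<zero>\<^bsub>?H A\<^esub>"
    show "\<forall>x\<in>carrier A. \<phi> (u x) = \<zero>\<^bsub>M\<^esub>"
    proof
      fix x assume x: "x \<in> carrier A"
      have "\<phi> (u x) = \<zero>\<^bsub>?H A\<^esub> x" using Gu[OF p x] fun_cong[OF g, of x] by (simp only:)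
      then show "\<phi> (u x) = \<zero>\<^bsub>M\<^esub>" using x by simp
    qed
  next
    assume k: "\<forall>x\<in>carrier A. \<phi> (u x) = \<zero>\<^bsub>M\<^esub>"
    have "G \<phi> \<in> mod_hom \<Lambda> A M" using mod_hom_closed[OF G1, of \<phi>] p by (simp only: hom_into_simps)
    from mod_hom_eqI[OF this mod_hom_const_zero[OF lA lM]] k Gu[OF p]
    show "G \<phi> = \<zero>\<^bsub>?H A\<^esub>" by simp
  qed
  have sI: "submodule (u ` carrier A) \<Lambda> B" by (rule submodule_image[OF lA lB u(1) submodule_carrier[OF lA]])
  obtain X :: "'a lmod" and \<pi> where lX: "left_module \<Lambda> X" and \<pi>: "\<pi> \<in> mod_hom \<Lambda> B X" "\<pi> ` carrier B = carrier X"
    and \<pi>0: "\<And>y. y \<in> carrier B \<Longrightarrow> \<pi> y = \<zero>\<^bsub>X\<^esub> \<longleftrightarrow> y \<in> u ` carrier A"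
    using quotient_module[OF lB sI] by metis
  have X: "finite_length_module \<Lambda> X" by (rule finite_length_surj[OF B(1) lX \<pi>])
  obtain M' M'' a b where M': "finite_length_module \<Lambda> M'" "in_add \<Lambda> {M} M'" and M'': "finite_length_module \<Lambda> M''" "in_add \<Lambda> {M} M''"
    and a: "a \<in> mod_hom \<Lambda> X M'" and b: "b \<in> mod_hom \<Lambda> M' M''" "b ` carrier M' = carrier M''"
    and b0: "\<And>y. y \<in> carrier M' \<Longrightarrow> b y = \<zero>\<^bsub>M''\<^esub> \<longleftrightarrow> y \<in> a ` carrier X"
    and ext: "\<And>f. f \<in> mod_hom \<Lambda> X M \<Longrightarrow> \<exists>f'\<in>mod_hom \<Lambda> M' M. \<forall>x\<in>carrier X. f' (a x) = f x"
    using crit[OF X] by metis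
  note lM' = finite_length_left_module[OF M'(1)] and lM'' = finite_length_left_module[OF M''(1)]
  \<comment> \<open>Precomposition with B \<rightarrow> X \<rightarrow> M' is the differential
    Hom(M', M) \<rightarrow> Hom(B, M), the passage through Hom(X, M) included.\<close>
  let ?w = "\<lambda>y\<in>carrier B. a (\<pi> y)"
  have w: "?w \<in> mod_hom \<Lambda> B M'" by (rule mod_hom_comp[OF lB \<pi>(1) a])
  define F2 where "F2 = (\<lambda>\<phi>\<in>carrier (?H M'). \<lambda>y\<in>carrier B. \<phi> (?w y))"
  define F3 where "F3 = (\<lambda>\<phi>\<in>carrier (?H M''). \<lambda>y\<in>carrier M'. \<phi> (b y))"
  have F2: "F2 \<in> mod_hom ?E (?H M') (?H B)" unfolding F2_def by (rule hom_into_precompose[OF lB lM' lM w])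
  have F3: "F3 \<in> mod_hom ?E (?H M'') (?H M')" unfolding F3_def by (rule hom_into_precompose[OF lM' lM'' lM b(1)])
  have F2v: "F2 \<phi> y = \<phi> (a (\<pi> y))" if "\<phi> \<in> mod_hom \<Lambda> M' M" "y \<in> carrier B" for \<phi> y
    using that by (simp add: F2_def)
  have F3v: "F3 \<phi> y = \<phi> (b y)" if "\<phi> \<in> mod_hom \<Lambda> M'' M" "y \<in> carrier M'" for \<phi> y
    using that by (simp add: F3_def)
  have F2c: "F2 \<phi> \<in> mod_hom \<Lambda> B M" if "\<phi> \<in> mod_hom \<Lambda> M' M" for \<phi>
    using mod_hom_closed[OF F2, of \<phi>] that by (simp only: hom_into_simps)
  have F3c: "F3 \<phi> \<in> mod_hom \<Lambda> M' M" if "\<phi> \<in> mod_hom \<Lambda> M'' M" for \<phi>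
    using mod_hom_closed[OF F3, of \<phi>] that by (simp only: hom_into_simps)
  have \<pi>u: "\<pi> (u x) = \<zero>\<^bsub>X\<^esub>" if "x \<in> carrier A" for x
    using \<pi>0[OF mod_hom_closed[OF u(1) that]] that by blast
  have ba: "b (a x) = \<zero>\<^bsub>M''\<^esub>" if "x \<in> carrier X" for x
    using b0[OF mod_hom_closed[OF a that]] that by blast
  have ex2: "F2 ` carrier (?H M') = {\<phi> \<in> carrier (?H B). G \<phi> = \<zero>\<^bsub>?H A\<^esub>}"
  proof
    show "F2 ` carrier (?H M') \<subseteq> {\<phi> \<in> carrier (?H B). G \<phi> = \<zero>\<^bsub>?H A\<^esub>}"
    proof
      fix \<psi> assume "\<psi> \<in> F2 ` carrier (?H M')"
      then obtain \<phi> where p: "\<phi> \<in> mod_hom \<Lambda> M' M" "\<psi> = F2 \<phi>" unfolding hom_into_simps by blast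
      have "F2 \<phi> (u x) = \<zero>\<^bsub>M\<^esub>" if x: "x \<in> carrier A" for x
        using F2v[OF p(1) mod_hom_closed[OF u(1) x]] \<pi>u[OF x] mod_hom_zero[OF lX lM' a] mod_hom_zero[OF lM' lM p(1)] by simp
      then show "\<psi> \<in> {\<phi> \<in> carrier (?H B). G \<phi> = \<zero>\<^bsub>?H A\<^esub>}"
        using F2c[OF p(1)] G0[OF F2c[OF p(1)]] p(2) by (simp del: hom_into_simps(2))
    qed
    \<comment> \<open>\<phi> vanishes on the image of u, hence factors over its cokernel X, and the
      factor extends to M' by the hypothesis on X.\<close>
    show "{\<phi> \<in> carrier (?H B). G \<phi> = \<zero>\<^bsub>?H A\<^esub>} \<subseteq> F2 ` carrier (?H M')"
    proof
      fix \<phi> assume "\<phi> \<in> {\<phi> \<in> carrier (?H B). G \<phi> = \<zero>\<^bsub>?H A\<^esub>}"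
      then have p: "\<phi> \<in> mod_hom \<Lambda> B M" and "G \<phi> = \<zero>\<^bsub>?H A\<^esub>" by (simp_all del: hom_into_simps(2))
      then have k: "\<forall>x\<in>carrier A. \<phi> (u x) = \<zero>\<^bsub>M\<^esub>" using G0[OF p] by blast
      have "\<phi> y = \<zero>\<^bsub>M\<^esub>" if "y \<in> carrier B" "\<pi> y = \<zero>\<^bsub>X\<^esub>" for y
        using \<pi>0[OF that(1)] that(2) k by auto
      from mod_hom_factor[OF lB lX lM \<pi> p this]
      obtain \<psi> where psi: "\<psi> \<in> mod_hom \<Lambda> X M" "\<forall>y\<in>carrier B. \<psi> (\<pi> y) = \<phi> y" by blast
      obtain \<chi> where chi: "\<chi> \<in> mod_hom \<Lambda> M' M" "\<forall>x\<in>carrier X. \<chi> (a x) = \<psi> x" using ext[OF psi(1)] by blast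
      have "\<phi> = F2 \<chi>"
        by (rule mod_hom_eqI[OF p F2c[OF chi(1)]])
          (use F2v[OF chi(1)] chi(2) psi(2) mod_hom_closed[OF \<pi>(1)] in simp)
      then show "\<phi> \<in> F2 ` carrier (?H M')" using chi(1) by (simp only: hom_into_simps image_eqI)
    qed
  qed
  have ex3: "F3 ` carrier (?H M'') = {\<phi> \<in> carrier (?H M'). F2 \<phi> = \<zero>\<^bsub>?H B\<^esub>}"
  proof
    show "F3 ` carrier (?H M'') \<subseteq> {\<phi> \<in> carrier (?H M'). F2 \<phi> = \<zero>\<^bsub>?H B\<^esub>}"
    proof
      fix \<psi> assume "\<psi> \<in> F3 ` carrier (?H M'')"
      then obtain \<phi> where p: "\<phi> \<in> mod_hom \<Lambda> M'' M" "\<psi> = F3 \<phi>" unfolding hom_into_simps by blast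
      have "F2 (F3 \<phi>) = (\<lambda>y\<in>carrier B. \<zero>\<^bsub>M\<^esub>)"
      proof (rule mod_hom_eqI[OF F2c[OF F3c[OF p(1)]] mod_hom_const_zero[OF lB lM]])
        fix y assume y: "y \<in> carrier B"
        have py: "\<pi> y \<in> carrier X" by (rule mod_hom_closed[OF \<pi>(1) y])
        show "F2 (F3 \<phi>) y = (\<lambda>y\<in>carrier B. \<zero>\<^bsub>M\<^esub>) y"
          using y F2v[OF F3c[OF p(1)] y] F3v[OF p(1) mod_hom_closed[OF a py]] ba[OF py] mod_hom_zero[OF lM'' lM p(1)] by simp
      qed
      then show "\<psi> \<in> {\<phi> \<in> carrier (?H M'). F2 \<phi> = \<zero>\<^bsub>?H B\<^esub>}"
        using F3c[OF p(1)] p(2) by (simp only: hom_into_simps mem_Collect_eq)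
    qed
    show "{\<phi> \<in> carrier (?H M'). F2 \<phi> = \<zero>\<^bsub>?H B\<^esub>} \<subseteq> F3 ` carrier (?H M'')"
    proof
      fix \<phi> assume "\<phi> \<in> {\<phi> \<in> carrier (?H M'). F2 \<phi> = \<zero>\<^bsub>?H B\<^esub>}"
      then have p: "\<phi> \<in> mod_hom \<Lambda> M' M" and z: "F2 \<phi> = \<zero>\<^bsub>?H B\<^esub>" by (simp_all only: hom_into_simps mem_Collect_eq)
      have "\<phi> y = \<zero>\<^bsub>M\<^esub>" if y: "y \<in> carrier M'" "b y = \<zero>\<^bsub>M''\<^esub>" for y
      proof -
        obtain x where x: "x \<in> carrier X" "y = a x" using b0[OF y(1)] y(2) by blast
        obtain v where v: "v \<in> carrier B" "x = \<pi> v" using x(1) \<pi>(2) by blast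
        have "F2 \<phi> v = \<zero>\<^bsub>?H B\<^esub> v" using z by (rule fun_cong)
        then show ?thesis using F2v[OF p v(1)] v x by simp
      qed
      from mod_hom_factor[OF lM' lM'' lM b p this]
      obtain \<psi> where psi: "\<psi> \<in> mod_hom \<Lambda> M'' M" "\<forall>y\<in>carrier M'. \<psi> (b y) = \<phi> y" by blast
      have "\<phi> = F3 \<psi>" by (rule mod_hom_eqI[OF p F3c[OF psi(1)]]) (use F3v[OF psi(1)] psi(2) in simp)
      then show "\<phi> \<in> F3 ` carrier (?H M'')" using psi(1) by (simp only: hom_into_simps image_eqI)
    qed
  qed
  have inj: "inj_on F3 (carrier (?H M''))"
  proof (rule inj_onI)
    fix \<phi> \<psi> assume "\<phi> \<in> carrier (?H M'')" "\<psi> \<in> carrier (?H M'')" and eq: "F3 \<phi> = F3 \<psi>"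
    then have p: "\<phi> \<in> mod_hom \<Lambda> M'' M" "\<psi> \<in> mod_hom \<Lambda> M'' M" by simp_all
    show "\<phi> = \<psi>"
    proof (rule mod_hom_eqI[OF p])
      fix z assume "z \<in> carrier M''"
      then obtain y where y: "y \<in> carrier M'" "z = b y" using b(2) by blast
      show "\<phi> z = \<psi> z" using F3v[OF p(1) y(1)] F3v[OF p(2) y(1)] eq y(2) by simp
    qed
  qed
  show "proj_dim ?E Z \<le> 3"
    by (rule proj_dim_le_3[OF ring_End_ring[OF lM] lZ projective_hom_into[OF A(1) M A(2)]
          projective_hom_into[OF B(1) M B(2)] projective_hom_into[OF M'(1) M M'(2)]
          projective_hom_into[OF M''(1) M M''(2)] F(1) G1 F2 F3 F(2) G2 ex2 ex3 inj])
qed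

end

section \<open>Modules generated by the dual of the regular module\<close>

context algebra_dual
begin

section \<open>The inverse Nakayama functor Hom(C, -)\<close>

lemma lC: "left_module \<Lambda> C"
  by (rule finite_length_left_module[OF C_finite_length])

lemma \<rho>_closed: "l \<in> carrier \<Lambda> \<Longrightarrow> c \<in> carrier C \<Longrightarrow> \<rho> l c \<in> carrier C"
  by (rule mod_hom_closed[OF \<rho>_hom])

text \<open>The inverse Nakayama functor, an equivalence from add C to the projective modules; the
  left module structure comes from the right action \<open>\<rho>\<close> on
  \<open>C\<close>.\<close>

definition homC :: "'a lmod \<Rightarrow> ('a, 'a list \<Rightarrow> 'a list) module"
  where "homC P = hom_mod \<Lambda> C P (\<lambda>l h. \<lambda>c\<in>carrier C. h (\<rho> l c))"

lemma homC_simps [simp]: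
  "carrier (homC P) = mod_hom \<Lambda> C P"
  "\<zero>\<^bsub>homC P\<^esub> = (\<lambda>c\<in>carrier C. \<zero>\<^bsub>P\<^esub>)"
  "f \<oplus>\<^bsub>homC P\<^esub> g = (\<lambda>c\<in>carrier C. f c \<oplus>\<^bsub>P\<^esub> g c)"
  "l \<odot>\<^bsub>homC P\<^esub> f = (\<lambda>c\<in>carrier C. f (\<rho> l c))"
  by (simp_all only: homC_def hom_mod_simps)

lemma left_module_homC:
  assumes P: "left_module \<Lambda> P"
  shows "left_module \<Lambda> (homC P)"
  unfolding homC_def
proof (intro left_module_hom_mod lC P \<Lambda>.ring_axioms)
  show "(\<lambda>c\<in>carrier C. h (\<rho> l c)) \<in> mod_hom \<Lambda> C P" if "l \<in> carrier \<Lambda>" "h \<in> mod_hom \<Lambda> C P" for l h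
    by (rule mod_hom_comp[OF lC \<rho>_hom[OF that(1)] that(2)])
qed (simp_all add: \<rho>_closed \<rho>_add \<rho>_mult \<rho>_one mod_hom_add[of _ \<Lambda> C P])

lemma finite_length_homC:
  assumes P: "finite_length_module \<Lambda> P"
  shows "finite_length_module \<Lambda> (homC P)"
  unfolding homC_def
proof (rule finite_length_hom_mod[OF C_finite_length P
      left_module_homC[OF finite_length_left_module[OF P], unfolded homC_def]])
  fix a assume a: "a \<in> carrier k"
  have "(\<lambda>c\<in>carrier C. h (\<rho> (a \<odot>\<^bsub>\<Lambda>\<^esub> \<one>\<^bsub>\<Lambda>\<^esub>) c)) = (\<lambda>c\<in>carrier C. (a \<odot>\<^bsub>\<Lambda>\<^esub> \<one>\<^bsub>\<Lambda>\<^esub>) \<odot>\<^bsub>P\<^esub> h c)"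
    if h: "h \<in> mod_hom \<Lambda> C P" for h
    using a by (intro restrict_ext) (simp add: \<rho>_scalar mod_hom_smult[OF h])
  then show "\<exists>s\<in>carrier \<Lambda>. \<forall>h\<in>mod_hom \<Lambda> C P. (\<lambda>c\<in>carrier C. h (\<rho> s c)) =
      (\<lambda>c\<in>carrier C. (a \<odot>\<^bsub>\<Lambda>\<^esub> \<one>\<^bsub>\<Lambda>\<^esub>) \<odot>\<^bsub>P\<^esub> h c)"
    using unit_smult_closed[OF a] by blast
qed

lemma homC_postcompose:
  assumes P: "left_module \<Lambda> P" and g: "g \<in> mod_hom \<Lambda> P P'"
  shows "(\<lambda>h\<in>carrier (homC P). \<lambda>c\<in>carrier C. g (h c)) \<in> mod_hom \<Lambda> (homC P) (homC P')"
proof (rule mod_hom_restrictI[OF left_module_homC[OF P]])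
  show "(\<lambda>c\<in>carrier C. g (h c)) \<in> carrier (homC P')" if "h \<in> carrier (homC P)" for h
    using mod_hom_comp[OF lC _ g, of h] that by (simp only: homC_simps)
  show "(\<lambda>c\<in>carrier C. g ((h \<oplus>\<^bsub>homC P\<^esub> h') c)) = (\<lambda>c\<in>carrier C. g (h c)) \<oplus>\<^bsub>homC P'\<^esub> (\<lambda>c\<in>carrier C. g (h' c))"
    if "h \<in> carrier (homC P)" "h' \<in> carrier (homC P)" for h h'
  proof -
    have h: "h \<in> mod_hom \<Lambda> C P" "h' \<in> mod_hom \<Lambda> C P" using that by simp_all
    show ?thesis unfolding homC_simps
      using mod_hom_closed[OF h(1)] mod_hom_closed[OF h(2)] by (intro restrict_ext) (simp add: mod_hom_add[OF g])
  qed
  show "(\<lambda>c\<in>carrier C. g ((l \<odot>\<^bsub>homC P\<^esub> h) c)) = l \<odot>\<^bsub>homC P'\<^esub> (\<lambda>c\<in>carrier C. g (h c))"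
    if "l \<in> carrier \<Lambda>" for l h
    unfolding homC_simps using \<rho>_closed[OF that] by (intro restrict_ext) simp
qed

text \<open>\<open>\<rho>\<close> is an isomorphism of left modules from \<Lambda> to Hom(C, C). Its
  inverse \<open>\<sigma>\<close> reads off the element of \<Lambda> that an endomorphism of
  \<open>C\<close> stands for.\<close>

lemma End_C_coordinate:
  obtains \<sigma> where "\<sigma> \<in> mod_hom \<Lambda> (homC C) (reg \<Lambda>)" "\<And>l. l \<in> carrier \<Lambda> \<Longrightarrow> \<sigma> (\<rho> l) = l"
    "\<And>h. h \<in> mod_hom \<Lambda> C C \<Longrightarrow> \<rho> (\<sigma> h) = h"
proof -
  let ?r = "\<lambda>l\<in>carrier (reg \<Lambda>). \<rho> l"
  note H = left_module_homC[OF lC]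
  have "\<rho> l = restrict (\<rho> l) (carrier C)" if "l \<in> carrier \<Lambda>" for l
    using mod_hom_restrict[OF \<rho>_hom[OF that]] by simp
  have eqI: "h = h'" if "h \<in> mod_hom \<Lambda> C C" "h' \<in> mod_hom \<Lambda> C C" "\<And>c. c \<in> carrier C \<Longrightarrow> h c = h' c" for h h'
    by (rule mod_hom_eqI[OF that])
  have r: "?r \<in> mod_hom \<Lambda> (reg \<Lambda>) (homC C)"
  proof (rule mod_hom_restrictI[OF left_module_reg_algebra])
    show "\<rho> l \<in> carrier (homC C)" if "l \<in> carrier (reg \<Lambda>)" for l using \<rho>_hom that by simp
    show "\<rho> (l \<oplus>\<^bsub>reg \<Lambda>\<^esub> m) = \<rho> l \<oplus>\<^bsub>homC C\<^esub> \<rho> m" if "l \<in> carrier (reg \<Lambda>)" "m \<in> carrier (reg \<Lambda>)" for l m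
    proof (rule eqI)
      show "\<rho> (l \<oplus>\<^bsub>reg \<Lambda>\<^esub> m) \<in> mod_hom \<Lambda> C C" using \<rho>_hom that by simp
      show "\<rho> l \<oplus>\<^bsub>homC C\<^esub> \<rho> m \<in> mod_hom \<Lambda> C C"
        unfolding homC_simps using \<rho>_hom that by (intro mod_hom_plus lC) simp_all
    qed (use that in \<open>simp add: \<rho>_add\<close>)
    show "\<rho> (l \<odot>\<^bsub>reg \<Lambda>\<^esub> m) = l \<odot>\<^bsub>homC C\<^esub> \<rho> m" if "l \<in> carrier \<Lambda>" "m \<in> carrier (reg \<Lambda>)" for l m
    proof (rule eqI)
      show "\<rho> (l \<odot>\<^bsub>reg \<Lambda>\<^esub> m) \<in> mod_hom \<Lambda> C C" using \<rho>_hom that by simp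
      show "l \<odot>\<^bsub>homC C\<^esub> \<rho> m \<in> mod_hom \<Lambda> C C"
        unfolding homC_simps using \<rho>_hom that by (intro mod_hom_comp[OF lC]) simp_all
    qed (use that in \<open>simp add: \<rho>_mult\<close>)
  qed
  have "inj_on ?r (carrier (reg \<Lambda>))" unfolding mod_hom_inj_iff[OF left_module_reg_algebra H r]
  proof (intro ballI impI)
    fix l assume l: "l \<in> carrier (reg \<Lambda>)" and z: "?r l = \<zero>\<^bsub>homC C\<^esub>"
    have "\<rho> l c = \<zero>\<^bsub>C\<^esub>" if "c \<in> carrier C" for c using fun_cong[OF z, of c] l that by simp
    then show "l = \<zero>\<^bsub>reg \<Lambda>\<^esub>" using \<rho>_inj[of l] l by simp
  qed
  moreover have "?r ` carrier (reg \<Lambda>) = carrier (homC C)"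
  proof
    show "?r ` carrier (reg \<Lambda>) \<subseteq> carrier (homC C)" using \<rho>_hom by auto
    show "carrier (homC C) \<subseteq> ?r ` carrier (reg \<Lambda>)"
    proof
      fix h assume "h \<in> carrier (homC C)"
      then obtain l where "l \<in> carrier \<Lambda>" "h = \<rho> l" using \<rho>_surj by auto
      then show "h \<in> ?r ` carrier (reg \<Lambda>)" by (intro image_eqI[of _ _ l]) simp_all
    qed
  qed
  ultimately have "bij_betw ?r (carrier (reg \<Lambda>)) (carrier (homC C))" by (simp add: bij_betw_def)
  from mod_hom_inverse[OF left_module_reg_algebra H r this]
  obtain \<sigma> where s: "\<sigma> \<in> mod_hom \<Lambda> (homC C) (reg \<Lambda>)"
    "\<forall>l\<in>carrier (reg \<Lambda>). \<sigma> (?r l) = l" "\<forall>h\<in>carrier (homC C). ?r (\<sigma> h) = h" by blast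
  show ?thesis
  proof (rule that)
    show "\<sigma> \<in> mod_hom \<Lambda> (homC C) (reg \<Lambda>)" by (rule s(1))
    show "\<sigma> (\<rho> l) = l" if "l \<in> carrier \<Lambda>" for l using s(2) that by simp
    show "\<rho> (\<sigma> h) = h" if "h \<in> mod_hom \<Lambda> C C" for h
      using s(3)[rule_format, of h] that mod_hom_closed[OF s(1), of h] by simp
  qed
qed

text \<open>\<open>P\<close> plays the role of \<open>\<nu>P'\<close> for a projective \<open>P'\<close> mapping onto \<open>X\<close>, with \<open>P' = Hom(C, \<nu>P')\<close>.\<close>

definition presentation :: "'a lmod \<Rightarrow> (('a list \<Rightarrow> 'a list) \<Rightarrow> 'a list) \<Rightarrow> 'a lmod \<Rightarrow> bool"
  where "presentation P \<theta> X \<longleftrightarrow> finite_length_module \<Lambda> P \<and> in_add \<Lambda> {C} P \<and>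
    \<theta> \<in> mod_hom \<Lambda> (homC P) X \<and> \<theta> ` carrier (homC P) = carrier X"

text \<open>The trace in \<open>P\<close> of the maps from \<open>C\<close> that
  \<open>\<theta>\<close> kills, written as an intersection. With P' = Hom(C, P) and the Nakayama
  functor \<nu> it is the image in P = \<nu>P' of \<nu> applied to the kernel of P' \<rightarrow>
  X.\<close>

definition relations :: "'a lmod \<Rightarrow> (('a list \<Rightarrow> 'a list) \<Rightarrow> 'a list) \<Rightarrow> 'a lmod \<Rightarrow> 'a list set"
  where "relations P \<theta> X = \<Inter>{U. submodule U \<Lambda> P \<and> (\<forall>h\<in>mod_hom \<Lambda> C P. \<theta> h = \<zero>\<^bsub>X\<^esub> \<longrightarrow> h ` carrier C \<subseteq> U)}"

abbreviation relmod :: "'a lmod \<Rightarrow> (('a list \<Rightarrow> 'a list) \<Rightarrow> 'a list) \<Rightarrow> 'a lmod \<Rightarrow> 'a lmod"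
  where "relmod P \<theta> X \<equiv> P\<lparr>carrier := relations P \<theta> X\<rparr>"

section \<open>Relations of a presentation and their functoriality modulo add C\<close>

lemma relations_upper:
  assumes "h \<in> mod_hom \<Lambda> C P" "\<theta> h = \<zero>\<^bsub>X\<^esub>" "c \<in> carrier C"
  shows "h c \<in> relations P \<theta> X"
  unfolding relations_def using assms by blast

lemma relations_least:
  assumes "submodule U \<Lambda> P" "\<And>h c. h \<in> mod_hom \<Lambda> C P \<Longrightarrow> \<theta> h = \<zero>\<^bsub>X\<^esub> \<Longrightarrow> c \<in> carrier C \<Longrightarrow> h c \<in> U"
  shows "relations P \<theta> X \<subseteq> U"
  unfolding relations_def using assms by blast

lemma submodule_relations:
  assumes P: "left_module \<Lambda> P"
  shows "submodule (relations P \<theta> X) \<Lambda> P"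
proof (rule left_module_submoduleI[OF P])
  let ?F = "{U. submodule U \<Lambda> P \<and> (\<forall>h\<in>mod_hom \<Lambda> C P. \<theta> h = \<zero>\<^bsub>X\<^esub> \<longrightarrow> h ` carrier C \<subseteq> U)}"
  have F: "submodule U \<Lambda> P" if "U \<in> ?F" for U using that by simp
  show "relations P \<theta> X \<subseteq> carrier P"
    by (rule relations_least[OF submodule_carrier[OF P]]) (rule mod_hom_closed)
  show "\<zero>\<^bsub>P\<^esub> \<in> relations P \<theta> X"
    unfolding relations_def by (rule InterI) (rule submodule_zero[OF P F])
  show "x \<oplus>\<^bsub>P\<^esub> y \<in> relations P \<theta> X" if "x \<in> relations P \<theta> X" "y \<in> relations P \<theta> X" for x y
    unfolding relations_def
  proof (rule InterI)
    fix U assume U: "U \<in> ?F"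
    then have "x \<in> U" "y \<in> U" using that unfolding relations_def by blast+
    then show "x \<oplus>\<^bsub>P\<^esub> y \<in> U" by (rule submodule_add[OF P F[OF U]])
  qed
  show "a \<odot>\<^bsub>P\<^esub> x \<in> relations P \<theta> X" if a: "a \<in> carrier \<Lambda>" and "x \<in> relations P \<theta> X" for a x
    unfolding relations_def
  proof (rule InterI)
    fix U assume U: "U \<in> ?F"
    then have "x \<in> U" using that(2) unfolding relations_def by blast
    then show "a \<odot>\<^bsub>P\<^esub> x \<in> U" by (rule submodule_smult[OF P F[OF U] a])
  qed
qed

lemma generated_relmod:
  assumes P: "left_module \<Lambda> P"
  shows "generated \<Lambda> C (relmod P \<theta> X)"
  unfolding generated_def
proof (intro allI impI)
  note sR = submodule_relations[OF P, of \<theta> X]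
  fix U assume U: "submodule U \<Lambda> (relmod P \<theta> X)"
    and all: "\<forall>f\<in>mod_hom \<Lambda> C (relmod P \<theta> X). f ` carrier C \<subseteq> U"
  have U': "submodule U \<Lambda> P" "U \<subseteq> relations P \<theta> X" using U unfolding submodule_submodule_iff[OF P sR] by auto
  have "relations P \<theta> X \<subseteq> U"
  proof (rule relations_least[OF U'(1)])
    fix h c assume h: "h \<in> mod_hom \<Lambda> C P" "\<theta> h = \<zero>\<^bsub>X\<^esub>" and c: "c \<in> carrier C"
    have "h \<in> mod_hom \<Lambda> C (relmod P \<theta> X)"
      using h(1) relations_upper[of h P \<theta> X, OF h] by (auto simp: mod_hom_def PiE_def)
    then show "h c \<in> U" using all c by blast
  qed
  then show "U = carrier (relmod P \<theta> X)" using U'(2) by simp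
qed

text \<open>For \<open>P\<close> in add C the module Hom(C, P) is projective, and every linear map
  from it to Hom(C, P') is induced by a map P \<rightarrow> P'. Both facts are obtained together by
  induction along the identity of \<open>P\<close>: for a summand g q through \<open>C\<close> some
  h' with \<open>\<theta>' h'\<close> = f(\<theta> g) is chosen, and h' q is added.\<close>

lemma presentation_lift:
  assumes p: "presentation P \<theta> X" and p': "presentation P' \<theta>' X'" and X: "left_module \<Lambda> X" and X': "left_module \<Lambda> X'"
    and f: "f \<in> mod_hom \<Lambda> X X'"
  shows "\<exists>F\<in>mod_hom \<Lambda> P P'. \<forall>h\<in>mod_hom \<Lambda> C P. \<theta>' (\<lambda>c\<in>carrier C. F (h c)) = f (\<theta> h)"
proof -
  have P: "left_module \<Lambda> P" "in_add \<Lambda> {C} P" and \<theta>: "\<theta> \<in> mod_hom \<Lambda> (homC P) X"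
    using p finite_length_left_module by (auto simp: presentation_def simp del: homC_simps)
  have P': "left_module \<Lambda> P'" and \<theta>': "\<theta>' \<in> mod_hom \<Lambda> (homC P') X'" "\<theta>' ` carrier (homC P') = carrier X'"
    using p' finite_length_left_module by (auto simp: presentation_def simp del: homC_simps)
  note H = left_module_homC[OF P(1)] and H' = left_module_homC[OF P']
  have "\<exists>F\<in>mod_hom \<Lambda> P P'. \<forall>h\<in>mod_hom \<Lambda> C P. \<theta>' (\<lambda>c\<in>carrier C. F (h c)) = f (\<theta> (\<lambda>c\<in>carrier C. \<tau> (h c)))"
    if "\<tau> \<in> thru \<Lambda> {C} P P" for \<tau>
    using that
  proof (induction rule: thru.induct)
    case thru_zero
    have "\<theta>' (\<lambda>c\<in>carrier C. (\<lambda>x\<in>carrier P. \<zero>\<^bsub>P'\<^esub>) (h c)) = f (\<theta> (\<lambda>c\<in>carrier C. (\<lambda>x\<in>carrier P. \<zero>\<^bsub>P\<^esub>) (h c)))"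
      if h: "h \<in> mod_hom \<Lambda> C P" for h
    proof -
      have "(\<lambda>c\<in>carrier C. (\<lambda>x\<in>carrier P. \<zero>\<^bsub>P'\<^esub>) (h c)) = \<zero>\<^bsub>homC P'\<^esub>"
        "(\<lambda>c\<in>carrier C. (\<lambda>x\<in>carrier P. \<zero>\<^bsub>P\<^esub>) (h c)) = \<zero>\<^bsub>homC P\<^esub>"
        unfolding homC_simps using mod_hom_closed[OF h] by (intro restrict_ext, simp)+
      then show ?thesis
        using mod_hom_zero[OF H' X' \<theta>'(1)] mod_hom_zero[OF H X \<theta>] mod_hom_zero[OF X X' f] by (simp only:)
    qed
    then show ?case using mod_hom_const_zero[OF P(1) P'] by blast
  next
    case (thru_step \<tau> D q g)
    have D: "D = C" using thru_step(2) by simp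
    have q: "q \<in> mod_hom \<Lambda> P C" and g: "g \<in> mod_hom \<Lambda> C P" using thru_step(3,4) D by auto
    note \<tau> = thru_mod_hom[OF P(1) P(1) thru_step(1)]
    obtain F where F: "F \<in> mod_hom \<Lambda> P P'"
      "\<And>h. h \<in> mod_hom \<Lambda> C P \<Longrightarrow> \<theta>' (\<lambda>c\<in>carrier C. F (h c)) = f (\<theta> (\<lambda>c\<in>carrier C. \<tau> (h c)))"
      using thru_step.IH by blast
    have "f (\<theta> g) \<in> \<theta>' ` carrier (homC P')"
      unfolding \<theta>'(2) using mod_hom_closed[OF f mod_hom_closed[OF \<theta>, of g]] g by simp
    then obtain h' where h': "h' \<in> mod_hom \<Lambda> C P'" "\<theta>' h' = f (\<theta> g)" by auto
    let ?F = "\<lambda>x\<in>carrier P. F x \<oplus>\<^bsub>P'\<^esub> (\<lambda>x\<in>carrier P. h' (q x)) x"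
    have "?F \<in> mod_hom \<Lambda> P P'" by (rule mod_hom_plus[OF P(1) P' F(1) mod_hom_comp[OF P(1) q h'(1)]])
    moreover have "\<theta>' (\<lambda>c\<in>carrier C. ?F (h c)) =
        f (\<theta> (\<lambda>c\<in>carrier C. (\<lambda>x\<in>carrier P. \<tau> x \<oplus>\<^bsub>P\<^esub> g (q x)) (h c)))"
      if h: "h \<in> mod_hom \<Lambda> C P" for h
    proof -
      note hc = mod_hom_closed[OF h]
      \<comment> \<open>The endomorphism q h of \<open>C\<close> is \<open>\<rho> l\<close>. So
        composing with q h becomes multiplication by the scalar l, for which \<open>\<theta>\<close>
        and \<open>\<theta>'\<close> are linear.\<close>
      obtain l where l: "l \<in> carrier \<Lambda>" "(\<lambda>c\<in>carrier C. q (h c)) = \<rho> l" using \<rho>_surj[OF mod_hom_comp[OF lC h q]] by blast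
      have ql: "q (h c) = \<rho> l c" if "c \<in> carrier C" for c using fun_cong[OF l(2), of c] that by simp
      have m1: "(\<lambda>c\<in>carrier C. F (h c)) \<in> carrier (homC P')" using mod_hom_comp[OF lC h F(1)] by (simp only: homC_simps)
      have m2: "(\<lambda>c\<in>carrier C. \<tau> (h c)) \<in> carrier (homC P)" using mod_hom_comp[OF lC h \<tau>] by (simp only: homC_simps)
      have m3: "h' \<in> carrier (homC P')" "g \<in> carrier (homC P)" using h'(1) g by simp_all
      have m4: "l \<odot>\<^bsub>homC P'\<^esub> h' \<in> carrier (homC P')" "l \<odot>\<^bsub>homC P\<^esub> g \<in> carrier (homC P)"
        by (rule left_module.smult_closed[OF H' l(1) m3(1)], rule left_module.smult_closed[OF H l(1) m3(2)])
      have 1: "(\<lambda>c\<in>carrier C. ?F (h c)) = (\<lambda>c\<in>carrier C. F (h c)) \<oplus>\<^bsub>homC P'\<^esub> l \<odot>\<^bsub>homC P'\<^esub> h'"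
        unfolding homC_simps using hc by (intro restrict_ext) (simp add: ql)
      have 2: "(\<lambda>c\<in>carrier C. (\<lambda>x\<in>carrier P. \<tau> x \<oplus>\<^bsub>P\<^esub> g (q x)) (h c)) = (\<lambda>c\<in>carrier C. \<tau> (h c)) \<oplus>\<^bsub>homC P\<^esub> l \<odot>\<^bsub>homC P\<^esub> g"
        unfolding homC_simps using hc by (intro restrict_ext) (simp add: ql)
      have "\<theta>' (\<lambda>c\<in>carrier C. ?F (h c)) = f (\<theta> (\<lambda>c\<in>carrier C. \<tau> (h c))) \<oplus>\<^bsub>X'\<^esub> l \<odot>\<^bsub>X'\<^esub> f (\<theta> g)"
        unfolding 1 mod_hom_add[OF \<theta>'(1) m1 m4(1)] mod_hom_smult[OF \<theta>'(1) l(1) m3(1)] F(2)[OF h] h'(2) ..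
      also have "\<dots> = f (\<theta> (\<lambda>c\<in>carrier C. \<tau> (h c)) \<oplus>\<^bsub>X\<^esub> l \<odot>\<^bsub>X\<^esub> \<theta> g)"
      proof -
        have c: "\<theta> (\<lambda>c\<in>carrier C. \<tau> (h c)) \<in> carrier X" "\<theta> g \<in> carrier X"
          by (rule mod_hom_closed[OF \<theta> m2], rule mod_hom_closed[OF \<theta> m3(2)])
        show ?thesis
          unfolding mod_hom_add[OF f c(1) left_module.smult_closed[OF X l(1) c(2)]] mod_hom_smult[OF f l(1) c(2)] ..
      qed
      also have "\<dots> = f (\<theta> ((\<lambda>c\<in>carrier C. \<tau> (h c)) \<oplus>\<^bsub>homC P\<^esub> l \<odot>\<^bsub>homC P\<^esub> g))"
        unfolding mod_hom_add[OF \<theta> m2 m4(2)] mod_hom_smult[OF \<theta> l(1) m3(2)] ..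
      finally show ?thesis unfolding 2 .
    qed
    ultimately show ?case by blast
  qed
  from this[OF P(2)[unfolded in_add_def]] obtain F where F: "F \<in> mod_hom \<Lambda> P P'"
    "\<forall>h\<in>mod_hom \<Lambda> C P. \<theta>' (\<lambda>c\<in>carrier C. F (h c)) = f (\<theta> (\<lambda>c\<in>carrier C. (\<lambda>x\<in>carrier P. x) (h c)))" by blast
  have idC: "(\<lambda>c\<in>carrier C. (\<lambda>x\<in>carrier P. x) (h c)) = h" if h: "h \<in> mod_hom \<Lambda> C P" for h
  proof -
    have "(\<lambda>c\<in>carrier C. (\<lambda>x\<in>carrier P. x) (h c)) = restrict h (carrier C)"
      using mod_hom_closed[OF h] by (intro restrict_ext) simp
    then show ?thesis using mod_hom_restrict[OF h] by (simp only:)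
  qed
  have "\<theta>' (\<lambda>c\<in>carrier C. F (h c)) = f (\<theta> h)" if h: "h \<in> mod_hom \<Lambda> C P" for h
    using F(2)[rule_format, OF h] unfolding idC[OF h] .
  then show ?thesis using F(1) by blast
qed

text \<open>If \<open>\<theta>\<close> kills h, then \<open>\<theta>'\<close> kills F h because
  \<open>F\<close> lifts f; so the generators of the relations are carried to relations.\<close>

lemma lift_maps_relations:
  assumes P: "left_module \<Lambda> P" and P': "left_module \<Lambda> P'" and X: "left_module \<Lambda> X" and X': "left_module \<Lambda> X'"
    and f: "f \<in> mod_hom \<Lambda> X X'" and F: "F \<in> mod_hom \<Lambda> P P'"
    and l: "\<And>h. h \<in> mod_hom \<Lambda> C P \<Longrightarrow> \<theta>' (\<lambda>c\<in>carrier C. F (h c)) = f (\<theta> h)"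
  shows "(\<lambda>y\<in>carrier (relmod P \<theta> X). F y) \<in> mod_hom \<Lambda> (relmod P \<theta> X) (relmod P' \<theta>' X')"
proof -
  have "relations P \<theta> X \<subseteq> {x \<in> carrier P. F x \<in> relations P' \<theta>' X'}"
  proof (rule relations_least[OF submodule_vimage[OF P P' F submodule_relations[OF P']]])
    fix h c assume h: "h \<in> mod_hom \<Lambda> C P" "\<theta> h = \<zero>\<^bsub>X\<^esub>" and c: "c \<in> carrier C"
    have "\<theta>' (\<lambda>c\<in>carrier C. F (h c)) = \<zero>\<^bsub>X'\<^esub>" using l[OF h(1)] h(2) mod_hom_zero[OF X X' f] by simp
    from relations_upper[where \<theta> = \<theta>' and X = X', OF mod_hom_comp[OF lC h(1) F] this c]
    show "h c \<in> {x \<in> carrier P. F x \<in> relations P' \<theta>' X'}" using c mod_hom_closed[OF h(1) c] by simp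
  qed
  then have m: "y \<in> carrier P \<and> F y \<in> relations P' \<theta>' X'" if "y \<in> relations P \<theta> X" for y using that by blast
  show ?thesis
    by (rule mod_hom_restrictI[OF left_module_submodule[OF P submodule_relations[OF P]]])
      (use m in \<open>simp_all add: mod_hom_add[OF F] mod_hom_smult[OF F]\<close>)
qed

text \<open>If \<open>F\<close> lifts zero, then F g is killed by \<open>\<theta>'\<close> for each
  g from \<open>C\<close> to \<open>P\<close>, and these g cover \<open>P\<close>, as it lies in add
  C. Two lifts of one map therefore differ, on the relations, by a map factoring through
  \<open>P\<close>. This is why \<open>C\<close> is adjoined in the statements that follow.\<close>

lemma null_lift:
  assumes P: "left_module \<Lambda> P" "in_add \<Lambda> {C} P" and P': "left_module \<Lambda> P'" and F: "F \<in> mod_hom \<Lambda> P P'"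
    and l: "\<And>h. h \<in> mod_hom \<Lambda> C P \<Longrightarrow> \<theta>' (\<lambda>c\<in>carrier C. F (h c)) = \<zero>\<^bsub>X'\<^esub>" and x: "x \<in> carrier P"
  shows "F x \<in> relations P' \<theta>' X'"
proof -
  note sR = submodule_relations[OF P', of \<theta>' X']
  have "F (\<tau> x) \<in> relations P' \<theta>' X'" if "\<tau> \<in> thru \<Lambda> {C} P P" for \<tau>
    using that
  proof (induction rule: thru.induct)
    case thru_zero
    then show ?case using x mod_hom_zero[OF P(1) P' F] submodule_zero[OF P' sR] by simp
  next
    case (thru_step \<tau> D q g)
    have D: "D = C" using thru_step(2) by simp
    have q: "q \<in> mod_hom \<Lambda> P C" and g: "g \<in> mod_hom \<Lambda> C P" using thru_step(3,4) D by auto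
    note \<tau> = thru_mod_hom[OF P(1) P(1) thru_step(1)]
    have qx: "q x \<in> carrier C" by (rule mod_hom_closed[OF q x])
    have "F (g (q x)) \<in> relations P' \<theta>' X'"
      using relations_upper[where \<theta> = \<theta>' and X = X', OF mod_hom_comp[OF lC g F] l[OF g] qx] qx by simp
    from submodule_add[OF P' sR thru_step.IH this] show ?case
      using x mod_hom_add[OF F mod_hom_closed[OF \<tau> x] mod_hom_closed[OF g qx]] by simp
  qed
  from this[OF P(2)[unfolded in_add_def]] show ?thesis using x by simp
qed

text \<open>Restricting lifts to relations is additive and compatible with composition, up to maps
  through add C. The induction removes one summand g f of h at a time and subtracts from
  \<open>F\<close> the composite of lifts of f and g, until a lift of zero remains.\<close>

lemma relmod_thru:
  assumes p: "presentation P \<theta> X" and p': "presentation P' \<theta>' X'" and X: "left_module \<Lambda> X" and X': "left_module \<Lambda> X'"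
    and S: "\<And>D. D \<in> S \<Longrightarrow> presentation (Pf D) (\<theta>f D) D"
    and h: "h \<in> thru \<Lambda> S X X'" and F: "F \<in> mod_hom \<Lambda> P P'"
    and l: "\<And>e. e \<in> mod_hom \<Lambda> C P \<Longrightarrow> \<theta>' (\<lambda>c\<in>carrier C. F (e c)) = h (\<theta> e)"
  shows "(\<lambda>y\<in>carrier (relmod P \<theta> X). F y) \<in>
    thru \<Lambda> (insert C ((\<lambda>D. relmod (Pf D) (\<theta>f D) D) ` S)) (relmod P \<theta> X) (relmod P' \<theta>' X')"
  using h F l
proof (induction arbitrary: F rule: thru.induct)
  let ?S = "insert C ((\<lambda>D. relmod (Pf D) (\<theta>f D) D) ` S)"
  have P: "left_module \<Lambda> P" "in_add \<Lambda> {C} P" and \<theta>: "\<theta> \<in> mod_hom \<Lambda> (homC P) X"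
    using p finite_length_left_module by (auto simp: presentation_def simp del: homC_simps)
  have P': "left_module \<Lambda> P'" and \<theta>': "\<theta>' \<in> mod_hom \<Lambda> (homC P') X'"
    using p' finite_length_left_module by (auto simp: presentation_def simp del: homC_simps)
  note H = left_module_homC[OF P(1)] and H' = left_module_homC[OF P']
  note lY = left_module_submodule[OF P(1) submodule_relations[OF P(1)], of \<theta> X]
  note lY' = left_module_submodule[OF P' submodule_relations[OF P'], of \<theta>' X']
  {
    case thru_zero
    have z: "\<theta>' (\<lambda>c\<in>carrier C. F (e c)) = \<zero>\<^bsub>X'\<^esub>" if e: "e \<in> mod_hom \<Lambda> C P" for e
      unfolding thru_zero(2)[OF e] using mod_hom_closed[OF \<theta>, of e] e by simp
    note Fr = null_lift[where \<theta>' = \<theta>' and X' = X', OF P P' thru_zero(1) z]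
    \<comment> \<open>All of \<open>P\<close> goes to the relations, so the restriction of
      \<open>F\<close> factors through the inclusion into \<open>P\<close>, a member of add
      C.\<close>
    have F': "F \<in> mod_hom \<Lambda> P (relmod P' \<theta>' X')"
      using thru_zero(1) Fr by (auto simp: mod_hom_def PiE_def)
    have i: "(\<lambda>y\<in>carrier (relmod P \<theta> X). y) \<in> mod_hom \<Lambda> (relmod P \<theta> X) P"
      using submodule_subset[OF P(1) submodule_relations[OF P(1), of \<theta> X]] by (intro mod_hom_restrictI[OF lY]) auto
    have "in_add \<Lambda> ?S P" by (rule in_add_mono[OF P(1) _ _ P(2)]) (use lC in auto)
    from thru_comp_right[OF P(1) lY thru_of_in_add(1)[OF P(1) lY' F' this] i]
    have "(\<lambda>y\<in>carrier (relmod P \<theta> X). F ((\<lambda>y\<in>carrier (relmod P \<theta> X). y) y)) \<in> thru \<Lambda> ?S (relmod P \<theta> X) (relmod P' \<theta>' X')" .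
    moreover have "(\<lambda>y\<in>carrier (relmod P \<theta> X). F ((\<lambda>y\<in>carrier (relmod P \<theta> X). y) y)) = (\<lambda>y\<in>carrier (relmod P \<theta> X). F y)"
      by (intro restrict_ext) simp
    ultimately show ?case by (simp only:)
  next
    case (thru_step h D f g)
    note lD = thru_step(5)
    have pD: "presentation (Pf D) (\<theta>f D) D" by (rule S[OF thru_step(2)])
    have PD: "left_module \<Lambda> (Pf D)" using pD finite_length_left_module by (auto simp: presentation_def)
    note lYD = left_module_submodule[OF PD submodule_relations[OF PD], of "\<theta>f D" D]
    note hh = thru_mod_hom[OF X X' thru_step(1)]
    interpret X': left_module \<Lambda> X' by (rule X')
    interpret P': left_module \<Lambda> P' by (rule P')
    obtain A where A: "A \<in> mod_hom \<Lambda> P (Pf D)"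
      "\<And>e. e \<in> mod_hom \<Lambda> C P \<Longrightarrow> \<theta>f D (\<lambda>c\<in>carrier C. A (e c)) = f (\<theta> e)"
      using presentation_lift[OF p pD X lD thru_step(3)] by blast
    obtain B where B: "B \<in> mod_hom \<Lambda> (Pf D) P'"
      "\<And>e. e \<in> mod_hom \<Lambda> C (Pf D) \<Longrightarrow> \<theta>' (\<lambda>c\<in>carrier C. B (e c)) = g (\<theta>f D e)"
      using presentation_lift[OF pD p' lD X' thru_step(4)] by blast
    have BA: "(\<lambda>x\<in>carrier P. B (A x)) \<in> mod_hom \<Lambda> P P'" by (rule mod_hom_comp[OF P(1) A(1) B(1)])
    note FF = thru_step.prems(1)
    \<comment> \<open>\<open>F\<close> minus the composite of the lifts of f and g; it lifts the
      remaining sum h.\<close>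
    let ?F0 = "\<lambda>x\<in>carrier P. F x \<oplus>\<^bsub>P'\<^esub> (\<lambda>x\<in>carrier P. \<ominus>\<^bsub>P'\<^esub> (\<lambda>x\<in>carrier P. B (A x)) x) x"
    have F0: "?F0 \<in> mod_hom \<Lambda> P P'" by (rule mod_hom_plus[OF P(1) P' FF mod_hom_uminus[OF P(1) P' BA]])
    have F0v: "?F0 x = F x \<ominus>\<^bsub>P'\<^esub> B (A x)" if "x \<in> carrier P" for x using that by (simp add: a_minus_def)
    have "\<theta>' (\<lambda>c\<in>carrier C. ?F0 (e c)) = h (\<theta> e)" if e: "e \<in> mod_hom \<Lambda> C P" for e
    proof -
      have Ae: "(\<lambda>c\<in>carrier C. A (e c)) \<in> mod_hom \<Lambda> C (Pf D)" by (rule mod_hom_comp[OF lC e A(1)])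
      let ?u = "\<lambda>c\<in>carrier C. B ((\<lambda>c\<in>carrier C. A (e c)) c)" and ?v = "\<lambda>c\<in>carrier C. ?F0 (e c)"
      have u: "?u \<in> carrier (homC P')" using mod_hom_comp[OF lC Ae B(1)] by (simp only: homC_simps)
      have v: "?v \<in> carrier (homC P')" using mod_hom_comp[OF lC e F0] by (simp only: homC_simps)
      have "?v \<oplus>\<^bsub>homC P'\<^esub> ?u = (\<lambda>c\<in>carrier C. F (e c))"
        unfolding homC_simps
      proof (intro restrict_ext)
        fix c assume c: "c \<in> carrier C"
        have ec: "e c \<in> carrier P" by (rule mod_hom_closed[OF e c])
        have "F (e c) \<ominus>\<^bsub>P'\<^esub> B (A (e c)) \<oplus>\<^bsub>P'\<^esub> B (A (e c)) = F (e c)"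
          using mod_hom_closed[OF FF ec] mod_hom_closed[OF B(1) mod_hom_closed[OF A(1) ec]]
          by (simp add: a_minus_def P'.M.a_assoc P'.M.l_neg)
        then show "?v c \<oplus>\<^bsub>P'\<^esub> ?u c = F (e c)" using c F0v[OF ec] by (simp del: restrict_apply add: restrict_apply'[OF c])
      qed
      then have "\<theta>' ?v \<oplus>\<^bsub>X'\<^esub> \<theta>' ?u = \<theta>' (\<lambda>c\<in>carrier C. F (e c))" using mod_hom_add[OF \<theta>' v u] by (simp only:)
      also have "\<dots> = h (\<theta> e) \<oplus>\<^bsub>X'\<^esub> g (f (\<theta> e))"
        unfolding thru_step.prems(2)[OF e] using mod_hom_closed[OF \<theta>, of e] e by simp
      also have "g (f (\<theta> e)) = \<theta>' ?u" unfolding B(2)[OF Ae] A(2)[OF e] ..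
      finally have eq: "\<theta>' ?v \<oplus>\<^bsub>X'\<^esub> \<theta>' ?u = h (\<theta> e) \<oplus>\<^bsub>X'\<^esub> \<theta>' ?u" .
      have "\<theta> e \<in> carrier X" using mod_hom_closed[OF \<theta>, of e] e by simp
      from X'.M.add.right_cancel[OF mod_hom_closed[OF \<theta>' u] mod_hom_closed[OF \<theta>' v] mod_hom_closed[OF hh this], THEN iffD1, OF eq]
      show ?thesis .
    qed
    note IH = thru_step.IH[OF F0 this]
    note rA = lift_maps_relations[where \<theta> = \<theta> and \<theta>' = "\<theta>f D", OF P(1) PD X lD thru_step(3) A]
    note rB = lift_maps_relations[where \<theta> = "\<theta>f D" and \<theta>' = \<theta>', OF PD P' lD X' thru_step(4) B]
    let ?Y = "relmod P \<theta> X" and ?YD = "relmod (Pf D) (\<theta>f D) D" and ?Y' = "relmod P' \<theta>' X'"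
    have "?YD \<in> ?S" using thru_step(2) by blast
    from thru.thru_step[OF IH this rA rB lYD]
    have "(\<lambda>y\<in>carrier ?Y. (\<lambda>y\<in>carrier ?Y. ?F0 y) y \<oplus>\<^bsub>?Y'\<^esub> (\<lambda>y\<in>carrier ?YD. B y) ((\<lambda>y\<in>carrier ?Y. A y) y))
        \<in> thru \<Lambda> ?S ?Y ?Y'" .
    moreover have "(\<lambda>y\<in>carrier ?Y. (\<lambda>y\<in>carrier ?Y. ?F0 y) y \<oplus>\<^bsub>?Y'\<^esub> (\<lambda>y\<in>carrier ?YD. B y) ((\<lambda>y\<in>carrier ?Y. A y) y)) =
        (\<lambda>y\<in>carrier ?Y. F y)"
    proof (intro restrict_ext)
      fix y assume y: "y \<in> carrier ?Y"
      have yP: "y \<in> carrier P" using y submodule_subset[OF P(1) submodule_relations[OF P(1), of \<theta> X]] by auto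
      have Ay: "A y \<in> carrier ?YD" using mod_hom_closed[OF rA y] y by simp
      have "F y \<ominus>\<^bsub>P'\<^esub> B (A y) \<oplus>\<^bsub>P'\<^esub> B (A y) = F y"
        using mod_hom_closed[OF FF yP] mod_hom_closed[OF B(1) mod_hom_closed[OF A(1) yP]]
        by (simp add: a_minus_def P'.M.a_assoc P'.M.l_neg)
      then show "(\<lambda>y\<in>carrier ?Y. ?F0 y) y \<oplus>\<^bsub>?Y'\<^esub> (\<lambda>y\<in>carrier ?YD. B y) ((\<lambda>y\<in>carrier ?Y. A y) y) = F y"
        using F0v[OF yP] unfolding restrict_apply'[OF y] restrict_apply'[OF Ay] by simp
    qed
    ultimately show ?case by (simp only:)
  }
qed

text \<open>The case of the identity of \<open>X\<close>, which is lifted by the identity of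
  \<open>P\<close>.\<close>

lemma relmod_in_add:
  assumes p: "presentation P \<theta> X" and X: "left_module \<Lambda> X"
    and S: "\<And>D. D \<in> S \<Longrightarrow> presentation (Pf D) (\<theta>f D) D" and add: "in_add \<Lambda> S X"
  shows "in_add \<Lambda> (insert C ((\<lambda>D. relmod (Pf D) (\<theta>f D) D) ` S)) (relmod P \<theta> X)"
proof -
  have P: "left_module \<Lambda> P" and \<theta>: "\<theta> \<in> mod_hom \<Lambda> (homC P) X"
    using p finite_length_left_module by (auto simp: presentation_def simp del: homC_simps)
  have "\<theta> (\<lambda>c\<in>carrier C. (\<lambda>x\<in>carrier P. x) (e c)) = (\<lambda>x\<in>carrier X. x) (\<theta> e)" if e: "e \<in> mod_hom \<Lambda> C P" for e
  proof -
    have "(\<lambda>c\<in>carrier C. (\<lambda>x\<in>carrier P. x) (e c)) = restrict e (carrier C)"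
      using mod_hom_closed[OF e] by (intro restrict_ext) simp
    then have idC: "(\<lambda>c\<in>carrier C. (\<lambda>x\<in>carrier P. x) (e c)) = e" using mod_hom_restrict[OF e] by (simp only:)
    show ?thesis unfolding idC using mod_hom_closed[OF \<theta>, of e] e by simp
  qed
  from relmod_thru[where Pf = Pf and \<theta>f = \<theta>f, OF p p X X S add[unfolded in_add_def] mod_hom_id[OF P] this]
  have "(\<lambda>y\<in>carrier (relmod P \<theta> X). (\<lambda>x\<in>carrier P. x) y) \<in>
      thru \<Lambda> (insert C ((\<lambda>D. relmod (Pf D) (\<theta>f D) D) ` S)) (relmod P \<theta> X) (relmod P \<theta> X)" .
  moreover have "(\<lambda>y\<in>carrier (relmod P \<theta> X). (\<lambda>x\<in>carrier P. x) y) = (\<lambda>y\<in>carrier (relmod P \<theta> X). y)"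
    using submodule_subset[OF P submodule_relations[OF P, of \<theta> X]] by (intro restrict_ext) auto
  ultimately show ?thesis unfolding in_add_def by (simp only:)
qed

end

section \<open>Approximations and presentations\<close>

text \<open>If a sum of maps does not kill x, then some summand g f does not, and f x is detected by
  a map to \<open>C\<close>.\<close>

lemma in_add_cogenerated:
  assumes A: "left_module R A" and C: "left_module R C" and S: "\<And>D. D \<in> S \<Longrightarrow> cogenerated R C D" and "in_add R S A"
  shows "cogenerated R C A"
  unfolding cogenerated_def
proof (intro ballI impI)
  interpret A: left_module R A by (rule A)
  fix x assume x: "x \<in> carrier A" "x \<noteq> \<zero>\<^bsub>A\<^esub>"
  have "\<exists>t\<in>mod_hom R A C. t x \<noteq> \<zero>\<^bsub>C\<^esub>" if "\<tau> \<in> thru R S A A" "\<tau> x \<noteq> \<zero>\<^bsub>A\<^esub>" for \<tau>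
    using that
  proof (induction rule: thru.induct)
    case thru_zero
    then show ?case using x(1) by simp
  next
    case (thru_step h D f g)
    show ?case
    proof (cases "h x = \<zero>\<^bsub>A\<^esub>")
      case True
      have "f x \<noteq> \<zero>\<^bsub>D\<^esub>"
      proof
        assume "f x = \<zero>\<^bsub>D\<^esub>"
        then show False using thru_step.prems x(1) True mod_hom_zero[OF thru_step(5) A thru_step(4)] by simp
      qed
      then obtain t where t: "t \<in> mod_hom R D C" "t (f x) \<noteq> \<zero>\<^bsub>C\<^esub>"
        using S[OF thru_step(2)] mod_hom_closed[OF thru_step(3) x(1)] unfolding cogenerated_def by blast
      then show ?thesis using mod_hom_comp[OF A thru_step(3) t(1)] x(1) by (intro bexI[of _ "\<lambda>y\<in>carrier A. t (f y)"]) simp_all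
    qed (use thru_step.IH in blast)
  qed
  from this[OF assms(4)[unfolded in_add_def]] show "\<exists>t\<in>mod_hom R A C. t x \<noteq> \<zero>\<^bsub>C\<^esub>" using x by simp
qed

lemma in_add_generated:
  assumes A: "left_module R A" and S: "\<And>D. D \<in> S \<Longrightarrow> generated R C D" and C: "left_module R C" and "in_add R S A"
  shows "generated R C A"
  unfolding generated_def
proof (intro allI impI)
  fix U assume U: "submodule U R A" and all: "\<forall>f\<in>mod_hom R C A. f ` carrier C \<subseteq> U"
  have "\<tau> x \<in> U" if "\<tau> \<in> thru R S A A" and x: "x \<in> carrier A" for \<tau> x
    using that(1)
  proof (induction rule: thru.induct)
    case thru_zero
    then show ?case using x submodule_zero[OF A U] by simp
  next
    case (thru_step h D f g)
    have "{y \<in> carrier D. g y \<in> U} = carrier D"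
    proof -
      have "t ` carrier C \<subseteq> {y \<in> carrier D. g y \<in> U}" if t: "t \<in> mod_hom R C D" for t
      proof
        fix y assume "y \<in> t ` carrier C"
        then obtain c where c: "c \<in> carrier C" "y = t c" by blast
        have "(\<lambda>c\<in>carrier C. g (t c)) ` carrier C \<subseteq> U" using all mod_hom_comp[OF C t thru_step(4)] by blast
        then have "g (t c) \<in> U" using c(1) by auto
        then show "y \<in> {y \<in> carrier D. g y \<in> U}" using c mod_hom_closed[OF t] by simp
      qed
      then show ?thesis
        using S[OF thru_step(2)] submodule_vimage[OF thru_step(5) A thru_step(4) U] unfolding generated_def by blast
    qed
    then have "g (f x) \<in> U" using mod_hom_closed[OF thru_step(3) x] by blast
    then show ?case using submodule_add[OF A U thru_step.IH] x by simp
  qed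
  from this[OF assms(4)[unfolded in_add_def]] have "carrier A \<subseteq> U" by auto
  then show "U = carrier A" using submodule_subset[OF A U] by blast
qed

lemma generated_image:
  assumes A: "left_module R A" and B: "left_module R B" and C: "left_module R C"
    and f: "f \<in> mod_hom R A B" "f ` carrier A = carrier B" and gen: "generated R C A"
  shows "generated R C B"
  unfolding generated_def
proof (intro allI impI)
  fix U assume U: "submodule U R B" and all: "\<forall>f\<in>mod_hom R C B. f ` carrier C \<subseteq> U"
  have "t ` carrier C \<subseteq> {y \<in> carrier A. f y \<in> U}" if t: "t \<in> mod_hom R C A" for t
  proof
    fix y assume "y \<in> t ` carrier C"
    then obtain c where c: "c \<in> carrier C" "y = t c" by blast
    have "(\<lambda>c\<in>carrier C. f (t c)) ` carrier C \<subseteq> U" using all mod_hom_comp[OF C t f(1)] by blast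
    then have "f (t c) \<in> U" using c(1) by auto
    then show "y \<in> {y \<in> carrier A. f y \<in> U}" using c mod_hom_closed[OF t] by simp
  qed
  then have "{y \<in> carrier A. f y \<in> U} = carrier A"
    using gen submodule_vimage[OF A B f(1) U] unfolding generated_def by blast
  then have "carrier B \<subseteq> U" unfolding f(2)[symmetric] by blast
  then show "U = carrier B" using submodule_subset[OF B U] by blast
qed

lemma generated_self:
  assumes "left_module R C"
  shows "generated R C C"
  unfolding generated_def
proof (intro allI impI)
  fix U assume U: "submodule U R C" and "\<forall>f\<in>mod_hom R C C. f ` carrier C \<subseteq> U"
  then have "(\<lambda>x\<in>carrier C. x) ` carrier C \<subseteq> U" using mod_hom_id[OF assms] by blast
  then show "U = carrier C" using submodule_subset[OF assms U] by auto
qed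

section \<open>Projective and injective modules in additive closures\<close>

lemma in_add_iso:
  assumes A: "left_module R A" and B: "left_module R B" and iso: "mod_iso R A B"
  shows "in_add R S A \<Longrightarrow> in_add R S B" "in_add R S B \<Longrightarrow> in_add R S A"
proof -
  obtain f where f: "f \<in> mod_hom R A B" "bij_betw f (carrier A) (carrier B)" using iso unfolding mod_iso_def by blast
  obtain g where g: "g \<in> mod_hom R B A" "\<And>x. x \<in> carrier A \<Longrightarrow> g (f x) = x" "\<And>y. y \<in> carrier B \<Longrightarrow> f (g y) = y"
    using mod_hom_inverse[OF A B f] by blast
  show "in_add R S A \<Longrightarrow> in_add R S B" by (rule in_add_retract[OF B A g(1) f(1) g(3)])
  show "in_add R S B \<Longrightarrow> in_add R S A" by (rule in_add_retract[OF A B f(1) g(1) g(2)])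
qed

lemma projective_in_add:
  fixes P L :: "'r lmod"
  assumes P: "finite_length_module R P" and L: "projective_mod R L" and "in_add R {L} P"
  shows "projective_mod R P"
proof -
  note lP = finite_length_left_module[OF P]
  have "\<exists>h\<in>mod_hom R P A. \<forall>x\<in>carrier P. g (h x) = f x"
    if A: "finite_length_module R A" and B: "finite_length_module R B" and g: "g \<in> mod_hom R A B"
      and f: "f \<in> mod_hom R P B" and surj: "g ` carrier A = carrier B" for A B :: "'r lmod" and g f
  proof -
    note lA = finite_length_left_module[OF A] and lB = finite_length_left_module[OF B]
    have "\<exists>h\<in>mod_hom R P A. \<forall>x\<in>carrier P. g (h x) = f (\<tau> x)" if "\<tau> \<in> thru R {L} P P" for \<tau>
      using that
    proof (induction rule: thru.induct)
      case thru_zero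
      show ?case
        using mod_hom_zero[OF lP lB f] mod_hom_zero[OF lA lB g]
        by (intro bexI[OF _ mod_hom_const_zero[OF lP lA]]) simp
    next
      case (thru_step \<tau> D q t)
      have D: "D = L" using thru_step(2) by simp
      note \<tau> = thru_mod_hom[OF lP lP thru_step(1)]
      have ft: "(\<lambda>x\<in>carrier L. f (t x)) \<in> mod_hom R L B"
        using mod_hom_comp[OF thru_step(5,4) f] unfolding D .
      obtain s where s: "s \<in> mod_hom R L A" "\<forall>x\<in>carrier L. g (s x) = (\<lambda>x\<in>carrier L. f (t x)) x"
        using L A B g surj ft unfolding projective_mod_def by blast
      obtain h where h: "h \<in> mod_hom R P A" "\<forall>x\<in>carrier P. g (h x) = f (\<tau> x)" using thru_step.IH by blast
      have q: "q \<in> mod_hom R P L" using thru_step(3) unfolding D .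
      let ?h = "\<lambda>x\<in>carrier P. h x \<oplus>\<^bsub>A\<^esub> (\<lambda>x\<in>carrier P. s (q x)) x"
      have "?h \<in> mod_hom R P A" by (rule mod_hom_plus[OF lP lA h(1) mod_hom_comp[OF lP q s(1)]])
      moreover have "g (?h x) = f ((\<lambda>x\<in>carrier P. \<tau> x \<oplus>\<^bsub>P\<^esub> t (q x)) x)" if x: "x \<in> carrier P" for x
      proof -
        have c: "q x \<in> carrier L" by (rule mod_hom_closed[OF q x])
        have tc: "t (q x) \<in> carrier P" using mod_hom_closed[OF thru_step(4), of "q x"] c unfolding D by blast
        have "g (?h x) = g (h x) \<oplus>\<^bsub>B\<^esub> g (s (q x))"
          using x mod_hom_add[OF g mod_hom_closed[OF h(1) x] mod_hom_closed[OF s(1) c]] by simp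
        also have "\<dots> = f (\<tau> x) \<oplus>\<^bsub>B\<^esub> f (t (q x))" using h(2) s(2) x c by simp
        also have "\<dots> = f (\<tau> x \<oplus>\<^bsub>P\<^esub> t (q x))" by (rule mod_hom_add[OF f mod_hom_closed[OF \<tau> x] tc, symmetric])
        finally show ?thesis using x by simp
      qed
      ultimately show ?case by blast
    qed
    from this[OF assms(3)[unfolded in_add_def]] obtain h where "h \<in> mod_hom R P A"
      "\<forall>x\<in>carrier P. g (h x) = f ((\<lambda>x\<in>carrier P. x) x)" by blast
    then show ?thesis by (intro bexI[of _ h]) simp_all
  qed
  then show ?thesis unfolding projective_mod_def using P by blast
qed

text \<open>Generation supplies a surjection from a member of add L, and projectivity splits
  it.\<close>

lemma projective_in_add_of_generated:
  fixes P L :: "'r lmod"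
  assumes P: "projective_mod R P" and L: "finite_length_module R L" and gen: "generated R L P"
  shows "in_add R {L} P"
proof -
  have fP: "finite_length_module R P" using P by (simp add: projective_mod_def)
  note lP = finite_length_left_module[OF fP]
  obtain Q s where Q: "finite_length_module R Q" "in_add R {L} Q" and s: "s \<in> mod_hom R Q P" "s ` carrier Q = carrier P"
    by (rule generated_surjection[OF fP L gen])
  obtain h where h: "h \<in> mod_hom R P Q" "\<forall>x\<in>carrier P. s (h x) = (\<lambda>x\<in>carrier P. x) x"
    using P Q(1) fP s mod_hom_id[OF lP] unfolding projective_mod_def by blast
  show ?thesis by (rule in_add_retract[OF lP finite_length_left_module[OF Q(1)] h(1) s(1) _ Q(2)]) (use h(2) in simp)
qed

text \<open>Cogeneration supplies an embedding into a member of add C, and injectivity splits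
  it.\<close>

lemma injective_in_add_of_cogenerated:
  fixes N C :: "'r lmod"
  assumes N: "injective_mod R N" and C: "finite_length_module R C" and co: "cogenerated R C N"
  shows "in_add R {C} N"
proof -
  have fN: "finite_length_module R N" using N by (simp add: injective_mod_def)
  note lN = finite_length_left_module[OF fN]
  obtain P f where P: "finite_length_module R P" "in_add R {C} P" and f: "f \<in> mod_hom R N P" "inj_on f (carrier N)"
    by (rule cogenerated_embedding[OF fN C co])
  obtain h where h: "h \<in> mod_hom R P N" "\<forall>x\<in>carrier N. h (f x) = (\<lambda>x\<in>carrier N. x) x"
    using N P(1) fN f mod_hom_id[OF lN] unfolding injective_mod_def by blast
  show ?thesis by (rule in_add_retract[OF lN finite_length_left_module[OF P(1)] f(1) h(1) _ P(2)]) (use h(2) in simp)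
qed

context artin_algebra
begin

lemma projective_reg: "projective_mod \<Lambda> (reg \<Lambda>)"
proof -
  have "\<exists>h\<in>mod_hom \<Lambda> (reg \<Lambda>) A. \<forall>x\<in>carrier (reg \<Lambda>). g (h x) = f x"
    if A: "finite_length_module \<Lambda> A" and B: "finite_length_module \<Lambda> B" and g: "g \<in> mod_hom \<Lambda> A B"
      and f: "f \<in> mod_hom \<Lambda> (reg \<Lambda>) B" and surj: "g ` carrier A = carrier B" for A B :: "'a lmod" and g f
  proof -
    interpret A: left_module \<Lambda> A by (rule finite_length_left_module[OF A])
    have "f \<one>\<^bsub>\<Lambda>\<^esub> \<in> g ` carrier A" unfolding surj using mod_hom_closed[OF f, of "\<one>\<^bsub>\<Lambda>\<^esub>"] by simp
    then obtain a where a: "a \<in> carrier A" "g a = f \<one>\<^bsub>\<Lambda>\<^esub>" by auto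
    have "g ((\<lambda>r\<in>carrier \<Lambda>. r \<odot>\<^bsub>A\<^esub> a) x) = f x" if x: "x \<in> carrier \<Lambda>" for x
      using x a mod_hom_smult[OF g x a(1)] mod_hom_smult[OF f x, of "\<one>\<^bsub>\<Lambda>\<^esub>"] by simp
    then show ?thesis using A.mod_hom_reg[OF a(1)] by (intro bexI[of _ "\<lambda>r\<in>carrier \<Lambda>. r \<odot>\<^bsub>A\<^esub> a"]) simp_all
  qed
  then show ?thesis
    unfolding projective_mod_def by (intro conjI allI impI ballI finite_length_reg_algebra)
qed

text \<open>As g(e) = 1, each y is the value at e of the map x \<mapsto> g(x) y. In the application
  \<open>L\<close> is the copy of the regular module on lists.\<close>

lemma generated_reg_copy:
  assumes L: "left_module \<Lambda> L" and g: "g \<in> mod_hom \<Lambda> L (reg \<Lambda>)" and e: "e \<in> carrier L" "g e = \<one>\<^bsub>\<Lambda>\<^esub>"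
    and Y: "left_module \<Lambda> Y"
  shows "generated \<Lambda> L Y"
  unfolding generated_def
proof (intro allI impI)
  interpret Y: left_module \<Lambda> Y by (rule Y)
  fix U assume U: "submodule U \<Lambda> Y" and all: "\<forall>f\<in>mod_hom \<Lambda> L Y. f ` carrier L \<subseteq> U"
  have "y \<in> U" if y: "y \<in> carrier Y" for y
  proof -
    let ?f = "\<lambda>x\<in>carrier L. (\<lambda>a\<in>carrier \<Lambda>. a \<odot>\<^bsub>Y\<^esub> y) (g x)"
    have "?f ` carrier L \<subseteq> U" by (rule bspec[OF all mod_hom_comp[OF L g Y.mod_hom_reg[OF y]]])
    then have "?f e \<in> U" using imageI[OF e(1), of ?f] by (rule subsetD)
    then show ?thesis using e y by simp
  qed
  then show "U = carrier Y" using submodule_subset[OF Y U] by blast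
qed

text \<open>The components of \<open>\<phi>\<close> generate \<open>Hom(X, Q)\<close> over \<open>End(Q)\<close>.\<close>

lemma left_approximation:
  fixes X Q :: "'a lmod"
  assumes X: "finite_length_module \<Lambda> X" and Q: "finite_length_module \<Lambda> Q"
  shows "\<exists>Q' \<phi>. finite_length_module \<Lambda> Q' \<and> in_add \<Lambda> {Q} Q' \<and> \<phi> \<in> mod_hom \<Lambda> X Q' \<and>
    (\<forall>f\<in>mod_hom \<Lambda> X Q. \<exists>g\<in>mod_hom \<Lambda> Q' Q. \<forall>x\<in>carrier X. g (\<phi> x) = f x)"
proof -
  note lX = finite_length_left_module[OF X] and lQ = finite_length_left_module[OF Q]
  obtain A F where A: "finite_length_module \<Lambda> A" "in_add \<Lambda> {Q} A"
    and F: "F \<in> mod_hom (End_ring \<Lambda> Q) (hom_into \<Lambda> Q A) (hom_into \<Lambda> Q X)"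
      "F ` carrier (hom_into \<Lambda> Q A) = carrier (hom_into \<Lambda> Q X)"
    using hom_into_surjection[OF Q finite_length_hom_into[OF X Q]] by (elim exE conjE)
  note lA = finite_length_left_module[OF A(1)]
  \<comment> \<open>Fullness turns the covering Hom(A, Q) \<rightarrow> Hom(X, Q) into
    precomposition with a map u from \<open>X\<close> to \<open>A\<close>, and its surjectivity is
    the extension property.\<close>
  obtain u where u: "u \<in> mod_hom \<Lambda> X A"
    "\<forall>\<phi>\<in>mod_hom \<Lambda> A Q. \<forall>x\<in>carrier X. F (\<lambda>y\<in>carrier A. \<phi> ((\<lambda>y\<in>carrier A. y) y)) x = \<phi> (u x)"
    using hom_into_full[OF lX lA lQ F(1) A(2)[unfolded in_add_def]] by blast
  have "\<exists>g\<in>mod_hom \<Lambda> A Q. \<forall>x\<in>carrier X. g (u x) = f x" if f: "f \<in> mod_hom \<Lambda> X Q" for f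
  proof -
    have "f \<in> F ` carrier (hom_into \<Lambda> Q A)" unfolding F(2) using f by simp
    then obtain g where g: "g \<in> mod_hom \<Lambda> A Q" "f = F g" by auto
    have "(\<lambda>y\<in>carrier A. g ((\<lambda>y\<in>carrier A. y) y)) = restrict g (carrier A)" by (intro restrict_ext) simp
    then have "(\<lambda>y\<in>carrier A. g ((\<lambda>y\<in>carrier A. y) y)) = g" using mod_hom_restrict[OF g(1)] by (simp only:)
    then show ?thesis using u(2) g by metis
  qed
  then show ?thesis using A u(1) by blast
qed

end

context algebra_dual
begin

text \<open>Hom(C, C) is the regular module, so n copies of \<open>C\<close> give a free module of
  rank n. With each new generator x one copy of \<open>C\<close> is added, and a map h with
  component q h on it contributes \<sigma>(q h) x.\<close>

lemma presentation_exists: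
  assumes X: "finite_length_module \<Lambda> X"
  shows "\<exists>P \<theta>. presentation P \<theta> X"
proof -
  note lX = finite_length_left_module[OF X]
  interpret X: left_module \<Lambda> X by (rule lX)
  obtain \<sigma> where \<sigma>: "\<sigma> \<in> mod_hom \<Lambda> (homC C) (reg \<Lambda>)" "\<And>l. l \<in> carrier \<Lambda> \<Longrightarrow> \<sigma> (\<rho> l) = l"
    "\<And>h. h \<in> mod_hom \<Lambda> C C \<Longrightarrow> \<rho> (\<sigma> h) = h"
    by (rule End_C_coordinate) (rule that)
  have "\<exists>P \<theta>. finite_length_module \<Lambda> P \<and> in_add \<Lambda> {C} P \<and> \<theta> \<in> mod_hom \<Lambda> (homC P) X \<and> X.lspan xs \<subseteq> \<theta> ` carrier (homC P)"
    if "set xs \<subseteq> carrier X" for xs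
    using that
  proof (induction xs)
    case Nil
    obtain N :: "'a lmod" where N: "finite_length_module \<Lambda> N" "carrier N = {\<zero>\<^bsub>N\<^esub>}"
      using zero_module_exists[OF \<Lambda>.ring_axioms] by auto
    note lN = finite_length_left_module[OF N(1)]
    note H = left_module_homC[OF lN]
    have "\<zero>\<^bsub>X\<^esub> \<in> (\<lambda>_\<in>carrier (homC N). \<zero>\<^bsub>X\<^esub>) ` carrier (homC N)"
      using submodule_zero[OF H submodule_carrier[OF H]] by (intro image_eqI[of _ _ "\<zero>\<^bsub>homC N\<^esub>"]) simp_all
    then have sub: "X.lspan [] \<subseteq> (\<lambda>_\<in>carrier (homC N). \<zero>\<^bsub>X\<^esub>) ` carrier (homC N)" unfolding X.lspan_Nil by blast
    show ?case
      by (intro exI[of _ N] exI[of _ "\<lambda>_\<in>carrier (homC N). \<zero>\<^bsub>X\<^esub>"] conjI N(1) in_add_zero[OF lN N(2)]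
          mod_hom_const_zero[OF H lX] sub)
  next
    case (Cons x xs)
    then have x: "x \<in> carrier X" and xs: "set xs \<subseteq> carrier X" by auto
    obtain P \<theta> where P: "finite_length_module \<Lambda> P" "in_add \<Lambda> {C} P" and \<theta>: "\<theta> \<in> mod_hom \<Lambda> (homC P) X"
      and im: "X.lspan xs \<subseteq> \<theta> ` carrier (homC P)"
      using Cons.IH[OF xs] by blast
    note lP = finite_length_left_module[OF P(1)]
    obtain P' i j p q where b: "biproduct \<Lambda> P C P' i j p q" using biproduct_exists[OF P(1) C_finite_length] by blast
    note b' = b[unfolded biproduct_def]
    have fP': "finite_length_module \<Lambda> P'" using b' by blast
    note lP' = finite_length_left_module[OF fP']
    have ij: "i \<in> mod_hom \<Lambda> P P'" "j \<in> mod_hom \<Lambda> C P'" "p \<in> mod_hom \<Lambda> P' P" "q \<in> mod_hom \<Lambda> P' C" using b' by auto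
    have pi: "p (i y) = y" "q (i y) = \<zero>\<^bsub>C\<^esub>" if "y \<in> carrier P" for y using b' that by blast+
    have pj: "p (j y) = \<zero>\<^bsub>P\<^esub>" "q (j y) = y" if "y \<in> carrier C" for y using b' that by blast+
    have addP': "in_add \<Lambda> {C} P'" by (rule biproduct_in_add[OF b lP lC P(2) in_add_member[OF lC]]) simp
    note H' = left_module_homC[OF lP']
    let ?pp = "\<lambda>h\<in>carrier (homC P'). \<lambda>c\<in>carrier C. p (h c)" and ?qq = "\<lambda>h\<in>carrier (homC P'). \<lambda>c\<in>carrier C. q (h c)"
    note t1 = mod_hom_comp[OF H' homC_postcompose[OF lP' ij(3)] \<theta>]
    note t2 = mod_hom_comp[OF H' mod_hom_comp[OF H' homC_postcompose[OF lP' ij(4)] \<sigma>(1)] X.mod_hom_reg[OF x]]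
    let ?t = "\<lambda>h\<in>carrier (homC P'). (\<lambda>h\<in>carrier (homC P'). \<theta> (?pp h)) h \<oplus>\<^bsub>X\<^esub>
      (\<lambda>h\<in>carrier (homC P'). (\<lambda>a\<in>carrier \<Lambda>. a \<odot>\<^bsub>X\<^esub> x) ((\<lambda>h\<in>carrier (homC P'). \<sigma> (?qq h)) h)) h"
    have t: "?t \<in> mod_hom \<Lambda> (homC P') X" by (rule mod_hom_plus[OF H' lX t1 t2])
    note sim = submodule_image[OF H' lX t submodule_carrier[OF H']]
    have t_eq: "?t h = \<theta> (\<lambda>c\<in>carrier C. p (h c)) \<oplus>\<^bsub>X\<^esub> \<sigma> (\<lambda>c\<in>carrier C. q (h c)) \<odot>\<^bsub>X\<^esub> x" if h: "h \<in> mod_hom \<Lambda> C P'" for h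
    proof -
      have "\<sigma> (\<lambda>c\<in>carrier C. q (h c)) \<in> carrier \<Lambda>"
        using mod_hom_closed[OF \<sigma>(1), of "\<lambda>c\<in>carrier C. q (h c)"] mod_hom_comp[OF lC h ij(4)] by (simp only: homC_simps reg_simps)
      then show ?thesis using h by (simp only: homC_simps restrict_apply if_True)
    qed
    have \<sigma>0: "\<sigma> \<zero>\<^bsub>homC C\<^esub> = \<zero>\<^bsub>\<Lambda>\<^esub>" using mod_hom_zero[OF left_module_homC[OF lC] left_module_reg_algebra \<sigma>(1)] by (simp only: reg_simps)
    have img: "\<theta> h \<in> ?t ` carrier (homC P')" if hH: "h \<in> carrier (homC P)" for h
    proof -
      have h: "h \<in> mod_hom \<Lambda> C P" using hH by (simp only: homC_simps)
      let ?h = "\<lambda>c\<in>carrier C. i (h c)"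
      have hh: "?h \<in> mod_hom \<Lambda> C P'" by (rule mod_hom_comp[OF lC h ij(1)])
      have "(\<lambda>c\<in>carrier C. p (?h c)) = restrict h (carrier C)"
        using mod_hom_closed[OF h] by (intro restrict_ext) (simp add: pi)
      then have 1: "(\<lambda>c\<in>carrier C. p (?h c)) = h" using mod_hom_restrict[OF h] by (simp only:)
      have 2: "(\<lambda>c\<in>carrier C. q (?h c)) = \<zero>\<^bsub>homC C\<^esub>"
        unfolding homC_simps using mod_hom_closed[OF h] by (intro restrict_ext) (simp add: pi)
      have "?t ?h = \<theta> h \<oplus>\<^bsub>X\<^esub> \<zero>\<^bsub>\<Lambda>\<^esub> \<odot>\<^bsub>X\<^esub> x"
        by (rule trans[OF t_eq[OF hh]]) (simp only: 1 2 \<sigma>0)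
      also have "\<dots> = \<theta> h" unfolding X.smult_zero_l[OF x] by (rule X.M.r_zero[OF mod_hom_closed[OF \<theta> hH]])
      finally have 3: "?t ?h = \<theta> h" .
      have "?h \<in> carrier (homC P')" using hh by (simp only: homC_simps)
      from imageI[OF this, of ?t] show ?thesis unfolding 3 .
    qed
    have sub: "X.lspan xs \<subseteq> ?t ` carrier (homC P')" by (rule subset_trans[OF im image_subsetI[OF img]])
    have xin: "x \<in> ?t ` carrier (homC P')"
    proof -
      have 1: "(\<lambda>c\<in>carrier C. p (j c)) = \<zero>\<^bsub>homC P\<^esub>" unfolding homC_simps by (intro restrict_ext) (simp add: pj)
      have "(\<lambda>c\<in>carrier C. q (j c)) = \<rho> \<one>\<^bsub>\<Lambda>\<^esub>"
        by (rule mod_hom_eqI[OF mod_hom_comp[OF lC ij(2,4)] \<rho>_hom[OF \<Lambda>.one_closed]]) (simp add: pj \<rho>_one)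
      then have 2: "\<sigma> (\<lambda>c\<in>carrier C. q (j c)) = \<one>\<^bsub>\<Lambda>\<^esub>" using \<sigma>(2)[OF \<Lambda>.one_closed] by (simp only:)
      have "?t j = \<zero>\<^bsub>X\<^esub> \<oplus>\<^bsub>X\<^esub> \<one>\<^bsub>\<Lambda>\<^esub> \<odot>\<^bsub>X\<^esub> x"
        by (rule trans[OF t_eq[OF ij(2)]]) (simp only: 1 2 mod_hom_zero[OF left_module_homC[OF lP] lX \<theta>])
      also have "\<dots> = x" using x by simp
      finally have 3: "?t j = x" .
      have "j \<in> carrier (homC P')" using ij(2) by (simp only: homC_simps)
      from imageI[OF this, of ?t] show ?thesis unfolding 3 .
    qed
    have "X.lspan (x # xs) \<subseteq> ?t ` carrier (homC P')"
    proof
      fix w assume "w \<in> X.lspan (x # xs)"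
      then obtain r y where r: "r \<in> carrier \<Lambda>" and y: "y \<in> X.lspan xs" and w: "w = r \<odot>\<^bsub>X\<^esub> x \<oplus>\<^bsub>X\<^esub> y"
        unfolding X.lspan_Cons by (elim CollectE exE conjE)
      show "w \<in> ?t ` carrier (homC P')"
        unfolding w by (rule submodule_add[OF lX sim submodule_smult[OF lX sim r xin] subsetD[OF sub y]])
    qed
    then show ?case by (intro exI[of _ P'] exI[of _ ?t] conjI fP' addP' t)
  qed
  moreover obtain xs where xs: "set xs \<subseteq> carrier X" "X.lspan xs = carrier X"
    using X.finite_length_imp_generated X by (auto simp: finite_length_module_def)
  ultimately obtain P \<theta> where P: "finite_length_module \<Lambda> P" "in_add \<Lambda> {C} P" and \<theta>: "\<theta> \<in> mod_hom \<Lambda> (homC P) X"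
    and sub: "carrier X \<subseteq> \<theta> ` carrier (homC P)"
    by (metis (no_types, lifting))
  have "\<theta> ` carrier (homC P) \<subseteq> carrier X" using mod_hom_closed[OF \<theta>] by (rule image_subsetI)
  with sub have "\<theta> ` carrier (homC P) = carrier X" by (rule subset_antisym[rotated])
  then show ?thesis unfolding presentation_def using P \<theta> by blast
qed

lemma cogenerated_C: "finite_length_module \<Lambda> Y \<Longrightarrow> cogenerated \<Lambda> C Y"
  unfolding cogenerated_def using C_cogenerator by blast

text \<open>For \<open>Y \<subseteq> P\<close> take for \<open>X\<close> the image of \<open>Hom(C, P) \<rightarrow> Hom(C, P/Y)\<close>.\<close>

lemma generated_presentation:
  assumes Y: "finite_length_module \<Lambda> Y" and gen: "generated \<Lambda> C Y"
    and L: "left_module \<Lambda> L" and e: "e \<in> mod_hom \<Lambda> (reg \<Lambda>) L" "inj_on e (carrier \<Lambda>)"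
  shows "\<exists>P \<theta> X. presentation P \<theta> X \<and> finite_length_module \<Lambda> X \<and> cogenerated \<Lambda> L X \<and> mod_iso \<Lambda> Y (relmod P \<theta> X)"
proof -
  note lY = finite_length_left_module[OF Y]
  obtain P f where P: "finite_length_module \<Lambda> P" "in_add \<Lambda> {C} P" and f: "f \<in> mod_hom \<Lambda> Y P" "inj_on f (carrier Y)"
    by (rule cogenerated_embedding[OF Y C_finite_length cogenerated_C[OF Y]])
  note lP = finite_length_left_module[OF P(1)]
  note H = left_module_homC[OF lP]
  let ?U = "f ` carrier Y"
  have sU: "submodule ?U \<Lambda> P" by (rule submodule_image[OF lY lP f(1) submodule_carrier[OF lY]])
  obtain W :: "'a lmod" and \<pi> where lW: "left_module \<Lambda> W" and \<pi>: "\<pi> \<in> mod_hom \<Lambda> P W" "\<pi> ` carrier P = carrier W"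
    and \<pi>0: "\<And>y. y \<in> carrier P \<Longrightarrow> \<pi> y = \<zero>\<^bsub>W\<^esub> \<longleftrightarrow> y \<in> ?U"
    using quotient_module[OF lP sU] by metis
  have W: "finite_length_module \<Lambda> W" by (rule finite_length_surj[OF P(1) lW \<pi>])
  note HW = left_module_homC[OF lW]
  let ?T = "\<lambda>h\<in>carrier (homC P). \<lambda>c\<in>carrier C. \<pi> (h c)"
  have T: "?T \<in> mod_hom \<Lambda> (homC P) (homC W)" by (rule homC_postcompose[OF lP \<pi>(1)])
  let ?I = "?T ` carrier (homC P)"
  have sI: "submodule ?I \<Lambda> (homC W)" by (rule submodule_image[OF H HW T submodule_carrier[OF H]])
  let ?HI = "homC W\<lparr>carrier := ?I\<rparr>"
  note lHI = left_module_submodule[OF HW sI]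
  have fHI: "finite_length_module \<Lambda> ?HI" by (rule finite_length_submodule[OF finite_length_homC[OF W] sI])
  obtain X :: "'a lmod" and \<alpha> where X: "finite_length_module \<Lambda> X" and \<alpha>: "\<alpha> \<in> mod_hom \<Lambda> ?HI X" "bij_betw \<alpha> (carrier ?HI) (carrier X)"
    using finite_length_module_on_lists[OF fHI] unfolding mod_iso_def by blast
  note lX = finite_length_left_module[OF X]
  obtain \<beta> where \<beta>: "\<beta> \<in> mod_hom \<Lambda> X ?HI" "\<forall>x\<in>carrier ?HI. \<beta> (\<alpha> x) = x" "\<forall>y\<in>carrier X. \<alpha> (\<beta> y) = y"
    using mod_hom_inverse[OF lHI lX \<alpha>] by blast
  have zHI: "\<zero>\<^bsub>?HI\<^esub> = (\<lambda>c\<in>carrier C. \<zero>\<^bsub>W\<^esub>)" by simp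
  have T': "?T \<in> mod_hom \<Lambda> (homC P) ?HI"
    using T by (auto simp: mod_hom_def PiE_def Pi_def simp del: homC_simps)
  \<comment> \<open>\<open>W\<close> is P/Y. \<open>\<theta>\<close> is the map Hom(C, P)
    \<rightarrow> Hom(C, W) onto its image, followed by the copying map \<alpha> of that image to
    lists.\<close>
  define \<theta> where "\<theta> = (\<lambda>h\<in>carrier (homC P). \<alpha> (?T h))"
  have \<theta>: "\<theta> \<in> mod_hom \<Lambda> (homC P) X" unfolding \<theta>_def by (rule mod_hom_comp[OF H T' \<alpha>(1)])
  have "\<theta> ` carrier (homC P) = \<alpha> ` ?I" unfolding \<theta>_def image_image by (rule image_cong[OF refl]) (simp only: restrict_apply if_True)
  also have "\<dots> = carrier X" using \<alpha>(2) by (simp add: bij_betw_def)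
  finally have pres: "presentation P \<theta> X" unfolding presentation_def using P \<theta> by blast
  have \<theta>0: "\<theta> h = \<zero>\<^bsub>X\<^esub> \<longleftrightarrow> (\<forall>c\<in>carrier C. h c \<in> ?U)" if h: "h \<in> mod_hom \<Lambda> C P" for h
  proof -
    have hH: "h \<in> carrier (homC P)" using h by simp
    have Th: "?T h \<in> carrier ?HI" by (rule mod_hom_closed[OF T' hH])
    have "\<theta> h = \<zero>\<^bsub>X\<^esub> \<longleftrightarrow> \<alpha> (?T h) = \<zero>\<^bsub>X\<^esub>" unfolding \<theta>_def restrict_apply'[OF hH] ..
    also have "\<dots> \<longleftrightarrow> ?T h = \<zero>\<^bsub>?HI\<^esub>"
      using \<beta>(2) Th mod_hom_zero[OF lX lHI \<beta>(1)] mod_hom_zero[OF lHI lX \<alpha>(1)] by metis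
    also have "\<dots> \<longleftrightarrow> (\<lambda>c\<in>carrier C. \<pi> (h c)) = (\<lambda>c\<in>carrier C. \<zero>\<^bsub>W\<^esub>)"
      unfolding restrict_apply'[OF hH] zHI ..
    also have "\<dots> \<longleftrightarrow> (\<forall>c\<in>carrier C. \<pi> (h c) = \<zero>\<^bsub>W\<^esub>)"
    proof
      assume eq: "(\<lambda>c\<in>carrier C. \<pi> (h c)) = (\<lambda>c\<in>carrier C. \<zero>\<^bsub>W\<^esub>)"
      show "\<forall>c\<in>carrier C. \<pi> (h c) = \<zero>\<^bsub>W\<^esub>"
      proof
        fix c assume "c \<in> carrier C"
        then show "\<pi> (h c) = \<zero>\<^bsub>W\<^esub>" using fun_cong[OF eq, of c] by simp
      qed
    qed (intro restrict_ext, simp)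
    also have "\<dots> \<longleftrightarrow> (\<forall>c\<in>carrier C. h c \<in> ?U)" using \<pi>0[OF mod_hom_closed[OF h]] by simp
    finally show ?thesis .
  qed
  \<comment> \<open>\<open>\<theta>\<close> kills h exactly when h takes its values in the copy of
    \<open>Y\<close>. The relations are thus the trace of \<open>C\<close> in \<open>Y\<close>,
    which is everything because \<open>Y\<close> is generated by \<open>C\<close>.\<close>
  have rel: "relations P \<theta> X = ?U"
  proof
    show "relations P \<theta> X \<subseteq> ?U" by (rule relations_least[OF sU]) (use \<theta>0 in blast)
    have "{y \<in> carrier Y. f y \<in> relations P \<theta> X} = carrier Y"
    proof -
      have "t ` carrier C \<subseteq> {y \<in> carrier Y. f y \<in> relations P \<theta> X}" if t: "t \<in> mod_hom \<Lambda> C Y" for t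
      proof
        fix y assume "y \<in> t ` carrier C"
        then obtain c where c: "c \<in> carrier C" "y = t c" by blast
        have ft: "(\<lambda>c\<in>carrier C. f (t c)) \<in> mod_hom \<Lambda> C P" by (rule mod_hom_comp[OF lC t f(1)])
        have "\<theta> (\<lambda>c\<in>carrier C. f (t c)) = \<zero>\<^bsub>X\<^esub>" unfolding \<theta>0[OF ft] using mod_hom_closed[OF t] by simp
        from relations_upper[where \<theta> = \<theta> and X = X, OF ft this c(1)]
        show "y \<in> {y \<in> carrier Y. f y \<in> relations P \<theta> X}" using c mod_hom_closed[OF t] by simp
      qed
      then show ?thesis
        using gen submodule_vimage[OF lY lP f(1) submodule_relations[OF lP, of \<theta> X]] unfolding generated_def by blast
    qed
    then show "?U \<subseteq> relations P \<theta> X" by blast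
  qed
  have iso: "mod_iso \<Lambda> Y (relmod P \<theta> X)"
  proof -
    have "f \<in> mod_hom \<Lambda> Y (relmod P \<theta> X)" using f(1) unfolding rel by (auto simp: mod_hom_def PiE_def)
    moreover have "bij_betw f (carrier Y) (carrier (relmod P \<theta> X))" using f(2) unfolding rel by (simp add: bij_betw_def)
    ultimately show ?thesis unfolding mod_iso_def by blast
  qed
  obtain \<sigma> where \<sigma>: "\<sigma> \<in> mod_hom \<Lambda> (homC C) (reg \<Lambda>)" "\<And>h. h \<in> mod_hom \<Lambda> C C \<Longrightarrow> \<rho> (\<sigma> h) = h"
    by (rule End_C_coordinate) (rule that)
  \<comment> \<open>An element x of X is a map from \<open>C\<close> to \<open>W\<close>. If it is
    nonzero at c, some g from \<open>W\<close> to \<open>C\<close> does not kill that value, and g x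
    is a nonzero endomorphism of \<open>C\<close>, hence a nonzero element of \<Lambda>, which
    \<open>e\<close> carries into \<open>L\<close>.\<close>
  have "cogenerated \<Lambda> L X" unfolding cogenerated_def
  proof (intro ballI impI)
    fix x assume x: "x \<in> carrier X" "x \<noteq> \<zero>\<^bsub>X\<^esub>"
    have bx: "\<beta> x \<in> carrier ?HI" by (rule mod_hom_closed[OF \<beta>(1) x(1)])
    have i: "(\<lambda>h\<in>carrier ?HI. h) \<in> mod_hom \<Lambda> ?HI (homC W)"
      using submodule_subset[OF HW sI] by (intro mod_hom_restrictI[OF lHI]) (auto simp del: homC_simps)
    have bW: "\<beta> x \<in> mod_hom \<Lambda> C W" using mod_hom_closed[OF i bx] bx by simp
    have "\<beta> x \<noteq> \<zero>\<^bsub>?HI\<^esub>" using \<beta>(3) x mod_hom_zero[OF lHI lX \<alpha>(1)] by metis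
    then have "\<beta> x \<noteq> (\<lambda>c\<in>carrier C. \<zero>\<^bsub>W\<^esub>)" unfolding zHI .
    then obtain c where c: "c \<in> carrier C" "\<beta> x c \<noteq> \<zero>\<^bsub>W\<^esub>"
      using mod_hom_eqI[OF bW mod_hom_const_zero[OF lC lW]] by auto
    obtain g where g: "g \<in> mod_hom \<Lambda> W C" "g (\<beta> x c) \<noteq> \<zero>\<^bsub>C\<^esub>"
      using C_cogenerator[OF W mod_hom_closed[OF bW c(1)] c(2)] by blast
    let ?G = "\<lambda>h\<in>carrier (homC W). \<lambda>c\<in>carrier C. g (h c)"
    note m1 = mod_hom_comp[OF lX \<beta>(1) i]
    note m2 = mod_hom_comp[OF lX m1 homC_postcompose[OF lW g(1)]]
    note m3 = mod_hom_comp[OF lX mod_hom_comp[OF lX m2 \<sigma>(1)] e(1)]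
    let ?t = "\<lambda>c\<in>carrier C. g (\<beta> x c)"
    have t: "?t \<in> mod_hom \<Lambda> C C" by (rule mod_hom_comp[OF lC bW g(1)])
    have \<sigma>t: "\<sigma> ?t \<in> carrier \<Lambda>" using mod_hom_closed[OF \<sigma>(1), of ?t] t by (simp only: homC_simps reg_simps)
    have "e (\<sigma> ?t) \<noteq> \<zero>\<^bsub>L\<^esub>"
    proof
      assume "e (\<sigma> ?t) = \<zero>\<^bsub>L\<^esub>"
      then have "\<sigma> ?t = \<zero>\<^bsub>\<Lambda>\<^esub>"
        using mod_hom_inj_iff[OF left_module_reg_algebra L e(1)] e(2) \<sigma>t by simp
      also have "\<dots> = \<sigma> \<zero>\<^bsub>homC C\<^esub>"
        using mod_hom_zero[OF left_module_homC[OF lC] left_module_reg_algebra \<sigma>(1)] by (simp only: reg_simps)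
      finally have eq: "\<sigma> ?t = \<sigma> \<zero>\<^bsub>homC C\<^esub>" .
      have z: "\<zero>\<^bsub>homC C\<^esub> \<in> mod_hom \<Lambda> C C" unfolding homC_simps by (rule mod_hom_const_zero[OF lC lC])
      have "?t = \<rho> (\<sigma> ?t)" by (rule \<sigma>(2)[OF t, symmetric])
      also have "\<dots> = \<zero>\<^bsub>homC C\<^esub>" unfolding eq by (rule \<sigma>(2)[OF z])
      finally have "?t c = \<zero>\<^bsub>homC C\<^esub> c" by (rule fun_cong)
      then show False using g(2) c(1) by simp
    qed
    moreover have "(\<lambda>x\<in>carrier X. e ((\<lambda>x\<in>carrier X. \<sigma> ((\<lambda>x\<in>carrier X. ?G ((\<lambda>x\<in>carrier X. (\<lambda>h\<in>carrier ?HI. h) (\<beta> x)) x)) x)) x)) x = e (\<sigma> ?t)"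
      unfolding restrict_apply'[OF x(1)] restrict_apply'[OF bx] using bW by (simp only: homC_simps restrict_apply if_True)
    ultimately show "\<exists>f\<in>mod_hom \<Lambda> X L. f x \<noteq> \<zero>\<^bsub>L\<^esub>" by (intro bexI[OF _ m3]) (simp only: not_False_eq_True)
  qed
  then show ?thesis using pres X iso by blast
qed

end

section \<open>Torsionless-finite algebras\<close>

text \<open>The hypothesis counts classes of a quotient set. A chosen member of each class turns it
  into finitely many actual modules, to which direct sums and presentations can be applied.\<close>

lemma torsionless_finite_representatives:
  fixes R :: "('r, 'c) ring_scheme"
  assumes "torsionless_finite R"
  shows "\<exists>S :: 'r lmod set. finite S \<and> (\<forall>N\<in>S. indecomposable R N \<and> torsionless R N) \<and>
    (\<forall>N :: 'r lmod. indecomposable R N \<longrightarrow> torsionless R N \<longrightarrow> (\<exists>D\<in>S. mod_iso R N D))"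
proof -
  define T where "T = {X :: 'r lmod. indecomposable R X \<and> torsionless R X}"
  define r where "r = {(X :: 'r lmod, Y :: 'r lmod). indecomposable R X \<and> torsionless R X \<and>
    indecomposable R Y \<and> torsionless R Y \<and> mod_iso R X Y}"
  have fin: "finite (T // r)" using assms unfolding torsionless_finite_def T_def r_def .
  have refl: "(N, N) \<in> r" if "N \<in> T" for N :: "'r lmod"
  proof -
    have N: "left_module R N" using that unfolding T_def indecomposable_def by (auto dest: finite_length_left_module)
    have "mod_iso R N N"
      unfolding mod_iso_def by (rule bexI[OF _ mod_hom_id[OF N]]) (simp add: bij_betw_def inj_on_def)
    then show ?thesis using that unfolding r_def T_def by simp
  qed
  have some: "(N, SOME X. X \<in> r `` {N}) \<in> r" if "N \<in> T" for N :: "'r lmod"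
    using someI[of "\<lambda>X. X \<in> r `` {N}" N] refl[OF that] by simp
  have rD: "indecomposable R Y \<and> torsionless R Y \<and> mod_iso R X Y" if "(X, Y) \<in> r" for X Y :: "'r lmod"
    using that unfolding r_def by simp
  define S where "S = (\<lambda>c. SOME X. X \<in> c) ` (T // r)"
  have "indecomposable R D \<and> torsionless R D" if "D \<in> S" for D
  proof -
    obtain N where "N \<in> T" "D = (SOME X. X \<in> r `` {N})" using \<open>D \<in> S\<close> unfolding S_def by (auto elim!: quotientE)
    then have "(N, D) \<in> r" using some by simp
    then show ?thesis using rD by blast
  qed
  moreover have "\<exists>D\<in>S. mod_iso R N D" if "indecomposable R N" "torsionless R N" for N :: "'r lmod"
  proof -
    have N: "N \<in> T" using that unfolding T_def by simp
    have "(SOME X. X \<in> r `` {N}) \<in> S" unfolding S_def by (rule imageI[OF quotientI[OF N]])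
    moreover have "mod_iso R N (SOME X. X \<in> r `` {N})" using rD[OF some[OF N]] by (elim conjE)
    ultimately show ?thesis by blast
  qed
  moreover have "finite S" unfolding S_def by (rule finite_imageI[OF fin])
  ultimately show ?thesis by (intro exI[of _ S]) simp
qed

text \<open>A torsionless module is a copy of a submodule of a projective one, and maps to
  \<open>L\<close> restrict along this inclusion.\<close>

lemma torsionless_cogenerated:
  fixes X L :: "'r lmod"
  assumes L: "\<forall>P :: 'r lmod. projective_mod R P \<longrightarrow> cogenerated R L P" and X: "torsionless R X"
  shows "cogenerated R L X"
  unfolding cogenerated_def
proof (intro ballI impI)
  have lX: "left_module R X" using X unfolding torsionless_def by (auto dest: finite_length_left_module)
  obtain P :: "'r lmod" and U where P: "projective_mod R P" and U: "submodule U R P" and iso: "mod_iso R X (P\<lparr>carrier := U\<rparr>)"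
    using X unfolding torsionless_def by (elim conjE exE)
  obtain h where h: "h \<in> mod_hom R X (P\<lparr>carrier := U\<rparr>)" "bij_betw h (carrier X) (carrier (P\<lparr>carrier := U\<rparr>))"
    using iso unfolding mod_iso_def by (elim bexE)
  have lP: "left_module R P" using P unfolding projective_mod_def by (auto dest: finite_length_left_module)
  note lU = left_module_submodule[OF lP U]
  fix x assume x: "x \<in> carrier X" "x \<noteq> \<zero>\<^bsub>X\<^esub>"
  have "h x \<noteq> \<zero>\<^bsub>P\<lparr>carrier := U\<rparr>\<^esub>"
    using mod_hom_inj_iff[OF lX lU h(1)] bij_betw_imp_inj_on[OF h(2)] x by blast
  then obtain f where f: "f \<in> mod_hom R (P\<lparr>carrier := U\<rparr>) L" "f (h x) \<noteq> \<zero>\<^bsub>L\<^esub>"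
    using cogenerated_submodule[OF L[rule_format, OF P] lP U] mod_hom_closed[OF h(1) x(1)] unfolding cogenerated_def by blast
  have "(\<lambda>x\<in>carrier X. f (h x)) x \<noteq> \<zero>\<^bsub>L\<^esub>" using f(2) x(1) by simp
  then show "\<exists>f\<in>mod_hom R X L. f x \<noteq> \<zero>\<^bsub>L\<^esub>" by (rule bexI[OF _ mod_hom_comp[OF lX h(1) f(1)]])
qed

context artin_algebra
begin

text \<open>Additive closures are formed for modules on lists, so the regular module is copied
  there. The last clause is the form in which freeness of rank one is used afterwards.\<close>

lemma regular_copy:
  "\<exists>(L :: 'a lmod) e. projective_mod \<Lambda> L \<and> e \<in> mod_hom \<Lambda> (reg \<Lambda>) L \<and> inj_on e (carrier \<Lambda>) \<and>
    (\<forall>Y. left_module \<Lambda> Y \<longrightarrow> generated \<Lambda> L Y)"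
proof -
  obtain L :: "'a lmod" and e g where L: "projective_mod \<Lambda> L" and e: "e \<in> mod_hom \<Lambda> (reg \<Lambda>) L"
    and g: "g \<in> mod_hom \<Lambda> L (reg \<Lambda>)" and ge: "\<And>x. x \<in> carrier (reg \<Lambda>) \<Longrightarrow> g (e x) = x"
    by (rule projective_mod_on_lists[OF projective_reg]) (rule that)
  have lL: "left_module \<Lambda> L" using L unfolding projective_mod_def by (auto dest: finite_length_left_module)
  have one: "\<one>\<^bsub>\<Lambda>\<^esub> \<in> carrier (reg \<Lambda>)" by simp
  have "inj_on e (carrier \<Lambda>)" using ge by (intro inj_on_inverseI[of _ g]) simp
  moreover have "generated \<Lambda> L Y" if Y: "left_module \<Lambda> Y" for Y
    by (rule generated_reg_copy[OF lL g mod_hom_closed[OF e one] ge[OF one] Y])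
  ultimately show ?thesis using L e by (intro exI[of _ L] exI[of _ e] conjI allI impI)
qed

text \<open>Torsionless modules are treated as the modules cogenerated by a copy \<open>L\<close> of
  the regular module on lists. Cogeneration passes to submodules, so it reduces to indecomposable
  modules, and these are torsionless and hence isomorphic to members of the finite set
  \<open>S\<close> of representatives.\<close>

lemma torsionless_finite_cogenerated:
  assumes tf: "torsionless_finite \<Lambda>"
  shows "\<exists>(L :: 'a lmod) e S. finite_length_module \<Lambda> L \<and> e \<in> mod_hom \<Lambda> (reg \<Lambda>) L \<and> inj_on e (carrier \<Lambda>) \<and>
    finite S \<and> (\<forall>D\<in>S. finite_length_module \<Lambda> D \<and> cogenerated \<Lambda> L D) \<and>
    (\<forall>X. finite_length_module \<Lambda> X \<longrightarrow> cogenerated \<Lambda> L X \<longrightarrow> in_add \<Lambda> S X) \<and>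
    (\<forall>P :: 'a lmod. projective_mod \<Lambda> P \<longrightarrow> cogenerated \<Lambda> L P)"
proof -
  obtain L :: "'a lmod" and e where L: "projective_mod \<Lambda> L" and e: "e \<in> mod_hom \<Lambda> (reg \<Lambda>) L" "inj_on e (carrier \<Lambda>)"
    and gen: "\<forall>Y. left_module \<Lambda> Y \<longrightarrow> generated \<Lambda> L Y"
    using regular_copy by (elim exE conjE)
  have fL: "finite_length_module \<Lambda> L" using L unfolding projective_mod_def by simp
  note lL = finite_length_left_module[OF fL]
  have LL: "cogenerated \<Lambda> L L" unfolding cogenerated_def
  proof (intro ballI impI)
    fix x assume "x \<in> carrier L" "x \<noteq> \<zero>\<^bsub>L\<^esub>"
    then show "\<exists>f\<in>mod_hom \<Lambda> L L. f x \<noteq> \<zero>\<^bsub>L\<^esub>" by (intro bexI[OF _ mod_hom_id[OF lL]]) simp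
  qed
  have proj: "\<forall>P :: 'a lmod. projective_mod \<Lambda> P \<longrightarrow> cogenerated \<Lambda> L P"
  proof (intro allI impI)
    fix P :: "'a lmod" assume P: "projective_mod \<Lambda> P"
    then have lP: "left_module \<Lambda> P" unfolding projective_mod_def by (auto dest: finite_length_left_module)
    show "cogenerated \<Lambda> L P"
      by (rule in_add_cogenerated[OF lP lL _ projective_in_add_of_generated[OF P fL gen[rule_format, OF lP]]])
        (simp add: LL)
  qed
  obtain S :: "'a lmod set" where S: "finite S" "\<forall>N\<in>S. indecomposable \<Lambda> N \<and> torsionless \<Lambda> N"
    "\<forall>N :: 'a lmod. indecomposable \<Lambda> N \<longrightarrow> torsionless \<Lambda> N \<longrightarrow> (\<exists>D\<in>S. mod_iso \<Lambda> N D)"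
    using torsionless_finite_representatives[OF tf] by (elim exE conjE)
  have SD: "finite_length_module \<Lambda> D \<and> cogenerated \<Lambda> L D" if "D \<in> S" for D
    using S(2) that torsionless_cogenerated[OF proj, of D] unfolding indecomposable_def by simp
  have ind: "in_add \<Lambda> S N" if N: "indecomposable \<Lambda> N" and co: "cogenerated \<Lambda> L N" for N :: "'a lmod"
  proof -
    have fN: "finite_length_module \<Lambda> N" using N unfolding indecomposable_def by simp
    note lN = finite_length_left_module[OF fN]
    obtain P f where P: "finite_length_module \<Lambda> P" "in_add \<Lambda> {L} P" and f: "f \<in> mod_hom \<Lambda> N P" "inj_on f (carrier N)"
      by (rule cogenerated_embedding[OF fN fL co])
    note lP = finite_length_left_module[OF P(1)]
    note U = submodule_image[OF lN lP f(1) submodule_carrier[OF lN]]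
    have "f \<in> mod_hom \<Lambda> N (P\<lparr>carrier := f ` carrier N\<rparr>)" using f(1) by (auto simp: mod_hom_def PiE_def)
    moreover have "bij_betw f (carrier N) (carrier (P\<lparr>carrier := f ` carrier N\<rparr>))" using f(2) by (simp add: bij_betw_def)
    ultimately have "mod_iso \<Lambda> N (P\<lparr>carrier := f ` carrier N\<rparr>)" unfolding mod_iso_def by blast
    \<comment> \<open>Members of add L are projective, so the embedding exhibits \<open>N\<close> as
      a submodule of a projective module.\<close>
    then have tl: "torsionless \<Lambda> N" unfolding torsionless_def
      by (intro conjI fN exI[of _ P] exI[of _ "f ` carrier N"] U projective_in_add[OF P(1) L P(2)])
    obtain D where D: "D \<in> S" "mod_iso \<Lambda> N D" using S(3)[rule_format, OF N tl] by (elim bexE)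
    have lD: "left_module \<Lambda> D" using SD[OF D(1)] by (auto dest: finite_length_left_module)
    show ?thesis by (rule in_add_iso(2)[OF lN lD D(2) in_add_member[OF lD D(1)]])
  qed
  have "in_add \<Lambda> S X" if X: "finite_length_module \<Lambda> X" "cogenerated \<Lambda> L X" for X
  proof (rule in_add_if_indecomposables[where P = "cogenerated \<Lambda> L", OF X])
    fix X :: "'a lmod" and U assume "finite_length_module \<Lambda> X" "cogenerated \<Lambda> L X" "submodule U \<Lambda> X"
    then show "cogenerated \<Lambda> L (X\<lparr>carrier := U\<rparr>)" by (intro cogenerated_submodule finite_length_left_module)
  qed (rule ind)
  then show ?thesis using fL e S(1) SD proj by (intro exI[of _ L] exI[of _ e] exI[of _ S] conjI ballI allI impI) simp_all
qed

end

context algebra_dual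
begin

text \<open>A module generated by \<open>C\<close> is isomorphic to the relations of a presentation
  of some X cogenerated by \<open>L\<close>. As X is in add S, it belongs to the additive closure of
  \<open>C\<close> and the relations of fixed presentations of the members of \<open>S\<close>.
  \<open>Q\<close> is the direct sum of these finitely many modules.\<close>

lemma generated_by_C_finite:
  assumes L: "left_module \<Lambda> L" and e: "e \<in> mod_hom \<Lambda> (reg \<Lambda>) L" "inj_on e (carrier \<Lambda>)"
    and S: "finite S" "\<And>D. D \<in> S \<Longrightarrow> finite_length_module \<Lambda> D"
    and cover: "\<And>X. finite_length_module \<Lambda> X \<Longrightarrow> cogenerated \<Lambda> L X \<Longrightarrow> in_add \<Lambda> S X"
  shows "\<exists>Q :: 'a lmod. finite_length_module \<Lambda> Q \<and> generated \<Lambda> C Q \<and>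
    (\<forall>Y. finite_length_module \<Lambda> Y \<longrightarrow> generated \<Lambda> C Y \<longrightarrow> in_add \<Lambda> {Q} Y)"
proof -
  have "\<forall>D\<in>S. \<exists>P. \<exists>\<theta>. presentation P \<theta> D" using presentation_exists[OF S(2)] by (rule ballI)
  from bchoice[OF this] obtain Pf where "\<forall>D\<in>S. \<exists>\<theta>. presentation (Pf D) \<theta> D" by (rule exE)
  from bchoice[OF this] obtain \<theta>f where pres: "\<forall>D\<in>S. presentation (Pf D) (\<theta>f D) D" by (rule exE)
  let ?Y = "\<lambda>D. relmod (Pf D) (\<theta>f D) D"
  let ?Ys = "insert C (?Y ` S)"
  have Ys: "finite_length_module \<Lambda> D \<and> generated \<Lambda> C D" if "D \<in> ?Ys" for D
    using that
  proof (elim insertE imageE)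
    assume "D = C"
    then show ?thesis using C_finite_length generated_self[OF lC] by simp
  next
    fix E assume D: "D = ?Y E" and E: "E \<in> S"
    have fP: "finite_length_module \<Lambda> (Pf E)" using pres E unfolding presentation_def by simp
    note lP = finite_length_left_module[OF fP]
    show ?thesis unfolding D by (rule conjI[OF finite_length_submodule[OF fP submodule_relations[OF lP]] generated_relmod[OF lP]])
  qed
  have Yf: "finite_length_module \<Lambda> D" and Yg: "generated \<Lambda> C D" if "D \<in> ?Ys" for D using Ys[OF that] by simp_all
  have fin: "finite ?Ys" using S(1) by simp
  obtain Q :: "'a lmod" where Q: "finite_length_module \<Lambda> Q" "\<forall>D\<in>?Ys. in_add \<Lambda> {Q} D" "in_add \<Lambda> ?Ys Q"
    using finite_sum_exists[OF \<Lambda>.ring_axioms fin Yf] by blast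
  have gen: "generated \<Lambda> C Q"
    by (rule in_add_generated[OF finite_length_left_module[OF Q(1)] Yg lC Q(3)])
  have "in_add \<Lambda> {Q} Y" if Y: "finite_length_module \<Lambda> Y" "generated \<Lambda> C Y" for Y
  proof -
    note lY = finite_length_left_module[OF Y(1)]
    obtain P \<theta> X where p: "presentation P \<theta> X" and X: "finite_length_module \<Lambda> X" "cogenerated \<Lambda> L X"
      and iso: "mod_iso \<Lambda> Y (relmod P \<theta> X)"
      using generated_presentation[OF Y L e] by (elim exE conjE)
    have lP: "left_module \<Lambda> P" using p unfolding presentation_def by (auto dest: finite_length_left_module)
    have "in_add \<Lambda> ?Ys (relmod P \<theta> X)"
      by (rule relmod_in_add[OF p finite_length_left_module[OF X(1)] _ cover[OF X]]) (use pres in simp)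
    then have add: "in_add \<Lambda> ?Ys Y"
      by (rule in_add_iso(2)[OF lY left_module_submodule[OF lP submodule_relations[OF lP]] iso])
    show ?thesis by (rule in_add_trans[OF lY bspec[OF Q(2)] add])
  qed
  then show ?thesis using Q(1) gen by (intro exI[of _ Q] conjI allI impI)
qed

text \<open>M' is the sum of the approximation Q' and X' = X/W, and M'' is the cokernel of X
  \<rightarrow> M'. \<open>M\<close> is known only to have the same additive closure as
  \<open>insert Q S\<close>, so maps are extended for targets \<open>Q\<close> and members of
  \<open>S\<close>, and the result is carried over to \<open>M\<close>.\<close>

lemma coresolution:
  fixes M Q L X :: "'a lmod"
  assumes Q: "finite_length_module \<Lambda> Q" "generated \<Lambda> C Q"
    and Q_cover: "\<And>Y. finite_length_module \<Lambda> Y \<Longrightarrow> generated \<Lambda> C Y \<Longrightarrow> in_add \<Lambda> {Q} Y"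
    and L: "left_module \<Lambda> L" and S: "\<And>D. D \<in> S \<Longrightarrow> finite_length_module \<Lambda> D \<and> cogenerated \<Lambda> L D"
    and S_cover: "\<And>X. finite_length_module \<Lambda> X \<Longrightarrow> cogenerated \<Lambda> L X \<Longrightarrow> in_add \<Lambda> S X"
    and M: "left_module \<Lambda> M" "\<And>D. D \<in> insert Q S \<Longrightarrow> in_add \<Lambda> {M} D" "in_add \<Lambda> (insert Q S) M"
    and X: "finite_length_module \<Lambda> X"
  shows "\<exists>M' M'' a b. finite_length_module \<Lambda> M' \<and> finite_length_module \<Lambda> M'' \<and> in_add \<Lambda> {M} M' \<and> in_add \<Lambda> {M} M'' \<and>
    a \<in> mod_hom \<Lambda> X M' \<and> b \<in> mod_hom \<Lambda> M' M'' \<and> b ` carrier M' = carrier M'' \<and>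
    (\<forall>y\<in>carrier M'. b y = \<zero>\<^bsub>M''\<^esub> \<longleftrightarrow> y \<in> a ` carrier X) \<and>
    (\<forall>f\<in>mod_hom \<Lambda> X M. \<exists>f'\<in>mod_hom \<Lambda> M' M. \<forall>x\<in>carrier X. f' (a x) = f x)"
proof -
  note lX = finite_length_left_module[OF X] and lQ = finite_length_left_module[OF Q(1)]
  interpret X: left_module \<Lambda> X by (rule lX)
  interpret L: left_module \<Lambda> L by (rule L)
  \<comment> \<open>The reject of \<open>L\<close> in \<open>X\<close>: the smallest submodule whose
    quotient is cogenerated by \<open>L\<close>.\<close>
  define W where "W = {x \<in> carrier X. \<forall>f\<in>mod_hom \<Lambda> X L. f x = \<zero>\<^bsub>L\<^esub>}"
  have sW: "submodule W \<Lambda> X"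
    unfolding X.submodule_iff
  proof (intro conjI ballI)
    show "W \<subseteq> carrier X" unfolding W_def by (rule Collect_restrict)
    show "\<zero>\<^bsub>X\<^esub> \<in> W" using mod_hom_zero[OF lX L] by (simp add: W_def)
  next
    fix x y assume "x \<in> W" "y \<in> W"
    then have xy: "x \<in> carrier X" "y \<in> carrier X" "\<And>f. f \<in> mod_hom \<Lambda> X L \<Longrightarrow> f x = \<zero>\<^bsub>L\<^esub>" "\<And>f. f \<in> mod_hom \<Lambda> X L \<Longrightarrow> f y = \<zero>\<^bsub>L\<^esub>"
      by (simp_all add: W_def)
    have "f (x \<oplus>\<^bsub>X\<^esub> y) = \<zero>\<^bsub>L\<^esub>" if f: "f \<in> mod_hom \<Lambda> X L" for f
      unfolding mod_hom_add[OF f xy(1,2)] xy(3)[OF f] xy(4)[OF f] by simp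
    then show "x \<oplus>\<^bsub>X\<^esub> y \<in> W" using xy(1,2) by (simp add: W_def)
  next
    fix l x assume l: "l \<in> carrier \<Lambda>" and "x \<in> W"
    then have x: "x \<in> carrier X" "\<And>f. f \<in> mod_hom \<Lambda> X L \<Longrightarrow> f x = \<zero>\<^bsub>L\<^esub>" by (simp_all add: W_def)
    have "f (l \<odot>\<^bsub>X\<^esub> x) = \<zero>\<^bsub>L\<^esub>" if f: "f \<in> mod_hom \<Lambda> X L" for f
      unfolding mod_hom_smult[OF f l x(1)] x(2)[OF f] by (rule L.smult_zero_r[OF l])
    then show "l \<odot>\<^bsub>X\<^esub> x \<in> W" using X.smult_closed[OF l x(1)] by (simp add: W_def)
  qed
  obtain X' :: "'a lmod" and p where lX': "left_module \<Lambda> X'" and p: "p \<in> mod_hom \<Lambda> X X'" "p ` carrier X = carrier X'"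
    and p0: "\<And>x. x \<in> carrier X \<Longrightarrow> p x = \<zero>\<^bsub>X'\<^esub> \<longleftrightarrow> x \<in> W"
    using quotient_module[OF lX sW] by metis
  note fX' = finite_length_surj[OF X lX' p]
  have co: "cogenerated \<Lambda> L X'" unfolding cogenerated_def
  proof (intro ballI impI)
    fix y assume y: "y \<in> carrier X'" "y \<noteq> \<zero>\<^bsub>X'\<^esub>"
    obtain x where x: "x \<in> carrier X" "y = p x" using y(1) unfolding p(2)[symmetric] by (elim imageE)
    have "x \<notin> W" using p0[OF x(1)] y(2) x(2) by simp
    then obtain f where f: "f \<in> mod_hom \<Lambda> X L" "f x \<noteq> \<zero>\<^bsub>L\<^esub>" using x(1) unfolding W_def by auto
    have k: "f x = \<zero>\<^bsub>L\<^esub>" if "x \<in> carrier X" "p x = \<zero>\<^bsub>X'\<^esub>" for x using p0[OF that(1)] that(2) f(1) by (simp add: W_def)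
    have "\<exists>g\<in>mod_hom \<Lambda> X' L. \<forall>x\<in>carrier X. g (p x) = f x" by (rule mod_hom_factor[OF lX lX' L p f(1) k])
    then obtain g where g: "g \<in> mod_hom \<Lambda> X' L" "\<forall>x\<in>carrier X. g (p x) = f x" by (elim bexE)
    show "\<exists>f\<in>mod_hom \<Lambda> X' L. f y \<noteq> \<zero>\<^bsub>L\<^esub>" by (rule bexI[OF _ g(1)]) (use g(2) f(2) x in simp)
  qed
  have addX': "in_add \<Lambda> {M} X'" by (rule in_add_trans[OF lX' _ S_cover[OF fX' co]]) (simp add: M(2))
  obtain Q' \<phi> where Q': "finite_length_module \<Lambda> Q'" "in_add \<Lambda> {Q} Q'" and \<phi>: "\<phi> \<in> mod_hom \<Lambda> X Q'"
    and \<phi>_ext: "\<forall>f\<in>mod_hom \<Lambda> X Q. \<exists>g\<in>mod_hom \<Lambda> Q' Q. \<forall>x\<in>carrier X. g (\<phi> x) = f x"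
    using left_approximation[OF X Q(1)] by (elim exE conjE)
  note lQ' = finite_length_left_module[OF Q'(1)]
  have addQ': "in_add \<Lambda> {M} Q'" by (rule in_add_trans[OF lQ' _ Q'(2)]) (simp add: M(2))
  obtain P i j s t where bip: "biproduct \<Lambda> Q' X' P i j s t" using biproduct_exists[OF Q'(1) fX'] by (elim exE)
  note bip' = bip[unfolded biproduct_def]
  have fP: "finite_length_module \<Lambda> P" and i: "i \<in> mod_hom \<Lambda> Q' P" and j: "j \<in> mod_hom \<Lambda> X' P"
    and s: "s \<in> mod_hom \<Lambda> P Q'" and t: "t \<in> mod_hom \<Lambda> P X'"
    using bip' by simp_all
  have si: "s (i y) = y" "t (i y) = \<zero>\<^bsub>X'\<^esub>" if "y \<in> carrier Q'" for y using bip' that by simp_all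
  have sj: "s (j y) = \<zero>\<^bsub>Q'\<^esub>" "t (j y) = y" if "y \<in> carrier X'" for y using bip' that by simp_all
  have st: "i (s z) \<oplus>\<^bsub>P\<^esub> j (t z) = z" if "z \<in> carrier P" for z using bip' that by simp
  note lP = finite_length_left_module[OF fP]
  interpret P: left_module \<Lambda> P by (rule lP)
  interpret Q': left_module \<Lambda> Q' by (rule lQ')
  interpret X': left_module \<Lambda> X' by (rule lX')
  define a where "a = (\<lambda>x\<in>carrier X. (\<lambda>x\<in>carrier X. i (\<phi> x)) x \<oplus>\<^bsub>P\<^esub> (\<lambda>x\<in>carrier X. j (p x)) x)"
  have a: "a \<in> mod_hom \<Lambda> X P"
    unfolding a_def by (rule mod_hom_plus[OF lX lP mod_hom_comp[OF lX \<phi> i] mod_hom_comp[OF lX p(1) j]])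
  have sa: "s (a x) = \<phi> x" and ta: "t (a x) = p x" if x: "x \<in> carrier X" for x
  proof -
    note \<phi>x = mod_hom_closed[OF \<phi> x] and px = mod_hom_closed[OF p(1) x]
    have ax: "a x = i (\<phi> x) \<oplus>\<^bsub>P\<^esub> j (p x)" using x unfolding a_def by simp
    show "s (a x) = \<phi> x"
      unfolding ax mod_hom_add[OF s mod_hom_closed[OF i \<phi>x] mod_hom_closed[OF j px]] si(1)[OF \<phi>x] sj(1)[OF px]
      by (rule Q'.M.r_zero[OF \<phi>x])
    show "t (a x) = p x"
      unfolding ax mod_hom_add[OF t mod_hom_closed[OF i \<phi>x] mod_hom_closed[OF j px]] si(2)[OF \<phi>x] sj(2)[OF px]
      by (rule X'.M.l_zero[OF px])
  qed
  obtain M'' :: "'a lmod" and b where lM'': "left_module \<Lambda> M''" and b: "b \<in> mod_hom \<Lambda> P M''" "b ` carrier P = carrier M''"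
    and b0: "\<And>y. y \<in> carrier P \<Longrightarrow> b y = \<zero>\<^bsub>M''\<^esub> \<longleftrightarrow> y \<in> a ` carrier X"
    using quotient_module[OF lP submodule_image[OF lX lP a submodule_carrier[OF lX]]] by metis
  interpret M'': left_module \<Lambda> M'' by (rule lM'')
  note fM'' = finite_length_surj[OF fP lM'' b]
  note bi = mod_hom_comp[OF lQ' i b(1)]
  \<comment> \<open>For z in P choose x with p x = t z. Then z - a x has zero component in X', so z
    has the same image in M'' as i y with y = s z - \<phi> x. This is where surjectivity of p
    enters.\<close>
  have "carrier M'' \<subseteq> (\<lambda>y\<in>carrier Q'. b (i y)) ` carrier Q'"
  proof
    fix m assume "m \<in> carrier M''"
    then obtain z where z: "z \<in> carrier P" "m = b z" unfolding b(2)[symmetric] by (elim imageE)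
    obtain x where x: "x \<in> carrier X" "t z = p x" using mod_hom_closed[OF t z(1)] unfolding p(2)[symmetric] by (elim imageE)
    note sz = mod_hom_closed[OF s z(1)] and \<phi>x = mod_hom_closed[OF \<phi> x(1)] and ax = mod_hom_closed[OF a x(1)]
    define y where "y = s z \<ominus>\<^bsub>Q'\<^esub> \<phi> x"
    have y: "y \<in> carrier Q'" unfolding y_def using sz \<phi>x by simp
    note iy = mod_hom_closed[OF i y]
    let ?z = "i y \<oplus>\<^bsub>P\<^esub> a x"
    have "s ?z = y \<oplus>\<^bsub>Q'\<^esub> \<phi> x" unfolding mod_hom_add[OF s iy ax] si(1)[OF y] sa[OF x(1)] ..
    also have "\<dots> = s z" unfolding y_def a_minus_def using sz \<phi>x by (simp add: Q'.M.a_assoc Q'.M.l_neg)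
    finally have 1: "s ?z = s z" .
    have 2: "t ?z = t z" unfolding mod_hom_add[OF t iy ax] si(2)[OF y] ta[OF x(1)] x(2)
      by (rule X'.M.l_zero[OF mod_hom_closed[OF p(1) x(1)]])
    have "?z = i (s ?z) \<oplus>\<^bsub>P\<^esub> j (t ?z)" by (rule st[OF P.M.a_closed[OF iy ax], symmetric])
    also have "\<dots> = z" unfolding 1 2 by (rule st[OF z(1)])
    finally have eq: "?z = z" .
    have bax: "b (a x) = \<zero>\<^bsub>M''\<^esub>" using b0[OF ax] x(1) by simp
    have "b z = b ?z" unfolding eq ..
    also have "\<dots> = b (i y)" unfolding mod_hom_add[OF b(1) iy ax] bax by (rule M''.M.r_zero[OF mod_hom_closed[OF b(1) iy]])
    finally show "m \<in> (\<lambda>y\<in>carrier Q'. b (i y)) ` carrier Q'" using y z(2) by (intro image_eqI[where x = y]) simp_all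
  qed
  moreover have "(\<lambda>y\<in>carrier Q'. b (i y)) ` carrier Q' \<subseteq> carrier M''" by (rule image_subsetI[OF mod_hom_closed[OF bi]])
  ultimately have surj: "(\<lambda>y\<in>carrier Q'. b (i y)) ` carrier Q' = carrier M''" by (rule subset_antisym[rotated])
  have "generated \<Lambda> C Q'" by (rule in_add_generated[OF lQ' _ lC Q'(2)]) (simp add: Q(2))
  then have "generated \<Lambda> C M''" by (rule generated_image[OF lQ' lM'' lC bi surj])
  then have "in_add \<Lambda> {Q} M''" by (rule Q_cover[OF fM''])
  then have addM'': "in_add \<Lambda> {M} M''" by (rule in_add_trans[OF lM'', rotated]) (simp add: M(2))
  have addP: "in_add \<Lambda> {M} P" by (rule biproduct_in_add[OF bip lQ' lX' addQ' addX'])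
  \<comment> \<open>A map to \<open>Q\<close> extends through the component s by the approximation
    property. A map to a member of \<open>S\<close> kills \<open>W\<close>, because the target is
    cogenerated by \<open>L\<close>, and extends through the component t.\<close>
  have ext: "\<exists>f'\<in>mod_hom \<Lambda> P D. \<forall>x\<in>carrier X. f' (a x) = f x" if D: "D \<in> insert Q S" and f: "f \<in> mod_hom \<Lambda> X D" for D f
  proof (cases "D = Q")
    case True
    obtain g where g: "g \<in> mod_hom \<Lambda> Q' D" "\<forall>x\<in>carrier X. g (\<phi> x) = f x"
      using bspec[OF \<phi>_ext f[unfolded True]] unfolding True by (elim bexE)
    show ?thesis
      by (rule bexI[OF _ mod_hom_comp[OF lP s g(1)]]) (use g(2) sa mod_hom_closed[OF a] in simp)
  next
    case False
    then have "D \<in> S" using D by simp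
    note D' = S[OF this]
    have lD: "left_module \<Lambda> D" using D' by (auto dest: finite_length_left_module)
    have k: "f x = \<zero>\<^bsub>D\<^esub>" if x: "x \<in> carrier X" "p x = \<zero>\<^bsub>X'\<^esub>" for x
    proof (rule ccontr)
      assume "f x \<noteq> \<zero>\<^bsub>D\<^esub>"
      then obtain u where u: "u \<in> mod_hom \<Lambda> D L" "u (f x) \<noteq> \<zero>\<^bsub>L\<^esub>"
        using D' mod_hom_closed[OF f x(1)] unfolding cogenerated_def by blast
      have "x \<in> W" using p0[OF x(1)] x(2) by simp
      then have "\<forall>f\<in>mod_hom \<Lambda> X L. f x = \<zero>\<^bsub>L\<^esub>" unfolding W_def by simp
      from bspec[OF this mod_hom_comp[OF lX f u(1)]] show False using u(2) x(1) by simp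
    qed
    have "\<exists>g\<in>mod_hom \<Lambda> X' D. \<forall>x\<in>carrier X. g (p x) = f x" by (rule mod_hom_factor[OF lX lX' lD p f k])
    then obtain g where g: "g \<in> mod_hom \<Lambda> X' D" "\<forall>x\<in>carrier X. g (p x) = f x" by (elim bexE)
    show ?thesis
      by (rule bexI[OF _ mod_hom_comp[OF lP t g(1)]]) (use g(2) ta mod_hom_closed[OF a] in simp)
  qed
  \<comment> \<open>A map to \<open>M\<close> is a sum of maps through \<open>Q\<close> and members
    of \<open>S\<close>; the extensions of the summands are added up.\<close>
  have "\<exists>f'\<in>mod_hom \<Lambda> P M. \<forall>x\<in>carrier X. f' (a x) = f x" if f: "f \<in> mod_hom \<Lambda> X M" for f
    using thru_of_in_add(2)[OF lX M(1) f M(3)]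
  proof (induction rule: thru.induct)
    case thru_zero
    show ?case
      by (rule bexI[OF _ mod_hom_const_zero[OF lP M(1)]]) (use mod_hom_closed[OF a] in simp)
  next
    case (thru_step h D f g)
    obtain h' where h': "h' \<in> mod_hom \<Lambda> P M" "\<forall>x\<in>carrier X. h' (a x) = h x" using thru_step.IH by (elim bexE)
    obtain f' where f': "f' \<in> mod_hom \<Lambda> P D" "\<forall>x\<in>carrier X. f' (a x) = f x"
      using ext[OF thru_step(2,3)] by (elim bexE)
    show ?case
      by (rule bexI[OF _ mod_hom_plus[OF lP M(1) h'(1) mod_hom_comp[OF lP f'(1) thru_step(4)]]])
        (use h'(2) f'(2) mod_hom_closed[OF a] in simp)
  qed
  then show ?thesis
    by (intro exI[of _ P] exI[of _ M''] exI[of _ a] exI[of _ b] conjI ballI fP fM'' addP addM'' a b b0)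
qed

text \<open>Projectives are cogenerated by \<open>L\<close> and so lie in add S. Injectives are
  cogenerated by \<open>C\<close>, so they split off members of add C, and \<open>C\<close>,
  generated by itself, lies in add Q. For indecomposable modules membership in add M means being a
  direct summand, as the definition of a generator-cogenerator demands.\<close>

lemma repdim_le_3:
  assumes tf: "torsionless_finite \<Lambda>"
  shows "repdim \<Lambda> \<le> 3"
proof -
  obtain L :: "'a lmod" and e S where fL: "finite_length_module \<Lambda> L"
    and e: "e \<in> mod_hom \<Lambda> (reg \<Lambda>) L" "inj_on e (carrier \<Lambda>)" and finS: "finite S"
    and S': "\<forall>D\<in>S. finite_length_module \<Lambda> D \<and> cogenerated \<Lambda> L D"
    and S_cover': "\<forall>X. finite_length_module \<Lambda> X \<longrightarrow> cogenerated \<Lambda> L X \<longrightarrow> in_add \<Lambda> S X"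
    and proj: "\<forall>P :: 'a lmod. projective_mod \<Lambda> P \<longrightarrow> cogenerated \<Lambda> L P"
    using torsionless_finite_cogenerated[OF tf] by (elim exE conjE)
  note lL = finite_length_left_module[OF fL] and S = bspec[OF S'] and S_cover = S_cover'[rule_format]
  have fS: "finite_length_module \<Lambda> D" if "D \<in> S" for D using S[OF that] by simp
  obtain Q :: "'a lmod" where Q: "finite_length_module \<Lambda> Q" "generated \<Lambda> C Q"
    and Q_cover': "\<forall>Y. finite_length_module \<Lambda> Y \<longrightarrow> generated \<Lambda> C Y \<longrightarrow> in_add \<Lambda> {Q} Y"
    using generated_by_C_finite[OF lL e finS fS S_cover] by blast
  note Q_cover = Q_cover'[rule_format]
  have fin: "finite (insert Q S)" using finS by simp
  have fl: "finite_length_module \<Lambda> D" if "D \<in> insert Q S" for D using that S Q(1) by auto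
  obtain M :: "'a lmod" where M: "finite_length_module \<Lambda> M" "\<forall>D\<in>insert Q S. in_add \<Lambda> {M} D" "in_add \<Lambda> (insert Q S) M"
    using finite_sum_exists[OF \<Lambda>.ring_axioms fin fl] by blast
  have "direct_summand \<Lambda> N M" if N: "indecomposable \<Lambda> N" and pi: "projective_mod \<Lambda> N \<or> injective_mod \<Lambda> N" for N :: "'a lmod"
  proof -
    have fN: "finite_length_module \<Lambda> N" using N unfolding indecomposable_def by simp
    note lN = finite_length_left_module[OF fN]
    from pi have "in_add \<Lambda> {M} N"
    proof
      assume "projective_mod \<Lambda> N"
      then have "in_add \<Lambda> S N" by (intro S_cover[OF fN] proj[rule_format])
      then show ?thesis by (rule in_add_trans[OF lN, rotated]) (use M(2) in simp)
    next
      assume N: "injective_mod \<Lambda> N"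
      have "in_add \<Lambda> {Q} C" by (rule Q_cover[OF C_finite_length generated_self[OF lC]])
      then have CM: "in_add \<Lambda> {M} C" by (rule in_add_trans[OF lC, rotated]) (use M(2) in simp)
      show ?thesis
        by (rule in_add_trans[OF lN _ injective_in_add_of_cogenerated[OF N C_finite_length cogenerated_C[OF fN]]])
          (simp add: CM)
    qed
    from indecomposable_in_add_summand[OF N this] show ?thesis by simp
  qed
  then have gc: "generator_cogenerator \<Lambda> M" unfolding generator_cogenerator_def using M(1) by simp
  have "gldim (End_ring \<Lambda> M) \<le> 3"
    by (rule gldim_End_ring_le_3[OF M(1)],
        rule coresolution[OF Q Q_cover lL S S_cover finite_length_left_module[OF M(1)] bspec[OF M(2)] M(3)])
  moreover have "repdim \<Lambda> \<le> gldim (End_ring \<Lambda> M)" unfolding repdim_def using gc by (intro Inf_lower CollectI exI[of _ M] conjI refl)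
  ultimately show ?thesis by (rule order_trans[rotated])
qed

end

theorem corollary4p2:
  fixes k :: "('k, 'c) ring_scheme" and \<Lambda> :: "('k, 'a, 'd) module_scheme"
  assumes "artin_algebra k \<Lambda>"
    and "torsionless_finite \<Lambda>"
  shows "repdim \<Lambda> \<le> 3"
proof -
  obtain C \<rho> where "algebra_dual k \<Lambda> C \<rho>" using artin_algebra.algebra_dual_exists[OF assms(1)] by (elim exE)
  then show ?thesis by (rule algebra_dual.repdim_le_3[OF _ assms(2)])
qed

end
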